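(* Let $k$ be a commutative ring, $\mathcal U$ a small category and $\mathcal A=(\mathcal A,m,f,c)$ a prestack of $k$-linear categories on $\mathcal U$, with Gerstenhaber–Schack complex $(\mathbf C^\bullet_{\mathrm{GS}}(\mathcal A),d)$ and subcomplex $\bar{\mathbf C}'^\bullet_{\mathrm{GS}}(\mathcal A)$ of normalized reduced cochains. (1) For $(m_1,f_1,c_1)\in\mathbf C^{0,2}(\mathcal A)\oplus\mathbf C^{1,1}(\mathcal A)\oplus\mathbf C^{2,0}(\mathcal A)$, the datum $(\mathcal A[\epsilon],m+m_1\epsilon,f+f_1\epsilon,c+c_1\epsilon)$ is a first order deformation of $\mathcal A$ if and only if $(m_1,f_1,c_1)\in\bar{\mathbf C}'^2_{\mathrm{GS}}(\mathcal A)$ and $d(m_1,f_1,c_1)=0$. (2) For $(m_1,f_1,c_1)$ and $(m_1',f_1',c_1')$ in $Z^2\bar{\mathbf C}'_{\mathrm{GS}}(\mathcal A)$, with corresponding deformations $\bar{\mathcal A}$ and $\bar{\mathcal A}'$, and $(g_1,-\tau_1)\in\mathbf C^{0,1}(\mathcal A)\oplus\mathbf C^{1,0}(\mathcal A)$, the pair $(g,\tau)=(1+g_1\epsilon,1+\tau_1\epsilon)$ is an isomorphism of prestacks $\bar{\mathcal A}\to\bar{\mathcal A}'$ if and only if $(g_1,-\tau_1)\in\bar{\mathbf C}'^1_{\mathrm{GS}}(\mathcal A)$ and $d(g_1,-\tau_1)=(m_1,f_1,c_1)-(m_1',f_1',c_1')$. Consequently, sending the class of $(m_1,f_1,c_1)$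 to the equivalence class of the deformation it defines is a bijection $H^2\bar{\mathbf C}'_{\mathrm{GS}}(\mathcal A)\to\mathrm{Def}(\mathcal A)$ onto the set of first order deformations of $\mathcal A$ up to equivalence. Hence $HH^2_{\mathrm{GS}}(\mathcal A)=H^2\mathbf C^\bullet_{\mathrm{GS}}(\mathcal A)\cong H^2\bar{\mathbf C}'_{\mathrm{GS}}(\mathcal A)$ classifies first order deformations of $\mathcal A$ up to equivalence.
   Context: **Prestacks.** A prestack $\mathcal A=(\mathcal A,m,f,c)$ on $\mathcal U$ consists of: for each object $U$ a $k$-linear category $\mathcal A(U)$ with composition $m^U$ (written as juxtaposition); for each $u:V\to U$ a $k$-linear functor $u^*=f^u:\mathcal A(U)\to\mathcal A(V)$, with $(1_U)^*=1$; for $v:W\to V$, $u:V\to U$ a natural isomorphism $c^{u,v}:v^*u^*\to(uv)^*$, equal to the identity if $u$ or $v$ is an identity, such that $c^{u,vw}(c^{v,w}u^* )=c^{uv,w}(w^*c^{u,v})$ for all $w:T\to W$. **Morphisms of prestacks.** A morphism $(g,\tau):\mathcal A\to\mathcal A'$ consists of functors $g^U:\mathcal A(U)\to\mathcal A'(U)$ and, for $u:V\to U$ and $A\in\mathcal A(U)$, morphisms $\tau^{u,A}:u'^*g^U(A)\to g^V(u^*A)$ in $\mathcal A'(V)$ such that: $g^V(u^*a)\,\tau^{u,A}=\tau^{u,B}\,u'^*(g^U(a))$ for $a:A\to B$; $\tau^{uv}c'^{u,v}=g^W(c^{u,v})\,\tau^v\,v'^*(\tau^u)$ for $v:W\to V$;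 and $\tau^{1_U}$ is the identity. **Simplices.** A $p$-simplex of the nerve $\mathcal N_p(\mathcal U)$ is $\sigma=(u_1,\dots,u_p)$, $U_0\xrightarrow{u_1}U_1\to\cdots\xrightarrow{u_p}U_p$. Put $\sigma^*=(u_p\cdots u_1)^*$, $\sigma^\star=u_1^*\cdots u_p^*:\mathcal A(U_p)\to\mathcal A(U_0)$ (identities if $p=0$), $L_k\sigma=(u_1,\dots,u_k)$, $R_k\sigma=(u_{k+1},\dots,u_p)$, and let $\partial_0\sigma=(u_2,\dots,u_p)$, $\partial_i\sigma=(u_1,\dots,u_{i+1}u_i,\dots,u_p)$, $\partial_p\sigma=(u_1,\dots,u_{p-1})$. Put $c^{\sigma,k}=c^{u_p\cdots u_{k+1},\,u_k\cdots u_1}:(L_k\sigma)^*(R_k\sigma)^*\to\sigma^*$ (identity for $k=0,p$) and, for $1\le k\le p-1$, $\epsilon^{\sigma,k}=u_1^*\cdots u_{k-1}^*c^{u_{k+1},u_k}u_{k+2}^*\cdots u_p^*:\sigma^\star\to(\partial_k\sigma)^\star$; components at $A$ are written $c^{\sigma,k,A}$, $\epsilon^{\sigma,k,A}$. A $q$-simplex $a=(a_1,\dots,a_q)$ in a category is $A_0\xrightarrow{a_q}A_1\to\cdots\xrightarrow{a_1}A_q$, so $a_i:A_{q-i}\to A_{q-i+1}$. **Cochains.** $\mathbf C^{p,q}(\mathcal A)=\prod_{\sigma\in\mathcal N_p(\mathcal U)}\prod_{A_0,\dots,A_q\in\mathcal A(U_p)}\mathrm{Hom}_k\big(\mathcal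 A(U_p)(A_{q-1},A_q)\otimes\cdots\otimes\mathcal A(U_p)(A_0,A_1),\mathcal A(U_0)(\sigma^\star A_0,\sigma^*A_q)\big)$ (for $q=0$ just $\mathcal A(U_0)(\sigma^\star A_0,\sigma^*A_0)$), and $\mathbf C^n_{\mathrm{GS}}(\mathcal A)=\prod_{p+q=n}\mathbf C^{p,q}(\mathcal A)$. **Paths.** For $\sigma=(u_1,\dots,u_n)$, $n\ge1$, the paths $r=(r_1,\dots,r_{n-1})\in\mathcal P(\sigma)$ are chains of natural transformations $T_0\xrightarrow{r_{n-1}}T_1\to\cdots\xrightarrow{r_1}T_{n-1}$ from $T_0=\sigma^\star$ to $T_{n-1}=\sigma^*$, with a sign $(-1)^r$: $\mathcal P(u_1)$ has only the empty path (with $T_0=u_1^*$, sign $1$); for $n\ge2$, $\mathcal P(\sigma)=\{(r_1,\dots,r_{n-2},\epsilon^{\sigma,i}):1\le i\le n-1,\ r\in\mathcal P(\partial_i\sigma)\}$ with sign $(-1)^i(-1)^r$. Paths are indexed by the choices made ($(n-1)!$ of them). **Shuffles.** $S_{m,l}$ is the set of permutations $\beta$ of $\{1,\dots,m+l\}$ increasing on $\{1,\dots,m\}$ and on $\{m+1,\dots,m+l\}$; $(-1)^\beta$ is its sign. Given an $m$-simplex $a$ in $\mathcal A(U)$ and a chain $r=(r_1,\dots,r_l)$, $T_0\xrightarrow{r_l}\cdots\xrightarrow{r_1}T_l$, of natural transformations of functors $\mathcal A(U)\to\mathcal A(V)$, place the $i$-th entry of $(a_1,\dots,a_m,r_1,\dots,r_l)$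 in position $\beta(i)$. Then $\beta(a,r)=(b_1,\dots,b_{m+l})$ is the simplex in $\mathcal A(V)$ from $T_0(A_0)$ to $T_l(A_m)$ with $b_x=T_{l-y}(a_i)$ if position $x$ holds $a_i$ and $y$ of the $r$'s are in positions $<x$, and $b_x=r_i(A_{m-y})$ if position $x$ holds $r_i$ and $y$ of the $a$'s are in positions $<x$. **Differential.** For $\phi\in\mathbf C^{p,q}(\mathcal A)$, $p+q=n-1$, $d\phi=\sum_{j=0}^{q+1}d_j\phi$ with $d_j\phi\in\mathbf C^{p+j,q+1-j}(\mathcal A)$: $(d_0\phi)^\sigma(a_1,\dots,a_{q+1})=\sigma^*(a_1)\phi^\sigma(a_2,\dots,a_{q+1})+\sum_{i=1}^q(-1)^i\phi^\sigma(\dots,a_ia_{i+1},\dots)+(-1)^{q+1}\phi^\sigma(a_1,\dots,a_q)\sigma^\star(a_{q+1})$; $d_1\phi=(-1)^nd_{\mathrm{simp}}\phi$, $(d_{\mathrm{simp}}\phi)^\sigma(a)=c^{\sigma,1,A_q}u_1^*(\phi^{\partial_0\sigma}(a))+\sum_{i=1}^p(-1)^i\phi^{\partial_i\sigma}(a)\epsilon^{\sigma,i,A_0}+(-1)^{p+1}c^{\sigma,p,A_q}\phi^{\partial_{p+1}\sigma}(u_{p+1}^*a_1,\dots,u_{p+1}^*a_q)$ for a $(p+1)$-simplex $\sigma$; for $j\ge2$, $t=q+1-j$, $\sigma$ a $(p+j)$-simplex: $(d_j\phi)^\sigma(a_1,\dots,a_t)=\sum_{r\in\mathcal P(R_p\sigma),\,\beta\in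 S_{t,j-1}}(-1)^r(-1)^\beta(-1)^t\,c^{\sigma,p,A_t}\,\phi^{L_p\sigma}(\beta(a,r))$. **Normalized reduced.** $\phi=(\phi^\sigma)_\sigma$ is normalized if $\phi^\sigma(a)=0$ whenever some $a_i$ is an identity, and reduced if $\phi^\sigma=0$ whenever some arrow $u_i$ of $\sigma$ is an identity. Normalized reduced cochains form a subcomplex $\bar{\mathbf C}'^\bullet_{\mathrm{GS}}(\mathcal A)$; $Z^2$ denotes its 2-cocycles. **Deformations.** $k[\epsilon]$ has $\epsilon^2=0$. A first order deformation of $\mathcal A$ is a prestack $(\mathcal A[\epsilon],m+m_1\epsilon,f+f_1\epsilon,c+c_1\epsilon)$ of $k[\epsilon]$-linear categories with $(m_1,f_1,c_1)\in\mathbf C^{0,2}(\mathcal A)\oplus\mathbf C^{1,1}(\mathcal A)\oplus\mathbf C^{2,0}(\mathcal A)$. Here $\mathcal A[\epsilon](U)$ has the objects of $\mathcal A(U)$, morphisms $\mathcal A(U)(A,B)\otimes_kk[\epsilon]$ and the same identities; restriction functors are unchanged on objects; $\bar c^{u,v,A}=c^{u,v,A}+c_1^{(v,u)}(A)\epsilon$. An equivalence of deformations is an isomorphism of prestacks of the form $(1+g_1\epsilon,1+\tau_1\epsilon)$ (identity on objects, $g^U(a)=a+g_1^U(a)\epsilon$, $\tau^{u,A}=1_{u^*A}+\tau_1^{u,A}\epsilon$) with $(g_1,\tau_1)\in\mathbf C^{0,1}(\mathcal A)\oplus\mathbf C^{1,0}(\mathcal A)$. *)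

theory Defs
  imports "HOL-Algebra.Module" "HOL-Algebra.AbelCoset" "HOL-Combinatorics.Permutations"
begin

section \<open>Linear categories\<close>

record ('o, 'a) cat =
  Ob :: "'o set"
  Ar :: "'a set"
  Dom :: "'a \<Rightarrow> 'o"
  Cod :: "'a \<Rightarrow> 'o"
  Ident :: "'o \<Rightarrow> 'a"
  Comp :: "'a \<Rightarrow> 'a \<Rightarrow> 'a"  (infixl \<open>\<bullet>\<index>\<close> 75)

definition Homs :: "('o, 'a, 'z) cat_scheme \<Rightarrow> 'o \<Rightarrow> 'o \<Rightarrow> 'a set" where
  "Homs C A B = {a \<in> Ar C. Dom C a = A \<and> Cod C a = B}"

locale category =
  fixes C :: "('o, 'a, 'z) cat_scheme"
  assumes Dom_closed: "a \<in> Ar C \<Longrightarrow> Dom C a \<in> Ob C"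
    and Cod_closed: "a \<in> Ar C \<Longrightarrow> Cod C a \<in> Ob C"
    and Ident_closed: "A \<in> Ob C \<Longrightarrow> Ident C A \<in> Homs C A A"
    and Comp_closed: "\<lbrakk>b \<in> Homs C B D; a \<in> Homs C A B\<rbrakk> \<Longrightarrow> b \<bullet>\<^bsub>C\<^esub> a \<in> Homs C A D"
    and Comp_assoc: "\<lbrakk>h \<in> Homs C D E; b \<in> Homs C B D; a \<in> Homs C A B\<rbrakk>
      \<Longrightarrow> (h \<bullet>\<^bsub>C\<^esub> b) \<bullet>\<^bsub>C\<^esub> a = h \<bullet>\<^bsub>C\<^esub> (b \<bullet>\<^bsub>C\<^esub> a)"
    and Comp_Ident_left: "a \<in> Homs C A B \<Longrightarrow> Ident C B \<bullet>\<^bsub>C\<^esub> a = a"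
    and Comp_Ident_right: "a \<in> Homs C A B \<Longrightarrow> a \<bullet>\<^bsub>C\<^esub> Ident C A = a"

definition is_iso :: "('o, 'a, 'z) cat_scheme \<Rightarrow> 'o \<Rightarrow> 'o \<Rightarrow> 'a \<Rightarrow> bool" where
  "is_iso C A B a \<longleftrightarrow> a \<in> Homs C A B \<and>
     (\<exists>b \<in> Homs C B A. b \<bullet>\<^bsub>C\<^esub> a = Ident C A \<and> a \<bullet>\<^bsub>C\<^esub> b = Ident C B)"

text \<open>
  The linear structure on the set of arrows from \<open>A\<close> to \<open>B\<close> is the module \<open>HomMod C A B\<close>.
  Only the additive part and the scalar multiplication of such a record matter; its
  multiplicative fields carry no information.
\<close>

record ('k, 'o, 'a) lincat = "('o, 'a) cat" +
  HomMod :: "'o \<Rightarrow> 'o \<Rightarrow> ('k, 'a) module"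

locale linear_category = category C
  for R :: "'k ring" and C :: "('k, 'o, 'a) lincat" +
  assumes HomMod_module: "\<lbrakk>A \<in> Ob C; B \<in> Ob C\<rbrakk> \<Longrightarrow> module R (HomMod C A B)"
    and HomMod_carrier: "\<lbrakk>A \<in> Ob C; B \<in> Ob C\<rbrakk> \<Longrightarrow> carrier (HomMod C A B) = Homs C A B"
    and Comp_add_left: "\<lbrakk>b \<in> Homs C B D; b' \<in> Homs C B D; a \<in> Homs C A B\<rbrakk>
      \<Longrightarrow> (b \<oplus>\<^bsub>HomMod C B D\<^esub> b') \<bullet>\<^bsub>C\<^esub> a = (b \<bullet>\<^bsub>C\<^esub> a) \<oplus>\<^bsub>HomMod C A D\<^esub> (b' \<bullet>\<^bsub>C\<^esub> a)"
    and Comp_add_right: "\<lbrakk>b \<in> Homs C B D; a \<in> Homs C A B; a' \<in> Homs C A B\<rbrakk>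
      \<Longrightarrow> b \<bullet>\<^bsub>C\<^esub> (a \<oplus>\<^bsub>HomMod C A B\<^esub> a') = (b \<bullet>\<^bsub>C\<^esub> a) \<oplus>\<^bsub>HomMod C A D\<^esub> (b \<bullet>\<^bsub>C\<^esub> a')"
    and Comp_smult_left: "\<lbrakk>r \<in> carrier R; b \<in> Homs C B D; a \<in> Homs C A B\<rbrakk>
      \<Longrightarrow> (r \<odot>\<^bsub>HomMod C B D\<^esub> b) \<bullet>\<^bsub>C\<^esub> a = r \<odot>\<^bsub>HomMod C A D\<^esub> (b \<bullet>\<^bsub>C\<^esub> a)"
    and Comp_smult_right: "\<lbrakk>r \<in> carrier R; b \<in> Homs C B D; a \<in> Homs C A B\<rbrakk>
      \<Longrightarrow> b \<bullet>\<^bsub>C\<^esub> (r \<odot>\<^bsub>HomMod C A B\<^esub> a) = r \<odot>\<^bsub>HomMod C A D\<^esub> (b \<bullet>\<^bsub>C\<^esub> a)"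

definition linear_functor ::
  "'k ring \<Rightarrow> ('k, 'o, 'a) lincat \<Rightarrow> ('k, 'p, 'b) lincat \<Rightarrow> ('o \<Rightarrow> 'p) \<Rightarrow> ('a \<Rightarrow> 'b) \<Rightarrow> bool" where
  "linear_functor R C D Fo Fm \<longleftrightarrow>
     (\<forall>A \<in> Ob C. Fo A \<in> Ob D) \<and>
     (\<forall>A \<in> Ob C. \<forall>B \<in> Ob C. \<forall>a \<in> Homs C A B. Fm a \<in> Homs D (Fo A) (Fo B)) \<and>
     (\<forall>A \<in> Ob C. Fm (Ident C A) = Ident D (Fo A)) \<and>
     (\<forall>a \<in> Ar C. \<forall>b \<in> Ar C. Cod C a = Dom C b \<longrightarrow> Fm (b \<bullet>\<^bsub>C\<^esub> a) = Fm b \<bullet>\<^bsub>D\<^esub> Fm a) \<and>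
     (\<forall>A \<in> Ob C. \<forall>B \<in> Ob C. \<forall>a \<in> Homs C A B. \<forall>a' \<in> Homs C A B.
        Fm (a \<oplus>\<^bsub>HomMod C A B\<^esub> a') = Fm a \<oplus>\<^bsub>HomMod D (Fo A) (Fo B)\<^esub> Fm a') \<and>
     (\<forall>A \<in> Ob C. \<forall>B \<in> Ob C. \<forall>r \<in> carrier R. \<forall>a \<in> Homs C A B.
        Fm (r \<odot>\<^bsub>HomMod C A B\<^esub> a) = r \<odot>\<^bsub>HomMod D (Fo A) (Fo B)\<^esub> Fm a)"


section \<open>Prestacks and their morphisms\<close>

text \<open>
  \<open>res_ob \<A> u\<close> and \<open>res_mor \<A> u\<close> are the two parts of the restriction functor \<open>u\<^sup>*\<close>;
  \<open>twist \<A> u v A\<close> is the component at \<open>A\<close> of \<open>c\<^sup>u\<^sup>,\<^sup>v : v\<^sup>* u\<^sup>* \<rightarrow> (u v)\<^sup>*\<close>.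
\<close>

record ('k, 'uo, 'ua, 'o, 'm) prestack =
  fib :: "'uo \<Rightarrow> ('k, 'o, 'm) lincat"
  res_ob :: "'ua \<Rightarrow> 'o \<Rightarrow> 'o"
  res_mor :: "'ua \<Rightarrow> 'm \<Rightarrow> 'm"
  twist :: "'ua \<Rightarrow> 'ua \<Rightarrow> 'o \<Rightarrow> 'm"

locale prestack = cring R + \<U>: category \<U>
  for R :: "'k ring" and \<U> :: "('uo, 'ua) cat" and \<A> :: "('k, 'uo, 'ua, 'o, 'm) prestack" +
  assumes fib: "U \<in> Ob \<U> \<Longrightarrow> linear_category R (fib \<A> U)"
    and res: "u \<in> Ar \<U> \<Longrightarrow>
      linear_functor R (fib \<A> (Cod \<U> u)) (fib \<A> (Dom \<U> u)) (res_ob \<A> u) (res_mor \<A> u)"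
    and res_ob_Ident: "\<lbrakk>U \<in> Ob \<U>; A \<in> Ob (fib \<A> U)\<rbrakk> \<Longrightarrow> res_ob \<A> (Ident \<U> U) A = A"
    and res_mor_Ident: "\<lbrakk>U \<in> Ob \<U>; a \<in> Ar (fib \<A> U)\<rbrakk> \<Longrightarrow> res_mor \<A> (Ident \<U> U) a = a"
    and twist_iso:
      "\<lbrakk>u \<in> Ar \<U>; v \<in> Ar \<U>; Cod \<U> v = Dom \<U> u; A \<in> Ob (fib \<A> (Cod \<U> u))\<rbrakk> \<Longrightarrow>
       is_iso (fib \<A> (Dom \<U> v)) (res_ob \<A> v (res_ob \<A> u A)) (res_ob \<A> (u \<bullet>\<^bsub>\<U>\<^esub> v) A) (twist \<A> u v A)"
    and twist_natural:
      "\<lbrakk>u \<in> Ar \<U>; v \<in> Ar \<U>; Cod \<U> v = Dom \<U> u; a \<in> Homs (fib \<A> (Cod \<U> u)) A B\<rbrakk> \<Longrightarrow>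
       res_mor \<A> (u \<bullet>\<^bsub>\<U>\<^esub> v) a \<bullet>\<^bsub>fib \<A> (Dom \<U> v)\<^esub> twist \<A> u v A
         = twist \<A> u v B \<bullet>\<^bsub>fib \<A> (Dom \<U> v)\<^esub> res_mor \<A> v (res_mor \<A> u a)"
    and twist_Ident_left:
      "\<lbrakk>v \<in> Ar \<U>; A \<in> Ob (fib \<A> (Cod \<U> v))\<rbrakk> \<Longrightarrow>
       twist \<A> (Ident \<U> (Cod \<U> v)) v A = Ident (fib \<A> (Dom \<U> v)) (res_ob \<A> v A)"
    and twist_Ident_right:
      "\<lbrakk>u \<in> Ar \<U>; A \<in> Ob (fib \<A> (Cod \<U> u))\<rbrakk> \<Longrightarrow>
       twist \<A> u (Ident \<U> (Dom \<U> u)) A = Ident (fib \<A> (Dom \<U> u)) (res_ob \<A> u A)"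
    and twist_coherent:
      "\<lbrakk>u \<in> Ar \<U>; v \<in> Ar \<U>; w \<in> Ar \<U>; Cod \<U> v = Dom \<U> u; Cod \<U> w = Dom \<U> v;
        A \<in> Ob (fib \<A> (Cod \<U> u))\<rbrakk> \<Longrightarrow>
       twist \<A> u (v \<bullet>\<^bsub>\<U>\<^esub> w) A \<bullet>\<^bsub>fib \<A> (Dom \<U> w)\<^esub> twist \<A> v w (res_ob \<A> u A)
         = twist \<A> (u \<bullet>\<^bsub>\<U>\<^esub> v) w A \<bullet>\<^bsub>fib \<A> (Dom \<U> w)\<^esub> res_mor \<A> w (twist \<A> u v A)"

record ('uo, 'ua, 'o, 'm, 'p, 'n) psmor =
  on_ob :: "'uo \<Rightarrow> 'o \<Rightarrow> 'p"
  on_mor :: "'uo \<Rightarrow> 'm \<Rightarrow> 'n"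
  tau :: "'ua \<Rightarrow> 'o \<Rightarrow> 'n"

definition prestack_morphism ::
  "'k ring \<Rightarrow> ('uo, 'ua) cat \<Rightarrow> ('k, 'uo, 'ua, 'o, 'm) prestack \<Rightarrow>
   ('k, 'uo, 'ua, 'p, 'n) prestack \<Rightarrow> ('uo, 'ua, 'o, 'm, 'p, 'n) psmor \<Rightarrow> bool" where
  "prestack_morphism R \<U> \<A> \<A>' g \<longleftrightarrow>
     (\<forall>U \<in> Ob \<U>. linear_functor R (fib \<A> U) (fib \<A>' U) (on_ob g U) (on_mor g U)) \<and>
     (\<forall>u \<in> Ar \<U>. \<forall>A \<in> Ob (fib \<A> (Cod \<U> u)).
        tau g u A \<in> Homs (fib \<A>' (Dom \<U> u))
          (res_ob \<A>' u (on_ob g (Cod \<U> u) A)) (on_ob g (Dom \<U> u) (res_ob \<A> u A))) \<and>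
     (\<forall>u \<in> Ar \<U>. \<forall>A \<in> Ob (fib \<A> (Cod \<U> u)). \<forall>B \<in> Ob (fib \<A> (Cod \<U> u)).
      \<forall>a \<in> Homs (fib \<A> (Cod \<U> u)) A B.
        on_mor g (Dom \<U> u) (res_mor \<A> u a) \<bullet>\<^bsub>fib \<A>' (Dom \<U> u)\<^esub> tau g u A
          = tau g u B \<bullet>\<^bsub>fib \<A>' (Dom \<U> u)\<^esub> res_mor \<A>' u (on_mor g (Cod \<U> u) a)) \<and>
     (\<forall>u \<in> Ar \<U>. \<forall>v \<in> Ar \<U>. Cod \<U> v = Dom \<U> u \<longrightarrow> (\<forall>A \<in> Ob (fib \<A> (Cod \<U> u)).
        tau g (u \<bullet>\<^bsub>\<U>\<^esub> v) A \<bullet>\<^bsub>fib \<A>' (Dom \<U> v)\<^esub> twist \<A>' u v (on_ob g (Cod \<U> u) A)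
          = on_mor g (Dom \<U> v) (twist \<A> u v A) \<bullet>\<^bsub>fib \<A>' (Dom \<U> v)\<^esub>
              (tau g v (res_ob \<A> u A) \<bullet>\<^bsub>fib \<A>' (Dom \<U> v)\<^esub> res_mor \<A>' v (tau g u A)))) \<and>
     (\<forall>U \<in> Ob \<U>. \<forall>A \<in> Ob (fib \<A> U). tau g (Ident \<U> U) A = Ident (fib \<A>' U) (on_ob g U A))"

definition psmor_id ::
  "('uo, 'ua) cat \<Rightarrow> ('k, 'uo, 'ua, 'o, 'm) prestack \<Rightarrow> ('uo, 'ua, 'o, 'm, 'o, 'm) psmor" where
  "psmor_id \<U> \<A> = \<lparr>on_ob = \<lambda>U A. A, on_mor = \<lambda>U a. a,
     tau = \<lambda>u A. Ident (fib \<A> (Dom \<U> u)) (res_ob \<A> u A)\<rparr>"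

text \<open>
  The composite of \<open>g : \<A> \<rightarrow> \<A>'\<close> and \<open>h : \<A>' \<rightarrow> \<A>''\<close>; its transformation pastes
  \<open>u''\<^sup>* h g A \<rightarrow> h (u'\<^sup>* g A) \<rightarrow> h g (u\<^sup>* A)\<close>. The prestack argument is the target \<open>\<A>''\<close>.
\<close>

definition psmor_comp ::
  "('uo, 'ua) cat \<Rightarrow> ('k, 'uo, 'ua, 'q, 'l) prestack \<Rightarrow> ('uo, 'ua, 'p, 'n, 'q, 'l) psmor \<Rightarrow>
   ('uo, 'ua, 'o, 'm, 'p, 'n) psmor \<Rightarrow> ('uo, 'ua, 'o, 'm, 'q, 'l) psmor" where
  "psmor_comp \<U> \<A>'' h g = \<lparr>on_ob = \<lambda>U A. on_ob h U (on_ob g U A),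
     on_mor = \<lambda>U a. on_mor h U (on_mor g U a),
     tau = \<lambda>u A. on_mor h (Dom \<U> u) (tau g u A)
       \<bullet>\<^bsub>fib \<A>'' (Dom \<U> u)\<^esub> tau h u (on_ob g (Cod \<U> u) A)\<rparr>"

definition psmor_eq ::
  "('uo, 'ua) cat \<Rightarrow> ('k, 'uo, 'ua, 'o, 'm) prestack \<Rightarrow> ('uo, 'ua, 'o, 'm, 'p, 'n) psmor \<Rightarrow>
   ('uo, 'ua, 'o, 'm, 'p, 'n) psmor \<Rightarrow> bool" where
  "psmor_eq \<U> \<A> g h \<longleftrightarrow>
     (\<forall>U \<in> Ob \<U>. \<forall>A \<in> Ob (fib \<A> U). on_ob g U A = on_ob h U A) \<and>
     (\<forall>U \<in> Ob \<U>. \<forall>a \<in> Ar (fib \<A> U). on_mor g U a = on_mor h U a) \<and>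
     (\<forall>u \<in> Ar \<U>. \<forall>A \<in> Ob (fib \<A> (Cod \<U> u)). tau g u A = tau h u A)"

definition prestack_iso ::
  "'k ring \<Rightarrow> ('uo, 'ua) cat \<Rightarrow> ('k, 'uo, 'ua, 'o, 'm) prestack \<Rightarrow>
   ('k, 'uo, 'ua, 'p, 'n) prestack \<Rightarrow> ('uo, 'ua, 'o, 'm, 'p, 'n) psmor \<Rightarrow> bool" where
  "prestack_iso R \<U> \<A> \<A>' g \<longleftrightarrow> prestack_morphism R \<U> \<A> \<A>' g \<and>
     (\<exists>h. prestack_morphism R \<U> \<A>' \<A> h \<and>
        psmor_eq \<U> \<A> (psmor_comp \<U> \<A> h g) (psmor_id \<U> \<A>) \<and>
        psmor_eq \<U> \<A>' (psmor_comp \<U> \<A>' g h) (psmor_id \<U> \<A>'))"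


section \<open>Simplices\<close>

text \<open>
  A simplex is stored as its initial vertex together with its list of arrows. There are two
  conventions: simplices of the base category, \<open>(U\<^sub>0, [u\<^sub>1, \<dots>, u\<^sub>p])\<close>, are listed in
  order of travel (\<open>simplices\<close>), whereas simplices \<open>(A\<^sub>0, [a\<^sub>1, \<dots>, a\<^sub>q])\<close> of a fibre are listed
  in order of composition, \<open>a\<^sub>q\<close> being the arrow that leaves \<open>A\<^sub>0\<close> (\<open>rsimplices\<close>).
\<close>

fun is_path :: "('o, 'a, 'z) cat_scheme \<Rightarrow> 'o \<Rightarrow> 'a list \<Rightarrow> bool" where
  "is_path C A [] \<longleftrightarrow> A \<in> Ob C"
| "is_path C A (a # as) \<longleftrightarrow> a \<in> Ar C \<and> Dom C a = A \<and> is_path C (Cod C a) as"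

definition simplices :: "('o, 'a, 'z) cat_scheme \<Rightarrow> nat \<Rightarrow> ('o \<times> 'a list) set" where
  "simplices C p = {(A, as). is_path C A as \<and> length as = p}"

definition rsimplices :: "('o, 'a, 'z) cat_scheme \<Rightarrow> nat \<Rightarrow> ('o \<times> 'a list) set" where
  "rsimplices C q = {(A, as). is_path C A (rev as) \<and> length as = q}"

definition vertex :: "('o, 'a, 'z) cat_scheme \<Rightarrow> 'o \<times> 'a list \<Rightarrow> nat \<Rightarrow> 'o" where
  "vertex C \<sigma> k = (if k = 0 then fst \<sigma> else Cod C (snd \<sigma> ! (k - 1)))"

definition rvertex :: "('o, 'a, 'z) cat_scheme \<Rightarrow> 'o \<times> 'a list \<Rightarrow> nat \<Rightarrow> 'o" where
  "rvertex C a k = vertex C (fst a, rev (snd a)) k"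

abbreviation dimn :: "'o \<times> 'a list \<Rightarrow> nat" where
  "dimn \<sigma> \<equiv> length (snd \<sigma>)"

abbreviation tgt :: "('o, 'a, 'z) cat_scheme \<Rightarrow> 'o \<times> 'a list \<Rightarrow> 'o" where
  "tgt C \<sigma> \<equiv> vertex C \<sigma> (dimn \<sigma>)"

abbreviation rtgt :: "('o, 'a, 'z) cat_scheme \<Rightarrow> 'o \<times> 'a list \<Rightarrow> 'o" where
  "rtgt C a \<equiv> rvertex C a (dimn a)"

definition total :: "('o, 'a, 'z) cat_scheme \<Rightarrow> 'o \<times> 'a list \<Rightarrow> 'a" where
  "total C \<sigma> = foldl (\<lambda>g u. u \<bullet>\<^bsub>C\<^esub> g) (Ident C (fst \<sigma>)) (snd \<sigma>)"

definition contract :: "('a \<Rightarrow> 'a \<Rightarrow> 'a) \<Rightarrow> nat \<Rightarrow> 'a list \<Rightarrow> 'a list" where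
  "contract f i xs = take (i - 1) xs @ [f (xs ! (i - 1)) (xs ! i)] @ drop (i + 1) xs"

definition face :: "('o, 'a, 'z) cat_scheme \<Rightarrow> nat \<Rightarrow> 'o \<times> 'a list \<Rightarrow> 'o \<times> 'a list" where
  "face C i \<sigma> =
     (if i = 0 then (vertex C \<sigma> 1, tl (snd \<sigma>))
      else if i = dimn \<sigma> then (fst \<sigma>, butlast (snd \<sigma>))
      else (fst \<sigma>, contract (\<lambda>x y. y \<bullet>\<^bsub>C\<^esub> x) i (snd \<sigma>)))"

definition Lpart :: "nat \<Rightarrow> 'o \<times> 'a list \<Rightarrow> 'o \<times> 'a list" where
  "Lpart k \<sigma> = (fst \<sigma>, take k (snd \<sigma>))"

definition Rpart :: "('o, 'a, 'z) cat_scheme \<Rightarrow> nat \<Rightarrow> 'o \<times> 'a list \<Rightarrow> 'o \<times> 'a list" where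
  "Rpart C k \<sigma> = (vertex C \<sigma> k, drop k (snd \<sigma>))"

definition star_ob :: "('k, 'uo, 'ua, 'o, 'm) prestack \<Rightarrow> 'uo \<times> 'ua list \<Rightarrow> 'o \<Rightarrow> 'o" where
  "star_ob \<A> \<sigma> A = foldr (res_ob \<A>) (snd \<sigma>) A"

definition star_mor :: "('k, 'uo, 'ua, 'o, 'm) prestack \<Rightarrow> 'uo \<times> 'ua list \<Rightarrow> 'm \<Rightarrow> 'm" where
  "star_mor \<A> \<sigma> a = foldr (res_mor \<A>) (snd \<sigma>) a"

text \<open>The component \<open>c\<^sup>\<sigma>\<^sup>,\<^sup>k\<^sup>,\<^sup>A : (L\<^sub>k \<sigma>)\<^sup>* (R\<^sub>k \<sigma>)\<^sup>* A \<rightarrow> \<sigma>\<^sup>* A\<close>.\<close>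

definition twist_at ::
  "('uo, 'ua) cat \<Rightarrow> ('k, 'uo, 'ua, 'o, 'm) prestack \<Rightarrow> 'uo \<times> 'ua list \<Rightarrow> nat \<Rightarrow> 'o \<Rightarrow> 'm" where
  "twist_at \<U> \<A> \<sigma> k A =
     (if k = 0 \<or> k = dimn \<sigma> then Ident (fib \<A> (fst \<sigma>)) (res_ob \<A> (total \<U> \<sigma>) A)
      else twist \<A> (total \<U> (Rpart \<U> k \<sigma>)) (total \<U> (Lpart k \<sigma>)) A)"

text \<open>The component at \<open>A\<close> of
  \<open>\<epsilon>\<^sup>\<sigma>\<^sup>,\<^sup>k = u\<^sub>1\<^sup>* \<dots> u\<^sub>k\<^sub>-\<^sub>1\<^sup>* c\<^bsup>u\<^sub>k\<^sub>+\<^sub>1,u\<^sub>k\<^esup> u\<^sub>k\<^sub>+\<^sub>2\<^sup>* \<dots> u\<^sub>p\<^sup>*\<close>.\<close>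

definition eps ::
  "('k, 'uo, 'ua, 'o, 'm) prestack \<Rightarrow> 'uo \<times> 'ua list \<Rightarrow> nat \<Rightarrow> 'o \<Rightarrow> 'm" where
  "eps \<A> \<sigma> k A = foldr (res_mor \<A>) (take (k - 1) (snd \<sigma>))
     (twist \<A> (snd \<sigma> ! k) (snd \<sigma> ! (k - 1)) (foldr (res_ob \<A>) (drop (k + 1) (snd \<sigma>)) A))"


section \<open>The Gerstenhaber--Schack cochains\<close>

type_synonym ('uo, 'ua, 'o, 'm) cochain = "'uo \<times> 'ua list \<Rightarrow> 'o \<times> 'm list \<Rightarrow> 'm"

text \<open>The module \<open>\<A>(U\<^sub>0)(\<sigma>\<^sup>\<star> A\<^sub>0, \<sigma>\<^sup>* A\<^sub>q)\<close> in which \<open>\<phi>\<^sup>\<sigma>(a)\<close> lives.\<close>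

definition val_mod ::
  "('uo, 'ua) cat \<Rightarrow> ('k, 'uo, 'ua, 'o, 'm) prestack \<Rightarrow> 'uo \<times> 'ua list \<Rightarrow> 'o \<times> 'm list \<Rightarrow>
   ('k, 'm) module" where
  "val_mod \<U> \<A> \<sigma> a = HomMod (fib \<A> (fst \<sigma>)) (star_ob \<A> \<sigma> (fst a))
     (res_ob \<A> (total \<U> \<sigma>) (rtgt (fib \<A> (tgt \<U> \<sigma>)) a))"

text \<open>Linear maps out of a tensor product are rendered as multilinear maps.\<close>

definition multilinear ::
  "'k ring \<Rightarrow> ('uo, 'ua) cat \<Rightarrow> ('k, 'uo, 'ua, 'o, 'm) prestack \<Rightarrow> nat \<Rightarrow> nat \<Rightarrow>
   ('uo, 'ua, 'o, 'm) cochain \<Rightarrow> bool" where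
  "multilinear R \<U> \<A> p q \<phi> \<longleftrightarrow>
     (\<forall>\<sigma> \<in> simplices \<U> p. \<forall>A xs b ys. (A, xs @ b # ys) \<in> rsimplices (fib \<A> (tgt \<U> \<sigma>)) q \<longrightarrow>
        (let C = fib \<A> (tgt \<U> \<sigma>); H = HomMod C (Dom C b) (Cod C b);
             M = val_mod \<U> \<A> \<sigma> (A, xs @ b # ys)
         in (\<forall>b' \<in> Homs C (Dom C b) (Cod C b).
               \<phi> \<sigma> (A, xs @ (b \<oplus>\<^bsub>H\<^esub> b') # ys)
                 = \<phi> \<sigma> (A, xs @ b # ys) \<oplus>\<^bsub>M\<^esub> \<phi> \<sigma> (A, xs @ b' # ys)) \<and>
            (\<forall>r \<in> carrier R.
               \<phi> \<sigma> (A, xs @ (r \<odot>\<^bsub>H\<^esub> b) # ys) = r \<odot>\<^bsub>M\<^esub> \<phi> \<sigma> (A, xs @ b # ys))))"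

definition mk_cochain ::
  "('uo, 'ua) cat \<Rightarrow> ('k, 'uo, 'ua, 'o, 'm) prestack \<Rightarrow> nat \<Rightarrow> nat \<Rightarrow>
   ('uo, 'ua, 'o, 'm) cochain \<Rightarrow> ('uo, 'ua, 'o, 'm) cochain" where
  "mk_cochain \<U> \<A> p q F = (\<lambda>\<sigma> \<in> simplices \<U> p. \<lambda>a \<in> rsimplices (fib \<A> (tgt \<U> \<sigma>)) q. F \<sigma> a)"

definition Cpq ::
  "'k ring \<Rightarrow> ('uo, 'ua) cat \<Rightarrow> ('k, 'uo, 'ua, 'o, 'm) prestack \<Rightarrow> nat \<Rightarrow> nat \<Rightarrow>
   ('k, ('uo, 'ua, 'o, 'm) cochain) module" where
  "Cpq R \<U> \<A> p q =
     \<lparr>carrier = {\<phi> \<in> (\<Pi>\<^sub>E \<sigma> \<in> simplices \<U> p. \<Pi>\<^sub>E a \<in> rsimplices (fib \<A> (tgt \<U> \<sigma>)) q.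
                  carrier (val_mod \<U> \<A> \<sigma> a)). multilinear R \<U> \<A> p q \<phi>},
      monoid.mult = undefined, one = undefined,
      zero = mk_cochain \<U> \<A> p q (\<lambda>\<sigma> a. \<zero>\<^bsub>val_mod \<U> \<A> \<sigma> a\<^esub>),
      add = \<lambda>\<phi> \<psi>. mk_cochain \<U> \<A> p q (\<lambda>\<sigma> a. \<phi> \<sigma> a \<oplus>\<^bsub>val_mod \<U> \<A> \<sigma> a\<^esub> \<psi> \<sigma> a),
      smult = \<lambda>r \<phi>. mk_cochain \<U> \<A> p q (\<lambda>\<sigma> a. r \<odot>\<^bsub>val_mod \<U> \<A> \<sigma> a\<^esub> \<phi> \<sigma> a)\<rparr>"

text \<open>A cochain of degree \<open>n\<close> assigns to \<open>p \<le> n\<close> its component in bidegree \<open>(p, n - p)\<close>.\<close>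

definition GS ::
  "'k ring \<Rightarrow> ('uo, 'ua) cat \<Rightarrow> ('k, 'uo, 'ua, 'o, 'm) prestack \<Rightarrow> nat \<Rightarrow>
   ('k, nat \<Rightarrow> ('uo, 'ua, 'o, 'm) cochain) module" where
  "GS R \<U> \<A> n =
     \<lparr>carrier = (\<Pi>\<^sub>E p \<in> {..n}. carrier (Cpq R \<U> \<A> p (n - p))),
      monoid.mult = undefined, one = undefined,
      zero = (\<lambda>p \<in> {..n}. \<zero>\<^bsub>Cpq R \<U> \<A> p (n - p)\<^esub>),
      add = \<lambda>\<phi> \<psi>. (\<lambda>p \<in> {..n}. \<phi> p \<oplus>\<^bsub>Cpq R \<U> \<A> p (n - p)\<^esub> \<psi> p),
      smult = \<lambda>r \<phi>. (\<lambda>p \<in> {..n}. r \<odot>\<^bsub>Cpq R \<U> \<A> p (n - p)\<^esub> \<phi> p)\<rparr>"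

definition normalized ::
  "('uo, 'ua) cat \<Rightarrow> ('k, 'uo, 'ua, 'o, 'm) prestack \<Rightarrow> nat \<Rightarrow> nat \<Rightarrow>
   ('uo, 'ua, 'o, 'm) cochain \<Rightarrow> bool" where
  "normalized \<U> \<A> p q \<phi> \<longleftrightarrow>
     (\<forall>\<sigma> \<in> simplices \<U> p. \<forall>a \<in> rsimplices (fib \<A> (tgt \<U> \<sigma>)) q.
        set (snd a) \<inter> Ident (fib \<A> (tgt \<U> \<sigma>)) ` Ob (fib \<A> (tgt \<U> \<sigma>)) \<noteq> {} \<longrightarrow>
        \<phi> \<sigma> a = \<zero>\<^bsub>val_mod \<U> \<A> \<sigma> a\<^esub>)"

definition reduced ::
  "('uo, 'ua) cat \<Rightarrow> ('k, 'uo, 'ua, 'o, 'm) prestack \<Rightarrow> nat \<Rightarrow> nat \<Rightarrow>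
   ('uo, 'ua, 'o, 'm) cochain \<Rightarrow> bool" where
  "reduced \<U> \<A> p q \<phi> \<longleftrightarrow>
     (\<forall>\<sigma> \<in> simplices \<U> p. set (snd \<sigma>) \<inter> Ident \<U> ` Ob \<U> \<noteq> {} \<longrightarrow>
        (\<forall>a \<in> rsimplices (fib \<A> (tgt \<U> \<sigma>)) q. \<phi> \<sigma> a = \<zero>\<^bsub>val_mod \<U> \<A> \<sigma> a\<^esub>))"

definition GSnr ::
  "'k ring \<Rightarrow> ('uo, 'ua) cat \<Rightarrow> ('k, 'uo, 'ua, 'o, 'm) prestack \<Rightarrow> nat \<Rightarrow>
   ('k, nat \<Rightarrow> ('uo, 'ua, 'o, 'm) cochain) module" where
  "GSnr R \<U> \<A> n = (GS R \<U> \<A> n)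
     \<lparr>carrier := {\<phi> \<in> carrier (GS R \<U> \<A> n).
        \<forall>p \<le> n. normalized \<U> \<A> p (n - p) (\<phi> p) \<and> reduced \<U> \<A> p (n - p) (\<phi> p)}\<rparr>"


section \<open>Paths and shuffles\<close>

text \<open>
  A path of an \<open>n\<close>-simplex \<open>\<sigma>\<close> is indexed by its list of choices: the head \<open>i\<close> selects
  \<open>\<epsilon>\<^sup>\<sigma>\<^sup>,\<^sup>i\<close> with \<open>1 \<le> i \<le> n - 1\<close>, the tail is a path of the face \<open>\<partial>\<^sub>i \<sigma>\<close>.
  \<open>path_functors\<close> lists \<open>T\<^sub>0, \<dots>, T\<^sub>n\<^sub>-\<^sub>1\<close> (object part and morphism part) and \<open>path_nats\<close> lists
  \<open>r\<^sub>1, \<dots>, r\<^sub>n\<^sub>-\<^sub>1\<close> as families of components.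
\<close>

definition path_choices :: "nat \<Rightarrow> nat list set" where
  "path_choices n = {cs. length cs = n - 1 \<and> (\<forall>k < n - 1. cs ! k \<in> {1..n - 1 - k})}"

definition path_sign :: "nat list \<Rightarrow> int" where
  "path_sign cs = (\<Prod>i\<leftarrow>cs. (- 1) ^ i)"

fun path_functors ::
  "('uo, 'ua) cat \<Rightarrow> ('k, 'uo, 'ua, 'o, 'm) prestack \<Rightarrow> 'uo \<times> 'ua list \<Rightarrow> nat list \<Rightarrow>
   (('o \<Rightarrow> 'o) \<times> ('m \<Rightarrow> 'm)) list" where
  "path_functors \<U> \<A> \<sigma> [] = [(star_ob \<A> \<sigma>, star_mor \<A> \<sigma>)]"
| "path_functors \<U> \<A> \<sigma> (i # cs) =
     (star_ob \<A> \<sigma>, star_mor \<A> \<sigma>) # path_functors \<U> \<A> (face \<U> i \<sigma>) cs"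

fun path_nats ::
  "('uo, 'ua) cat \<Rightarrow> ('k, 'uo, 'ua, 'o, 'm) prestack \<Rightarrow> 'uo \<times> 'ua list \<Rightarrow> nat list \<Rightarrow>
   ('o \<Rightarrow> 'm) list" where
  "path_nats \<U> \<A> \<sigma> [] = []"
| "path_nats \<U> \<A> \<sigma> (i # cs) = path_nats \<U> \<A> (face \<U> i \<sigma>) cs @ [eps \<A> \<sigma> i]"

definition shuffles_set :: "nat \<Rightarrow> nat \<Rightarrow> (nat \<Rightarrow> nat) set" where
  "shuffles_set m l = {\<beta>. \<beta> permutes {1..m + l} \<and>
     strict_mono_on {1..m} \<beta> \<and> strict_mono_on {m + 1..m + l} \<beta>}"

definition shuffle_simplex ::
  "('k, 'o, 'm) lincat \<Rightarrow> (('o \<Rightarrow> 'o) \<times> ('m \<Rightarrow> 'm)) list \<Rightarrow> ('o \<Rightarrow> 'm) list \<Rightarrow> (nat \<Rightarrow> nat) \<Rightarrow>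
   'o \<times> 'm list \<Rightarrow> 'o \<times> 'm list" where
  "shuffle_simplex C T r \<beta> a =
     (let m = dimn a; l = length r
      in (fst (T ! 0) (fst a),
          map (\<lambda>x. let i = inv_into UNIV \<beta> x in
                 if i \<le> m
                 then snd (T ! (l - card {k \<in> {m + 1..m + l}. \<beta> k < x})) (snd a ! (i - 1))
                 else (r ! (i - m - 1)) (rvertex C a (m - card {k \<in> {1..m}. \<beta> k < x})))
              [1..<m + l + 1]))"


section \<open>The differential\<close>

definition d_zero ::
  "('uo, 'ua) cat \<Rightarrow> ('k, 'uo, 'ua, 'o, 'm) prestack \<Rightarrow> nat \<Rightarrow>
   ('uo, 'ua, 'o, 'm) cochain \<Rightarrow> ('uo, 'ua, 'o, 'm) cochain" where
  "d_zero \<U> \<A> q \<phi> \<sigma> a =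
     (let M = val_mod \<U> \<A> \<sigma> a; C = fib \<A> (fst \<sigma>); D = fib \<A> (tgt \<U> \<sigma>);
          A = fst a; as = snd a
      in (res_mor \<A> (total \<U> \<sigma>) (hd as) \<bullet>\<^bsub>C\<^esub> \<phi> \<sigma> (A, tl as))
         \<oplus>\<^bsub>M\<^esub> (\<Oplus>\<^bsub>M\<^esub>i \<in> {1..q}. [((- 1 :: int) ^ i)] \<cdot>\<^bsub>M\<^esub> \<phi> \<sigma> (A, contract (\<lambda>x y. x \<bullet>\<^bsub>D\<^esub> y) i as))
         \<oplus>\<^bsub>M\<^esub> [((- 1 :: int) ^ (q + 1))] \<cdot>\<^bsub>M\<^esub>
              (\<phi> \<sigma> (Cod D (last as), butlast as) \<bullet>\<^bsub>C\<^esub> star_mor \<A> \<sigma> (last as)))"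

definition d_simp ::
  "('uo, 'ua) cat \<Rightarrow> ('k, 'uo, 'ua, 'o, 'm) prestack \<Rightarrow> nat \<Rightarrow>
   ('uo, 'ua, 'o, 'm) cochain \<Rightarrow> ('uo, 'ua, 'o, 'm) cochain" where
  "d_simp \<U> \<A> p \<phi> \<sigma> a =
     (let M = val_mod \<U> \<A> \<sigma> a; C = fib \<A> (fst \<sigma>); Aq = rtgt (fib \<A> (tgt \<U> \<sigma>)) a;
          u = last (snd \<sigma>)
      in (twist_at \<U> \<A> \<sigma> 1 Aq \<bullet>\<^bsub>C\<^esub> res_mor \<A> (hd (snd \<sigma>)) (\<phi> (face \<U> 0 \<sigma>) a))
         \<oplus>\<^bsub>M\<^esub> (\<Oplus>\<^bsub>M\<^esub>i \<in> {1..p}. [((- 1 :: int) ^ i)] \<cdot>\<^bsub>M\<^esub>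
              (\<phi> (face \<U> i \<sigma>) a \<bullet>\<^bsub>C\<^esub> eps \<A> \<sigma> i (fst a)))
         \<oplus>\<^bsub>M\<^esub> [((- 1 :: int) ^ (p + 1))] \<cdot>\<^bsub>M\<^esub>
              (twist_at \<U> \<A> \<sigma> p Aq \<bullet>\<^bsub>C\<^esub>
               \<phi> (face \<U> (p + 1) \<sigma>) (res_ob \<A> u (fst a), map (res_mor \<A> u) (snd a))))"

definition d_higher ::
  "('uo, 'ua) cat \<Rightarrow> ('k, 'uo, 'ua, 'o, 'm) prestack \<Rightarrow> nat \<Rightarrow> nat \<Rightarrow> nat \<Rightarrow>
   ('uo, 'ua, 'o, 'm) cochain \<Rightarrow> ('uo, 'ua, 'o, 'm) cochain" where
  "d_higher \<U> \<A> p q j \<phi> \<sigma> a =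
     (let M = val_mod \<U> \<A> \<sigma> a; C = fib \<A> (fst \<sigma>); D = fib \<A> (tgt \<U> \<sigma>);
          t = q + 1 - j; \<rho> = Rpart \<U> p \<sigma>
      in \<Oplus>\<^bsub>M\<^esub>cs \<in> path_choices j. \<Oplus>\<^bsub>M\<^esub>\<beta> \<in> shuffles_set t (j - 1).
           [(path_sign cs * sign \<beta> * (- 1) ^ t)] \<cdot>\<^bsub>M\<^esub>
             (twist_at \<U> \<A> \<sigma> p (rtgt D a) \<bullet>\<^bsub>C\<^esub>
              \<phi> (Lpart p \<sigma>)
                (shuffle_simplex D (path_functors \<U> \<A> \<rho> cs) (path_nats \<U> \<A> \<rho> cs) \<beta> a)))"

text \<open>The component of the differential from bidegree \<open>(p, q)\<close> to bidegree
  \<open>(p + j, q + 1 - j)\<close>.\<close>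

definition d_comp ::
  "('uo, 'ua) cat \<Rightarrow> ('k, 'uo, 'ua, 'o, 'm) prestack \<Rightarrow> nat \<Rightarrow> nat \<Rightarrow> nat \<Rightarrow>
   ('uo, 'ua, 'o, 'm) cochain \<Rightarrow> ('uo, 'ua, 'o, 'm) cochain" where
  "d_comp \<U> \<A> p q j \<phi> \<sigma> a =
     (if j = 0 then d_zero \<U> \<A> q \<phi> \<sigma> a
      else if j = 1
      then [((- 1 :: int) ^ (p + q + 1))] \<cdot>\<^bsub>val_mod \<U> \<A> \<sigma> a\<^esub> d_simp \<U> \<A> p \<phi> \<sigma> a
      else d_higher \<U> \<A> p q j \<phi> \<sigma> a)"

text \<open>The differential from degree \<open>n\<close> to degree \<open>n + 1\<close>.\<close>

definition gs_d ::
  "('uo, 'ua) cat \<Rightarrow> ('k, 'uo, 'ua, 'o, 'm) prestack \<Rightarrow> nat \<Rightarrow>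
   (nat \<Rightarrow> ('uo, 'ua, 'o, 'm) cochain) \<Rightarrow> (nat \<Rightarrow> ('uo, 'ua, 'o, 'm) cochain)" where
  "gs_d \<U> \<A> n \<phi> = (\<lambda>s \<in> {..n + 1}. mk_cochain \<U> \<A> s (n + 1 - s)
     (\<lambda>\<sigma> a. \<Oplus>\<^bsub>val_mod \<U> \<A> \<sigma> a\<^esub>p \<in> {p. p \<le> n \<and> p \<le> s}.
        d_comp \<U> \<A> p (n - p) (s - p) (\<phi> p) \<sigma> a))"


section \<open>Cohomology\<close>

definition quot_module :: "('k, 'c) module \<Rightarrow> 'c set \<Rightarrow> ('k, 'c set) module" where
  "quot_module M N =
     \<lparr>carrier = a_rcosets\<^bsub>M\<^esub> N, monoid.mult = undefined, one = undefined, zero = N,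
      add = set_add M, smult = \<lambda>r X. (\<Union>x \<in> X. N +>\<^bsub>M\<^esub> (r \<odot>\<^bsub>M\<^esub> x))\<rparr>"

definition cocycles ::
  "(nat \<Rightarrow> ('k, 'c) module) \<Rightarrow> (nat \<Rightarrow> 'c \<Rightarrow> 'c) \<Rightarrow> nat \<Rightarrow> 'c set" where
  "cocycles M d n = {x \<in> carrier (M n). d n x = \<zero>\<^bsub>M (n + 1)\<^esub>}"

definition coboundaries ::
  "(nat \<Rightarrow> ('k, 'c) module) \<Rightarrow> (nat \<Rightarrow> 'c \<Rightarrow> 'c) \<Rightarrow> nat \<Rightarrow> 'c set" where
  "coboundaries M d n = (case n of 0 \<Rightarrow> {\<zero>\<^bsub>M 0\<^esub>} | Suc k \<Rightarrow> d k ` carrier (M k))"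

definition cohomology ::
  "(nat \<Rightarrow> ('k, 'c) module) \<Rightarrow> (nat \<Rightarrow> 'c \<Rightarrow> 'c) \<Rightarrow> nat \<Rightarrow> ('k, 'c set) module" where
  "cohomology M d n = quot_module ((M n)\<lparr>carrier := cocycles M d n\<rparr>) (coboundaries M d n)"

definition cohom_class ::
  "(nat \<Rightarrow> ('k, 'c) module) \<Rightarrow> (nat \<Rightarrow> 'c \<Rightarrow> 'c) \<Rightarrow> nat \<Rightarrow> 'c \<Rightarrow> 'c set" where
  "cohom_class M d n x = coboundaries M d n +>\<^bsub>M n\<^esub> x"

definition module_iso ::
  "'k ring \<Rightarrow> ('k, 'c) module \<Rightarrow> ('k, 'd) module \<Rightarrow> ('c \<Rightarrow> 'd) set" where
  "module_iso R M N = {f \<in> iso (add_monoid M) (add_monoid N).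
     \<forall>r \<in> carrier R. \<forall>x \<in> carrier M. f (r \<odot>\<^bsub>M\<^esub> x) = r \<odot>\<^bsub>N\<^esub> f x}"


section \<open>First order deformations\<close>

text \<open>
  The pair \<open>(a, a')\<close> stands for \<open>a + a' \<epsilon>\<close>, both in \<open>k[\<epsilon>]\<close> and in \<open>M \<otimes>\<^sub>k k[\<epsilon>] = M \<oplus> M \<epsilon>\<close>.
\<close>

definition dual_ring :: "'k ring \<Rightarrow> ('k \<times> 'k) ring" where
  "dual_ring R =
     \<lparr>carrier = carrier R \<times> carrier R,
      monoid.mult = \<lambda>(a, a') (b, b'). (a \<otimes>\<^bsub>R\<^esub> b, (a \<otimes>\<^bsub>R\<^esub> b') \<oplus>\<^bsub>R\<^esub> (a' \<otimes>\<^bsub>R\<^esub> b)),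
      one = (\<one>\<^bsub>R\<^esub>, \<zero>\<^bsub>R\<^esub>),
      zero = (\<zero>\<^bsub>R\<^esub>, \<zero>\<^bsub>R\<^esub>),
      add = \<lambda>(a, a') (b, b'). (a \<oplus>\<^bsub>R\<^esub> b, a' \<oplus>\<^bsub>R\<^esub> b')\<rparr>"

definition dual_module :: "('k, 'm) module \<Rightarrow> ('k \<times> 'k, 'm \<times> 'm) module" where
  "dual_module M =
     \<lparr>carrier = carrier M \<times> carrier M, monoid.mult = undefined, one = undefined,
      zero = (\<zero>\<^bsub>M\<^esub>, \<zero>\<^bsub>M\<^esub>),
      add = \<lambda>(x, x') (y, y'). (x \<oplus>\<^bsub>M\<^esub> y, x' \<oplus>\<^bsub>M\<^esub> y'),
      smult = \<lambda>(r, r') (x, x'). (r \<odot>\<^bsub>M\<^esub> x, (r \<odot>\<^bsub>M\<^esub> x') \<oplus>\<^bsub>M\<^esub> (r' \<odot>\<^bsub>M\<^esub> x))\<rparr>"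

definition deform_cat ::
  "('k, 'o, 'm) lincat \<Rightarrow> ('o \<times> 'm list \<Rightarrow> 'm) \<Rightarrow> ('k \<times> 'k, 'o, 'm \<times> 'm) lincat" where
  "deform_cat C \<mu> =
     \<lparr>Ob = Ob C,
      Ar = {(a, a'). a \<in> Ar C \<and> a' \<in> Homs C (Dom C a) (Cod C a)},
      Dom = \<lambda>(a, a'). Dom C a,
      Cod = \<lambda>(a, a'). Cod C a,
      Ident = \<lambda>A. (Ident C A, \<zero>\<^bsub>HomMod C A A\<^esub>),
      Comp = \<lambda>(b, b') (a, a').
        (b \<bullet>\<^bsub>C\<^esub> a,
         (b \<bullet>\<^bsub>C\<^esub> a') \<oplus>\<^bsub>HomMod C (Dom C a) (Cod C b)\<^esub> (b' \<bullet>\<^bsub>C\<^esub> a)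
           \<oplus>\<^bsub>HomMod C (Dom C a) (Cod C b)\<^esub> \<mu> (Dom C a, [b, a])),
      HomMod = \<lambda>A B. dual_module (HomMod C A B)\<rparr>"

text \<open>
  The datum \<open>(\<A>[\<epsilon>], m + m\<^sub>1 \<epsilon>, f + f\<^sub>1 \<epsilon>, c + c\<^sub>1 \<epsilon>)\<close>. Recall that \<open>c\<^sub>1\<close> is indexed by the simplex
  \<open>(v, u)\<close>, in order of travel, while \<open>twist\<close> takes \<open>u\<close> and \<open>v\<close> in order of composition.
\<close>

definition deform ::
  "('uo, 'ua) cat \<Rightarrow> ('k, 'uo, 'ua, 'o, 'm) prestack \<Rightarrow> ('uo, 'ua, 'o, 'm) cochain \<Rightarrow>
   ('uo, 'ua, 'o, 'm) cochain \<Rightarrow> ('uo, 'ua, 'o, 'm) cochain \<Rightarrow>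
   ('k \<times> 'k, 'uo, 'ua, 'o, 'm \<times> 'm) prestack" where
  "deform \<U> \<A> m1 f1 c1 =
     \<lparr>fib = \<lambda>U. deform_cat (fib \<A> U) (m1 (U, [])),
      res_ob = res_ob \<A>,
      res_mor = \<lambda>u (a, a').
        (let C = fib \<A> (Cod \<U> u)
         in (res_mor \<A> u a,
             res_mor \<A> u a'
               \<oplus>\<^bsub>HomMod (fib \<A> (Dom \<U> u)) (res_ob \<A> u (Dom C a)) (res_ob \<A> u (Cod C a))\<^esub>
               f1 (Dom \<U> u, [u]) (Dom C a, [a]))),
      twist = \<lambda>u v A. (twist \<A> u v A, c1 (Dom \<U> v, [v, u]) (A, []))\<rparr>"

definition deform_mor ::
  "('uo, 'ua) cat \<Rightarrow> ('k, 'uo, 'ua, 'o, 'm) prestack \<Rightarrow> ('uo, 'ua, 'o, 'm) cochain \<Rightarrow>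
   ('uo, 'ua, 'o, 'm) cochain \<Rightarrow> ('uo, 'ua, 'o, 'm \<times> 'm, 'o, 'm \<times> 'm) psmor" where
  "deform_mor \<U> \<A> g1 t1 =
     \<lparr>on_ob = \<lambda>U A. A,
      on_mor = \<lambda>U (a, a').
        (let C = fib \<A> U
         in (a, a' \<oplus>\<^bsub>HomMod C (Dom C a) (Cod C a)\<^esub> g1 (U, []) (Dom C a, [a]))),
      tau = \<lambda>u A. (Ident (fib \<A> (Dom \<U> u)) (res_ob \<A> u A), t1 (Dom \<U> u, [u]) (A, []))\<rparr>"

definition first_order_deformation ::
  "'k ring \<Rightarrow> ('uo, 'ua) cat \<Rightarrow> ('k, 'uo, 'ua, 'o, 'm) prestack \<Rightarrow>
   ('k \<times> 'k, 'uo, 'ua, 'o, 'm \<times> 'm) prestack \<Rightarrow> bool" where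
  "first_order_deformation R \<U> \<A> \<B> \<longleftrightarrow>
     prestack (dual_ring R) \<U> \<B> \<and>
     (\<exists>m1 \<in> carrier (Cpq R \<U> \<A> 0 2). \<exists>f1 \<in> carrier (Cpq R \<U> \<A> 1 1).
      \<exists>c1 \<in> carrier (Cpq R \<U> \<A> 2 0). \<B> = deform \<U> \<A> m1 f1 c1)"

definition deformation_equiv ::
  "'k ring \<Rightarrow> ('uo, 'ua) cat \<Rightarrow> ('k, 'uo, 'ua, 'o, 'm) prestack \<Rightarrow>
   ('k \<times> 'k, 'uo, 'ua, 'o, 'm \<times> 'm) prestack rel" where
  "deformation_equiv R \<U> \<A> =
     {(\<B>, \<B>'). first_order_deformation R \<U> \<A> \<B> \<and> first_order_deformation R \<U> \<A> \<B>' \<and>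
        (\<exists>g1 \<in> carrier (Cpq R \<U> \<A> 0 1). \<exists>t1 \<in> carrier (Cpq R \<U> \<A> 1 0).
           prestack_iso (dual_ring R) \<U> \<B> \<B>' (deform_mor \<U> \<A> g1 t1))}"

definition Def ::
  "'k ring \<Rightarrow> ('uo, 'ua) cat \<Rightarrow> ('k, 'uo, 'ua, 'o, 'm) prestack \<Rightarrow>
   ('k \<times> 'k, 'uo, 'ua, 'o, 'm \<times> 'm) prestack set set" where
  "Def R \<U> \<A> = {\<B>. first_order_deformation R \<U> \<A> \<B>} // deformation_equiv R \<U> \<A>"

definition cochain1 ::
  "('uo, 'ua, 'o, 'm) cochain \<Rightarrow> ('uo, 'ua, 'o, 'm) cochain \<Rightarrow>
   nat \<Rightarrow> ('uo, 'ua, 'o, 'm) cochain" where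
  "cochain1 g t = (\<lambda>p \<in> {..1}. [g, t] ! p)"

definition cochain2 ::
  "('uo, 'ua, 'o, 'm) cochain \<Rightarrow> ('uo, 'ua, 'o, 'm) cochain \<Rightarrow> ('uo, 'ua, 'o, 'm) cochain \<Rightarrow>
   nat \<Rightarrow> ('uo, 'ua, 'o, 'm) cochain" where
  "cochain2 m f c = (\<lambda>p \<in> {..2}. [m, f, c] ! p)"

end

theory Submission
  imports Defs
begin

text \<open>
  A datum \<open>(\<A>[\<epsilon>], m + m\<^sub>1 \<epsilon>, f + f\<^sub>1 \<epsilon>, c + c\<^sub>1 \<epsilon>)\<close> is a prestack when four
  families of equations between composites hold: associativity of \<open>m + m\<^sub>1 \<epsilon>\<close>, functoriality of
  \<open>f + f\<^sub>1 \<epsilon>\<close>, naturality of \<open>c + c\<^sub>1 \<epsilon>\<close> and its coherence; in addition, units must be respected and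
  \<open>c + c\<^sub>1 \<epsilon>\<close> must be invertible. Each equation holds in degree zero because \<open>\<A>\<close> is a prestack, so
  what remains is its coefficient at \<open>\<epsilon>\<close>, and these four coefficients are exactly the four
  components of \<open>d (m\<^sub>1, f\<^sub>1, c\<^sub>1) = 0\<close>. In degrees one and two only paths and shuffles of length at
  most two occur, so the components can be written out (\<open>gs_val_2_0\<close> to \<open>gs_val_2_3\<close>,
  \<open>cocycle_iff\<close>). The unit conditions say that \<open>(m\<^sub>1, f\<^sub>1, c\<^sub>1)\<close> is normalized and reduced, and
  invertibility is automatic because a lift of an isomorphism along \<open>\<epsilon> \<mapsto> 0\<close> is an isomorphism
  (\<open>E_iso\<close>). This proves \<open>deform_prestack_iff\<close>.

  In the same way \<open>(1 + g\<^sub>1 \<epsilon>, 1 + \<tau>\<^sub>1 \<epsilon>)\<close> is a morphism between two deformations when the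
  \<open>\<epsilon>\<close>-coefficients of functoriality, naturality and compatibility with the twists vanish, and these
  are the three components of \<open>d (g\<^sub>1, -\<tau>\<^sub>1)\<close> being the difference of the two cocycles
  (\<open>coboundary_iff\<close>, \<open>deform_morphism_iff\<close>). Its inverse is \<open>(1 - g\<^sub>1 \<epsilon>, 1 - \<tau>\<^sub>1 \<epsilon>)\<close>, a morphism
  by linearity of \<open>d\<close> (\<open>deform_iso_iff\<close>). Hence two normalized reduced cocycles define equivalent
  deformations if and only if they differ by the coboundary of a normalized reduced cochain, which
  gives the bijection between cohomology classes and equivalence classes of deformations.

  For the comparison with the full complex two facts are needed. A one-cochain whose coboundary is
  normalized and reduced is itself normalized and reduced (\<open>coboundary_normalized_reduced\<close>): evaluate
  the coboundary at identities. And every two-cocycle \<open>z = (m, f, c)\<close> is cohomologous to a normalized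
  reduced one (\<open>cocycle_normalize\<close>): subtract the coboundary of \<open>(g, t)\<close> with \<open>g(a) = a m(1, 1)\<close> and
  \<open>t\<^sup>u = c\<^bsup>1,u\<^esup> + m(1, 1)\<close>, which removes \<open>m(1, 1)\<close> and \<open>c\<^bsup>1,1\<^esup>\<close>; the cocycle equations at
  identities then force all other degenerate values to vanish (\<open>cocycle_normalized_reduced\<close>). That
  the difference is still a cocycle uses \<open>d d = 0\<close> on one-cochains (\<open>gs_d_gs_d\<close>), where the terms
  cancel in pairs by naturality and coherence of the twists.
\<close>

section \<open>Calculation rules for linear categories\<close>

lemma mem_Homs: "a \<in> Homs C A B \<longleftrightarrow> a \<in> Ar C \<and> Dom C a = A \<and> Cod C a = B"
  by (auto simp: Homs_def)

text \<open>
  The form of \<open>mem_Homs\<close> that is safe as a simplification rule. Membership of a sum in a set of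
  arrows has to be reduced to membership of the two summands (\<open>hadd_closed\<close>); unfolding it instead
  would ask for domain and codomain of the sum separately, each of which asks for the summands
  again, and the number of subgoals would grow exponentially with the length of a sum.
\<close>

lemma mem_Homs_guarded:
  assumes "NO_MATCH (x \<oplus>\<^bsub>HomMod C' A' B'\<^esub> y) a"
  shows "a \<in> Homs C A B \<longleftrightarrow> a \<in> Ar C \<and> Dom C a = A \<and> Cod C a = B"
  by (rule mem_Homs)

context category begin

lemma Comp_type:
  assumes "a \<in> Ar C" "b \<in> Ar C" "Dom C b = Cod C a"
  shows "b \<bullet>\<^bsub>C\<^esub> a \<in> Ar C" "Dom C (b \<bullet>\<^bsub>C\<^esub> a) = Dom C a" "Cod C (b \<bullet>\<^bsub>C\<^esub> a) = Cod C b"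
  using Comp_closed[of b "Cod C a" "Cod C b" a "Dom C a"] assms by (auto simp: Homs_def)

lemma Ident_type:
  assumes "A \<in> Ob C"
  shows "Ident C A \<in> Ar C" "Dom C (Ident C A) = A" "Cod C (Ident C A) = A"
  using Ident_closed[OF assms] by (auto simp: Homs_def)

lemma assoc:
  assumes "a \<in> Ar C" "b \<in> Ar C" "h \<in> Ar C" "Dom C b = Cod C a" "Dom C h = Cod C b"
  shows "(h \<bullet>\<^bsub>C\<^esub> b) \<bullet>\<^bsub>C\<^esub> a = h \<bullet>\<^bsub>C\<^esub> (b \<bullet>\<^bsub>C\<^esub> a)"
  using Comp_assoc[of h "Cod C b" "Cod C h" b "Cod C a" a "Dom C a"] assms by (auto simp: Homs_def)

lemma ident_left: "a \<in> Ar C \<Longrightarrow> Cod C a = B \<Longrightarrow> Ident C B \<bullet>\<^bsub>C\<^esub> a = a"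
  using Comp_Ident_left[of a "Dom C a" B] by (auto simp: Homs_def)

lemma ident_right: "a \<in> Ar C \<Longrightarrow> Dom C a = A \<Longrightarrow> a \<bullet>\<^bsub>C\<^esub> Ident C A = a"
  using Comp_Ident_right[of a A "Cod C a"] by (auto simp: Homs_def)

lemmas cat_rules = Dom_closed Cod_closed mem_Homs_guarded Comp_type Ident_type assoc ident_left ident_right

end

context linear_category begin

lemma HomMod_abelian_group: "A \<in> Ob C \<Longrightarrow> B \<in> Ob C \<Longrightarrow> abelian_group (HomMod C A B)"
  using HomMod_module module.axioms(2) by blast

lemma hom_obs: "x \<in> Homs C A B \<Longrightarrow> A \<in> Ob C" "x \<in> Homs C A B \<Longrightarrow> B \<in> Ob C"
  using Dom_closed Cod_closed by (auto simp: Homs_def)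

lemma hadd_closed:
  assumes "x \<in> Homs C A B" "y \<in> Homs C A B"
  shows "x \<oplus>\<^bsub>HomMod C A B\<^esub> y \<in> Homs C A B"
proof -
  note ob = hom_obs[OF assms(1)]
  interpret abelian_group "HomMod C A B" using HomMod_abelian_group ob by blast
  show ?thesis using a_closed[of x y] assms HomMod_carrier ob by simp
qed

lemma hadd_type:
  assumes "x \<in> Homs C A B" "y \<in> Homs C A B"
  shows "x \<oplus>\<^bsub>HomMod C A B\<^esub> y \<in> Ar C" "Dom C (x \<oplus>\<^bsub>HomMod C A B\<^esub> y) = A"
    "Cod C (x \<oplus>\<^bsub>HomMod C A B\<^esub> y) = B"
  using hadd_closed[OF assms] by (auto simp: Homs_def)

lemma hzero_type:
  assumes "A \<in> Ob C" "B \<in> Ob C"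
  shows "\<zero>\<^bsub>HomMod C A B\<^esub> \<in> Ar C" "Dom C (\<zero>\<^bsub>HomMod C A B\<^esub>) = A" "Cod C (\<zero>\<^bsub>HomMod C A B\<^esub>) = B"
  using HomMod_abelian_group[OF assms] HomMod_carrier[OF assms]
  by (metis (mono_tags, lifting) Homs_def abelian_group_def abelian_monoid.zero_closed mem_Collect_eq)+

lemma hneg_closed:
  assumes "x \<in> Homs C A B"
  shows "\<ominus>\<^bsub>HomMod C A B\<^esub> x \<in> Homs C A B"
  using HomMod_abelian_group[OF hom_obs[OF assms]] HomMod_carrier[OF hom_obs[OF assms]] assms
  by (metis abelian_group.a_inv_closed)

lemma hneg_type:
  assumes "x \<in> Homs C A B"
  shows "\<ominus>\<^bsub>HomMod C A B\<^esub> x \<in> Ar C" "Dom C (\<ominus>\<^bsub>HomMod C A B\<^esub> x) = A" "Cod C (\<ominus>\<^bsub>HomMod C A B\<^esub> x) = B"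
  using hneg_closed[OF assms] by (auto simp: Homs_def)

lemma hsmult_closed:
  assumes "r \<in> carrier R" "x \<in> Homs C A B"
  shows "r \<odot>\<^bsub>HomMod C A B\<^esub> x \<in> Homs C A B"
  using HomMod_module[OF hom_obs[OF assms(2)]] HomMod_carrier[OF hom_obs[OF assms(2)]] assms
  by (metis module.smult_closed)

lemma hsmult_type:
  assumes "r \<in> carrier R" "x \<in> Homs C A B"
  shows "r \<odot>\<^bsub>HomMod C A B\<^esub> x \<in> Ar C" "Dom C (r \<odot>\<^bsub>HomMod C A B\<^esub> x) = A"
    "Cod C (r \<odot>\<^bsub>HomMod C A B\<^esub> x) = B"
  using hsmult_closed[OF assms] by (auto simp: Homs_def)

lemma hadd_group:
  assumes "x \<in> Homs C A B" 
  shows "\<zero>\<^bsub>HomMod C A B\<^esub> \<oplus>\<^bsub>HomMod C A B\<^esub> x = x" "x \<oplus>\<^bsub>HomMod C A B\<^esub> \<zero>\<^bsub>HomMod C A B\<^esub> = x"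
    "x \<oplus>\<^bsub>HomMod C A B\<^esub> \<ominus>\<^bsub>HomMod C A B\<^esub> x = \<zero>\<^bsub>HomMod C A B\<^esub>"
    "\<ominus>\<^bsub>HomMod C A B\<^esub> x \<oplus>\<^bsub>HomMod C A B\<^esub> x = \<zero>\<^bsub>HomMod C A B\<^esub>"
    "\<ominus>\<^bsub>HomMod C A B\<^esub> (\<ominus>\<^bsub>HomMod C A B\<^esub> x) = x"
proof -
  note ob = hom_obs[OF assms(1)]
  interpret abelian_group "HomMod C A B" using HomMod_abelian_group ob by blast
  show "\<zero>\<^bsub>HomMod C A B\<^esub> \<oplus>\<^bsub>HomMod C A B\<^esub> x = x" "x \<oplus>\<^bsub>HomMod C A B\<^esub> \<zero>\<^bsub>HomMod C A B\<^esub> = x"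
    "x \<oplus>\<^bsub>HomMod C A B\<^esub> \<ominus>\<^bsub>HomMod C A B\<^esub> x = \<zero>\<^bsub>HomMod C A B\<^esub>"
    "\<ominus>\<^bsub>HomMod C A B\<^esub> x \<oplus>\<^bsub>HomMod C A B\<^esub> x = \<zero>\<^bsub>HomMod C A B\<^esub>"
    "\<ominus>\<^bsub>HomMod C A B\<^esub> (\<ominus>\<^bsub>HomMod C A B\<^esub> x) = x"
    using assms HomMod_carrier ob by (simp_all add: r_neg l_neg)
qed

lemma hneg_zero:
  assumes "A \<in> Ob C" "B \<in> Ob C"
  shows "\<ominus>\<^bsub>HomMod C A B\<^esub> \<zero>\<^bsub>HomMod C A B\<^esub> = \<zero>\<^bsub>HomMod C A B\<^esub>"
    "\<zero>\<^bsub>HomMod C A B\<^esub> \<oplus>\<^bsub>HomMod C A B\<^esub> \<zero>\<^bsub>HomMod C A B\<^esub> = \<zero>\<^bsub>HomMod C A B\<^esub>"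
proof -
  interpret abelian_group "HomMod C A B" using HomMod_abelian_group assms by blast
  show "\<ominus>\<^bsub>HomMod C A B\<^esub> \<zero>\<^bsub>HomMod C A B\<^esub> = \<zero>\<^bsub>HomMod C A B\<^esub>"
    "\<zero>\<^bsub>HomMod C A B\<^esub> \<oplus>\<^bsub>HomMod C A B\<^esub> \<zero>\<^bsub>HomMod C A B\<^esub> = \<zero>\<^bsub>HomMod C A B\<^esub>" by simp_all
qed

lemma hadd_assoc:
  assumes "x \<in> Homs C A B" "y \<in> Homs C A B" "z \<in> Homs C A B"
  shows "(x \<oplus>\<^bsub>HomMod C A B\<^esub> y) \<oplus>\<^bsub>HomMod C A B\<^esub> z = x \<oplus>\<^bsub>HomMod C A B\<^esub> (y \<oplus>\<^bsub>HomMod C A B\<^esub> z)"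
  using HomMod_abelian_group[OF hom_obs[OF assms(1)]] HomMod_carrier[OF hom_obs[OF assms(1)]] assms
  by (simp add: abelian_group_def abelian_monoid.a_assoc)

lemma hadd_comm:
  assumes "x \<in> Homs C A B" "y \<in> Homs C A B"
  shows "x \<oplus>\<^bsub>HomMod C A B\<^esub> y = y \<oplus>\<^bsub>HomMod C A B\<^esub> x"
  using HomMod_abelian_group[OF hom_obs[OF assms(1)]] HomMod_carrier[OF hom_obs[OF assms(1)]] assms
  by (simp add: abelian_group_def abelian_monoid.a_comm)

lemma hadd_left_comm:
  assumes "x \<in> Homs C A B" "y \<in> Homs C A B" "z \<in> Homs C A B"
  shows "x \<oplus>\<^bsub>HomMod C A B\<^esub> (y \<oplus>\<^bsub>HomMod C A B\<^esub> z) = y \<oplus>\<^bsub>HomMod C A B\<^esub> (x \<oplus>\<^bsub>HomMod C A B\<^esub> z)"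
  using hadd_assoc[OF assms] hadd_assoc[OF assms(2,1,3)] hadd_comm[OF assms(1,2)] by simp

lemmas hadd_ac = hadd_assoc hadd_comm hadd_left_comm

lemma comp_hadd_right:
  assumes "b \<in> Ar C" "Dom C b = B" "x \<in> Homs C A B" "y \<in> Homs C A B"
  shows "b \<bullet>\<^bsub>C\<^esub> (x \<oplus>\<^bsub>HomMod C A B\<^esub> y) = (b \<bullet>\<^bsub>C\<^esub> x) \<oplus>\<^bsub>HomMod C A (Cod C b)\<^esub> (b \<bullet>\<^bsub>C\<^esub> y)"
  using assms by (intro Comp_add_right) (auto simp: Homs_def)

lemma comp_hadd_left:
  assumes "a \<in> Ar C" "Cod C a = B" "x \<in> Homs C B D" "y \<in> Homs C B D"
  shows "(x \<oplus>\<^bsub>HomMod C B D\<^esub> y) \<bullet>\<^bsub>C\<^esub> a = (x \<bullet>\<^bsub>C\<^esub> a) \<oplus>\<^bsub>HomMod C (Dom C a) D\<^esub> (y \<bullet>\<^bsub>C\<^esub> a)"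
  using assms by (intro Comp_add_left) (auto simp: Homs_def)

lemma comp_hsmult_right:
  assumes "r \<in> carrier R" "b \<in> Ar C" "Dom C b = B" "x \<in> Homs C A B"
  shows "b \<bullet>\<^bsub>C\<^esub> (r \<odot>\<^bsub>HomMod C A B\<^esub> x) = r \<odot>\<^bsub>HomMod C A (Cod C b)\<^esub> (b \<bullet>\<^bsub>C\<^esub> x)"
  using assms by (intro Comp_smult_right) (auto simp: Homs_def)

lemma comp_hsmult_left:
  assumes "r \<in> carrier R" "a \<in> Ar C" "Cod C a = B" "x \<in> Homs C B D"
  shows "(r \<odot>\<^bsub>HomMod C B D\<^esub> x) \<bullet>\<^bsub>C\<^esub> a = r \<odot>\<^bsub>HomMod C (Dom C a) D\<^esub> (x \<bullet>\<^bsub>C\<^esub> a)"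
  using assms by (intro Comp_smult_left) (auto simp: Homs_def)

text \<open>
  The way in which the vanishing of a degenerate value is always obtained: an equation evaluated at
  identities reads \<open>x + x = x\<close>.
\<close>

lemma hadd_idem_zero:
  assumes "x \<in> Homs C A B" "x \<oplus>\<^bsub>HomMod C A B\<^esub> x = x"
  shows "x = \<zero>\<^bsub>HomMod C A B\<^esub>"
proof -
  interpret abelian_group "HomMod C A B" using HomMod_abelian_group hom_obs[OF assms(1)] by blast
  show ?thesis using assms HomMod_carrier hom_obs[OF assms(1)] add.r_cancel_one by metis
qed

lemma comp_hzero:
  assumes "a \<in> Ar C"
  shows "D \<in> Ob C \<Longrightarrow> Cod C a = B \<Longrightarrow> \<zero>\<^bsub>HomMod C B D\<^esub> \<bullet>\<^bsub>C\<^esub> a = \<zero>\<^bsub>HomMod C (Dom C a) D\<^esub>"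
    "D \<in> Ob C \<Longrightarrow> Dom C a = B \<Longrightarrow> a \<bullet>\<^bsub>C\<^esub> \<zero>\<^bsub>HomMod C D B\<^esub> = \<zero>\<^bsub>HomMod C D (Cod C a)\<^esub>"
proof -
  note ob = Dom_closed[OF assms] Cod_closed[OF assms]
  show "\<zero>\<^bsub>HomMod C B D\<^esub> \<bullet>\<^bsub>C\<^esub> a = \<zero>\<^bsub>HomMod C (Dom C a) D\<^esub>" if "D \<in> Ob C" "Cod C a = B"
    using that ob assms comp_hadd_left[of a B "\<zero>\<^bsub>HomMod C B D\<^esub>" D "\<zero>\<^bsub>HomMod C B D\<^esub>"]
    by (intro hadd_idem_zero) (auto simp: cat_rules hzero_type hneg_zero)
  show "a \<bullet>\<^bsub>C\<^esub> \<zero>\<^bsub>HomMod C D B\<^esub> = \<zero>\<^bsub>HomMod C D (Cod C a)\<^esub>" if "D \<in> Ob C" "Dom C a = B"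
    using that ob assms comp_hadd_right[of a B "\<zero>\<^bsub>HomMod C D B\<^esub>" D "\<zero>\<^bsub>HomMod C D B\<^esub>"]
    by (intro hadd_idem_zero) (auto simp: cat_rules hzero_type hneg_zero)
qed

lemma hneg_unique:
  assumes "x \<in> Homs C A B" "y \<in> Homs C A B" "x \<oplus>\<^bsub>HomMod C A B\<^esub> y = \<zero>\<^bsub>HomMod C A B\<^esub>"
  shows "x = \<ominus>\<^bsub>HomMod C A B\<^esub> y"
  using assms abelian_group.minus_equality[OF HomMod_abelian_group[OF hom_obs[OF assms(1)]]]
    HomMod_carrier[OF hom_obs[OF assms(1)]] by metis

lemma comp_hneg:
  assumes "a \<in> Ar C"
  shows "x \<in> Homs C B D \<Longrightarrow> Cod C a = B \<Longrightarrow>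
      (\<ominus>\<^bsub>HomMod C B D\<^esub> x) \<bullet>\<^bsub>C\<^esub> a = \<ominus>\<^bsub>HomMod C (Dom C a) D\<^esub> (x \<bullet>\<^bsub>C\<^esub> a)"
    "x \<in> Homs C D B \<Longrightarrow> Dom C a = B \<Longrightarrow>
      a \<bullet>\<^bsub>C\<^esub> (\<ominus>\<^bsub>HomMod C D B\<^esub> x) = \<ominus>\<^bsub>HomMod C D (Cod C a)\<^esub> (a \<bullet>\<^bsub>C\<^esub> x)"
proof -
  note ob = Dom_closed[OF assms] Cod_closed[OF assms]
  show "(\<ominus>\<^bsub>HomMod C B D\<^esub> x) \<bullet>\<^bsub>C\<^esub> a = \<ominus>\<^bsub>HomMod C (Dom C a) D\<^esub> (x \<bullet>\<^bsub>C\<^esub> a)"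
    if x: "x \<in> Homs C B D" and [simp]: "Cod C a = B"
    using x hom_obs[OF x] ob assms comp_hadd_left[of a B "\<ominus>\<^bsub>HomMod C B D\<^esub> x" D x]
    by (intro hneg_unique) (auto simp: cat_rules hneg_type hadd_group comp_hzero)
  show "a \<bullet>\<^bsub>C\<^esub> (\<ominus>\<^bsub>HomMod C D B\<^esub> x) = \<ominus>\<^bsub>HomMod C D (Cod C a)\<^esub> (a \<bullet>\<^bsub>C\<^esub> x)"
    if x: "x \<in> Homs C D B" and [simp]: "Dom C a = B"
    using x hom_obs[OF x] ob assms comp_hadd_right[of a B "\<ominus>\<^bsub>HomMod C D B\<^esub> x" D x]
    by (intro hneg_unique) (auto simp: cat_rules hneg_type hadd_group comp_hzero)
qed

lemma hsmult_hadd: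
  assumes "r \<in> carrier R" "x \<in> Homs C A B" "y \<in> Homs C A B"
  shows "r \<odot>\<^bsub>HomMod C A B\<^esub> (x \<oplus>\<^bsub>HomMod C A B\<^esub> y)
    = (r \<odot>\<^bsub>HomMod C A B\<^esub> x) \<oplus>\<^bsub>HomMod C A B\<^esub> (r \<odot>\<^bsub>HomMod C A B\<^esub> y)"
  using HomMod_module[OF hom_obs[OF assms(2)]] HomMod_carrier[OF hom_obs[OF assms(2)]] assms
  by (metis module.smult_r_distr)

lemma hsmult_hneg:
  assumes "r \<in> carrier R" "x \<in> Homs C A B"
  shows "r \<odot>\<^bsub>HomMod C A B\<^esub> (\<ominus>\<^bsub>HomMod C A B\<^esub> x) = \<ominus>\<^bsub>HomMod C A B\<^esub> (r \<odot>\<^bsub>HomMod C A B\<^esub> x)"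
  using HomMod_module[OF hom_obs[OF assms(2)]] HomMod_carrier[OF hom_obs[OF assms(2)]] assms
  by (metis module.smult_r_minus)

lemma hadd_neg_eq_iff:
  assumes "p \<in> Homs C A B" "n \<in> Homs C A B" "x \<in> Homs C A B"
  shows "p \<oplus>\<^bsub>HomMod C A B\<^esub> \<ominus>\<^bsub>HomMod C A B\<^esub> n = x \<longleftrightarrow> p = x \<oplus>\<^bsub>HomMod C A B\<^esub> n"
proof -
  interpret abelian_group "HomMod C A B" using HomMod_abelian_group hom_obs[OF assms(1)] by blast
  have "p \<in> carrier (HomMod C A B)" "n \<in> carrier (HomMod C A B)" "x \<in> carrier (HomMod C A B)"
    using assms HomMod_carrier[OF hom_obs[OF assms(1)]] by simp_all
  then show ?thesis
    by (metis a_inv_closed a_assoc l_neg r_neg r_zero)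
qed

lemmas lin_rules = cat_rules hadd_closed hadd_type hzero_type hneg_type hsmult_type
lemmas lin_dist = comp_hadd_right comp_hadd_left comp_hsmult_right comp_hsmult_left comp_hzero
  comp_hneg hsmult_hadd

end

section \<open>First order deformations of a linear category\<close>

lemma dual_ring_cring:
  assumes "cring R"
  shows "cring (dual_ring R)"
proof -
  interpret cring R by fact
  show ?thesis
  proof (rule cringI)
    show "abelian_group (dual_ring R)"
    proof (rule abelian_groupI)
      fix x assume "x \<in> carrier (dual_ring R)"
      then obtain a b where x: "x = (a, b)" "a \<in> carrier R" "b \<in> carrier R"
        by (auto simp: dual_ring_def)
      show "\<exists>y \<in> carrier (dual_ring R). y \<oplus>\<^bsub>dual_ring R\<^esub> x = \<zero>\<^bsub>dual_ring R\<^esub>"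
        using x by (intro bexI[of _ "(\<ominus>\<^bsub>R\<^esub> a, \<ominus>\<^bsub>R\<^esub> b)"]) (auto simp: dual_ring_def l_neg)
    qed (auto simp: dual_ring_def a_ac)
    show "comm_monoid (dual_ring R)"
      by (rule comm_monoidI) (auto simp: dual_ring_def m_ac r_distr l_distr a_ac)
  qed (auto simp: dual_ring_def l_distr a_ac)
qed

lemma dual_module_module:
  assumes "module R M"
  shows "module (dual_ring R) (dual_module M)"
proof -
  interpret module R M by fact
  show ?thesis
  proof (rule moduleI)
    show "cring (dual_ring R)" using dual_ring_cring R.is_cring by blast
    show "abelian_group (dual_module M)"
    proof (rule abelian_groupI)
      fix x assume "x \<in> carrier (dual_module M)"
      then obtain a b where x: "x = (a, b)" "a \<in> carrier M" "b \<in> carrier M"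
        by (auto simp: dual_module_def)
      show "\<exists>y \<in> carrier (dual_module M). y \<oplus>\<^bsub>dual_module M\<^esub> x = \<zero>\<^bsub>dual_module M\<^esub>"
        using x by (intro bexI[of _ "(\<ominus>\<^bsub>M\<^esub> a, \<ominus>\<^bsub>M\<^esub> b)"]) (auto simp: dual_module_def M.l_neg)
    qed (auto simp: dual_module_def M.a_ac)
  qed (auto simp: dual_module_def dual_ring_def M.a_ac smult_l_distr smult_r_distr smult_assoc1)
qed

lemma (in linear_category) hadd_neg_sum:
  assumes "x \<in> Homs C A B" "y \<in> Homs C A B"
  shows "x \<oplus>\<^bsub>HomMod C A B\<^esub> (y \<oplus>\<^bsub>HomMod C A B\<^esub> \<ominus>\<^bsub>HomMod C A B\<^esub> (x \<oplus>\<^bsub>HomMod C A B\<^esub> y)) = \<zero>\<^bsub>HomMod C A B\<^esub>"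
  using assms hadd_assoc[of x A B y] hneg_closed[OF hadd_closed[OF assms]]
    hadd_group(3)[OF hadd_closed[OF assms]] by metis

text \<open>
  A Hochschild two-cochain \<open>\<mu>\<close> of a single linear category, that is, a first order change of its
  composition. The component \<open>m\<^sub>1\<close> of a cochain of the prestack is a family of these
  (\<open>C02_hoch\<close>, \<open>C02_I\<close>).
\<close>

locale hoch_cochain = linear_category R C
  for R :: "'k ring" and C :: "('k, 'o, 'a) lincat" +
  fixes \<mu> :: "'o \<times> 'a list \<Rightarrow> 'a"
  assumes mu_closed: "\<lbrakk>a \<in> Ar C; b \<in> Ar C; Dom C a = A; Dom C b = Cod C a\<rbrakk>
      \<Longrightarrow> \<mu> (A, [b, a]) \<in> Homs C A (Cod C b)"
    and mu_add_left: "\<lbrakk>a \<in> Homs C A B; b \<in> Homs C B D; b' \<in> Homs C B D\<rbrakk>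
      \<Longrightarrow> \<mu> (A, [b \<oplus>\<^bsub>HomMod C B D\<^esub> b', a]) = \<mu> (A, [b, a]) \<oplus>\<^bsub>HomMod C A D\<^esub> \<mu> (A, [b', a])"
    and mu_add_right: "\<lbrakk>a \<in> Homs C A B; a' \<in> Homs C A B; b \<in> Homs C B D\<rbrakk>
      \<Longrightarrow> \<mu> (A, [b, a \<oplus>\<^bsub>HomMod C A B\<^esub> a']) = \<mu> (A, [b, a]) \<oplus>\<^bsub>HomMod C A D\<^esub> \<mu> (A, [b, a'])"
    and mu_smult_left: "\<lbrakk>r \<in> carrier R; a \<in> Homs C A B; b \<in> Homs C B D\<rbrakk>
      \<Longrightarrow> \<mu> (A, [r \<odot>\<^bsub>HomMod C B D\<^esub> b, a]) = r \<odot>\<^bsub>HomMod C A D\<^esub> \<mu> (A, [b, a])"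
    and mu_smult_right: "\<lbrakk>r \<in> carrier R; a \<in> Homs C A B; b \<in> Homs C B D\<rbrakk>
      \<Longrightarrow> \<mu> (A, [b, r \<odot>\<^bsub>HomMod C A B\<^esub> a]) = r \<odot>\<^bsub>HomMod C A D\<^esub> \<mu> (A, [b, a])"
begin

lemma mu_type:
  assumes "a \<in> Ar C" "b \<in> Ar C" "Dom C a = A" "Dom C b = Cod C a"
  shows "\<mu> (A, [b, a]) \<in> Ar C" "Dom C (\<mu> (A, [b, a])) = A" "Cod C (\<mu> (A, [b, a])) = Cod C b"
  using mu_closed[OF assms] by (auto simp: Homs_def)

definition mu_unital :: bool where
  "mu_unital \<longleftrightarrow> (\<forall>a \<in> Ar C.
     \<mu> (Dom C a, [Ident C (Cod C a), a]) = \<zero>\<^bsub>HomMod C (Dom C a) (Cod C a)\<^esub> \<and>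
     \<mu> (Dom C a, [a, Ident C (Dom C a)]) = \<zero>\<^bsub>HomMod C (Dom C a) (Cod C a)\<^esub>)"

definition mu_cocycle :: bool where
  "mu_cocycle \<longleftrightarrow> (\<forall>a \<in> Ar C. \<forall>b \<in> Ar C. \<forall>h \<in> Ar C. Dom C b = Cod C a \<longrightarrow> Dom C h = Cod C b \<longrightarrow>
     (h \<bullet>\<^bsub>C\<^esub> \<mu> (Dom C a, [b, a])) \<oplus>\<^bsub>HomMod C (Dom C a) (Cod C h)\<^esub> \<mu> (Dom C a, [h, b \<bullet>\<^bsub>C\<^esub> a])
     = \<mu> (Dom C a, [h \<bullet>\<^bsub>C\<^esub> b, a])
         \<oplus>\<^bsub>HomMod C (Dom C a) (Cod C h)\<^esub> (\<mu> (Dom C b, [h, b]) \<bullet>\<^bsub>C\<^esub> a))"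

abbreviation "E \<equiv> deform_cat C \<mu>"

lemma E_sel:
  "Ob E = Ob C" "Ar E = {(a, a'). a \<in> Ar C \<and> a' \<in> Homs C (Dom C a) (Cod C a)}"
  "Dom E (a, a') = Dom C a" "Cod E (a, a') = Cod C a" "Ident E A = (Ident C A, \<zero>\<^bsub>HomMod C A A\<^esub>)"
  "(b, b') \<bullet>\<^bsub>E\<^esub> (a, a') = (b \<bullet>\<^bsub>C\<^esub> a,
         (b \<bullet>\<^bsub>C\<^esub> a') \<oplus>\<^bsub>HomMod C (Dom C a) (Cod C b)\<^esub> (b' \<bullet>\<^bsub>C\<^esub> a)
           \<oplus>\<^bsub>HomMod C (Dom C a) (Cod C b)\<^esub> \<mu> (Dom C a, [b, a]))"
  "HomMod E A B = dual_module (HomMod C A B)"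
  by (simp_all add: deform_cat_def)

lemma Homs_E: "Homs E A B = Homs C A B \<times> Homs C A B"
  by (auto simp: Homs_def E_sel)

lemma dual_sel:
  "(x, x') \<oplus>\<^bsub>dual_module M\<^esub> (y, y') = (x \<oplus>\<^bsub>M\<^esub> y, x' \<oplus>\<^bsub>M\<^esub> y')"
  "(r, r') \<odot>\<^bsub>dual_module M\<^esub> (x, x') = (r \<odot>\<^bsub>M\<^esub> x, (r \<odot>\<^bsub>M\<^esub> x') \<oplus>\<^bsub>M\<^esub> (r' \<odot>\<^bsub>M\<^esub> x))"
  "\<zero>\<^bsub>dual_module M\<^esub> = (\<zero>\<^bsub>M\<^esub>, \<zero>\<^bsub>M\<^esub>)"
  "carrier (dual_module M) = carrier M \<times> carrier M"
  "carrier (dual_ring K) = carrier K \<times> carrier K"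
  by (simp_all add: dual_module_def dual_ring_def)

text \<open>
  The \<open>\<epsilon>\<close>-coefficients of the unit laws and of associativity. They are extracted from the category
  axioms at arrows of the form \<open>a + 0 \<epsilon>\<close>; conversely these suffice because the terms in which the
  \<open>\<epsilon>\<close>-part of an arrow occurs cancel by associativity and the unit laws of \<open>C\<close>.
\<close>

lemma E_category_iff: "category E \<longleftrightarrow> mu_unital \<and> mu_cocycle"
proof
  assume "category E"
  then interpret E: category E .
  have "mu_unital"
    unfolding mu_unital_def
  proof (intro ballI conjI)
    fix a assume a: "a \<in> Ar C"
    then have *: "(a, \<zero>\<^bsub>HomMod C (Dom C a) (Cod C a)\<^esub>) \<in> Ar E"
      by (simp add: E_sel lin_rules)
    show "\<mu> (Dom C a, [Ident C (Cod C a), a]) = \<zero>\<^bsub>HomMod C (Dom C a) (Cod C a)\<^esub>"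
      using E.ident_left[OF * refl] a by (simp add: E_sel lin_rules lin_dist hadd_group hneg_zero mu_type)
    show "\<mu> (Dom C a, [a, Ident C (Dom C a)]) = \<zero>\<^bsub>HomMod C (Dom C a) (Cod C a)\<^esub>"
      using E.ident_right[OF * refl] a by (simp add: E_sel lin_rules lin_dist hadd_group hneg_zero mu_type)
  qed
  moreover have "mu_cocycle"
    unfolding mu_cocycle_def
  proof (intro ballI impI)
    fix a b h assume 1: "a \<in> Ar C" "b \<in> Ar C" "h \<in> Ar C" "Dom C b = Cod C a" "Dom C h = Cod C b"
    let ?z = "\<lambda>a. (a, \<zero>\<^bsub>HomMod C (Dom C a) (Cod C a)\<^esub>)"
    have "?z a \<in> Ar E" "?z b \<in> Ar E" "?z h \<in> Ar E"
      using 1 by (simp_all add: E_sel lin_rules)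
    from E.assoc[OF this] 1 show "(h \<bullet>\<^bsub>C\<^esub> \<mu> (Dom C a, [b, a]))
        \<oplus>\<^bsub>HomMod C (Dom C a) (Cod C h)\<^esub> \<mu> (Dom C a, [h, b \<bullet>\<^bsub>C\<^esub> a])
     = \<mu> (Dom C a, [h \<bullet>\<^bsub>C\<^esub> b, a])
         \<oplus>\<^bsub>HomMod C (Dom C a) (Cod C h)\<^esub> (\<mu> (Dom C b, [h, b]) \<bullet>\<^bsub>C\<^esub> a)"
      by (simp add: E_sel lin_rules lin_dist hadd_group hneg_zero mu_type hadd_ac)
  qed
  ultimately show "mu_unital \<and> mu_cocycle" by blast
next
  assume *: "mu_unital \<and> mu_cocycle"
  have unital: "\<mu> (A, [Ident C B, a]) = \<zero>\<^bsub>HomMod C A B\<^esub>" "\<mu> (A, [a, Ident C A]) = \<zero>\<^bsub>HomMod C A B\<^esub>"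
    if "a \<in> Ar C" "Dom C a = A" "Cod C a = B" for a A B
    using * that by (auto simp: mu_unital_def)
  have coc: "(h \<bullet>\<^bsub>C\<^esub> \<mu> (A, [b, a])) \<oplus>\<^bsub>HomMod C A D\<^esub> \<mu> (A, [h, b \<bullet>\<^bsub>C\<^esub> a])
     = \<mu> (A, [h \<bullet>\<^bsub>C\<^esub> b, a]) \<oplus>\<^bsub>HomMod C A D\<^esub> (\<mu> (B, [h, b]) \<bullet>\<^bsub>C\<^esub> a)"
    if "a \<in> Ar C" "b \<in> Ar C" "h \<in> Ar C" "Dom C b = B" "Cod C a = B" "Dom C h = Cod C b" "Dom C a = A" "Cod C h = D"
    for a b h A B D
    using * that by (auto simp: mu_cocycle_def)
  show "category E"
  proof
    fix h b a A B D G assume "h \<in> Homs E D G" "b \<in> Homs E B D" "a \<in> Homs E A B"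
    then obtain h1 h2 b1 b2 a1 a2 where e: "h = (h1, h2)" "b = (b1, b2)" "a = (a1, a2)"
      and t: "h1 \<in> Ar C" "Dom C h1 = D" "Cod C h1 = G" "h2 \<in> Ar C" "Dom C h2 = D" "Cod C h2 = G"
       "b1 \<in> Ar C" "Dom C b1 = B" "Cod C b1 = D" "b2 \<in> Ar C" "Dom C b2 = B" "Cod C b2 = D"
       "a1 \<in> Ar C" "Dom C a1 = A" "Cod C a1 = B" "a2 \<in> Ar C" "Dom C a2 = A" "Cod C a2 = B"
      by (auto simp: Homs_E mem_Homs)
    show "h \<bullet>\<^bsub>E\<^esub> b \<bullet>\<^bsub>E\<^esub> a = h \<bullet>\<^bsub>E\<^esub> (b \<bullet>\<^bsub>E\<^esub> a)"
      using coc[of a1 b1 h1 B A G] t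
      by (simp add: e E_sel lin_rules lin_dist hadd_group mu_type hadd_ac)
  qed (auto simp: E_sel Homs_E lin_rules lin_dist hadd_group hneg_zero mu_type unital)
qed

lemma E_linear_category:
  assumes "category E"
  shows "linear_category (dual_ring R) E"
proof -
  interpret E: category E by fact
  show ?thesis
  proof (intro linear_category.intro linear_category_axioms.intro E.category_axioms)
    fix A B assume "A \<in> Ob E" "B \<in> Ob E"
    then show "module (dual_ring R) (HomMod E A B)" "carrier (HomMod E A B) = Homs E A B"
      using HomMod_module[of A B] HomMod_carrier[of A B]
      by (simp_all add: E_sel dual_module_module Homs_E dual_sel)
  next
    fix b b' a A B D assume "b \<in> Homs E B D" "b' \<in> Homs E B D" "a \<in> Homs E A B"
    then show "(b \<oplus>\<^bsub>HomMod E B D\<^esub> b') \<bullet>\<^bsub>E\<^esub> a = b \<bullet>\<^bsub>E\<^esub> a \<oplus>\<^bsub>HomMod E A D\<^esub> b' \<bullet>\<^bsub>E\<^esub> a"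
      by (auto simp: Homs_E mem_Homs E_sel dual_sel lin_rules lin_dist mu_type mu_add_left hadd_ac)
  next
    fix b a a' A B D assume "b \<in> Homs E B D" "a \<in> Homs E A B" "a' \<in> Homs E A B"
    then show "b \<bullet>\<^bsub>E\<^esub> (a \<oplus>\<^bsub>HomMod E A B\<^esub> a') = b \<bullet>\<^bsub>E\<^esub> a \<oplus>\<^bsub>HomMod E A D\<^esub> b \<bullet>\<^bsub>E\<^esub> a'"
      by (auto simp: Homs_E mem_Homs E_sel dual_sel lin_rules lin_dist mu_type mu_add_right hadd_ac)
  next
    fix r b a A B D assume "r \<in> carrier (dual_ring R)" "b \<in> Homs E B D" "a \<in> Homs E A B"
    then show "(r \<odot>\<^bsub>HomMod E B D\<^esub> b) \<bullet>\<^bsub>E\<^esub> a = r \<odot>\<^bsub>HomMod E A D\<^esub> (b \<bullet>\<^bsub>E\<^esub> a)"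
      "b \<bullet>\<^bsub>E\<^esub> (r \<odot>\<^bsub>HomMod E A B\<^esub> a) = r \<odot>\<^bsub>HomMod E A D\<^esub> (b \<bullet>\<^bsub>E\<^esub> a)"
      by (auto simp: Homs_E mem_Homs E_sel dual_sel lin_rules lin_dist mu_type mu_smult_left
          mu_smult_right hadd_ac)
  qed
qed

text \<open>
  If \<open>y\<close> is inverse to \<open>x\<close>, then the inverse of \<open>x + x' \<epsilon>\<close> must be \<open>y + y' \<epsilon>\<close>, and each of the two
  equations can be solved for \<open>y'\<close>. The two solutions \<open>?l\<close> and \<open>?r\<close> agree because a left inverse
  equals a right inverse in the category \<open>E\<close>.
\<close>

lemma E_iso:
  assumes "category E" "is_iso C A B x" "x' \<in> Homs C A B"
  shows "is_iso E A B (x, x')"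
proof -
  interpret E: category E by fact
  obtain y where y: "y \<in> Homs C B A" "y \<bullet>\<^bsub>C\<^esub> x = Ident C A" "x \<bullet>\<^bsub>C\<^esub> y = Ident C B"
    and x: "x \<in> Homs C A B"
    using assms(2) by (auto simp: is_iso_def)
  note t = x y assms(3) hom_obs[OF x]
  let ?AA = "HomMod C A A" and ?BB = "HomMod C B B" and ?BA = "HomMod C B A"
  let ?l = "\<ominus>\<^bsub>?BA\<^esub> ((y \<bullet>\<^bsub>C\<^esub> x' \<oplus>\<^bsub>?AA\<^esub> \<mu> (A, [y, x])) \<bullet>\<^bsub>C\<^esub> y)"
  let ?r = "\<ominus>\<^bsub>?BA\<^esub> (y \<bullet>\<^bsub>C\<^esub> (x' \<bullet>\<^bsub>C\<^esub> y \<oplus>\<^bsub>?BB\<^esub> \<mu> (B, [x, y])))"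
  have l: "?l \<in> Homs C B A" and r: "?r \<in> Homs C B A"
    using t by (auto simp: lin_rules mu_type)
  have L: "(y, ?l) \<bullet>\<^bsub>E\<^esub> (x, x') = Ident E A"
    using t
    by (simp add: E_sel lin_rules lin_dist mu_type hadd_ac hadd_group hadd_neg_sum)
  have xy: "x \<bullet>\<^bsub>C\<^esub> (y \<bullet>\<^bsub>C\<^esub> z) = z" if "z \<in> Ar C" "Cod C z = B" for z
    using that t y assoc[of z y x] by (simp add: lin_rules)
  have R: "(x, x') \<bullet>\<^bsub>E\<^esub> (y, ?r) = Ident E B"
    using t
    by (simp add: E_sel lin_rules lin_dist mu_type hadd_ac hadd_group hadd_neg_sum xy)
  \<comment> \<open>A left inverse equals a right inverse.\<close>
  have "(y, ?l) = (y, ?l) \<bullet>\<^bsub>E\<^esub> ((x, x') \<bullet>\<^bsub>E\<^esub> (y, ?r))"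
    unfolding R using l y(1) by (intro E.ident_right[symmetric]) (auto simp: E_sel mem_Homs)
  also have "\<dots> = ((y, ?l) \<bullet>\<^bsub>E\<^esub> (x, x')) \<bullet>\<^bsub>E\<^esub> (y, ?r)"
    using l r t by (intro E.assoc[symmetric]) (auto simp: E_sel mem_Homs)
  also have "\<dots> = (y, ?r)"
    unfolding L using r y(1) by (intro E.ident_left) (auto simp: E_sel mem_Homs)
  finally have "?l = ?r" by simp
  then show ?thesis
    unfolding is_iso_def using L R t(1) l y(1) assms(3)
    by (intro conjI bexI[of _ "(y, ?l)"]) (auto simp: Homs_E)
qed

end

section \<open>First order deformations of a linear functor\<close>

locale lin_functor = C: linear_category R C + D: linear_category R D
  for R :: "'k ring" and C :: "('k, 'o, 'a) lincat" and D :: "('k, 'p, 'b) lincat" +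
  fixes Fo :: "'o \<Rightarrow> 'p" and Fm :: "'a \<Rightarrow> 'b"
  assumes F: "linear_functor R C D Fo Fm"
begin

lemma F_ob: "A \<in> Ob C \<Longrightarrow> Fo A \<in> Ob D"
  using F by (auto simp: linear_functor_def)

lemma F_type:
  assumes "a \<in> Ar C"
  shows "Fm a \<in> Ar D" "Dom D (Fm a) = Fo (Dom C a)" "Cod D (Fm a) = Fo (Cod C a)"
proof -
  have "Fm a \<in> Homs D (Fo (Dom C a)) (Fo (Cod C a))"
    using F C.Dom_closed[OF assms] C.Cod_closed[OF assms] assms mem_Homs[of a C]
    unfolding linear_functor_def by blast
  then show "Fm a \<in> Ar D" "Dom D (Fm a) = Fo (Dom C a)" "Cod D (Fm a) = Fo (Cod C a)"
    by (auto simp: mem_Homs)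
qed

lemma F_Ident: "A \<in> Ob C \<Longrightarrow> Fm (Ident C A) = Ident D (Fo A)"
  using F by (auto simp: linear_functor_def)

lemma F_comp: "\<lbrakk>a \<in> Ar C; b \<in> Ar C; Dom C b = Cod C a\<rbrakk> \<Longrightarrow> Fm (b \<bullet>\<^bsub>C\<^esub> a) = Fm b \<bullet>\<^bsub>D\<^esub> Fm a"
  using F by (auto simp: linear_functor_def)

lemma F_add:
  assumes "x \<in> Homs C A B" "y \<in> Homs C A B"
  shows "Fm (x \<oplus>\<^bsub>HomMod C A B\<^esub> y) = Fm x \<oplus>\<^bsub>HomMod D (Fo A) (Fo B)\<^esub> Fm y"
  using F assms C.hom_obs[OF assms(1)] unfolding linear_functor_def by blast

lemma F_smult:
  assumes "r \<in> carrier R" "x \<in> Homs C A B"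
  shows "Fm (r \<odot>\<^bsub>HomMod C A B\<^esub> x) = r \<odot>\<^bsub>HomMod D (Fo A) (Fo B)\<^esub> Fm x"
  using F assms C.hom_obs[OF assms(2)] unfolding linear_functor_def by blast

lemma F_zero:
  assumes "A \<in> Ob C" "B \<in> Ob C"
  shows "Fm \<zero>\<^bsub>HomMod C A B\<^esub> = \<zero>\<^bsub>HomMod D (Fo A) (Fo B)\<^esub>"
  using F_add[of "\<zero>\<^bsub>HomMod C A B\<^esub>" A B "\<zero>\<^bsub>HomMod C A B\<^esub>"] assms
  by (intro D.hadd_idem_zero) (auto simp: C.lin_rules C.hneg_zero F_type)

lemma F_neg:
  assumes "x \<in> Homs C A B"
  shows "Fm (\<ominus>\<^bsub>HomMod C A B\<^esub> x) = \<ominus>\<^bsub>HomMod D (Fo A) (Fo B)\<^esub> Fm x"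
  using F_add[of "\<ominus>\<^bsub>HomMod C A B\<^esub> x" A B x] assms C.hom_obs[OF assms]
  by (intro D.hneg_unique) (auto simp: C.lin_rules C.hadd_group F_type F_zero)

lemmas F_rules = F_ob F_type F_Ident F_comp F_add F_smult F_zero F_neg

end

text \<open>
  A first order change \<open>\<eta>\<close> of the effect of a linear functor on arrows. It is used both for the
  component \<open>f\<^sub>1\<close> of a two-cochain, over a restriction functor, and for the component \<open>g\<^sub>1\<close> of a
  one-cochain, over the identity functor (\<open>C11_functor\<close>, \<open>C01_functor\<close>).
\<close>

locale functor_cochain = lin_functor R C D Fo Fm
  for R :: "'k ring" and C :: "('k, 'o, 'a) lincat" and D :: "('k, 'p, 'b) lincat" and Fo Fm +
  fixes \<eta> :: "'o \<times> 'a list \<Rightarrow> 'b"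
  assumes eta_closed: "a \<in> Ar C \<Longrightarrow> Dom C a = A \<Longrightarrow> \<eta> (A, [a]) \<in> Homs D (Fo A) (Fo (Cod C a))"
    and eta_add: "\<lbrakk>a \<in> Homs C A B; a' \<in> Homs C A B\<rbrakk>
      \<Longrightarrow> \<eta> (A, [a \<oplus>\<^bsub>HomMod C A B\<^esub> a']) = \<eta> (A, [a]) \<oplus>\<^bsub>HomMod D (Fo A) (Fo B)\<^esub> \<eta> (A, [a'])"
    and eta_smult: "\<lbrakk>r \<in> carrier R; a \<in> Homs C A B\<rbrakk>
      \<Longrightarrow> \<eta> (A, [r \<odot>\<^bsub>HomMod C A B\<^esub> a]) = r \<odot>\<^bsub>HomMod D (Fo A) (Fo B)\<^esub> \<eta> (A, [a])"
begin

lemma eta_type: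
  assumes "a \<in> Ar C" "Dom C a = A"
  shows "\<eta> (A, [a]) \<in> Ar D" "Dom D (\<eta> (A, [a])) = Fo A" "Cod D (\<eta> (A, [a])) = Fo (Cod C a)"
  using eta_closed[OF assms] by (auto simp: mem_Homs)

definition eta_unital :: bool where
  "eta_unital \<longleftrightarrow> (\<forall>A \<in> Ob C. \<eta> (A, [Ident C A]) = \<zero>\<^bsub>HomMod D (Fo A) (Fo A)\<^esub>)"

definition eta_multiplicative :: "('o \<times> 'a list \<Rightarrow> 'a) \<Rightarrow> ('p \<times> 'b list \<Rightarrow> 'b) \<Rightarrow> bool" where
  "eta_multiplicative \<mu> \<nu> \<longleftrightarrow> (\<forall>a \<in> Ar C. \<forall>b \<in> Ar C. Dom C b = Cod C a \<longrightarrow>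
     \<eta> (Dom C a, [b \<bullet>\<^bsub>C\<^esub> a]) \<oplus>\<^bsub>HomMod D (Fo (Dom C a)) (Fo (Cod C b))\<^esub> Fm (\<mu> (Dom C a, [b, a]))
     = (Fm b \<bullet>\<^bsub>D\<^esub> \<eta> (Dom C a, [a]))
        \<oplus>\<^bsub>HomMod D (Fo (Dom C a)) (Fo (Cod C b))\<^esub> ((\<eta> (Dom C b, [b]) \<bullet>\<^bsub>D\<^esub> Fm a)
        \<oplus>\<^bsub>HomMod D (Fo (Dom C a)) (Fo (Cod C b))\<^esub> \<nu> (Fo (Dom C a), [Fm b, Fm a])))"

text \<open>
  The \<open>\<epsilon>\<close>-coefficients of \<open>F 1 = 1\<close> and \<open>F (b a) = F b F a\<close>, where source and target carry deformed
  compositions \<open>\<mu>\<close> and \<open>\<nu>\<close>.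
\<close>

lemma deform_functor_iff:
  assumes "hoch_cochain R C \<mu>" "hoch_cochain R D \<nu>"
    and "category (deform_cat C \<mu>)" "category (deform_cat D \<nu>)"
  shows "linear_functor (dual_ring R) (deform_cat C \<mu>) (deform_cat D \<nu>) Fo
      (\<lambda>(a, a'). (Fm a, Fm a' \<oplus>\<^bsub>HomMod D (Fo (Dom C a)) (Fo (Cod C a))\<^esub> \<eta> (Dom C a, [a])))
    \<longleftrightarrow> eta_unital \<and> eta_multiplicative \<mu> \<nu>" (is "linear_functor _ _ _ _ ?G \<longleftrightarrow> _")
proof -
  interpret C: hoch_cochain R C \<mu> by fact
  interpret D: hoch_cochain R D \<nu> by fact
  note rules = C.lin_rules D.lin_rules D.lin_dist C.hadd_group D.hadd_group D.hneg_zero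
    C.mu_type D.mu_type F_rules eta_type
  note sel = C.E_sel D.E_sel C.dual_sel D.dual_sel
  show ?thesis
  proof
    assume G: "linear_functor (dual_ring R) (deform_cat C \<mu>) (deform_cat D \<nu>) Fo ?G"
    have eta_unital
      unfolding eta_unital_def
    proof
      fix A assume A: "A \<in> Ob C"
      then have "?G (Ident C.E A) = Ident D.E (Fo A)"
        using G by (auto simp: linear_functor_def sel)
      then show "\<eta> (A, [Ident C A]) = \<zero>\<^bsub>HomMod D (Fo A) (Fo A)\<^esub>"
        using A by (simp add: sel rules)
    qed
    moreover have "eta_multiplicative \<mu> \<nu>"
      unfolding eta_multiplicative_def
    proof (intro ballI impI)
      fix a b assume 1: "a \<in> Ar C" "b \<in> Ar C" "Dom C b = Cod C a"
      let ?z = "\<lambda>a. (a, \<zero>\<^bsub>HomMod C (Dom C a) (Cod C a)\<^esub>)"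
      have "?z a \<in> Ar C.E" "?z b \<in> Ar C.E" "Cod C.E (?z a) = Dom C.E (?z b)"
        using 1 by (simp_all add: sel rules)
      then have "?G (?z b \<bullet>\<^bsub>C.E\<^esub> ?z a) = ?G (?z b) \<bullet>\<^bsub>D.E\<^esub> ?G (?z a)"
        using G unfolding linear_functor_def by blast
      then show "\<eta> (Dom C a, [b \<bullet>\<^bsub>C\<^esub> a]) \<oplus>\<^bsub>HomMod D (Fo (Dom C a)) (Fo (Cod C b))\<^esub> Fm (\<mu> (Dom C a, [b, a]))
     = (Fm b \<bullet>\<^bsub>D\<^esub> \<eta> (Dom C a, [a]))
        \<oplus>\<^bsub>HomMod D (Fo (Dom C a)) (Fo (Cod C b))\<^esub> ((\<eta> (Dom C b, [b]) \<bullet>\<^bsub>D\<^esub> Fm a)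
        \<oplus>\<^bsub>HomMod D (Fo (Dom C a)) (Fo (Cod C b))\<^esub> \<nu> (Fo (Dom C a), [Fm b, Fm a]))"
        using 1 by (simp add: sel rules C.lin_dist D.hadd_ac)
    qed
    ultimately show "eta_unital \<and> eta_multiplicative \<mu> \<nu>" by blast
  next
    assume *: "eta_unital \<and> eta_multiplicative \<mu> \<nu>"
    have un: "\<eta> (A, [Ident C A]) = \<zero>\<^bsub>HomMod D (Fo A) (Fo A)\<^esub>" if "A \<in> Ob C" for A
      using * that by (simp add: eta_unital_def)
    have mult: "\<eta> (A, [b \<bullet>\<^bsub>C\<^esub> a]) \<oplus>\<^bsub>HomMod D (Fo A) (Fo B)\<^esub> Fm (\<mu> (A, [b, a]))
     = (Fm b \<bullet>\<^bsub>D\<^esub> \<eta> (A, [a]))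
        \<oplus>\<^bsub>HomMod D (Fo A) (Fo B)\<^esub> ((\<eta> (Cod C a, [b]) \<bullet>\<^bsub>D\<^esub> Fm a)
        \<oplus>\<^bsub>HomMod D (Fo A) (Fo B)\<^esub> \<nu> (Fo A, [Fm b, Fm a]))"
      if "a \<in> Ar C" "b \<in> Ar C" "Dom C b = Cod C a" "Dom C a = A" "Cod C b = B" for a b A B
      using * that by (auto simp: eta_multiplicative_def)
    show "linear_functor (dual_ring R) (deform_cat C \<mu>) (deform_cat D \<nu>) Fo ?G"
      unfolding linear_functor_def
    proof (intro conjI ballI impI)
      fix A assume A: "A \<in> Ob C.E"
      then show "Fo A \<in> Ob D.E" by (simp add: sel rules)
      show "?G (Ident C.E A) = Ident D.E (Fo A)" using A by (simp add: sel rules un)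
      fix B a assume B: "B \<in> Ob C.E" "a \<in> Homs C.E A B"
      then show "?G a \<in> Homs D.E (Fo A) (Fo B)"
        by (auto simp: C.Homs_E D.Homs_E rules)
      show "?G (a \<oplus>\<^bsub>HomMod C.E A B\<^esub> a') = ?G a \<oplus>\<^bsub>HomMod D.E (Fo A) (Fo B)\<^esub> ?G a'"
        if "a' \<in> Homs C.E A B" for a'
        using that B by (auto simp: C.Homs_E sel rules eta_add D.hadd_ac)
      show "?G (r \<odot>\<^bsub>HomMod C.E A B\<^esub> a) = r \<odot>\<^bsub>HomMod D.E (Fo A) (Fo B)\<^esub> ?G a"
        if "r \<in> carrier (dual_ring R)" for r
        using that B by (auto simp: C.Homs_E sel rules eta_smult D.hadd_ac)
    next
      fix a b assume "a \<in> Ar C.E" "b \<in> Ar C.E" "Cod C.E a = Dom C.E b"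
      then obtain a1 a2 b1 b2 where e: "a = (a1, a2)" "b = (b1, b2)"
        and t: "a1 \<in> Ar C" "a2 \<in> Ar C" "b1 \<in> Ar C" "b2 \<in> Ar C" "Dom C a2 = Dom C a1"
          "Cod C a2 = Cod C a1" "Dom C b2 = Cod C a1" "Cod C b2 = Cod C b1" "Dom C b1 = Cod C a1"
        by (auto simp: sel mem_Homs)
      show "?G (b \<bullet>\<^bsub>C.E\<^esub> a) = ?G b \<bullet>\<^bsub>D.E\<^esub> ?G a"
        using mult[of a1 b1 "Dom C a1" "Cod C b1"] t by (simp add: e sel rules D.hadd_ac)
    qed
  qed
qed

end

section \<open>Calculation rules for prestacks\<close>

context prestack begin

text \<open>
  Here \<open>\<F>\<close> and \<open>\<H>\<close> are the fibres and their modules of arrows, \<open>\<T> \<sigma>\<close> is the fibre in which the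
  arguments of a cochain at \<open>\<sigma>\<close> live and \<open>\<V>\<close> the module of its values, \<open>\<C>\<close>, \<open>\<G>\<close> and \<open>\<N>\<close> are the
  cochains of a bidegree, all cochains and the normalized reduced ones, and \<open>\<delta>\<close> is the differential.
\<close>

abbreviation "\<F> \<equiv> fib \<A>"
abbreviation "\<H> U \<equiv> HomMod (fib \<A> U)"
abbreviation "\<T> \<sigma> \<equiv> fib \<A> (tgt \<U> \<sigma>)"
abbreviation "\<V> \<equiv> val_mod \<U> \<A>"
abbreviation "\<C> \<equiv> Cpq R \<U> \<A>"
abbreviation "\<G> \<equiv> GS R \<U> \<A>"
abbreviation "\<N> \<equiv> GSnr R \<U> \<A>"
abbreviation "\<delta> \<equiv> gs_d \<U> \<A>"

lemmas base_rules = \<U>.cat_rules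
lemmas fib_type = linear_category.lin_rules[OF fib]
lemmas fib_dist = linear_category.lin_dist[OF fib]
lemmas fib_group = linear_category.hadd_group[OF fib] linear_category.hneg_zero[OF fib]
lemmas fib_ac = linear_category.hadd_ac[OF fib]

lemma res_functor: "u \<in> Ar \<U> \<Longrightarrow>
   lin_functor R (\<F> (Cod \<U> u)) (\<F> (Dom \<U> u)) (res_ob \<A> u) (res_mor \<A> u)"
  by (intro lin_functor.intro lin_functor_axioms.intro fib res \<U>.Dom_closed \<U>.Cod_closed)

lemma res_rules:
  assumes "u \<in> Ar \<U>"
  shows "A \<in> Ob (\<F> (Cod \<U> u)) \<Longrightarrow> Dom \<U> u = V \<Longrightarrow> res_ob \<A> u A \<in> Ob (\<F> V)"
    "a \<in> Ar (\<F> (Cod \<U> u)) \<Longrightarrow> Dom \<U> u = V \<Longrightarrow> res_mor \<A> u a \<in> Ar (\<F> V)"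
    "a \<in> Ar (\<F> (Cod \<U> u)) \<Longrightarrow> Dom \<U> u = V
      \<Longrightarrow> Dom (\<F> V) (res_mor \<A> u a) = res_ob \<A> u (Dom (\<F> (Cod \<U> u)) a)"
    "a \<in> Ar (\<F> (Cod \<U> u)) \<Longrightarrow> Dom \<U> u = V
      \<Longrightarrow> Cod (\<F> V) (res_mor \<A> u a) = res_ob \<A> u (Cod (\<F> (Cod \<U> u)) a)"
    "Cod \<U> u = W \<Longrightarrow> A \<in> Ob (\<F> W)
      \<Longrightarrow> res_mor \<A> u (Ident (\<F> W) A) = Ident (\<F> (Dom \<U> u)) (res_ob \<A> u A)"
    "Cod \<U> u = W \<Longrightarrow> a \<in> Ar (\<F> W) \<Longrightarrow> b \<in> Ar (\<F> W) \<Longrightarrow> Dom (\<F> W) b = Cod (\<F> W) a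
      \<Longrightarrow> res_mor \<A> u (b \<bullet>\<^bsub>\<F> W\<^esub> a) = res_mor \<A> u b \<bullet>\<^bsub>\<F> (Dom \<U> u)\<^esub> res_mor \<A> u a"
    "Cod \<U> u = W \<Longrightarrow> x \<in> Homs (\<F> W) A B \<Longrightarrow> y \<in> Homs (\<F> W) A B
      \<Longrightarrow> res_mor \<A> u (x \<oplus>\<^bsub>\<H> W A B\<^esub> y) = res_mor \<A> u x
       \<oplus>\<^bsub>\<H> (Dom \<U> u) (res_ob \<A> u A) (res_ob \<A> u B)\<^esub> res_mor \<A> u y"
    "Cod \<U> u = W \<Longrightarrow> r \<in> carrier R \<Longrightarrow> x \<in> Homs (\<F> W) A B
      \<Longrightarrow> res_mor \<A> u (r \<odot>\<^bsub>\<H> W A B\<^esub> x) = r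
       \<odot>\<^bsub>\<H> (Dom \<U> u) (res_ob \<A> u A) (res_ob \<A> u B)\<^esub> res_mor \<A> u x"
    "Cod \<U> u = W \<Longrightarrow> A \<in> Ob (\<F> W) \<Longrightarrow> B \<in> Ob (\<F> W)
      \<Longrightarrow> res_mor \<A> u (\<zero>\<^bsub>\<H> W A B\<^esub>)
       = \<zero>\<^bsub>\<H> (Dom \<U> u) (res_ob \<A> u A) (res_ob \<A> u B)\<^esub>"
    "Cod \<U> u = W \<Longrightarrow> x \<in> Homs (\<F> W) A B
      \<Longrightarrow> res_mor \<A> u (\<ominus>\<^bsub>\<H> W A B\<^esub> x)
       = \<ominus>\<^bsub>\<H> (Dom \<U> u) (res_ob \<A> u A) (res_ob \<A> u B)\<^esub> res_mor \<A> u x"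
  using lin_functor.F_rules[OF res_functor[OF assms]] by auto

lemma res_base_Ident:
  "U \<in> Ob \<U> \<Longrightarrow> A \<in> Ob (\<F> U) \<Longrightarrow> res_ob \<A> (Ident \<U> U) A = A"
  "U \<in> Ob \<U> \<Longrightarrow> a \<in> Ar (\<F> U) \<Longrightarrow> res_mor \<A> (Ident \<U> U) a = a"
  by (rule res_ob_Ident res_mor_Ident; assumption)+

lemma twist_type:
  assumes "u \<in> Ar \<U>" "v \<in> Ar \<U>" "Cod \<U> v = Dom \<U> u" "A \<in> Ob (\<F> (Cod \<U> u))" "Dom \<U> v = V"
  shows "twist \<A> u v A \<in> Ar (\<F> V)"
    "Dom (\<F> V) (twist \<A> u v A) = res_ob \<A> v (res_ob \<A> u A)"
    "Cod (\<F> V) (twist \<A> u v A) = res_ob \<A> (u \<bullet>\<^bsub>\<U>\<^esub> v) A"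
  using twist_iso[OF assms(1-4)] assms(5) by (auto simp: is_iso_def mem_Homs)

lemma twist_nat:
  assumes "u \<in> Ar \<U>" "v \<in> Ar \<U>" "Cod \<U> v = Dom \<U> u" "a \<in> Ar (\<F> (Cod \<U> u))"
    "Dom (\<F> (Cod \<U> u)) a = A" "Dom \<U> v = V"
  shows "res_mor \<A> (u \<bullet>\<^bsub>\<U>\<^esub> v) a \<bullet>\<^bsub>\<F> V\<^esub> twist \<A> u v A
      = twist \<A> u v (Cod (\<F> (Cod \<U> u)) a) \<bullet>\<^bsub>\<F> V\<^esub> res_mor \<A> v (res_mor \<A> u a)"
  using twist_natural[of u v a A] assms by (simp add: mem_Homs)

lemma twist_Ident:
  "v \<in> Ar \<U> \<Longrightarrow> Cod \<U> v = V \<Longrightarrow> A \<in> Ob (\<F> V)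
    \<Longrightarrow> twist \<A> (Ident \<U> V) v A = Ident (\<F> (Dom \<U> v)) (res_ob \<A> v A)"
  "u \<in> Ar \<U> \<Longrightarrow> Dom \<U> u = V \<Longrightarrow> A \<in> Ob (\<F> (Cod \<U> u))
    \<Longrightarrow> twist \<A> u (Ident \<U> V) A = Ident (\<F> V) (res_ob \<A> u A)"
  using twist_Ident_left twist_Ident_right by auto

lemmas ps_rules = base_rules fib_type res_rules res_base_Ident twist_type twist_Ident

end

section \<open>Simplices and the modules of cochains\<close>

lemma vertex_simps [simp]:
  "vertex C (U, us) 0 = U"
  "vertex C (U, [u]) (Suc 0) = Cod C u"
  "vertex C (U, [u, v]) (Suc (Suc 0)) = Cod C v"
  "vertex C (U, [u, v, w]) (Suc (Suc (Suc 0))) = Cod C w"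
  "vertex C (U, u # us) (Suc (length us)) = vertex C (Cod C u, us) (length us)"
  by (auto simp: vertex_def nth_Cons')

lemma rtgt_eq: "rtgt C (A, as) = (if as = [] then A else Cod C (hd as))"
  by (auto simp: rvertex_def vertex_def rev_nth hd_conv_nth)

lemma rvertex_simps [simp]:
  "rvertex C (A, as) 0 = A"
  "rvertex C (A, [a]) (Suc 0) = Cod C a"
  "rvertex C (A, [b, a]) (Suc (Suc 0)) = Cod C b"
  "rvertex C (A, [h, b, a]) (Suc (Suc (Suc 0))) = Cod C h"
  by (auto simp: rvertex_def)

lemma is_path_source: "is_path C A xs \<Longrightarrow> category C \<Longrightarrow> A \<in> Ob C"
  by (cases xs) (auto dest: category.Dom_closed)

lemma is_path_tgt: "is_path C A xs \<Longrightarrow> tgt C (A, xs) \<in> Ob C"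
  by (induction xs arbitrary: A) auto

lemma is_path_replace:
  "is_path C A (xs @ b # ys) \<Longrightarrow> b' \<in> Homs C (Dom C b) (Cod C b) \<Longrightarrow> is_path C A (xs @ b' # ys)"
  by (induction xs arbitrary: A) (auto simp: mem_Homs)

lemma is_path_mem: "is_path C A xs \<Longrightarrow> b \<in> set xs \<Longrightarrow> b \<in> Ar C"
  by (induction xs arbitrary: A) auto

lemma rsimplices_replace:
  assumes "(A, xs @ b # ys) \<in> rsimplices C q" "b' \<in> Homs C (Dom C b) (Cod C b)"
  shows "(A, xs @ b' # ys) \<in> rsimplices C q"
    "rtgt C (A, xs @ b' # ys) = rtgt C (A, xs @ b # ys)"
proof -
  show "(A, xs @ b' # ys) \<in> rsimplices C q"
    using assms is_path_replace[of C A "rev ys" b "rev xs" b'] by (auto simp: rsimplices_def)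
  show "rtgt C (A, xs @ b' # ys) = rtgt C (A, xs @ b # ys)"
    using assms(2) unfolding rtgt_eq by (auto simp: mem_Homs hd_append)
qed

lemma (in category) simplices_small:
  "simplices C 0 = {(U, []) | U. U \<in> Ob C}"
  "simplices C (Suc 0) = {(Dom C u, [u]) | u. u \<in> Ar C}"
  "simplices C 2 = {(Dom C u, [u, v]) | u v. u \<in> Ar C \<and> v \<in> Ar C \<and> Dom C v = Cod C u}"
  "simplices C 3 = {(Dom C u, [u, v, w]) | u v w. u \<in> Ar C \<and> v \<in> Ar C \<and> w \<in> Ar C \<and>
     Dom C v = Cod C u \<and> Dom C w = Cod C v}"
  by (auto simp: simplices_def length_Suc_conv numeral_2_eq_2 numeral_3_eq_3 Cod_closed)

lemma (in category) rsimplices_small: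
  "rsimplices C 0 = {(U, []) | U. U \<in> Ob C}"
  "rsimplices C (Suc 0) = {(Dom C a, [a]) | a. a \<in> Ar C}"
  "rsimplices C 2 = {(Dom C a, [b, a]) | a b. a \<in> Ar C \<and> b \<in> Ar C \<and> Dom C b = Cod C a}"
  "rsimplices C 3 = {(Dom C a, [h, b, a]) | a b h. a \<in> Ar C \<and> b \<in> Ar C \<and> h \<in> Ar C \<and>
     Dom C b = Cod C a \<and> Dom C h = Cod C b}"
  by (auto simp: rsimplices_def length_Suc_conv numeral_2_eq_2 numeral_3_eq_3 Cod_closed)

lemma star_simps [simp]:
  "star_ob \<A> (U, []) A = A" "star_ob \<A> (U, [u]) A = res_ob \<A> u A"
  "star_ob \<A> (U, [u, v]) A = res_ob \<A> u (res_ob \<A> v A)"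
  "star_ob \<A> (U, [u, v, w]) A = res_ob \<A> u (res_ob \<A> v (res_ob \<A> w A))"
  "star_mor \<A> (U, []) a = a" "star_mor \<A> (U, [u]) a = res_mor \<A> u a"
  "star_mor \<A> (U, [u, v]) a = res_mor \<A> u (res_mor \<A> v a)"
  by (simp_all add: star_ob_def star_mor_def)

context prestack begin

lemma tgt_closed: "\<sigma> \<in> simplices \<U> p \<Longrightarrow> tgt \<U> \<sigma> \<in> Ob \<U>" "\<sigma> \<in> simplices \<U> p \<Longrightarrow> fst \<sigma> \<in> Ob \<U>"
  using is_path_tgt is_path_source[OF _ \<U>.category_axioms] by (auto simp: simplices_def)

text \<open>
  The induction has to start from an arbitrary arrow into the first vertex, since the accumulator of
  the fold changes.
\<close>

lemma total_type:
  assumes "\<sigma> \<in> simplices \<U> p"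
  shows "total \<U> \<sigma> \<in> Homs \<U> (fst \<sigma>) (tgt \<U> \<sigma>)"
proof -
  have *: "foldl (\<lambda>g u. u \<bullet>\<^bsub>\<U>\<^esub> g) g us \<in> Homs \<U> (Dom \<U> g) (tgt \<U> (U, us))"
    if "is_path \<U> U us" "g \<in> Ar \<U>" "Cod \<U> g = U" for g U us
    using that
  proof (induction us arbitrary: U g)
    case (Cons u us)
    then show ?case using Cons.IH[of "Cod \<U> u" "u \<bullet>\<^bsub>\<U>\<^esub> g"] by (simp add: base_rules)
  qed (simp add: mem_Homs)
  show ?thesis
    using *[of "fst \<sigma>" "snd \<sigma>" "Ident \<U> (fst \<sigma>)"] assms tgt_closed[OF assms]
    by (auto simp: total_def simplices_def base_rules)
qed

lemma star_ob_closed: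
  assumes "\<sigma> \<in> simplices \<U> p" "A \<in> Ob (\<T> \<sigma>)"
  shows "star_ob \<A> \<sigma> A \<in> Ob (\<F> (fst \<sigma>))"
proof -
  have "foldr (res_ob \<A>) us A \<in> Ob (\<F> U)" if "is_path \<U> U us" "A \<in> Ob (\<F> (tgt \<U> (U, us)))" for U us
    using that by (induction us arbitrary: U) (auto simp: res_rules)
  then show ?thesis using assms by (cases \<sigma>) (auto simp: star_ob_def simplices_def)
qed

lemma fib_cat: "U \<in> Ob \<U> \<Longrightarrow> category (\<F> U)"
  using fib linear_category.axioms(1) by blast

lemma rsimplex_ends:
  assumes "U \<in> Ob \<U>" "a \<in> rsimplices (\<F> U) q"
  shows "fst a \<in> Ob (\<F> U)" "rtgt (\<F> U) a \<in> Ob (\<F> U)"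
proof -
  obtain A as where a: "a = (A, as)" by (cases a)
  have p: "is_path (\<F> U) A (rev as)" using assms by (simp add: rsimplices_def a)
  show "fst a \<in> Ob (\<F> U)" using is_path_source[OF p fib_cat[OF assms(1)]] by (simp add: a)
  show "rtgt (\<F> U) a \<in> Ob (\<F> U)"
    using is_path_tgt[OF p] by (simp add: a rvertex_def)
qed

lemma val_mod_ob:
  assumes "\<sigma> \<in> simplices \<U> p" "a \<in> rsimplices (\<T> \<sigma>) q"
  shows "star_ob \<A> \<sigma> (fst a) \<in> Ob (\<F> (fst \<sigma>))"
    "res_ob \<A> (total \<U> \<sigma>) (rtgt (\<T> \<sigma>) a) \<in> Ob (\<F> (fst \<sigma>))"
  using rsimplex_ends[OF tgt_closed(1)[OF assms(1)] assms(2)] star_ob_closed[OF assms(1)]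
    total_type[OF assms(1)] by (auto simp: mem_Homs res_rules)

lemma val_mod_module:
  assumes "\<sigma> \<in> simplices \<U> p" "a \<in> rsimplices (\<T> \<sigma>) q"
  shows "module R (\<V> \<sigma> a)"
  unfolding val_mod_def
  using linear_category.HomMod_module[OF fib[OF tgt_closed(2)[OF assms(1)]] val_mod_ob[OF assms]] .

lemma mk_cochain_apply [simp]:
  "\<sigma> \<in> simplices \<U> p \<Longrightarrow> a \<in> rsimplices (\<T> \<sigma>) q \<Longrightarrow> mk_cochain \<U> \<A> p q F \<sigma> a = F \<sigma> a"
  by (simp add: mk_cochain_def)

lemma mk_cochain_eqI:
  "(\<And>\<sigma> a. \<sigma> \<in> simplices \<U> p \<Longrightarrow> a \<in> rsimplices (\<T> \<sigma>) q \<Longrightarrow> F \<sigma> a = G \<sigma> a)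
    \<Longrightarrow> mk_cochain \<U> \<A> p q F = mk_cochain \<U> \<A> p q G"
  unfolding mk_cochain_def by (intro restrict_ext) auto

lemma mk_cochain_eq_iff:
  "mk_cochain \<U> \<A> p q F = mk_cochain \<U> \<A> p q G \<longleftrightarrow>
   (\<forall>\<sigma> \<in> simplices \<U> p. \<forall>a \<in> rsimplices (\<T> \<sigma>) q. F \<sigma> a = G \<sigma> a)"
  by (metis mk_cochain_apply mk_cochain_eqI)

lemma mk_cochain_idem:
  "mk_cochain \<U> \<A> p q (mk_cochain \<U> \<A> p q F) = mk_cochain \<U> \<A> p q F"
  by (rule mk_cochain_eqI) simp

lemma Cpq_carrier:
  "\<phi> \<in> carrier (\<C> p q) \<longleftrightarrow> \<phi> = mk_cochain \<U> \<A> p q \<phi> \<and>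
    (\<forall>\<sigma> \<in> simplices \<U> p. \<forall>a \<in> rsimplices (\<T> \<sigma>) q. \<phi> \<sigma> a \<in> carrier (\<V> \<sigma> a)) \<and>
    multilinear R \<U> \<A> p q \<phi>"
proof -
  have "\<phi> = mk_cochain \<U> \<A> p q \<phi> \<longleftrightarrow> \<phi> \<in> extensional (simplices \<U> p) \<and>
      (\<forall>\<sigma> \<in> simplices \<U> p. \<phi> \<sigma> \<in> extensional (rsimplices (\<T> \<sigma>) q))"
    unfolding mk_cochain_def
    by (auto simp: fun_eq_iff extensional_def restrict_def)
  then show ?thesis by (auto simp: Cpq_def PiE_def Pi_def)
qed

lemma Cpq_sel:
  "\<phi> \<oplus>\<^bsub>\<C> p q\<^esub> \<psi> = mk_cochain \<U> \<A> p q (\<lambda>\<sigma> a. \<phi> \<sigma> a \<oplus>\<^bsub>\<V> \<sigma> a\<^esub> \<psi> \<sigma> a)"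
  "r \<odot>\<^bsub>\<C> p q\<^esub> \<phi> = mk_cochain \<U> \<A> p q (\<lambda>\<sigma> a. r \<odot>\<^bsub>\<V> \<sigma> a\<^esub> \<phi> \<sigma> a)"
  "\<zero>\<^bsub>\<C> p q\<^esub> = mk_cochain \<U> \<A> p q (\<lambda>\<sigma> a. \<zero>\<^bsub>\<V> \<sigma> a\<^esub>)"
  by (simp_all add: Cpq_def)

lemma val_mod_replace:
  assumes "(A, xs @ b # ys) \<in> rsimplices (\<T> \<sigma>) q"
    "b' \<in> Homs (\<T> \<sigma>) (Dom (\<T> \<sigma>) b) (Cod (\<T> \<sigma>) b)"
  shows "\<V> \<sigma> (A, xs @ b' # ys) = \<V> \<sigma> (A, xs @ b # ys)"
  using rsimplices_replace[OF assms] by (simp add: val_mod_def)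

lemma multilinearI:
  assumes "\<And>\<sigma> A xs b ys b'. \<sigma> \<in> simplices \<U> p \<Longrightarrow> (A, xs @ b # ys) \<in> rsimplices (\<T> \<sigma>) q \<Longrightarrow>
      b' \<in> Homs (\<T> \<sigma>) (Dom (\<T> \<sigma>) b) (Cod (\<T> \<sigma>) b) \<Longrightarrow>
      \<phi> \<sigma> (A, xs @ (b \<oplus>\<^bsub>\<H> (tgt \<U> \<sigma>) (Dom (\<T> \<sigma>) b) (Cod (\<T> \<sigma>) b)\<^esub> b') # ys)
       = \<phi> \<sigma> (A, xs @ b # ys) \<oplus>\<^bsub>\<V> \<sigma> (A, xs @ b # ys)\<^esub> \<phi> \<sigma> (A, xs @ b' # ys)"
    and "\<And>\<sigma> A xs b ys r. \<sigma> \<in> simplices \<U> p \<Longrightarrow> (A, xs @ b # ys) \<in> rsimplices (\<T> \<sigma>) q \<Longrightarrow>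
      r \<in> carrier R \<Longrightarrow>
      \<phi> \<sigma> (A, xs @ (r \<odot>\<^bsub>\<H> (tgt \<U> \<sigma>) (Dom (\<T> \<sigma>) b) (Cod (\<T> \<sigma>) b)\<^esub> b) # ys)
       = r \<odot>\<^bsub>\<V> \<sigma> (A, xs @ b # ys)\<^esub> \<phi> \<sigma> (A, xs @ b # ys)"
  shows "multilinear R \<U> \<A> p q \<phi>"
  unfolding multilinear_def Let_def using assms by blast

lemma middle_closed:
  assumes "\<sigma> \<in> simplices \<U> p" "(A, xs @ b # ys) \<in> rsimplices (\<T> \<sigma>) q"
  shows "b \<in> Homs (\<T> \<sigma>) (Dom (\<T> \<sigma>) b) (Cod (\<T> \<sigma>) b)"
  using assms is_path_mem[of "\<T> \<sigma>" A "rev (xs @ b # ys)" b]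
  by (auto simp: rsimplices_def mem_Homs)

text \<open>
  The operations on cochains are pointwise, so the module axioms hold because they hold for the
  values; what has to be proved is that a pointwise construction is again multilinear.
\<close>

lemma Cpq_pointwise_closed:
  assumes vals: "\<And>\<sigma> a. \<sigma> \<in> simplices \<U> p \<Longrightarrow> a \<in> rsimplices (\<T> \<sigma>) q \<Longrightarrow>
      F \<sigma> a \<in> carrier (\<V> \<sigma> a)"
    and add: "\<And>\<sigma> A xs b ys b'. \<sigma> \<in> simplices \<U> p \<Longrightarrow> (A, xs @ b # ys) \<in> rsimplices (\<T> \<sigma>) q \<Longrightarrow>
      b' \<in> Homs (\<T> \<sigma>) (Dom (\<T> \<sigma>) b) (Cod (\<T> \<sigma>) b) \<Longrightarrow>
      F \<sigma> (A, xs @ (b \<oplus>\<^bsub>\<H> (tgt \<U> \<sigma>) (Dom (\<T> \<sigma>) b) (Cod (\<T> \<sigma>) b)\<^esub> b') # ys)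
       = F \<sigma> (A, xs @ b # ys) \<oplus>\<^bsub>\<V> \<sigma> (A, xs @ b # ys)\<^esub> F \<sigma> (A, xs @ b' # ys)"
    and smult: "\<And>\<sigma> A xs b ys r. \<sigma> \<in> simplices \<U> p \<Longrightarrow> (A, xs @ b # ys) \<in> rsimplices (\<T> \<sigma>) q \<Longrightarrow>
      r \<in> carrier R \<Longrightarrow>
      F \<sigma> (A, xs @ (r \<odot>\<^bsub>\<H> (tgt \<U> \<sigma>) (Dom (\<T> \<sigma>) b) (Cod (\<T> \<sigma>) b)\<^esub> b) # ys)
       = r \<odot>\<^bsub>\<V> \<sigma> (A, xs @ b # ys)\<^esub> F \<sigma> (A, xs @ b # ys)"
  shows "mk_cochain \<U> \<A> p q F \<in> carrier (\<C> p q)"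
  unfolding Cpq_carrier
proof (intro conjI ballI)
  show "mk_cochain \<U> \<A> p q F = mk_cochain \<U> \<A> p q (mk_cochain \<U> \<A> p q F)"
    by (simp add: mk_cochain_idem)
  show "mk_cochain \<U> \<A> p q F \<sigma> a \<in> carrier (\<V> \<sigma> a)"
    if "\<sigma> \<in> simplices \<U> p" "a \<in> rsimplices (\<T> \<sigma>) q" for \<sigma> a
    using that vals by simp
  show "multilinear R \<U> \<A> p q (mk_cochain \<U> \<A> p q F)"
  proof (rule multilinearI)
    fix \<sigma> A xs b ys b' assume 1: "\<sigma> \<in> simplices \<U> p" "(A, xs @ b # ys) \<in> rsimplices (\<T> \<sigma>) q"
      "b' \<in> Homs (\<T> \<sigma>) (Dom (\<T> \<sigma>) b) (Cod (\<T> \<sigma>) b)"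
    let ?C = "\<T> \<sigma>"
    have "b \<oplus>\<^bsub>HomMod ?C (Dom ?C b) (Cod ?C b)\<^esub> b' \<in> Homs ?C (Dom ?C b) (Cod ?C b)"
      using linear_category.hadd_closed[OF fib[OF tgt_closed(1)[OF 1(1)]] middle_closed[OF 1(1,2)] 1(3)] .
    from rsimplices_replace(1)[OF 1(2) this] rsimplices_replace(1)[OF 1(2,3)]
    show "mk_cochain \<U> \<A> p q F \<sigma> (A, xs @ (b \<oplus>\<^bsub>\<H> (tgt \<U> \<sigma>) (Dom (\<T> \<sigma>) b) (Cod (\<T> \<sigma>) b)\<^esub> b') # ys)
       = mk_cochain \<U> \<A> p q F \<sigma> (A, xs @ b # ys) \<oplus>\<^bsub>\<V> \<sigma> (A, xs @ b # ys)\<^esub> mk_cochain \<U> \<A> p q F \<sigma> (A, xs @ b' # ys)"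
      using 1 add[OF 1] by simp
  next
    fix \<sigma> A xs b ys r assume 1: "\<sigma> \<in> simplices \<U> p" "(A, xs @ b # ys) \<in> rsimplices (\<T> \<sigma>) q"
      "r \<in> carrier R"
    let ?C = "\<T> \<sigma>"
    have "r \<odot>\<^bsub>HomMod ?C (Dom ?C b) (Cod ?C b)\<^esub> b \<in> Homs ?C (Dom ?C b) (Cod ?C b)"
      using linear_category.hsmult_closed[OF fib[OF tgt_closed(1)[OF 1(1)]] 1(3) middle_closed[OF 1(1,2)]] .
    from rsimplices_replace(1)[OF 1(2) this]
    show "mk_cochain \<U> \<A> p q F \<sigma> (A, xs @ (r \<odot>\<^bsub>\<H> (tgt \<U> \<sigma>) (Dom (\<T> \<sigma>) b) (Cod (\<T> \<sigma>) b)\<^esub> b) # ys)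
       = r \<odot>\<^bsub>\<V> \<sigma> (A, xs @ b # ys)\<^esub> mk_cochain \<U> \<A> p q F \<sigma> (A, xs @ b # ys)"
      using 1 smult[OF 1] by simp
  qed
qed

lemma Cpq_vals:
  assumes "\<phi> \<in> carrier (\<C> p q)" "\<sigma> \<in> simplices \<U> p" "a \<in> rsimplices (\<T> \<sigma>) q"
  shows "\<phi> \<sigma> a \<in> carrier (\<V> \<sigma> a)"
  using assms Cpq_carrier by blast

lemma Cpq_multilinear:
  assumes "\<phi> \<in> carrier (\<C> p q)"
    "\<sigma> \<in> simplices \<U> p" "(A, xs @ b # ys) \<in> rsimplices (\<T> \<sigma>) q"
  shows "b' \<in> Homs (\<T> \<sigma>) (Dom (\<T> \<sigma>) b) (Cod (\<T> \<sigma>) b) \<Longrightarrow>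
      \<phi> \<sigma> (A, xs @ (b \<oplus>\<^bsub>\<H> (tgt \<U> \<sigma>) (Dom (\<T> \<sigma>) b) (Cod (\<T> \<sigma>) b)\<^esub> b') # ys)
       = \<phi> \<sigma> (A, xs @ b # ys) \<oplus>\<^bsub>\<V> \<sigma> (A, xs @ b # ys)\<^esub> \<phi> \<sigma> (A, xs @ b' # ys)"
    "r \<in> carrier R \<Longrightarrow>
      \<phi> \<sigma> (A, xs @ (r \<odot>\<^bsub>\<H> (tgt \<U> \<sigma>) (Dom (\<T> \<sigma>) b) (Cod (\<T> \<sigma>) b)\<^esub> b) # ys)
       = r \<odot>\<^bsub>\<V> \<sigma> (A, xs @ b # ys)\<^esub> \<phi> \<sigma> (A, xs @ b # ys)"
  using assms unfolding Cpq_carrier multilinear_def Let_def by blast+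

lemma Cpq_add_closed:
  assumes "\<phi> \<in> carrier (\<C> p q)" "\<psi> \<in> carrier (\<C> p q)"
  shows "\<phi> \<oplus>\<^bsub>\<C> p q\<^esub> \<psi> \<in> carrier (\<C> p q)"
  unfolding Cpq_sel
proof (rule Cpq_pointwise_closed, goal_cases)
  case (1 \<sigma> a)
  interpret module R "\<V> \<sigma> a" using val_mod_module 1 by blast
  show ?case using Cpq_vals[OF assms(1) 1] Cpq_vals[OF assms(2) 1] by simp
next
  case (2 \<sigma> A xs b ys b')
  interpret V: module R "\<V> \<sigma> (A, xs @ b # ys)" using val_mod_module 2 by blast
  let ?C = "\<T> \<sigma>"
  have "b \<oplus>\<^bsub>HomMod ?C (Dom ?C b) (Cod ?C b)\<^esub> b' \<in> Homs ?C (Dom ?C b) (Cod ?C b)"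
    using linear_category.hadd_closed[OF fib[OF tgt_closed(1)[OF 2(1)]] middle_closed[OF 2(1,2)] 2(3)] .
  note r = val_mod_replace[OF 2(2) this] val_mod_replace[OF 2(2,3)]
  show ?case
    using Cpq_vals[OF assms(1) 2(1,2)] Cpq_vals[OF assms(2) 2(1,2)]
      Cpq_vals[OF assms(1) 2(1) rsimplices_replace(1)[OF 2(2,3)]]
      Cpq_vals[OF assms(2) 2(1) rsimplices_replace(1)[OF 2(2,3)]]
    by (simp add: r Cpq_multilinear(1)[OF assms(1) 2] Cpq_multilinear(1)[OF assms(2) 2] V.M.a_ac)
next
  case (3 \<sigma> A xs b ys r)
  interpret V: module R "\<V> \<sigma> (A, xs @ b # ys)" using val_mod_module 3 by blast
  let ?C = "\<T> \<sigma>"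
  have "r \<odot>\<^bsub>HomMod ?C (Dom ?C b) (Cod ?C b)\<^esub> b \<in> Homs ?C (Dom ?C b) (Cod ?C b)"
    using linear_category.hsmult_closed[OF fib[OF tgt_closed(1)[OF 3(1)]] 3(3) middle_closed[OF 3(1,2)]] .
  note r = val_mod_replace[OF 3(2) this]
  show ?case
    using Cpq_vals[OF assms(1) 3(1,2)] Cpq_vals[OF assms(2) 3(1,2)] 3(3)
    by (simp add: r Cpq_multilinear(2)[OF assms(1) 3] Cpq_multilinear(2)[OF assms(2) 3] V.smult_r_distr)
qed

lemma Cpq_smult_closed:
  assumes "s \<in> carrier R" "\<phi> \<in> carrier (\<C> p q)"
  shows "s \<odot>\<^bsub>\<C> p q\<^esub> \<phi> \<in> carrier (\<C> p q)"
  unfolding Cpq_sel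
proof (rule Cpq_pointwise_closed, goal_cases)
  case (1 \<sigma> a)
  interpret module R "\<V> \<sigma> a" using val_mod_module 1 by blast
  show ?case using Cpq_vals[OF assms(2) 1] assms(1) by simp
next
  case (2 \<sigma> A xs b ys b')
  interpret V: module R "\<V> \<sigma> (A, xs @ b # ys)" using val_mod_module 2 by blast
  let ?C = "\<T> \<sigma>"
  have "b \<oplus>\<^bsub>HomMod ?C (Dom ?C b) (Cod ?C b)\<^esub> b' \<in> Homs ?C (Dom ?C b) (Cod ?C b)"
    using linear_category.hadd_closed[OF fib[OF tgt_closed(1)[OF 2(1)]] middle_closed[OF 2(1,2)] 2(3)] .
  note r = val_mod_replace[OF 2(2) this] val_mod_replace[OF 2(2,3)]
  show ?case
    using Cpq_vals[OF assms(2) 2(1,2)] assms(1)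
      Cpq_vals[OF assms(2) 2(1) rsimplices_replace(1)[OF 2(2,3)]]
    by (simp add: r Cpq_multilinear(1)[OF assms(2) 2] V.smult_r_distr)
next
  case (3 \<sigma> A xs b ys r)
  interpret V: module R "\<V> \<sigma> (A, xs @ b # ys)" using val_mod_module 3 by blast
  let ?C = "\<T> \<sigma>"
  have "r \<odot>\<^bsub>HomMod ?C (Dom ?C b) (Cod ?C b)\<^esub> b \<in> Homs ?C (Dom ?C b) (Cod ?C b)"
    using linear_category.hsmult_closed[OF fib[OF tgt_closed(1)[OF 3(1)]] 3(3) middle_closed[OF 3(1,2)]] .
  note r = val_mod_replace[OF 3(2) this]
  show ?case
    using Cpq_vals[OF assms(2) 3(1,2)] 3(3) assms(1)
    by (simp add: r Cpq_multilinear(2)[OF assms(2) 3] m_comm flip: V.smult_assoc1)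
qed

lemma Cpq_zero_closed: "\<zero>\<^bsub>\<C> p q\<^esub> \<in> carrier (\<C> p q)"
  unfolding Cpq_sel
proof (rule Cpq_pointwise_closed, goal_cases)
  case (1 \<sigma> a)
  interpret module R "\<V> \<sigma> a" using val_mod_module 1 by blast
  show ?case by simp
next
  case (2 \<sigma> A xs b ys b')
  interpret V: module R "\<V> \<sigma> (A, xs @ b # ys)" using val_mod_module 2 by blast
  let ?C = "\<T> \<sigma>"
  have "b \<oplus>\<^bsub>HomMod ?C (Dom ?C b) (Cod ?C b)\<^esub> b' \<in> Homs ?C (Dom ?C b) (Cod ?C b)"
    using linear_category.hadd_closed[OF fib[OF tgt_closed(1)[OF 2(1)]] middle_closed[OF 2(1,2)] 2(3)] .
  note r = val_mod_replace[OF 2(2) this] val_mod_replace[OF 2(2,3)]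
  show ?case by (simp add: r)
next
  case (3 \<sigma> A xs b ys r)
  interpret V: module R "\<V> \<sigma> (A, xs @ b # ys)" using val_mod_module 3 by blast
  let ?C = "\<T> \<sigma>"
  have "r \<odot>\<^bsub>HomMod ?C (Dom ?C b) (Cod ?C b)\<^esub> b \<in> Homs ?C (Dom ?C b) (Cod ?C b)"
    using linear_category.hsmult_closed[OF fib[OF tgt_closed(1)[OF 3(1)]] 3(3) middle_closed[OF 3(1,2)]] .
  note r = val_mod_replace[OF 3(2) this]
  show ?case using 3 by (simp add: r)
qed

lemma Cpq_module: "module R (\<C> p q)"
proof (rule moduleI)
  show "cring R" by (rule is_cring)
  show "abelian_group (\<C> p q)"
  proof (rule abelian_groupI)
    fix x y z assume c: "x \<in> carrier (\<C> p q)" "y \<in> carrier (\<C> p q)" "z \<in> carrier (\<C> p q)"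
    show "x \<oplus>\<^bsub>\<C> p q\<^esub> y \<in> carrier (\<C> p q)" using c Cpq_add_closed by blast
    show "x \<oplus>\<^bsub>\<C> p q\<^esub> y \<oplus>\<^bsub>\<C> p q\<^esub> z = x \<oplus>\<^bsub>\<C> p q\<^esub> (y \<oplus>\<^bsub>\<C> p q\<^esub> z)"
      unfolding Cpq_sel
    proof (rule mk_cochain_eqI, goal_cases)
      case (1 \<sigma> a)
      interpret V: module R "\<V> \<sigma> a" using val_mod_module 1 by blast
      show ?case using 1 c[THEN Cpq_vals, OF 1] by (simp add: V.M.a_ac)
    qed
    show "x \<oplus>\<^bsub>\<C> p q\<^esub> y = y \<oplus>\<^bsub>\<C> p q\<^esub> x"
      unfolding Cpq_sel
    proof (rule mk_cochain_eqI, goal_cases)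
      case (1 \<sigma> a)
      interpret V: module R "\<V> \<sigma> a" using val_mod_module 1 by blast
      show ?case using 1 c[THEN Cpq_vals, OF 1] by (simp add: V.M.a_ac)
    qed
  next
    show "\<zero>\<^bsub>\<C> p q\<^esub> \<in> carrier (\<C> p q)" by (rule Cpq_zero_closed)
    fix x assume x: "x \<in> carrier (\<C> p q)"
    have zx: "\<zero>\<^bsub>\<C> p q\<^esub> \<oplus>\<^bsub>\<C> p q\<^esub> x = mk_cochain \<U> \<A> p q x"
      unfolding Cpq_sel
    proof (rule mk_cochain_eqI, goal_cases)
      case (1 \<sigma> a)
      interpret V: module R "\<V> \<sigma> a" using val_mod_module 1 by blast
      show ?case using 1 x[THEN Cpq_vals, OF 1] by simp
    qed
    then show "\<zero>\<^bsub>\<C> p q\<^esub> \<oplus>\<^bsub>\<C> p q\<^esub> x = x"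
      using x unfolding Cpq_carrier by simp
    show "\<exists>y \<in> carrier (\<C> p q). y \<oplus>\<^bsub>\<C> p q\<^esub> x = \<zero>\<^bsub>\<C> p q\<^esub>"
    proof
      show "(\<ominus>\<^bsub>R\<^esub> \<one>\<^bsub>R\<^esub>) \<odot>\<^bsub>\<C> p q\<^esub> x \<in> carrier (\<C> p q)" using x by (simp add: Cpq_smult_closed)
      show "(\<ominus>\<^bsub>R\<^esub> \<one>\<^bsub>R\<^esub>) \<odot>\<^bsub>\<C> p q\<^esub> x \<oplus>\<^bsub>\<C> p q\<^esub> x = \<zero>\<^bsub>\<C> p q\<^esub>"
        unfolding Cpq_sel
      proof (rule mk_cochain_eqI, goal_cases)
        case (1 \<sigma> a)
        interpret V: module R "\<V> \<sigma> a" using val_mod_module 1 by blast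
        show ?case using 1 x[THEN Cpq_vals, OF 1] by (simp add: V.smult_l_minus V.M.l_neg)
      qed
    qed
  qed
next
  fix r s x y assume c: "r \<in> carrier R" "s \<in> carrier R" "x \<in> carrier (\<C> p q)" "y \<in> carrier (\<C> p q)"
  show "(r \<oplus>\<^bsub>R\<^esub> s) \<odot>\<^bsub>\<C> p q\<^esub> x = (r \<odot>\<^bsub>\<C> p q\<^esub> x) \<oplus>\<^bsub>\<C> p q\<^esub> (s \<odot>\<^bsub>\<C> p q\<^esub> x)"
    unfolding Cpq_sel
  proof (rule mk_cochain_eqI, goal_cases)
    case (1 \<sigma> a)
    interpret V: module R "\<V> \<sigma> a" using val_mod_module 1 by blast
    show ?case using 1 c(1,2) c(3)[THEN Cpq_vals, OF 1] by (simp add: V.smult_l_distr)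
  qed
  show "r \<odot>\<^bsub>\<C> p q\<^esub> (x \<oplus>\<^bsub>\<C> p q\<^esub> y) = (r \<odot>\<^bsub>\<C> p q\<^esub> x) \<oplus>\<^bsub>\<C> p q\<^esub> (r \<odot>\<^bsub>\<C> p q\<^esub> y)"
    unfolding Cpq_sel
  proof (rule mk_cochain_eqI, goal_cases)
    case (1 \<sigma> a)
    interpret V: module R "\<V> \<sigma> a" using val_mod_module 1 by blast
    show ?case using 1 c(1,2) c(3,4)[THEN Cpq_vals, OF 1] by (simp add: V.smult_r_distr)
  qed
  show "(r \<otimes>\<^bsub>R\<^esub> s) \<odot>\<^bsub>\<C> p q\<^esub> x = r \<odot>\<^bsub>\<C> p q\<^esub> (s \<odot>\<^bsub>\<C> p q\<^esub> x)"
    unfolding Cpq_sel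
  proof (rule mk_cochain_eqI, goal_cases)
    case (1 \<sigma> a)
    interpret V: module R "\<V> \<sigma> a" using val_mod_module 1 by blast
    show ?case using 1 c(1,2) c(3)[THEN Cpq_vals, OF 1] by (simp add: V.smult_assoc1)
  qed
next
  fix x assume x: "x \<in> carrier (\<C> p q)"
  have "\<one>\<^bsub>R\<^esub> \<odot>\<^bsub>\<C> p q\<^esub> x = mk_cochain \<U> \<A> p q x"
    unfolding Cpq_sel
  proof (rule mk_cochain_eqI, goal_cases)
    case (1 \<sigma> a)
    interpret V: module R "\<V> \<sigma> a" using val_mod_module 1 by blast
    show ?case using 1 x[THEN Cpq_vals, OF 1] by simp
  qed
  then show "\<one>\<^bsub>R\<^esub> \<odot>\<^bsub>\<C> p q\<^esub> x = x"
    using x unfolding Cpq_carrier by simp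
qed (simp_all add: Cpq_smult_closed)

lemma Cpq_apply:
  assumes "\<phi> \<in> carrier (\<C> p q)" "\<psi> \<in> carrier (\<C> p q)" "r \<in> carrier R"
    "\<sigma> \<in> simplices \<U> p" "a \<in> rsimplices (\<T> \<sigma>) q"
  shows "(\<phi> \<oplus>\<^bsub>\<C> p q\<^esub> \<psi>) \<sigma> a = \<phi> \<sigma> a \<oplus>\<^bsub>\<V> \<sigma> a\<^esub> \<psi> \<sigma> a"
    "(r \<odot>\<^bsub>\<C> p q\<^esub> \<phi>) \<sigma> a = r \<odot>\<^bsub>\<V> \<sigma> a\<^esub> \<phi> \<sigma> a"
    "(\<ominus>\<^bsub>\<C> p q\<^esub> \<phi>) \<sigma> a = \<ominus>\<^bsub>\<V> \<sigma> a\<^esub> \<phi> \<sigma> a"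
    "\<zero>\<^bsub>\<C> p q\<^esub> \<sigma> a = \<zero>\<^bsub>\<V> \<sigma> a\<^esub>"
proof -
  show 1: "(\<phi> \<oplus>\<^bsub>\<C> p q\<^esub> \<psi>) \<sigma> a = \<phi> \<sigma> a \<oplus>\<^bsub>\<V> \<sigma> a\<^esub> \<psi> \<sigma> a" for \<phi> \<psi>
    using assms(4,5) by (simp add: Cpq_sel)
  show "(r \<odot>\<^bsub>\<C> p q\<^esub> \<phi>) \<sigma> a = r \<odot>\<^bsub>\<V> \<sigma> a\<^esub> \<phi> \<sigma> a"
    using assms(4,5) by (simp add: Cpq_sel)
  show 0: "\<zero>\<^bsub>\<C> p q\<^esub> \<sigma> a = \<zero>\<^bsub>\<V> \<sigma> a\<^esub>"
    using assms(4,5) by (simp add: Cpq_sel)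
  interpret M: module R "\<C> p q" by (rule Cpq_module)
  interpret V: module R "\<V> \<sigma> a" using val_mod_module assms(4,5) by blast
  have "(\<ominus>\<^bsub>\<C> p q\<^esub> \<phi>) \<sigma> a \<oplus>\<^bsub>\<V> \<sigma> a\<^esub> \<phi> \<sigma> a = \<zero>\<^bsub>\<V> \<sigma> a\<^esub>"
    using 1[of "\<ominus>\<^bsub>\<C> p q\<^esub> \<phi>" \<phi>] 0 assms(1) by (simp add: M.M.l_neg)
  then show "(\<ominus>\<^bsub>\<C> p q\<^esub> \<phi>) \<sigma> a = \<ominus>\<^bsub>\<V> \<sigma> a\<^esub> \<phi> \<sigma> a"
    using assms Cpq_vals[OF _ assms(4,5)] by (metis M.M.a_inv_closed V.M.minus_equality)
qed

lemma GS_module: "module R (\<G> n)"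
proof -
  interpret M: module R "\<C> p (n - p)" for p by (rule Cpq_module)
  have ext: "x = (\<lambda>p \<in> {..n}. x p)" if "x \<in> carrier (\<G> n)" for x
    using that by (auto simp: GS_def PiE_def extensional_def restrict_def)
  have c: "x p \<in> carrier (\<C> p (n - p))" if "x \<in> carrier (\<G> n)" "p \<le> n" for x p
    using that by (auto simp: GS_def)
  show ?thesis
  proof (rule moduleI)
    show "cring R" by (rule is_cring)
    show "abelian_group (\<G> n)"
    proof (rule abelian_groupI)
      fix x assume x: "x \<in> carrier (\<G> n)"
      show "\<zero>\<^bsub>\<G> n\<^esub> \<oplus>\<^bsub>\<G> n\<^esub> x = x"
        by (subst (2) ext[OF x]) (auto simp: GS_def restrict_def fun_eq_iff c[OF x])
      show "\<exists>y \<in> carrier (\<G> n). y \<oplus>\<^bsub>\<G> n\<^esub> x = \<zero>\<^bsub>\<G> n\<^esub>"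
        by (rule bexI[of _ "\<lambda>p \<in> {..n}. \<ominus>\<^bsub>\<C> p (n - p)\<^esub> x p"])
          (auto simp: GS_def restrict_def fun_eq_iff c[OF x] M.M.l_neg)
    qed (auto simp: GS_def restrict_def fun_eq_iff M.M.a_ac PiE_iff extensional_def)
  qed (auto simp: GS_def restrict_def fun_eq_iff M.M.a_ac PiE_iff M.smult_l_distr
      M.smult_r_distr M.smult_assoc1 extensional_def)
qed

end

section \<open>Formal differences\<close>

text \<open>
  The differential is an alternating sum. Collecting the terms by sign as \<open>p - n\<close>, with \<open>p\<close> and \<open>n\<close>
  sums without signs, turns every equation between such sums into an equation without signs, which
  is decided by associativity and commutativity. The rules below push differences outwards through
  sums, negation and composition.
\<close>

definition hdif :: "('k, 'o, 'a) lincat \<Rightarrow> 'o \<Rightarrow> 'o \<Rightarrow> 'a \<Rightarrow> 'a \<Rightarrow> 'a" where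
  "hdif C A B p n = p \<oplus>\<^bsub>HomMod C A B\<^esub> \<ominus>\<^bsub>HomMod C A B\<^esub> n"

context linear_category begin

lemma hdif_type:
  assumes "p \<in> Homs C A B" "n \<in> Homs C A B"
  shows "hdif C A B p n \<in> Ar C" "Dom C (hdif C A B p n) = A" "Cod C (hdif C A B p n) = B"
  unfolding hdif_def using assms by (simp_all add: lin_rules)

lemma hdif_neg_def: "x \<in> Homs C A B \<Longrightarrow> \<ominus>\<^bsub>HomMod C A B\<^esub> x = hdif C A B \<zero>\<^bsub>HomMod C A B\<^esub> x"
  unfolding hdif_def by (simp add: hadd_group hneg_closed)

lemma hneg_hadd:
  assumes "x \<in> Homs C A B" "y \<in> Homs C A B"
  shows "\<ominus>\<^bsub>HomMod C A B\<^esub> (x \<oplus>\<^bsub>HomMod C A B\<^esub> y)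
    = \<ominus>\<^bsub>HomMod C A B\<^esub> x \<oplus>\<^bsub>HomMod C A B\<^esub> \<ominus>\<^bsub>HomMod C A B\<^esub> y"
proof -
  interpret abelian_group "HomMod C A B" using HomMod_abelian_group hom_obs[OF assms(1)] by blast
  show ?thesis using assms HomMod_carrier hom_obs[OF assms(1)] minus_add by simp
qed

lemma hdif_add:
  assumes "x \<in> Homs C A B" "p \<in> Homs C A B" "n \<in> Homs C A B"
  shows "x \<oplus>\<^bsub>HomMod C A B\<^esub> hdif C A B p n = hdif C A B (x \<oplus>\<^bsub>HomMod C A B\<^esub> p) n"
    "hdif C A B p n \<oplus>\<^bsub>HomMod C A B\<^esub> x = hdif C A B (p \<oplus>\<^bsub>HomMod C A B\<^esub> x) n"
  unfolding hdif_def using assms by (simp_all add: hadd_ac lin_rules)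

lemma hdif_add_hdif:
  assumes "p \<in> Homs C A B" "n \<in> Homs C A B" "p' \<in> Homs C A B" "n' \<in> Homs C A B"
  shows "hdif C A B p n \<oplus>\<^bsub>HomMod C A B\<^esub> hdif C A B p' n'
     = hdif C A B (p \<oplus>\<^bsub>HomMod C A B\<^esub> p') (n \<oplus>\<^bsub>HomMod C A B\<^esub> n')"
  unfolding hdif_def using assms by (simp add: hneg_hadd hadd_ac lin_rules)

lemma hdif_neg:
  assumes "p \<in> Homs C A B" "n \<in> Homs C A B"
  shows "\<ominus>\<^bsub>HomMod C A B\<^esub> hdif C A B p n = hdif C A B n p"
  unfolding hdif_def using assms by (simp add: hneg_hadd hadd_ac lin_rules hadd_group)

lemma hdif_eq_iff:
  assumes "p \<in> Homs C A B" "n \<in> Homs C A B"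
  shows "x \<in> Homs C A B \<Longrightarrow> hdif C A B p n = x \<longleftrightarrow> p = x \<oplus>\<^bsub>HomMod C A B\<^esub> n"
    "x \<in> Homs C A B \<Longrightarrow> x = hdif C A B p n \<longleftrightarrow> x \<oplus>\<^bsub>HomMod C A B\<^esub> n = p"
    "p' \<in> Homs C A B \<Longrightarrow> n' \<in> Homs C A B \<Longrightarrow> hdif C A B p n = hdif C A B p' n'
      \<longleftrightarrow> p \<oplus>\<^bsub>HomMod C A B\<^esub> n' = p' \<oplus>\<^bsub>HomMod C A B\<^esub> n"
proof -
  show 1: "x \<in> Homs C A B \<Longrightarrow> hdif C A B p n = x \<longleftrightarrow> p = x \<oplus>\<^bsub>HomMod C A B\<^esub> n" for x
    unfolding hdif_def using hadd_neg_eq_iff[OF assms] .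
  then show "x \<in> Homs C A B \<Longrightarrow> x = hdif C A B p n \<longleftrightarrow> x \<oplus>\<^bsub>HomMod C A B\<^esub> n = p" by metis
  show "hdif C A B p n = hdif C A B p' n' \<longleftrightarrow> p \<oplus>\<^bsub>HomMod C A B\<^esub> n' = p' \<oplus>\<^bsub>HomMod C A B\<^esub> n"
    if p': "p' \<in> Homs C A B" "n' \<in> Homs C A B"
  proof -
    have "hdif C A B p n = hdif C A B p' n' \<longleftrightarrow> p = hdif C A B (p' \<oplus>\<^bsub>HomMod C A B\<^esub> n) n'"
      using p' assms 1[of "hdif C A B p' n'"] hdif_add(2)[OF assms(2) p'] hdif_type[OF p']
      by (simp add: mem_Homs)
    also have "\<dots> \<longleftrightarrow> p \<oplus>\<^bsub>HomMod C A B\<^esub> n' = p' \<oplus>\<^bsub>HomMod C A B\<^esub> n"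
      unfolding hdif_def using p' assms hadd_neg_eq_iff[of "p' \<oplus>\<^bsub>HomMod C A B\<^esub> n" A B n' p]
        hadd_closed[of p' A B n] by metis
    finally show ?thesis .
  qed
qed

lemma hdif_hdif:
  assumes "p \<in> Homs C A B" "n \<in> Homs C A B" "x \<in> Homs C A B"
  shows "hdif C A B (hdif C A B p n) x = hdif C A B p (n \<oplus>\<^bsub>HomMod C A B\<^esub> x)"
    "hdif C A B x (hdif C A B p n) = hdif C A B (x \<oplus>\<^bsub>HomMod C A B\<^esub> n) p"
  using assms by (simp_all add: hdif_def hneg_hadd hadd_ac lin_rules hadd_group)

lemma comp_hdif:
  "\<lbrakk>b \<in> Ar C; Dom C b = B; x \<in> Homs C A B; y \<in> Homs C A B\<rbrakk>
    \<Longrightarrow> b \<bullet>\<^bsub>C\<^esub> hdif C A B x y = hdif C A (Cod C b) (b \<bullet>\<^bsub>C\<^esub> x) (b \<bullet>\<^bsub>C\<^esub> y)"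
  "\<lbrakk>a \<in> Ar C; Cod C a = B; z \<in> Homs C B D; w \<in> Homs C B D\<rbrakk>
    \<Longrightarrow> hdif C B D z w \<bullet>\<^bsub>C\<^esub> a = hdif C (Dom C a) D (z \<bullet>\<^bsub>C\<^esub> a) (w \<bullet>\<^bsub>C\<^esub> a)"
  unfolding hdif_def by (auto simp: lin_rules lin_dist)

lemma hsmult_hdif:
  assumes "r \<in> carrier R" "x \<in> Homs C A B" "y \<in> Homs C A B"
  shows "r \<odot>\<^bsub>HomMod C A B\<^esub> hdif C A B x y = hdif C A B (r \<odot>\<^bsub>HomMod C A B\<^esub> x) (r \<odot>\<^bsub>HomMod C A B\<^esub> y)"
  unfolding hdif_def using assms by (simp add: lin_rules hsmult_hadd hsmult_hneg)

lemma hsign: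
  assumes "x \<in> Homs C A B"
  shows "[(1::int)] \<cdot>\<^bsub>HomMod C A B\<^esub> x = x"
    "[(-1::int)] \<cdot>\<^bsub>HomMod C A B\<^esub> x = \<ominus>\<^bsub>HomMod C A B\<^esub> x"
proof -
  interpret abelian_group "HomMod C A B" using HomMod_abelian_group hom_obs[OF assms(1)] by blast
  have x: "x \<in> carrier (HomMod C A B)" using assms HomMod_carrier hom_obs[OF assms(1)] by simp
  show 1: "[(1::int)] \<cdot>\<^bsub>HomMod C A B\<^esub> x = x" using x group.int_pow_1[OF a_group, of x] by (simp add: add_pow_def)
  show "[(-1::int)] \<cdot>\<^bsub>HomMod C A B\<^esub> x = \<ominus>\<^bsub>HomMod C A B\<^esub> x"
    using x 1 group.int_pow_neg[OF a_group, of x 1] by (simp add: add_pow_def a_inv_def)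
qed

lemma hfinsum_small:
  shows "A \<in> Ob C \<Longrightarrow> B \<in> Ob C \<Longrightarrow> finsum (HomMod C A B) f {} = \<zero>\<^bsub>HomMod C A B\<^esub>"
    "f i \<in> Homs C A B \<Longrightarrow> finsum (HomMod C A B) f {i} = f i"
    "f i \<in> Homs C A B \<Longrightarrow> f j \<in> Homs C A B \<Longrightarrow> i \<noteq> j
      \<Longrightarrow> finsum (HomMod C A B) f {i, j} = f i \<oplus>\<^bsub>HomMod C A B\<^esub> f j"
    "f i \<in> Homs C A B \<Longrightarrow> f j \<in> Homs C A B \<Longrightarrow> f k \<in> Homs C A B \<Longrightarrow> i \<noteq> j \<Longrightarrow> i \<noteq> k \<Longrightarrow> j \<noteq> k
      \<Longrightarrow> finsum (HomMod C A B) f {i, j, k} = f i \<oplus>\<^bsub>HomMod C A B\<^esub> (f j \<oplus>\<^bsub>HomMod C A B\<^esub> f k)"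
proof -
  have *: "abelian_group (HomMod C A B) \<and> f i \<in> carrier (HomMod C A B)" if "f i \<in> Homs C A B" for i
    using HomMod_abelian_group HomMod_carrier hom_obs[OF that] that by auto
  show "finsum (HomMod C A B) f {} = \<zero>\<^bsub>HomMod C A B\<^esub>" if "A \<in> Ob C" "B \<in> Ob C"
  proof -
    interpret abelian_group "HomMod C A B" using HomMod_abelian_group that by blast
    show ?thesis by simp
  qed
  show "finsum (HomMod C A B) f {i} = f i" if "f i \<in> Homs C A B"
  proof -
    interpret abelian_group "HomMod C A B" using * that by blast
    show ?thesis using *[OF that] by simp
  qed
  show "finsum (HomMod C A B) f {i, j} = f i \<oplus>\<^bsub>HomMod C A B\<^esub> f j"
    if "f i \<in> Homs C A B" "f j \<in> Homs C A B" "i \<noteq> j"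
  proof -
    interpret abelian_group "HomMod C A B" using * that by blast
    show ?thesis using that(1,2)[THEN *] that(3) by simp
  qed
  show "finsum (HomMod C A B) f {i, j, k} = f i \<oplus>\<^bsub>HomMod C A B\<^esub> (f j \<oplus>\<^bsub>HomMod C A B\<^esub> f k)"
    if "f i \<in> Homs C A B" "f j \<in> Homs C A B" "f k \<in> Homs C A B" "i \<noteq> j" "i \<noteq> k" "j \<noteq> k"
  proof -
    interpret abelian_group "HomMod C A B" using * that by blast
    show ?thesis using that(1-3)[THEN *] that(4-) by simp
  qed
qed

lemmas hdif_rules = hdif_type hdif_neg_def hdif_add hdif_add_hdif hdif_neg hdif_hdif comp_hdif

end

section \<open>Paths and shuffles of low dimension\<close>

text \<open>
  A component of the differential from bidegree \<open>(p, q)\<close> in total degree at most two raises \<open>p\<close> by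
  at most three, so simplices with two and three arrows are the only ones whose paths occur.
\<close>

lemma path_choices_small: "path_choices 2 = {[1]}" "path_choices 3 = {[1, 1], [2, 1]}"
proof -
  have *: "{1..2 - Suc 0} = {1::nat}" "{1..2::nat} = {1, 2}" by auto
  show "path_choices 2 = {[1]}"
    by (auto simp: path_choices_def length_Suc_conv)
  show "path_choices 3 = {[1, 1], [2, 1]}"
    by (auto simp: path_choices_def length_Suc_conv numeral_2_eq_2 numeral_3_eq_3 less_Suc_eq all_conj_distrib
        nth_Cons' le_Suc_eq)
qed

lemma shuffles_set_small:
  "shuffles_set 0 1 = {id}" "shuffles_set 0 2 = {id}"
  "shuffles_set 1 1 = {id, Transposition.transpose 1 2}"
proof -
  have 2: "{1..2::nat} = {1, 2}" "{Suc 0..Suc (Suc 0)} = {1, 2}" "{Suc 0..2} = {1, 2}" by auto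
  show "shuffles_set 0 1 = {id}"
    by (auto simp: shuffles_set_def strict_mono_on_def)
  have "\<not> strict_mono_on {1, 2} (Transposition.transpose 1 (2::nat))"
    using strict_mono_onD[of "{1, 2}" "Transposition.transpose 1 (2::nat)" 1 2] by auto
  then show "shuffles_set 0 2 = {id}"
    by (auto simp: shuffles_set_def 2 permutes_doubleton_iff strict_mono_on_def)
  show "shuffles_set 1 1 = {id, Transposition.transpose 1 2}"
    by (auto simp: shuffles_set_def 2 permutes_doubleton_iff numeral_2_eq_2[symmetric] strict_mono_on_def)
qed

lemma card_filter_singleton:
  "card {k. k = i \<and> P k} = (if P i then 1 else 0)"
  "card {k. i \<le> k \<and> k \<le> (i::nat) \<and> P k} = (if P i then 1 else 0)"
proof -
  have "{k. k = i \<and> P k} = (if P i then {i} else {})" "{k. i \<le> k \<and> k \<le> i \<and> P k} = (if P i then {i} else {})"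
    by auto
  then show "card {k. k = i \<and> P k} = (if P i then 1 else 0)"
    "card {k. i \<le> k \<and> k \<le> (i::nat) \<and> P k} = (if P i then 1 else 0)" by simp_all
qed

lemma shuffle_simplex_small:
  "shuffle_simplex D T [r] id (A, []) = (fst (T ! 0) A, [r A])"
  "shuffle_simplex D T [r, r'] id (A, []) = (fst (T ! 0) A, [r A, r' A])"
  "shuffle_simplex D T [r] id (A, [a]) = (fst (T ! 0) A, [snd (T ! 1) a, r A])"
  "shuffle_simplex D T [r] (Transposition.transpose 1 2) (A, [a])
     = (fst (T ! 0) A, [r (Cod D a), snd (T ! 0) a])"
proof -
  have *: "[1..<Suc (Suc 0)] = [1]" "[1..<Suc (Suc (Suc 0))] = [1, 2]" by (simp_all add: upt_rec)
  have i: "inv_into UNIV (Transposition.transpose 1 (2::nat)) = Transposition.transpose 1 2"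
    by (rule inv_equality) auto
  show "shuffle_simplex D T [r] id (A, []) = (fst (T ! 0) A, [r A])"
    by (simp add: shuffle_simplex_def * Let_def upt_rec)
  show "shuffle_simplex D T [r, r'] id (A, []) = (fst (T ! 0) A, [r A, r' A])"
    by (simp add: shuffle_simplex_def * Let_def upt_rec)
  show "shuffle_simplex D T [r] id (A, [a]) = (fst (T ! 0) A, [snd (T ! 1) a, r A])"
    by (simp add: shuffle_simplex_def * Let_def numeral_2_eq_2[symmetric] card_filter_singleton)
  show "shuffle_simplex D T [r] (Transposition.transpose 1 2) (A, [a])
     = (fst (T ! 0) A, [r (Cod D a), snd (T ! 0) a])"
    by (simp add: shuffle_simplex_def * Let_def numeral_2_eq_2[symmetric] i card_filter_singleton)
qed

context prestack begin

lemmas fib_hdif = linear_category.hdif_rules[OF fib]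
lemmas fib_hdif_eq = linear_category.hdif_eq_iff[OF fib]
lemmas fib_sign = linear_category.hsign[OF fib]
lemmas fib_finsum = linear_category.hfinsum_small[OF fib]
lemmas fib_simplices = category.rsimplices_small[OF fib_cat]

lemma res_hdif:
  "u \<in> Ar \<U> \<Longrightarrow> Cod \<U> u = W \<Longrightarrow> x \<in> Homs (\<F> W) A B \<Longrightarrow> y \<in> Homs (\<F> W) A B
    \<Longrightarrow> res_mor \<A> u (hdif (\<F> W) A B x y)
     = hdif (\<F> (Dom \<U> u)) (res_ob \<A> u A) (res_ob \<A> u B) (res_mor \<A> u x) (res_mor \<A> u y)"
  unfolding hdif_def by (auto simp: ps_rules)

lemma total_small:
  "total \<U> (U, []) = Ident \<U> U"
  "u \<in> Ar \<U> \<Longrightarrow> Dom \<U> u = U \<Longrightarrow> total \<U> (U, [u]) = u"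
  "\<lbrakk>u \<in> Ar \<U>; v \<in> Ar \<U>; Dom \<U> u = U; Dom \<U> v = Cod \<U> u\<rbrakk> \<Longrightarrow> total \<U> (U, [u, v]) = v \<bullet>\<^bsub>\<U>\<^esub> u"
  "\<lbrakk>u \<in> Ar \<U>; v \<in> Ar \<U>; w \<in> Ar \<U>; Dom \<U> u = U; Dom \<U> v = Cod \<U> u; Dom \<U> w = Cod \<U> v\<rbrakk>
    \<Longrightarrow> total \<U> (U, [u, v, w]) = w \<bullet>\<^bsub>\<U>\<^esub> (v \<bullet>\<^bsub>\<U>\<^esub> u)"
  by (auto simp: total_def base_rules)

lemmas small_rules = ps_rules total_small val_mod_def \<U>.simplices_small fib_simplices

lemma val_carrier: "U \<in> Ob \<U> \<Longrightarrow> A \<in> Ob (\<F> U) \<Longrightarrow> B \<in> Ob (\<F> U)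
    \<Longrightarrow> carrier (\<H> U A B) = Homs (\<F> U) A B"
  using linear_category.HomMod_carrier[OF fib] .

section \<open>Cochains of total degree one and two\<close>

text \<open>
  Multilinearity, which is stated for arbitrary positions in a list of arrows, becomes the usual
  linearity in each variable in low degrees. The lemmas \<open>C02_I\<close>, \<open>C11_I\<close>, \<open>C01_I\<close>, \<open>C20_I\<close> and
  \<open>C10_I\<close> go back.
\<close>

lemma C02_hoch:
  assumes m: "m \<in> carrier (\<C> 0 2)" and U: "U \<in> Ob \<U>"
  shows "hoch_cochain R (\<F> U) (m (U, []))"
proof (rule hoch_cochain.intro[OF fib[OF U]], rule hoch_cochain_axioms.intro)
  fix a b A assume "a \<in> Ar (\<F> U)" "b \<in> Ar (\<F> U)" "Dom (\<F> U) a = A" "Dom (\<F> U) b = Cod (\<F> U) a"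
  then show "m (U, []) (A, [b, a]) \<in> Homs (\<F> U) A (Cod (\<F> U) b)"
    using Cpq_vals[OF m, of "(U, [])" "(A, [b, a])"] U by (auto simp: small_rules val_carrier)
next
  fix a b b' A B D assume "a \<in> Homs (\<F> U) A B" "b \<in> Homs (\<F> U) B D" "b' \<in> Homs (\<F> U) B D"
  then show "m (U, []) (A, [b \<oplus>\<^bsub>\<H> U B D\<^esub> b', a])
     = m (U, []) (A, [b, a]) \<oplus>\<^bsub>\<H> U A D\<^esub> m (U, []) (A, [b', a])"
    using Cpq_multilinear(1)[OF m, of "(U, [])" A "[]" b "[a]" b'] U by (auto simp: small_rules)
next
  fix a b a' A B D assume "a \<in> Homs (\<F> U) A B" "a' \<in> Homs (\<F> U) A B" "b \<in> Homs (\<F> U) B D"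
  then show "m (U, []) (A, [b, a \<oplus>\<^bsub>\<H> U A B\<^esub> a'])
     = m (U, []) (A, [b, a]) \<oplus>\<^bsub>\<H> U A D\<^esub> m (U, []) (A, [b, a'])"
    using Cpq_multilinear(1)[OF m, of "(U, [])" A "[b]" a "[]" a'] U by (auto simp: small_rules)
next
  fix r a b A B D assume "r \<in> carrier R" "a \<in> Homs (\<F> U) A B" "b \<in> Homs (\<F> U) B D"
  then show "m (U, []) (A, [r \<odot>\<^bsub>\<H> U B D\<^esub> b, a]) = r \<odot>\<^bsub>\<H> U A D\<^esub> m (U, []) (A, [b, a])"
     "m (U, []) (A, [b, r \<odot>\<^bsub>\<H> U A B\<^esub> a]) = r \<odot>\<^bsub>\<H> U A D\<^esub> m (U, []) (A, [b, a])"
    using Cpq_multilinear(2)[OF m, of "(U, [])" A "[]" b "[a]" r]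
      Cpq_multilinear(2)[OF m, of "(U, [])" A "[b]" a "[]" r] U by (auto simp: small_rules)
qed

lemma C02_I:
  assumes F: "\<And>U. U \<in> Ob \<U> \<Longrightarrow> hoch_cochain R (\<F> U) (F (U, []))"
  shows "mk_cochain \<U> \<A> 0 2 F \<in> carrier (\<C> 0 2)"
proof (rule Cpq_pointwise_closed, goal_cases)
  case (1 \<sigma> a)
  then obtain U where U: "\<sigma> = (U, [])" "U \<in> Ob \<U>" by (auto simp: \<U>.simplices_small)
  interpret hoch_cochain R "\<F> U" "F (U, [])" using F U by blast
  show ?case using 1(2) U by (auto simp: small_rules val_carrier mu_type)
next
  case (2 \<sigma> A xs b ys b')
  then obtain U where U: "\<sigma> = (U, [])" "U \<in> Ob \<U>" by (auto simp: \<U>.simplices_small)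
  interpret hoch_cochain R "\<F> U" "F (U, [])" using F U by blast
  consider a where "xs = []" "ys = [a]" | a where "xs = [a]" "ys = []"
    using 2(2) by (cases xs; cases ys) (auto simp: rsimplices_def)
  then show ?case using 2(2,3) U
    by cases (auto simp: small_rules mu_type mu_add_left mu_add_right)
next
  case (3 \<sigma> A xs b ys r)
  then obtain U where U: "\<sigma> = (U, [])" "U \<in> Ob \<U>" by (auto simp: \<U>.simplices_small)
  interpret hoch_cochain R "\<F> U" "F (U, [])" using F U by blast
  consider a where "xs = []" "ys = [a]" | a where "xs = [a]" "ys = []"
    using 3(2) by (cases xs; cases ys) (auto simp: rsimplices_def)
  then show ?case using 3(2,3) U
    by cases (auto simp: small_rules mu_type mu_smult_left mu_smult_right)
qed

lemma C11_functor:
  assumes f: "f \<in> carrier (\<C> 1 1)" and u: "u \<in> Ar \<U>" "Dom \<U> u = V" "Cod \<U> u = W"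
  shows "functor_cochain R (\<F> W) (\<F> V) (res_ob \<A> u) (res_mor \<A> u) (f (V, [u]))"
proof -
  have "lin_functor R (\<F> W) (\<F> V) (res_ob \<A> u) (res_mor \<A> u)"
    using res_functor[OF u(1)] u by simp
  then show ?thesis
  proof (rule functor_cochain.intro, intro functor_cochain_axioms.intro)
    fix a A assume "a \<in> Ar (\<F> W)" "Dom (\<F> W) a = A"
    then show "f (V, [u]) (A, [a]) \<in> Homs (\<F> V) (res_ob \<A> u A) (res_ob \<A> u (Cod (\<F> W) a))"
      using Cpq_vals[OF f, of "(V, [u])" "(A, [a])"] u by (auto simp: small_rules val_carrier)
  next
    fix a a' A B assume "a \<in> Homs (\<F> W) A B" "a' \<in> Homs (\<F> W) A B"
    then show "f (V, [u]) (A, [a \<oplus>\<^bsub>\<H> W A B\<^esub> a'])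
      = f (V, [u]) (A, [a]) \<oplus>\<^bsub>\<H> V (res_ob \<A> u A) (res_ob \<A> u B)\<^esub> f (V, [u]) (A, [a'])"
      using Cpq_multilinear(1)[OF f, of "(V, [u])" A "[]" a "[]" a'] u by (auto simp: small_rules)
  next
    fix r a A B assume "r \<in> carrier R" "a \<in> Homs (\<F> W) A B"
    then show "f (V, [u]) (A, [r \<odot>\<^bsub>\<H> W A B\<^esub> a])
      = r \<odot>\<^bsub>\<H> V (res_ob \<A> u A) (res_ob \<A> u B)\<^esub> f (V, [u]) (A, [a])"
      using Cpq_multilinear(2)[OF f, of "(V, [u])" A "[]" a "[]" r] u by (auto simp: small_rules)
  qed
qed

lemma C11_I:
  assumes F: "\<And>u. u \<in> Ar \<U> \<Longrightarrow>
    functor_cochain R (\<F> (Cod \<U> u)) (\<F> (Dom \<U> u)) (res_ob \<A> u) (res_mor \<A> u) (F (Dom \<U> u, [u]))"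
  shows "mk_cochain \<U> \<A> 1 1 F \<in> carrier (\<C> 1 1)"
proof (rule Cpq_pointwise_closed, goal_cases)
  case (1 \<sigma> a)
  then obtain u where u: "\<sigma> = (Dom \<U> u, [u])" "u \<in> Ar \<U>" by (auto simp: \<U>.simplices_small)
  interpret functor_cochain R "\<F> (Cod \<U> u)" "\<F> (Dom \<U> u)" "res_ob \<A> u" "res_mor \<A> u" "F (Dom \<U> u, [u])"
    using F u by blast
  show ?case using 1(2) u by (auto simp: small_rules val_carrier eta_type)
next
  case (2 \<sigma> A xs b ys b')
  then obtain u where u: "\<sigma> = (Dom \<U> u, [u])" "u \<in> Ar \<U>" by (auto simp: \<U>.simplices_small)
  interpret functor_cochain R "\<F> (Cod \<U> u)" "\<F> (Dom \<U> u)" "res_ob \<A> u" "res_mor \<A> u" "F (Dom \<U> u, [u])"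
    using F u by blast
  show ?case using 2(2,3) u by (cases xs) (auto simp: small_rules eta_type eta_add)
next
  case (3 \<sigma> A xs b ys r)
  then obtain u where u: "\<sigma> = (Dom \<U> u, [u])" "u \<in> Ar \<U>" by (auto simp: \<U>.simplices_small)
  interpret functor_cochain R "\<F> (Cod \<U> u)" "\<F> (Dom \<U> u)" "res_ob \<A> u" "res_mor \<A> u" "F (Dom \<U> u, [u])"
    using F u by blast
  show ?case using 3(2,3) u by (cases xs) (auto simp: small_rules eta_type eta_smult)
qed

lemma id_functor: "U \<in> Ob \<U> \<Longrightarrow> lin_functor R (\<F> U) (\<F> U) (\<lambda>A. A) (\<lambda>a. a)"
  by (intro lin_functor.intro lin_functor_axioms.intro fib) (auto simp: linear_functor_def)

lemma C01_functor:
  assumes f: "f \<in> carrier (\<C> 0 1)" and U: "U \<in> Ob \<U>"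
  shows "functor_cochain R (\<F> U) (\<F> U) (\<lambda>A. A) (\<lambda>a. a) (f (U, []))"
proof (rule functor_cochain.intro[OF id_functor[OF U]], rule functor_cochain_axioms.intro)
  fix a A assume "a \<in> Ar (\<F> U)" "Dom (\<F> U) a = A"
  then show "f (U, []) (A, [a]) \<in> Homs (\<F> U) A (Cod (\<F> U) a)"
    using Cpq_vals[OF f, of "(U, [])" "(A, [a])"] U by (auto simp: small_rules val_carrier)
next
  fix a a' A B assume "a \<in> Homs (\<F> U) A B" "a' \<in> Homs (\<F> U) A B"
  then show "f (U, []) (A, [a \<oplus>\<^bsub>\<H> U A B\<^esub> a'])
    = f (U, []) (A, [a]) \<oplus>\<^bsub>\<H> U A B\<^esub> f (U, []) (A, [a'])"
    using Cpq_multilinear(1)[OF f, of "(U, [])" A "[]" a "[]" a'] U by (auto simp: small_rules)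
next
  fix r a A B assume "r \<in> carrier R" "a \<in> Homs (\<F> U) A B"
  then show "f (U, []) (A, [r \<odot>\<^bsub>\<H> U A B\<^esub> a])
    = r \<odot>\<^bsub>\<H> U A B\<^esub> f (U, []) (A, [a])"
    using Cpq_multilinear(2)[OF f, of "(U, [])" A "[]" a "[]" r] U by (auto simp: small_rules)
qed

lemma C01_I:
  assumes F: "\<And>U. U \<in> Ob \<U> \<Longrightarrow> functor_cochain R (\<F> U) (\<F> U) (\<lambda>A. A) (\<lambda>a. a) (F (U, []))"
  shows "mk_cochain \<U> \<A> 0 1 F \<in> carrier (\<C> 0 1)"
proof (rule Cpq_pointwise_closed, goal_cases)
  case (1 \<sigma> a)
  then obtain U where u: "\<sigma> = (U, [])" "U \<in> Ob \<U>" by (auto simp: \<U>.simplices_small)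
  interpret functor_cochain R "\<F> U" "\<F> U" "\<lambda>A. A" "\<lambda>a. a" "F (U, [])"
    using F u by blast
  show ?case using 1(2) u by (auto simp: small_rules val_carrier eta_type)
next
  case (2 \<sigma> A xs b ys b')
  then obtain U where u: "\<sigma> = (U, [])" "U \<in> Ob \<U>" by (auto simp: \<U>.simplices_small)
  interpret functor_cochain R "\<F> U" "\<F> U" "\<lambda>A. A" "\<lambda>a. a" "F (U, [])"
    using F u by blast
  show ?case using 2(2,3) u by (cases xs) (auto simp: small_rules eta_type eta_add)
next
  case (3 \<sigma> A xs b ys r)
  then obtain U where u: "\<sigma> = (U, [])" "U \<in> Ob \<U>" by (auto simp: \<U>.simplices_small)
  interpret functor_cochain R "\<F> U" "\<F> U" "\<lambda>A. A" "\<lambda>a. a" "F (U, [])"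
    using F u by blast
  show ?case using 3(2,3) u by (cases xs) (auto simp: small_rules eta_type eta_smult)
qed

lemma C20_type:
  assumes "c \<in> carrier (\<C> 2 0)" "u \<in> Ar \<U>" "v \<in> Ar \<U>" "Dom \<U> v = Cod \<U> u"
    "A \<in> Ob (\<F> (Cod \<U> v))" "Dom \<U> u = V"
  shows "c (V, [u, v]) (A, []) \<in> Ar (\<F> V)"
    "Dom (\<F> V) (c (V, [u, v]) (A, [])) = res_ob \<A> u (res_ob \<A> v A)"
    "Cod (\<F> V) (c (V, [u, v]) (A, [])) = res_ob \<A> (v \<bullet>\<^bsub>\<U>\<^esub> u) A"
  using Cpq_vals[OF assms(1), of "(V, [u, v])" "(A, [])"] assms(2-)
  by (auto simp: small_rules val_carrier)

lemma C20_I: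
  assumes "\<And>u v A. \<lbrakk>u \<in> Ar \<U>; v \<in> Ar \<U>; Dom \<U> v = Cod \<U> u; A \<in> Ob (\<F> (Cod \<U> v))\<rbrakk> \<Longrightarrow>
    F (Dom \<U> u, [u, v]) (A, []) \<in> Homs (\<F> (Dom \<U> u)) (res_ob \<A> u (res_ob \<A> v A)) (res_ob \<A> (v \<bullet>\<^bsub>\<U>\<^esub> u) A)"
  shows "mk_cochain \<U> \<A> 2 0 F \<in> carrier (\<C> 2 0)"
proof (rule Cpq_pointwise_closed, goal_cases)
  case (1 \<sigma> a)
  then show ?case using assms by (auto simp: small_rules val_carrier)
qed (auto simp: rsimplices_def)

lemma C10_type:
  assumes "c \<in> carrier (\<C> 1 0)" "u \<in> Ar \<U>" "A \<in> Ob (\<F> (Cod \<U> u))" "Dom \<U> u = V"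
  shows "c (V, [u]) (A, []) \<in> Ar (\<F> V)"
    "Dom (\<F> V) (c (V, [u]) (A, [])) = res_ob \<A> u A"
    "Cod (\<F> V) (c (V, [u]) (A, [])) = res_ob \<A> u A"
  using Cpq_vals[OF assms(1), of "(V, [u])" "(A, [])"] assms(2-)
  by (auto simp: small_rules val_carrier)

lemma C10_I:
  assumes "\<And>u A. \<lbrakk>u \<in> Ar \<U>; A \<in> Ob (\<F> (Cod \<U> u))\<rbrakk> \<Longrightarrow>
    F (Dom \<U> u, [u]) (A, []) \<in> Homs (\<F> (Dom \<U> u)) (res_ob \<A> u A) (res_ob \<A> u A)"
  shows "mk_cochain \<U> \<A> 1 0 F \<in> carrier (\<C> 1 0)"
proof (rule Cpq_pointwise_closed, goal_cases)
  case (1 \<sigma> a)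
  then show ?case using assms by (auto simp: small_rules val_carrier)
qed (auto simp: rsimplices_def)

lemmas C02_type = hoch_cochain.mu_type[OF C02_hoch]
lemmas C11_type = functor_cochain.eta_type[OF C11_functor]
lemmas C01_type = functor_cochain.eta_type[OF C01_functor]

end

section \<open>The differential in degrees one and two\<close>

text \<open>
  The value of the differential at a simplex, before it is cut down to an extensional function.
\<close>

definition gs_val ::
  "('uo, 'ua) cat \<Rightarrow> ('k, 'uo, 'ua, 'o, 'm) prestack \<Rightarrow> nat \<Rightarrow>
   (nat \<Rightarrow> ('uo, 'ua, 'o, 'm) cochain) \<Rightarrow> nat \<Rightarrow> ('uo, 'ua, 'o, 'm) cochain" where
  "gs_val \<U> \<A> n x s \<sigma> a =
     (\<Oplus>\<^bsub>val_mod \<U> \<A> \<sigma> a\<^esub>p \<in> {p. p \<le> n \<and> p \<le> s}. d_comp \<U> \<A> p (n - p) (s - p) (x p) \<sigma> a)"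

lemma gs_d_eq: "gs_d \<U> \<A> n x = (\<lambda>s \<in> {..n + 1}. mk_cochain \<U> \<A> s (n + 1 - s) (gs_val \<U> \<A> n x s))"
  by (simp add: gs_d_def gs_val_def[abs_def])

lemma gs_sets:
  "{p. p \<le> 1 \<and> p \<le> 0} = {0::nat}" "{p. p \<le> 1 \<and> p \<le> 1} = {0::nat, 1}" "{p. p \<le> 1 \<and> p \<le> 2} = {0::nat, 1}"
  "{p. p \<le> 2 \<and> p \<le> 0} = {0::nat}" "{p. p \<le> 2 \<and> p \<le> 1} = {0::nat, 1}"
  "{p. p \<le> 2 \<and> p \<le> 2} = {0::nat, 1, 2}" "{p. p \<le> 2 \<and> p \<le> 3} = {0::nat, 1, 2}"
  by auto

lemma interval_sets: "{Suc 0..2} = {1::nat, 2}" "{Suc 0..Suc (Suc 0)} = {1::nat, 2}"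
  by auto

lemma id_neq_transpose: "id \<noteq> Transposition.transpose (Suc 0) 2"
  by (metis id_apply n_not_Suc_n numeral_2_eq_2 transpose_apply_first)

lemma vertex_1 [simp]:
  "vertex C (U, u # us) (Suc 0) = Cod C u" "vertex C (U, u # v # us) 2 = Cod C v"
  by (simp_all add: vertex_def)

lemmas d_defs = d_comp_def d_zero_def d_simp_def d_higher_def Let_def contract_def face_def
  eps_def twist_at_def Rpart_def Lpart_def path_sign_def interval_sets numeral_3_eq_3
  path_choices_small[unfolded One_nat_def numeral_3_eq_3]
  shuffles_set_small[unfolded One_nat_def] shuffles_set_small(2)[unfolded numeral_2_eq_2]
  shuffle_simplex_small[unfolded One_nat_def] id_neq_transpose sign_swap_id

context prestack begin

text \<open>
  The names of the following lemmas list \<open>p\<close>, \<open>q\<close> and \<open>j\<close>: each evaluates the component \<open>d\<^sub>j\<close> from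
  bidegree \<open>(p, q)\<close> to \<open>(p + j, q + 1 - j)\<close>, with its terms collected by sign. The paths and shuffles
  appear for \<open>j \<ge> 2\<close>: the path of two arrows is the twist, the two shuffles of an arrow with a twist
  are the two sides of the naturality square, and the two paths of three arrows are the two sides of
  the coherence square.
\<close>

lemma d_comp_010:
  assumes x: "g \<in> carrier (\<C> 0 1)"
    and "U \<in> Ob \<U>" "a \<in> Ar (\<F> U)" "b \<in> Ar (\<F> U)" "Dom (\<F> U) b = Cod (\<F> U) a" "Dom (\<F> U) a = A"
      "Cod (\<F> U) b = D"
  shows "d_comp \<U> \<A> 0 1 0 g (U, []) (A, [b, a]) =
    hdif (\<F> U) A D
      ((b \<bullet>\<^bsub>\<F> U\<^esub> g (U, []) (A, [a])) \<oplus>\<^bsub>\<H> U A D\<^esub> (g (U, []) (Cod (\<F> U) a, [b]) \<bullet>\<^bsub>\<F> U\<^esub> a))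
      (g (U, []) (A, [(b \<bullet>\<^bsub>\<F> U\<^esub> a)]))"
  using assms(2-)
  by (auto simp: d_defs small_rules fib_finsum fib_sign fib_hdif C01_type[OF x, unfolded One_nat_def] fib_ac
      fib_group)

lemma d_comp_020:
  assumes x: "m \<in> carrier (\<C> 0 2)"
    and "U \<in> Ob \<U>" "a \<in> Ar (\<F> U)" "b \<in> Ar (\<F> U)" "Dom (\<F> U) b = Cod (\<F> U) a" "Dom (\<F> U) a = A"
      "h \<in> Ar (\<F> U)" "Dom (\<F> U) h = Cod (\<F> U) b" "Cod (\<F> U) h = D"
  shows "d_comp \<U> \<A> 0 2 0 m (U, []) (A, [h, b, a]) =
    hdif (\<F> U) A D
      ((h \<bullet>\<^bsub>\<F> U\<^esub> m (U, []) (A, [b, a])) \<oplus>\<^bsub>\<H> U A D\<^esub> m (U, []) (A, [h, (b \<bullet>\<^bsub>\<F> U\<^esub> a)]))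
      (m (U, []) (A, [(h \<bullet>\<^bsub>\<F> U\<^esub> b), a]) \<oplus>\<^bsub>\<H> U A D\<^esub> (m (U, []) (Cod (\<F> U) a, [h, b]) \<bullet>\<^bsub>\<F> U\<^esub> a))"
  using assms(2-)
  by (auto simp: d_defs small_rules fib_finsum fib_sign fib_hdif C02_type[OF x, unfolded One_nat_def] fib_ac
      fib_group)

lemma d_comp_011:
  assumes x: "g \<in> carrier (\<C> 0 1)"
    and "u \<in> Ar \<U>" "Dom \<U> u = V" "a \<in> Ar (\<F> (Cod \<U> u))" "Dom (\<F> (Cod \<U> u)) a = A"
      "Cod (\<F> (Cod \<U> u)) a = B"
  shows "d_comp \<U> \<A> 0 1 1 g (V, [u]) (A, [a]) =
    hdif (\<F> V) (res_ob \<A> u A) (res_ob \<A> u B)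
      (res_mor \<A> u (g ((Cod \<U> u), []) (A, [a])))
      (g (V, []) (res_ob \<A> u A, [res_mor \<A> u a]))"
  using assms(2-)
  by (auto simp: d_defs small_rules fib_finsum fib_sign fib_hdif C01_type[OF x, unfolded One_nat_def] fib_ac
      fib_group)

lemma d_comp_100:
  assumes x: "t \<in> carrier (\<C> 1 0)"
    and "u \<in> Ar \<U>" "Dom \<U> u = V" "a \<in> Ar (\<F> (Cod \<U> u))" "Dom (\<F> (Cod \<U> u)) a = A"
      "Cod (\<F> (Cod \<U> u)) a = B"
  shows "d_comp \<U> \<A> 1 0 0 t (V, [u]) (A, [a]) =
    hdif (\<F> V) (res_ob \<A> u A) (res_ob \<A> u B)
      (res_mor \<A> u a \<bullet>\<^bsub>\<F> V\<^esub> t (V, [u]) (A, []))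
      (t (V, [u]) (B, []) \<bullet>\<^bsub>\<F> V\<^esub> res_mor \<A> u a)"
  using assms(2-)
  by (auto simp: d_defs small_rules fib_finsum fib_sign fib_hdif C10_type[OF x, unfolded One_nat_def] fib_ac
      fib_group)

lemma d_comp_021:
  assumes x: "m \<in> carrier (\<C> 0 2)"
    and "u \<in> Ar \<U>" "Dom \<U> u = V" "a \<in> Ar (\<F> (Cod \<U> u))" "Dom (\<F> (Cod \<U> u)) a = A"
      "b \<in> Ar (\<F> (Cod \<U> u))" "Dom (\<F> (Cod \<U> u)) b = Cod (\<F> (Cod \<U> u)) a" "Cod (\<F> (Cod \<U> u)) b = D"
  shows "d_comp \<U> \<A> 0 2 1 m (V, [u]) (A, [b, a]) =
    hdif (\<F> V) (res_ob \<A> u A) (res_ob \<A> u D)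
      (m (V, []) (res_ob \<A> u A, [res_mor \<A> u b, res_mor \<A> u a]))
      (res_mor \<A> u (m ((Cod \<U> u), []) (A, [b, a])))"
  using assms(2-)
  by (auto simp: d_defs small_rules fib_finsum fib_sign fib_hdif C02_type[OF x, unfolded One_nat_def] fib_ac
      fib_group)

lemma d_comp_110:
  assumes x: "f \<in> carrier (\<C> 1 1)"
    and "u \<in> Ar \<U>" "Dom \<U> u = V" "a \<in> Ar (\<F> (Cod \<U> u))" "Dom (\<F> (Cod \<U> u)) a = A"
      "b \<in> Ar (\<F> (Cod \<U> u))" "Dom (\<F> (Cod \<U> u)) b = Cod (\<F> (Cod \<U> u)) a" "Cod (\<F> (Cod \<U> u)) b = D"
  shows "d_comp \<U> \<A> 1 1 0 f (V, [u]) (A, [b, a]) =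
    hdif (\<F> V) (res_ob \<A> u A) (res_ob \<A> u D)
      ((res_mor \<A> u b \<bullet>\<^bsub>\<F> V\<^esub> f (V, [u]) (A, [a])) \<oplus>\<^bsub>\<H> V (res_ob \<A> u A) (res_ob \<A> u D)\<^esub> (f (V, [u]) (Cod (\<F>
          (Cod \<U> u)) a, [b]) \<bullet>\<^bsub>\<F> V\<^esub> res_mor \<A> u a))
      (f (V, [u]) (A, [(b \<bullet>\<^bsub>\<F> (Cod \<U> u)\<^esub> a)]))"
  using assms(2-)
  by (auto simp: d_defs small_rules fib_finsum fib_sign fib_hdif C11_type[OF x, unfolded One_nat_def] fib_ac
      fib_group)

lemma d_comp_012:
  assumes x: "g \<in> carrier (\<C> 0 1)"
    and "u \<in> Ar \<U>" "v \<in> Ar \<U>" "Dom \<U> v = Cod \<U> u" "Dom \<U> u = V" "A \<in> Ob (\<F> (Cod \<U> v))"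
  shows "d_comp \<U> \<A> 0 1 2 g (V, [u, v]) (A, []) =
    hdif (\<F> V) (res_ob \<A> u (res_ob \<A> v A)) (res_ob \<A> (v \<bullet>\<^bsub>\<U>\<^esub> u) A)
      (\<zero>\<^bsub>\<H> V (res_ob \<A> u (res_ob \<A> v A)) (res_ob \<A> (v \<bullet>\<^bsub>\<U>\<^esub> u) A)\<^esub>)
      (g (V, []) ((res_ob \<A> u (res_ob \<A> v A)), [twist \<A> v u A]))"
  using assms(2-)
  by (auto simp: d_defs small_rules fib_finsum fib_sign fib_hdif C01_type[OF x, unfolded One_nat_def] fib_ac
      fib_group)

lemma d_comp_101:
  assumes x: "t \<in> carrier (\<C> 1 0)"
    and "u \<in> Ar \<U>" "v \<in> Ar \<U>" "Dom \<U> v = Cod \<U> u" "Dom \<U> u = V" "A \<in> Ob (\<F> (Cod \<U> v))"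
  shows "d_comp \<U> \<A> 1 0 1 t (V, [u, v]) (A, []) =
    hdif (\<F> V) (res_ob \<A> u (res_ob \<A> v A)) (res_ob \<A> (v \<bullet>\<^bsub>\<U>\<^esub> u) A)
      ((twist \<A> v u A \<bullet>\<^bsub>\<F> V\<^esub> res_mor \<A> u (t (Cod \<U> u, [v]) (A, [])))
          \<oplus>\<^bsub>\<H> V (res_ob \<A> u (res_ob \<A> v A)) (res_ob \<A> (v \<bullet>\<^bsub>\<U>\<^esub> u) A)\<^esub> (twist \<A> v u A \<bullet>\<^bsub>\<F> V\<^esub> t (V, [u])
              (res_ob \<A> v A, [])))
      (t (V, [(v \<bullet>\<^bsub>\<U>\<^esub> u)]) (A, []) \<bullet>\<^bsub>\<F> V\<^esub> twist \<A> v u A)"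
  using assms(2-)
  by (auto simp: d_defs small_rules fib_finsum fib_sign fib_hdif C10_type[OF x, unfolded One_nat_def] fib_ac
      fib_group)

lemma d_comp_022:
  assumes x: "m \<in> carrier (\<C> 0 2)"
    and "u \<in> Ar \<U>" "v \<in> Ar \<U>" "Dom \<U> v = Cod \<U> u" "Dom \<U> u = V" "a \<in> Ar (\<F> (Cod \<U> v))"
      "Dom (\<F> (Cod \<U> v)) a = A" "Cod (\<F> (Cod \<U> v)) a = B"
  shows "d_comp \<U> \<A> 0 2 2 m (V, [u, v]) (A, [a]) =
    hdif (\<F> V) (res_ob \<A> u (res_ob \<A> v A)) (res_ob \<A> (v \<bullet>\<^bsub>\<U>\<^esub> u) B)
      (m (V, []) ((res_ob \<A> u (res_ob \<A> v A)), [res_mor \<A> (v \<bullet>\<^bsub>\<U>\<^esub> u) a, twist \<A> v u A]))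
      (m (V, []) ((res_ob \<A> u (res_ob \<A> v A)), [twist \<A> v u B, res_mor \<A> u (res_mor \<A> v a)]))"
  using assms(2-)
  by (auto simp: d_defs small_rules fib_finsum fib_sign fib_hdif C02_type[OF x, unfolded One_nat_def] fib_ac
      fib_group)

lemma d_comp_111:
  assumes x: "f \<in> carrier (\<C> 1 1)"
    and "u \<in> Ar \<U>" "v \<in> Ar \<U>" "Dom \<U> v = Cod \<U> u" "Dom \<U> u = V" "a \<in> Ar (\<F> (Cod \<U> v))"
      "Dom (\<F> (Cod \<U> v)) a = A" "Cod (\<F> (Cod \<U> v)) a = B"
  shows "d_comp \<U> \<A> 1 1 1 f (V, [u, v]) (A, [a]) =
    hdif (\<F> V) (res_ob \<A> u (res_ob \<A> v A)) (res_ob \<A> (v \<bullet>\<^bsub>\<U>\<^esub> u) B)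
      (f (V, [(v \<bullet>\<^bsub>\<U>\<^esub> u)]) (A, [a]) \<bullet>\<^bsub>\<F> V\<^esub> twist \<A> v u A)
      ((twist \<A> v u B \<bullet>\<^bsub>\<F> V\<^esub> res_mor \<A> u (f (Cod \<U> u, [v]) (A, [a])))
          \<oplus>\<^bsub>\<H> V (res_ob \<A> u (res_ob \<A> v A)) (res_ob \<A> (v \<bullet>\<^bsub>\<U>\<^esub> u) B)\<^esub> (twist \<A> v u B \<bullet>\<^bsub>\<F> V\<^esub> f (V, [u])
              (res_ob \<A> v A, [res_mor \<A> v a])))"
  using assms(2-)
  by (auto simp: d_defs small_rules fib_finsum fib_sign fib_hdif C11_type[OF x, unfolded One_nat_def] fib_ac
      fib_group)

lemma d_comp_200:
  assumes x: "c \<in> carrier (\<C> 2 0)"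
    and "u \<in> Ar \<U>" "v \<in> Ar \<U>" "Dom \<U> v = Cod \<U> u" "Dom \<U> u = V" "a \<in> Ar (\<F> (Cod \<U> v))"
      "Dom (\<F> (Cod \<U> v)) a = A" "Cod (\<F> (Cod \<U> v)) a = B"
  shows "d_comp \<U> \<A> 2 0 0 c (V, [u, v]) (A, [a]) =
    hdif (\<F> V) (res_ob \<A> u (res_ob \<A> v A)) (res_ob \<A> (v \<bullet>\<^bsub>\<U>\<^esub> u) B)
      (res_mor \<A> (v \<bullet>\<^bsub>\<U>\<^esub> u) a \<bullet>\<^bsub>\<F> V\<^esub> c (V, [u, v]) (A, []))
      (c (V, [u, v]) (B, []) \<bullet>\<^bsub>\<F> V\<^esub> res_mor \<A> u (res_mor \<A> v a))"
  using assms(2-)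
  by (auto simp: d_defs small_rules fib_finsum fib_sign fib_hdif C20_type[OF x, unfolded One_nat_def] fib_ac
      fib_group)

lemma d_comp_023:
  assumes x: "m \<in> carrier (\<C> 0 2)"
    and "u \<in> Ar \<U>" "v \<in> Ar \<U>" "w \<in> Ar \<U>" "Dom \<U> v = Cod \<U> u" "Dom \<U> w = Cod \<U> v" "Dom \<U> u = V"
      "A \<in> Ob (\<F> (Cod \<U> w))"
  shows "d_comp \<U> \<A> 0 2 3 m (V, [u, v, w]) (A, []) =
    hdif (\<F> V) (res_ob \<A> u (res_ob \<A> v (res_ob \<A> w A))) (res_ob \<A> (w \<bullet>\<^bsub>\<U>\<^esub> (v \<bullet>\<^bsub>\<U>\<^esub> u)) A)
      (m (V, []) ((res_ob \<A> u (res_ob \<A> v (res_ob \<A> w A))), [twist \<A> w (v \<bullet>\<^bsub>\<U>\<^esub> u) A, twist \<A> v u (res_ob \<A> w A)]))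
      (m (V, []) ((res_ob \<A> u (res_ob \<A> v (res_ob \<A> w A))), [twist \<A> (w \<bullet>\<^bsub>\<U>\<^esub> v) u A, res_mor \<A> u (twist \<A> w v A)]))"
  using assms(2-)
  by (auto simp: d_defs small_rules fib_finsum fib_sign fib_hdif C02_type[OF x, unfolded One_nat_def] fib_ac
      fib_group)

lemma d_comp_112:
  assumes x: "f \<in> carrier (\<C> 1 1)"
    and "u \<in> Ar \<U>" "v \<in> Ar \<U>" "w \<in> Ar \<U>" "Dom \<U> v = Cod \<U> u" "Dom \<U> w = Cod \<U> v" "Dom \<U> u = V"
      "A \<in> Ob (\<F> (Cod \<U> w))"
  shows "d_comp \<U> \<A> 1 1 2 f (V, [u, v, w]) (A, []) =
    hdif (\<F> V) (res_ob \<A> u (res_ob \<A> v (res_ob \<A> w A))) (res_ob \<A> (w \<bullet>\<^bsub>\<U>\<^esub> (v \<bullet>\<^bsub>\<U>\<^esub> u)) A)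
      (\<zero>\<^bsub>\<H> V (res_ob \<A> u (res_ob \<A> v (res_ob \<A> w A))) (res_ob \<A> (w \<bullet>\<^bsub>\<U>\<^esub> (v \<bullet>\<^bsub>\<U>\<^esub> u)) A)\<^esub>)
      (twist \<A> (w \<bullet>\<^bsub>\<U>\<^esub> v) u A \<bullet>\<^bsub>\<F> V\<^esub> f (V, [u]) (res_ob \<A> v (res_ob \<A> w A), [twist \<A> w v A]))"
  using assms(2-)
  by (auto simp: d_defs small_rules fib_finsum fib_sign fib_hdif C11_type[OF x, unfolded One_nat_def] fib_ac
      fib_group)

lemma d_comp_201:
  assumes x: "c \<in> carrier (\<C> 2 0)"
    and "u \<in> Ar \<U>" "v \<in> Ar \<U>" "w \<in> Ar \<U>" "Dom \<U> v = Cod \<U> u" "Dom \<U> w = Cod \<U> v" "Dom \<U> u = V"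
      "A \<in> Ob (\<F> (Cod \<U> w))"
  shows "d_comp \<U> \<A> 2 0 1 c (V, [u, v, w]) (A, []) =
    hdif (\<F> V) (res_ob \<A> u (res_ob \<A> v (res_ob \<A> w A))) (res_ob \<A> (w \<bullet>\<^bsub>\<U>\<^esub> (v \<bullet>\<^bsub>\<U>\<^esub> u)) A)
      ((c (V, [(v \<bullet>\<^bsub>\<U>\<^esub> u), w]) (A, []) \<bullet>\<^bsub>\<F> V\<^esub> twist \<A> v u (res_ob \<A> w A))
          \<oplus>\<^bsub>\<H> V (res_ob \<A> u (res_ob \<A> v (res_ob \<A> w A))) (res_ob \<A> (w \<bullet>\<^bsub>\<U>\<^esub> (v \<bullet>\<^bsub>\<U>\<^esub> u)) A)\<^esub> (twist \<A> w (v
              \<bullet>\<^bsub>\<U>\<^esub> u) A \<bullet>\<^bsub>\<F> V\<^esub> c (V, [u, v]) (res_ob \<A> w A, [])))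
      ((twist \<A> (w \<bullet>\<^bsub>\<U>\<^esub> v) u A \<bullet>\<^bsub>\<F> V\<^esub> res_mor \<A> u (c (Cod \<U> u, [v, w]) (A, [])))
          \<oplus>\<^bsub>\<H> V (res_ob \<A> u (res_ob \<A> v (res_ob \<A> w A))) (res_ob \<A> (w \<bullet>\<^bsub>\<U>\<^esub> (v \<bullet>\<^bsub>\<U>\<^esub> u)) A)\<^esub> (c (V, [u, (w
              \<bullet>\<^bsub>\<U>\<^esub> v)]) (A, []) \<bullet>\<^bsub>\<F> V\<^esub> res_mor \<A> u (twist \<A> w v A)))"
  using assms(2-)
  by (auto simp: d_defs small_rules fib_finsum fib_sign fib_hdif C20_type[OF x, unfolded One_nat_def] fib_ac
      fib_group)

lemmas comp_rules = d_comp_010 d_comp_020 d_comp_011 d_comp_100 d_comp_021 d_comp_110 d_comp_012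
  d_comp_101 d_comp_022 d_comp_111 d_comp_200 d_comp_023 d_comp_112 d_comp_201

text \<open>
  In short, the components of \<open>d (g, t)\<close> are \<open>b g(a) + g(b) a - g(b a)\<close>, then
  \<open>u\<^sup>* g(a) + u\<^sup>* a t - g(u\<^sup>* a) - t u\<^sup>* a\<close> and \<open>c u\<^sup>* t\<^sup>v + c t\<^sup>u - t\<^bsup>vu\<^esup> c - g(c)\<close> with \<open>c = c\<^bsup>v,u\<^esup>\<close>.
\<close>

lemma gs_val_1_0:
  assumes x: "x 0 \<in> carrier (\<C> 0 1)" "x 1 \<in> carrier (\<C> 1 0)"
    and "U \<in> Ob \<U>" "a \<in> Ar (\<F> U)" "b \<in> Ar (\<F> U)" "Dom (\<F> U) b = Cod (\<F> U) a"
    "Dom (\<F> U) a = A" "Cod (\<F> U) b = D"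
  shows "gs_val \<U> \<A> 1 x 0 (U, []) (A, [b, a]) =
    hdif (\<F> U) A D
      (b \<bullet>\<^bsub>\<F> U\<^esub> x 0 (U, []) (A, [a]) \<oplus>\<^bsub>\<H> U A D\<^esub> x 0 (U, []) (Cod (\<F> U) a, [b]) \<bullet>\<^bsub>\<F> U\<^esub> a)
      (x 0 (U, []) (A, [b \<bullet>\<^bsub>\<F> U\<^esub> a]))"
  unfolding gs_val_def gs_sets using assms(3-)
  by (auto simp: comp_rules[unfolded One_nat_def] x[unfolded One_nat_def] small_rules fib_finsum fib_hdif
      C01_type[OF x(1)])

lemma gs_val_1_1:
  assumes x: "x 0 \<in> carrier (\<C> 0 1)" "x 1 \<in> carrier (\<C> 1 0)"
    and "u \<in> Ar \<U>" "Dom \<U> u = V" "a \<in> Ar (\<F> (Cod \<U> u))" 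
    "Dom (\<F> (Cod \<U> u)) a = A" "Cod (\<F> (Cod \<U> u)) a = B"
  shows "gs_val \<U> \<A> 1 x 1 (V, [u]) (A, [a]) =
    hdif (\<F> V) (res_ob \<A> u A) (res_ob \<A> u B)
      (res_mor \<A> u (x 0 (Cod \<U> u, []) (A, [a])) \<oplus>\<^bsub>\<H> V (res_ob \<A> u A) (res_ob \<A> u B)\<^esub>
        (res_mor \<A> u a \<bullet>\<^bsub>\<F> V\<^esub> x 1 (V, [u]) (A, [])))
      (x 0 (V, []) (res_ob \<A> u A, [res_mor \<A> u a]) \<oplus>\<^bsub>\<H> V (res_ob \<A> u A) (res_ob \<A> u B)\<^esub>
        (x 1 (V, [u]) (B, []) \<bullet>\<^bsub>\<F> V\<^esub> res_mor \<A> u a))"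
  unfolding gs_val_def gs_sets using assms(3-)
  by (auto simp: comp_rules[unfolded One_nat_def] x[unfolded One_nat_def] small_rules fib_finsum fib_hdif
      C01_type[OF x(1)] C10_type[OF x(2), unfolded One_nat_def])

lemma gs_val_1_2:
  assumes x: "x 0 \<in> carrier (\<C> 0 1)" "x 1 \<in> carrier (\<C> 1 0)"
    and "u \<in> Ar \<U>" "v \<in> Ar \<U>" "Dom \<U> v = Cod \<U> u" "Dom \<U> u = V" "A \<in> Ob (\<F> (Cod \<U> v))"
  shows "gs_val \<U> \<A> 1 x 2 (V, [u, v]) (A, []) =
    hdif (\<F> V) (res_ob \<A> u (res_ob \<A> v A)) (res_ob \<A> (v \<bullet>\<^bsub>\<U>\<^esub> u) A)
      (twist \<A> v u A \<bullet>\<^bsub>\<F> V\<^esub> res_mor \<A> u (x 1 (Cod \<U> u, [v]) (A, []))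
       \<oplus>\<^bsub>\<H> V (res_ob \<A> u (res_ob \<A> v A)) (res_ob \<A> (v \<bullet>\<^bsub>\<U>\<^esub> u) A)\<^esub>
        (twist \<A> v u A \<bullet>\<^bsub>\<F> V\<^esub> x 1 (V, [u]) (res_ob \<A> v A, [])))
      (x 1 (V, [v \<bullet>\<^bsub>\<U>\<^esub> u]) (A, []) \<bullet>\<^bsub>\<F> V\<^esub> twist \<A> v u A
       \<oplus>\<^bsub>\<H> V (res_ob \<A> u (res_ob \<A> v A)) (res_ob \<A> (v \<bullet>\<^bsub>\<U>\<^esub> u) A)\<^esub>
        x 0 (V, []) (res_ob \<A> u (res_ob \<A> v A), [twist \<A> v u A]))"
  unfolding gs_val_def gs_sets using assms(3-)
  by (auto simp: comp_rules[unfolded One_nat_def] x[unfolded One_nat_def] small_rules fib_finsum fib_hdif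
      C01_type[OF x(1)] C10_type[OF x(2), unfolded One_nat_def] fib_ac fib_group)

text \<open>
  The differential of a two-cochain \<open>(m, f, c)\<close> at simplices with \<open>0\<close>, \<open>1\<close>, \<open>2\<close> and \<open>3\<close> arrows in
  the base. Minuend and subtrahend are the two sides of the \<open>\<epsilon>\<close>-coefficient of associativity,
  functoriality, naturality of the twist and its coherence.
\<close>

lemma gs_val_2_0:
  assumes x: "x 0 \<in> carrier (\<C> 0 2)" "x 1 \<in> carrier (\<C> 1 1)" "x 2 \<in> carrier (\<C> 2 0)"
    and "U \<in> Ob \<U>" "a \<in> Ar (\<F> U)" "b \<in> Ar (\<F> U)" "Dom (\<F> U) b = Cod (\<F> U) a"
    "Dom (\<F> U) a = A" "h \<in> Ar (\<F> U)" "Dom (\<F> U) h = Cod (\<F> U) b" "Cod (\<F> U) h = D"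
  shows "gs_val \<U> \<A> 2 x 0 (U, []) (A, [h, b, a]) = hdif (\<F> U) A D
    ((h \<bullet>\<^bsub>\<F> U\<^esub> x 0 (U, []) (A, [b, a])) \<oplus>\<^bsub>\<H> U A D\<^esub> x 0 (U, []) (A, [h, b \<bullet>\<^bsub>\<F> U\<^esub> a]))
    (x 0 (U, []) (A, [h \<bullet>\<^bsub>\<F> U\<^esub> b, a])
         \<oplus>\<^bsub>\<H> U A D\<^esub> (x 0 (U, []) (Cod (\<F> U) a, [h, b]) \<bullet>\<^bsub>\<F> U\<^esub> a))"
  unfolding gs_val_def gs_sets using assms(4-)
  by (auto simp: comp_rules[unfolded One_nat_def] x[unfolded One_nat_def] small_rules fib_finsum fib_hdif
      C02_type[OF x(1)]
     fib_group)

lemma gs_val_2_1: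
  assumes x: "x 0 \<in> carrier (\<C> 0 2)" "x 1 \<in> carrier (\<C> 1 1)" "x 2 \<in> carrier (\<C> 2 0)"
    and "u \<in> Ar \<U>" "Dom \<U> u = V" "a \<in> Ar (\<F> (Cod \<U> u))" "Dom (\<F> (Cod \<U> u)) a = A"
    "b \<in> Ar (\<F> (Cod \<U> u))" "Dom (\<F> (Cod \<U> u)) b = Cod (\<F> (Cod \<U> u)) a" 
    "Cod (\<F> (Cod \<U> u)) b = B"
  shows "gs_val \<U> \<A> 2 x 1 (V, [u]) (A, [b, a]) = hdif (\<F> V) (res_ob \<A> u A) (res_ob \<A> u B)
    ((res_mor \<A> u b \<bullet>\<^bsub>\<F> V\<^esub> x 1 (V, [u]) (A, [a]))
        \<oplus>\<^bsub>\<H> V (res_ob \<A> u A) (res_ob \<A> u B)\<^esub>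
       ((x 1 (V, [u]) (Dom (\<F> (Cod \<U> u)) b, [b]) \<bullet>\<^bsub>\<F> V\<^esub> res_mor \<A> u a)
        \<oplus>\<^bsub>\<H> V (res_ob \<A> u A) (res_ob \<A> u B)\<^esub>
         x 0 (V, []) (res_ob \<A> u A, [res_mor \<A> u b, res_mor \<A> u a])))
    (x 1 (V, [u]) (A, [b \<bullet>\<^bsub>\<F> (Cod \<U> u)\<^esub> a]) \<oplus>\<^bsub>\<H> V (res_ob \<A> u A) (res_ob \<A> u B)\<^esub>
        res_mor \<A> u (x 0 (Cod \<U> u, []) (A, [b, a])))"
  unfolding gs_val_def gs_sets using assms(4-)
  by (auto simp: comp_rules[unfolded One_nat_def] x[unfolded One_nat_def] small_rules fib_finsum fib_hdif
      C02_type[OF x(1)]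
     C11_type[OF x(2), unfolded One_nat_def] fib_group fib_ac)

lemma gs_val_2_2:
  assumes x: "x 0 \<in> carrier (\<C> 0 2)" "x 1 \<in> carrier (\<C> 1 1)" "x 2 \<in> carrier (\<C> 2 0)"
    and "u \<in> Ar \<U>" "v \<in> Ar \<U>" "Dom \<U> v = Cod \<U> u" "Dom \<U> u = V"
    "a \<in> Ar (\<F> (Cod \<U> v))" "Dom (\<F> (Cod \<U> v)) a = A" "Cod (\<F> (Cod \<U> v)) a = B"
  defines "M \<equiv> \<H> V (res_ob \<A> u (res_ob \<A> v A)) (res_ob \<A> (v \<bullet>\<^bsub>\<U>\<^esub> u) B)"
  shows "gs_val \<U> \<A> 2 x 2 (V, [u, v]) (A, [a]) = hdif (\<F> V) (res_ob \<A> u (res_ob \<A> v A)) (res_ob \<A> (v \<bullet>\<^bsub>\<U>\<^esub> u) B)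
    ((res_mor \<A> (v \<bullet>\<^bsub>\<U>\<^esub> u) a \<bullet>\<^bsub>\<F> V\<^esub> x 2 (V, [u, v]) (A, [])) \<oplus>\<^bsub>M\<^esub>
      ((x 1 (V, [v \<bullet>\<^bsub>\<U>\<^esub> u]) (A, [a]) \<bullet>\<^bsub>\<F> V\<^esub> twist \<A> v u A) \<oplus>\<^bsub>M\<^esub>
       x 0 (V, []) (res_ob \<A> u (res_ob \<A> v A), [res_mor \<A> (v \<bullet>\<^bsub>\<U>\<^esub> u) a, twist \<A> v u A])))
    ((twist \<A> v u B \<bullet>\<^bsub>\<F> V\<^esub> res_mor \<A> u (x 1 (Cod \<U> u, [v]) (A, [a]))) \<oplus>\<^bsub>M\<^esub>
      ((twist \<A> v u B \<bullet>\<^bsub>\<F> V\<^esub> x 1 (V, [u]) (res_ob \<A> v A, [res_mor \<A> v a])) \<oplus>\<^bsub>M\<^esub>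
       ((x 2 (V, [u, v]) (B, []) \<bullet>\<^bsub>\<F> V\<^esub> res_mor \<A> u (res_mor \<A> v a)) \<oplus>\<^bsub>M\<^esub>
        x 0 (V, []) (res_ob \<A> u (res_ob \<A> v A), [twist \<A> v u B, res_mor \<A> u (res_mor \<A> v a)]))))"
  unfolding gs_val_def gs_sets M_def using assms(4-10)
  by (auto simp: comp_rules[unfolded One_nat_def] x[unfolded One_nat_def] small_rules fib_finsum fib_hdif
      C02_type[OF x(1)]
     C11_type[OF x(2), unfolded One_nat_def] C20_type[OF x(3)] fib_group fib_ac)

lemma gs_val_2_3:
  assumes x: "x 0 \<in> carrier (\<C> 0 2)" "x 1 \<in> carrier (\<C> 1 1)" "x 2 \<in> carrier (\<C> 2 0)"
    and "u \<in> Ar \<U>" "v \<in> Ar \<U>" "w \<in> Ar \<U>" "Dom \<U> v = Cod \<U> u" "Dom \<U> w = Cod \<U> v" "Dom \<U> u = V"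
    "A \<in> Ob (\<F> (Cod \<U> w))"
  defines "S \<equiv> res_ob \<A> u (res_ob \<A> v (res_ob \<A> w A))" and "T \<equiv> res_ob \<A> (w \<bullet>\<^bsub>\<U>\<^esub> (v \<bullet>\<^bsub>\<U>\<^esub> u)) A"
  defines "M \<equiv> \<H> V S T"
  shows "gs_val \<U> \<A> 2 x 3 (V, [u, v, w]) (A, []) = hdif (\<F> V) S T
    (x 0 (V, []) (S, [twist \<A> w (v \<bullet>\<^bsub>\<U>\<^esub> u) A, twist \<A> v u (res_ob \<A> w A)]) \<oplus>\<^bsub>M\<^esub>
      ((x 2 (V, [v \<bullet>\<^bsub>\<U>\<^esub> u, w]) (A, []) \<bullet>\<^bsub>\<F> V\<^esub> twist \<A> v u (res_ob \<A> w A)) \<oplus>\<^bsub>M\<^esub>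
       (twist \<A> w (v \<bullet>\<^bsub>\<U>\<^esub> u) A \<bullet>\<^bsub>\<F> V\<^esub> x 2 (V, [u, v]) (res_ob \<A> w A, []))))
    (x 0 (V, []) (S, [twist \<A> (w \<bullet>\<^bsub>\<U>\<^esub> v) u A, res_mor \<A> u (twist \<A> w v A)]) \<oplus>\<^bsub>M\<^esub>
      ((twist \<A> (w \<bullet>\<^bsub>\<U>\<^esub> v) u A \<bullet>\<^bsub>\<F> V\<^esub> x 1 (V, [u]) (res_ob \<A> v (res_ob \<A> w A), [twist \<A> w v A])) \<oplus>\<^bsub>M\<^esub>
       ((twist \<A> (w \<bullet>\<^bsub>\<U>\<^esub> v) u A \<bullet>\<^bsub>\<F> V\<^esub> res_mor \<A> u (x 2 (Cod \<U> u, [v, w]) (A, []))) \<oplus>\<^bsub>M\<^esub>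
        (x 2 (V, [u, w \<bullet>\<^bsub>\<U>\<^esub> v]) (A, []) \<bullet>\<^bsub>\<F> V\<^esub> res_mor \<A> u (twist \<A> w v A)))))"
  unfolding gs_val_def gs_sets M_def S_def T_def using assms(4-10)
  by (auto simp: comp_rules[unfolded One_nat_def] x[unfolded One_nat_def] small_rules fib_finsum fib_hdif
      C02_type[OF x(1)]
     C11_type[OF x(2), unfolded One_nat_def] C20_type[OF x(3)] fib_group fib_ac)

lemma GS_carrier:
  "x \<in> carrier (\<G> n) \<longleftrightarrow> (\<forall>p \<le> n. x p \<in> carrier (\<C> p (n - p))) \<and> x \<in> extensional {..n}"
  by (auto simp: GS_def PiE_iff)

lemma GS_1_carrier:
  "x \<in> carrier (\<G> 1) \<longleftrightarrow> x 0 \<in> carrier (\<C> 0 1) \<and> x 1 \<in> carrier (\<C> 1 0)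
    \<and> x \<in> extensional {..1}"
  by (auto simp: GS_carrier le_Suc_eq)

lemma GS_2_carrier:
  "x \<in> carrier (\<G> 2) \<longleftrightarrow> x 0 \<in> carrier (\<C> 0 2) \<and> x 1 \<in> carrier (\<C> 1 1)
    \<and> x 2 \<in> carrier (\<C> 2 0) \<and> x \<in> extensional {..2}"
  by (auto simp: GS_carrier le_Suc_eq numeral_2_eq_2)

lemma gs_d_eq_iff:
  assumes w: "w \<in> carrier (\<G> (n + 1))"
  shows "\<delta> n x = w \<longleftrightarrow> (\<forall>s \<le> n + 1. \<forall>\<sigma> \<in> simplices \<U> s.
    \<forall>a \<in> rsimplices (\<T> \<sigma>) (n + 1 - s). gs_val \<U> \<A> n x s \<sigma> a = w s \<sigma> a)"
proof -
  have ws: "w s = mk_cochain \<U> \<A> s (n + 1 - s) (w s)" if "s \<le> n + 1" for s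
    using w that Cpq_carrier GS_carrier by blast
  have ex: "w s = undefined" if "\<not> s \<le> n + 1" for s
    using w that GS_carrier[of w "n + 1"] by (auto simp: extensional_def)
  have "\<delta> n x = w \<longleftrightarrow>
      (\<forall>s \<le> n + 1. mk_cochain \<U> \<A> s (n + 1 - s) (gs_val \<U> \<A> n x s) = w s)"
    unfolding gs_d_eq by (auto simp: fun_eq_iff[of _ w] ex)
  also have "\<dots> \<longleftrightarrow> (\<forall>s \<le> n + 1. mk_cochain \<U> \<A> s (n + 1 - s) (gs_val \<U> \<A> n x s)
       = mk_cochain \<U> \<A> s (n + 1 - s) (w s))"
    using ws by auto
  finally show ?thesis unfolding mk_cochain_eq_iff .
qed

lemmas fib_smult_hdif = linear_category.hsmult_hdif[OF fib]

lemmas C01_linear = functor_cochain.eta_add[OF C01_functor] functor_cochain.eta_smult[OF C01_functor]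

lemma GS_1_D:
  assumes "x \<in> carrier (\<G> 1)"
  shows "x 0 \<in> carrier (\<C> 0 1)" "x 1 \<in> carrier (\<C> 1 0)"
  using assms unfolding GS_1_carrier by auto

lemma GS_2_D:
  assumes "x \<in> carrier (\<G> 2)"
  shows "x 0 \<in> carrier (\<C> 0 2)" "x 1 \<in> carrier (\<C> 1 1)" "x 2 \<in> carrier (\<C> 2 0)"
  using assms unfolding GS_2_carrier by auto

lemma GS_apply:
  assumes "p \<le> n"
  shows "(x \<oplus>\<^bsub>\<G> n\<^esub> y) p = x p \<oplus>\<^bsub>\<C> p (n - p)\<^esub> y p"
    "(r \<odot>\<^bsub>\<G> n\<^esub> x) p = r \<odot>\<^bsub>\<C> p (n - p)\<^esub> x p"
    "\<zero>\<^bsub>\<G> n\<^esub> p = \<zero>\<^bsub>\<C> p (n - p)\<^esub>"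
  using assms by (simp_all add: GS_def)

text \<open>
  In the explicit formulas both sides expand into the same terms, in a different order.
\<close>

lemma gs_val_1_linear:
  assumes "x \<in> carrier (\<G> 1)" "y \<in> carrier (\<G> 1)" "r \<in> carrier R"
    and "s \<le> 2" "\<sigma> \<in> simplices \<U> s" "a \<in> rsimplices (\<T> \<sigma>) (2 - s)"
  shows "gs_val \<U> \<A> 1 (x \<oplus>\<^bsub>\<G> 1\<^esub> y) s \<sigma> a = gs_val \<U> \<A> 1 x s \<sigma> a \<oplus>\<^bsub>\<V> \<sigma> a\<^esub> gs_val \<U> \<A> 1 y s \<sigma> a"
    "gs_val \<U> \<A> 1 (r \<odot>\<^bsub>\<G> 1\<^esub> x) s \<sigma> a = r \<odot>\<^bsub>\<V> \<sigma> a\<^esub> gs_val \<U> \<A> 1 x s \<sigma> a"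
proof -
  interpret G: module R "\<G> 1" by (rule GS_module)
  have c: "x \<oplus>\<^bsub>\<G> 1\<^esub> y \<in> carrier (\<G> 1)" "r \<odot>\<^bsub>\<G> 1\<^esub> x \<in> carrier (\<G> 1)"
    by (rule G.M.a_closed[OF assms(1,2)], rule G.smult_closed[OF assms(3,1)])
  note X = GS_1_D[OF assms(1)]
  note Y = GS_1_D[OF assms(2)]
  note XY = GS_1_D[OF c(1)]
  note rX = GS_1_D[OF c(2)]
  have ap: "(x \<oplus>\<^bsub>\<G> 1\<^esub> y) 0 = x 0 \<oplus>\<^bsub>\<C> 0 1\<^esub> y 0" "(x \<oplus>\<^bsub>\<G> 1\<^esub> y) 1 = x 1 \<oplus>\<^bsub>\<C> 1 0\<^esub> y 1"
    "(r \<odot>\<^bsub>\<G> 1\<^esub> x) 0 = r \<odot>\<^bsub>\<C> 0 1\<^esub> x 0" "(r \<odot>\<^bsub>\<G> 1\<^esub> x) 1 = r \<odot>\<^bsub>\<C> 1 0\<^esub> x 1"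
    by (simp_all add: GS_apply)
  note tys = C01_type[OF X(1)] C10_type[OF X(2), unfolded One_nat_def] C01_type[OF Y(1)] C10_type[OF Y(2),
      unfolded One_nat_def]
  note rules = ap[unfolded One_nat_def] Cpq_sel small_rules fib_hdif fib_dist tys fib_smult_hdif
  consider "s = 0" | "s = 1" | "s = 2" using assms(4) by linarith
  then show "gs_val \<U> \<A> 1 (x \<oplus>\<^bsub>\<G> 1\<^esub> y) s \<sigma> a = gs_val \<U> \<A> 1 x s \<sigma> a \<oplus>\<^bsub>\<V> \<sigma> a\<^esub> gs_val \<U> \<A> 1 y s \<sigma> a"
  proof cases
    case 1
    show ?thesis using assms(5-) unfolding 1
      by (auto simp: small_rules gs_val_1_0[OF X, unfolded One_nat_def] gs_val_1_0[OF Y, unfolded One_nat_def]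
          gs_val_1_0[OF XY, unfolded One_nat_def]) (simp add: rules fib_ac)
  next
    case 2
    show ?thesis using assms(5-) unfolding 2
      by (auto simp: small_rules gs_val_1_1[OF X, unfolded One_nat_def] gs_val_1_1[OF Y, unfolded One_nat_def]
          gs_val_1_1[OF XY, unfolded One_nat_def]) (simp add: rules fib_ac)
  next
    case 3
    show ?thesis using assms(5-) unfolding 3
      by (auto simp: small_rules gs_val_1_2[OF X, unfolded One_nat_def] gs_val_1_2[OF Y, unfolded One_nat_def]
          gs_val_1_2[OF XY, unfolded One_nat_def]) (simp add: rules fib_ac)
  qed
  consider "s = 0" | "s = 1" | "s = 2" using assms(4) by linarith
  then show "gs_val \<U> \<A> 1 (r \<odot>\<^bsub>\<G> 1\<^esub> x) s \<sigma> a = r \<odot>\<^bsub>\<V> \<sigma> a\<^esub> gs_val \<U> \<A> 1 x s \<sigma> a"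
  proof cases
    case 1
    show ?thesis using assms(3,5-) unfolding 1
      by (auto simp: small_rules gs_val_1_0[OF X, unfolded One_nat_def] 
          gs_val_1_0[OF rX, unfolded One_nat_def]) (simp add: rules fib_ac)
  next
    case 2
    show ?thesis using assms(3,5-) unfolding 2
      by (auto simp: small_rules gs_val_1_1[OF X, unfolded One_nat_def] 
          gs_val_1_1[OF rX, unfolded One_nat_def]) (simp add: rules fib_ac)
  next
    case 3
    show ?thesis using assms(3,5-) unfolding 3
      by (auto simp: small_rules gs_val_1_2[OF X, unfolded One_nat_def] 
          gs_val_1_2[OF rX, unfolded One_nat_def]) (simp add: rules fib_ac)
  qed
qed

lemma gs_val_2_linear:
  assumes "x \<in> carrier (\<G> 2)" "y \<in> carrier (\<G> 2)" "r \<in> carrier R"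
    and "s \<le> 3" "\<sigma> \<in> simplices \<U> s" "a \<in> rsimplices (\<T> \<sigma>) (3 - s)"
  shows "gs_val \<U> \<A> 2 (x \<oplus>\<^bsub>\<G> 2\<^esub> y) s \<sigma> a = gs_val \<U> \<A> 2 x s \<sigma> a \<oplus>\<^bsub>\<V> \<sigma> a\<^esub> gs_val \<U> \<A> 2 y s \<sigma> a"
    "gs_val \<U> \<A> 2 (r \<odot>\<^bsub>\<G> 2\<^esub> x) s \<sigma> a = r \<odot>\<^bsub>\<V> \<sigma> a\<^esub> gs_val \<U> \<A> 2 x s \<sigma> a"
proof -
  interpret G: module R "\<G> 2" by (rule GS_module)
  have c: "x \<oplus>\<^bsub>\<G> 2\<^esub> y \<in> carrier (\<G> 2)" "r \<odot>\<^bsub>\<G> 2\<^esub> x \<in> carrier (\<G> 2)"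
    by (rule G.M.a_closed[OF assms(1,2)], rule G.smult_closed[OF assms(3,1)])
  note X = GS_2_D[OF assms(1)]
  note Y = GS_2_D[OF assms(2)]
  note XY = GS_2_D[OF c(1)]
  note rX = GS_2_D[OF c(2)]
  have ap: "(x \<oplus>\<^bsub>\<G> 2\<^esub> y) 0 = x 0 \<oplus>\<^bsub>\<C> 0 2\<^esub> y 0" "(x \<oplus>\<^bsub>\<G> 2\<^esub> y) 1 = x 1 \<oplus>\<^bsub>\<C> 1 1\<^esub> y 1"
    "(x \<oplus>\<^bsub>\<G> 2\<^esub> y) 2 = x 2 \<oplus>\<^bsub>\<C> 2 0\<^esub> y 2"
    "(r \<odot>\<^bsub>\<G> 2\<^esub> x) 0 = r \<odot>\<^bsub>\<C> 0 2\<^esub> x 0" "(r \<odot>\<^bsub>\<G> 2\<^esub> x) 1 = r \<odot>\<^bsub>\<C> 1 1\<^esub> x 1"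
    "(r \<odot>\<^bsub>\<G> 2\<^esub> x) 2 = r \<odot>\<^bsub>\<C> 2 0\<^esub> x 2"
    by (simp_all add: GS_apply)
  note tys = C02_type[OF X(1)] C11_type[OF X(2), unfolded One_nat_def] C20_type[OF X(3)]
    C02_type[OF Y(1)] C11_type[OF Y(2), unfolded One_nat_def] C20_type[OF Y(3)]
  note rules = ap[unfolded One_nat_def] Cpq_sel small_rules fib_hdif fib_dist tys fib_smult_hdif
  consider "s = 0" | "s = 1" | "s = 2" | "s = 3" using assms(4) by linarith
  then show "gs_val \<U> \<A> 2 (x \<oplus>\<^bsub>\<G> 2\<^esub> y) s \<sigma> a = gs_val \<U> \<A> 2 x s \<sigma> a \<oplus>\<^bsub>\<V> \<sigma> a\<^esub> gs_val \<U> \<A> 2 y s \<sigma> a"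
  proof cases
    case 1
    show ?thesis using assms(5-) unfolding 1
      by (auto simp: small_rules gs_val_2_0[OF X, unfolded One_nat_def]
          gs_val_2_0[OF Y, unfolded One_nat_def] gs_val_2_0[OF XY, unfolded One_nat_def]) (simp add: rules fib_ac)
  next
    case 2
    show ?thesis using assms(5-) unfolding 2
      by (auto simp: small_rules gs_val_2_1[OF X, unfolded One_nat_def]
          gs_val_2_1[OF Y, unfolded One_nat_def] gs_val_2_1[OF XY, unfolded One_nat_def]) (simp add: rules fib_ac)
  next
    case 3
    show ?thesis using assms(5-) unfolding 3
      by (auto simp: small_rules gs_val_2_2[OF X, unfolded One_nat_def]
          gs_val_2_2[OF Y, unfolded One_nat_def] gs_val_2_2[OF XY, unfolded One_nat_def]) (simp add: rules fib_ac)
  next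
    case 4
    show ?thesis using assms(5-) unfolding 4
      by (auto simp: small_rules gs_val_2_3[OF X, unfolded One_nat_def]
          gs_val_2_3[OF Y, unfolded One_nat_def] gs_val_2_3[OF XY, unfolded One_nat_def]) (simp add: rules fib_ac)
  qed
  consider "s = 0" | "s = 1" | "s = 2" | "s = 3" using assms(4) by linarith
  then show "gs_val \<U> \<A> 2 (r \<odot>\<^bsub>\<G> 2\<^esub> x) s \<sigma> a = r \<odot>\<^bsub>\<V> \<sigma> a\<^esub> gs_val \<U> \<A> 2 x s \<sigma> a"
  proof cases
    case 1
    show ?thesis using assms(3,5-) unfolding 1
      by (auto simp: small_rules gs_val_2_0[OF X, unfolded One_nat_def]
          gs_val_2_0[OF rX, unfolded One_nat_def]) (simp add: rules fib_ac)
  next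
    case 2
    show ?thesis using assms(3,5-) unfolding 2
      by (auto simp: small_rules gs_val_2_1[OF X, unfolded One_nat_def]
          gs_val_2_1[OF rX, unfolded One_nat_def]) (simp add: rules fib_ac)
  next
    case 3
    show ?thesis using assms(3,5-) unfolding 3
      by (auto simp: small_rules gs_val_2_2[OF X, unfolded One_nat_def]
          gs_val_2_2[OF rX, unfolded One_nat_def]) (simp add: rules fib_ac)
  next
    case 4
    show ?thesis using assms(3,5-) unfolding 4
      by (auto simp: small_rules gs_val_2_3[OF X, unfolded One_nat_def]
          gs_val_2_3[OF rX, unfolded One_nat_def]) (simp add: rules fib_ac)
  qed
qed

section \<open>The square of the differential\<close>

lemma gs_d_1_closed:
  assumes "x \<in> carrier (\<G> 1)"
  shows "\<delta> 1 x \<in> carrier (\<G> 2)"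
proof -
  note X = GS_1_D[OF assms]
  note tys = C01_type[OF X(1)] C10_type[OF X(2), unfolded One_nat_def]
  note lin = C01_linear[OF X(1)]
  have 0: "mk_cochain \<U> \<A> 0 2 (gs_val \<U> \<A> 1 x 0) \<in> carrier (\<C> 0 2)"
  proof (rule C02_I)
    fix U assume U: "U \<in> Ob \<U>"
    show "hoch_cochain R (\<F> U) (gs_val \<U> \<A> 1 x 0 (U, []))"
      by (rule hoch_cochain.intro[OF fib[OF U]], rule hoch_cochain_axioms.intro)
        (simp_all add: gs_val_1_0[OF X, unfolded One_nat_def] U ps_rules tys lin fib_hdif fib_dist
            fib_smult_hdif fib_ac)
  qed
  have 1: "mk_cochain \<U> \<A> 1 1 (gs_val \<U> \<A> 1 x 1) \<in> carrier (\<C> 1 1)"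
  proof (rule C11_I)
    fix u assume u: "u \<in> Ar \<U>"
    show "functor_cochain R (\<F> (Cod \<U> u)) (\<F> (Dom \<U> u)) (res_ob \<A> u) (res_mor \<A> u) (gs_val \<U> \<A> 1 x 1 (Dom \<U> u, [u]))"
      by (rule functor_cochain.intro[OF res_functor[OF u]], rule functor_cochain_axioms.intro)
        (auto simp: gs_val_1_1[OF X, unfolded One_nat_def] u ps_rules tys lin fib_hdif fib_dist fib_smult_hdif fib_ac)
  qed
  have 2: "mk_cochain \<U> \<A> 2 0 (gs_val \<U> \<A> 1 x 2) \<in> carrier (\<C> 2 0)"
    by (rule C20_I) (simp add: gs_val_1_2[OF X, unfolded One_nat_def] ps_rules tys fib_hdif)
  show ?thesis
    unfolding GS_2_carrier gs_d_eq using 0 1 2 by (auto simp: extensional_def numeral_2_eq_2)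
qed

text \<open>
  Naturality and coherence of the twists, with a further arrow composed on the right: composites are
  kept associated to the right, so the plain equations do not match inside a longer composite.
\<close>

lemma twist_nat':
  assumes "u \<in> Ar \<U>" "v \<in> Ar \<U>" "Cod \<U> v = Dom \<U> u" "a \<in> Ar (\<F> (Cod \<U> u))"
    "Dom (\<F> (Cod \<U> u)) a = A" "Dom \<U> v = V" "z \<in> Ar (\<F> V)" "Cod (\<F> V) z = res_ob \<A> v (res_ob \<A> u A)"
  shows "res_mor \<A> (u \<bullet>\<^bsub>\<U>\<^esub> v) a \<bullet>\<^bsub>\<F> V\<^esub> (twist \<A> u v A \<bullet>\<^bsub>\<F> V\<^esub> z)
      = twist \<A> u v (Cod (\<F> (Cod \<U> u)) a) \<bullet>\<^bsub>\<F> V\<^esub> (res_mor \<A> v (res_mor \<A> u a) \<bullet>\<^bsub>\<F> V\<^esub> z)"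
proof -
  have V: "V \<in> Ob \<U>" using assms \<U>.Dom_closed by blast
  interpret C: linear_category R "\<F> V" by (rule fib[OF V])
  have "res_mor \<A> (u \<bullet>\<^bsub>\<U>\<^esub> v) a \<bullet>\<^bsub>\<F> V\<^esub> (twist \<A> u v A \<bullet>\<^bsub>\<F> V\<^esub> z)
      = (res_mor \<A> (u \<bullet>\<^bsub>\<U>\<^esub> v) a \<bullet>\<^bsub>\<F> V\<^esub> twist \<A> u v A) \<bullet>\<^bsub>\<F> V\<^esub> z"
    by (rule C.assoc[symmetric]) (use assms in \<open>auto simp: ps_rules\<close>)
  also have "\<dots> = twist \<A> u v (Cod (\<F> (Cod \<U> u)) a) \<bullet>\<^bsub>\<F> V\<^esub> (res_mor \<A> v (res_mor \<A> u a) \<bullet>\<^bsub>\<F> V\<^esub> z)"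
    unfolding twist_nat[OF assms(1-6)]
    by (rule C.assoc) (use assms in \<open>auto simp: ps_rules\<close>)
  finally show ?thesis .
qed

lemma twist_coh:
  assumes "u \<in> Ar \<U>" "v \<in> Ar \<U>" "w \<in> Ar \<U>" "Cod \<U> v = Dom \<U> u" "Cod \<U> w = Dom \<U> v"
    "A \<in> Ob (\<F> (Cod \<U> u))" "Dom \<U> w = W"
  shows "twist \<A> u (v \<bullet>\<^bsub>\<U>\<^esub> w) A \<bullet>\<^bsub>\<F> W\<^esub> twist \<A> v w (res_ob \<A> u A)
         = twist \<A> (u \<bullet>\<^bsub>\<U>\<^esub> v) w A \<bullet>\<^bsub>\<F> W\<^esub> res_mor \<A> w (twist \<A> u v A)"
    "z \<in> Ar (\<F> W) \<Longrightarrow> Cod (\<F> W) z = res_ob \<A> w (res_ob \<A> v (res_ob \<A> u A)) \<Longrightarrow>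
      twist \<A> u (v \<bullet>\<^bsub>\<U>\<^esub> w) A \<bullet>\<^bsub>\<F> W\<^esub> (twist \<A> v w (res_ob \<A> u A) \<bullet>\<^bsub>\<F> W\<^esub> z)
         = twist \<A> (u \<bullet>\<^bsub>\<U>\<^esub> v) w A \<bullet>\<^bsub>\<F> W\<^esub> (res_mor \<A> w (twist \<A> u v A) \<bullet>\<^bsub>\<F> W\<^esub> z)"
proof -
  show 1: "twist \<A> u (v \<bullet>\<^bsub>\<U>\<^esub> w) A \<bullet>\<^bsub>\<F> W\<^esub> twist \<A> v w (res_ob \<A> u A)
         = twist \<A> (u \<bullet>\<^bsub>\<U>\<^esub> v) w A \<bullet>\<^bsub>\<F> W\<^esub> res_mor \<A> w (twist \<A> u v A)"
    using twist_coherent[OF assms(1-6)] assms(7) by simp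
  have W: "W \<in> Ob \<U>" using assms \<U>.Dom_closed by blast
  interpret C: linear_category R "\<F> W" by (rule fib[OF W])
  assume z: "z \<in> Ar (\<F> W)" "Cod (\<F> W) z = res_ob \<A> w (res_ob \<A> v (res_ob \<A> u A))"
  have "twist \<A> u (v \<bullet>\<^bsub>\<U>\<^esub> w) A \<bullet>\<^bsub>\<F> W\<^esub> (twist \<A> v w (res_ob \<A> u A) \<bullet>\<^bsub>\<F> W\<^esub> z)
      = (twist \<A> u (v \<bullet>\<^bsub>\<U>\<^esub> w) A \<bullet>\<^bsub>\<F> W\<^esub> twist \<A> v w (res_ob \<A> u A)) \<bullet>\<^bsub>\<F> W\<^esub> z"
    by (rule C.assoc[symmetric]) (use assms z in \<open>auto simp: ps_rules\<close>)
  also have "\<dots> = twist \<A> (u \<bullet>\<^bsub>\<U>\<^esub> v) w A \<bullet>\<^bsub>\<F> W\<^esub> (res_mor \<A> w (twist \<A> u v A) \<bullet>\<^bsub>\<F> W\<^esub> z)"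
    unfolding 1 by (rule C.assoc) (use assms z in \<open>auto simp: ps_rules\<close>)
  finally show "twist \<A> u (v \<bullet>\<^bsub>\<U>\<^esub> w) A \<bullet>\<^bsub>\<F> W\<^esub> (twist \<A> v w (res_ob \<A> u A) \<bullet>\<^bsub>\<F> W\<^esub> z)
         = twist \<A> (u \<bullet>\<^bsub>\<U>\<^esub> v) w A \<bullet>\<^bsub>\<F> W\<^esub> (res_mor \<A> w (twist \<A> u v A) \<bullet>\<^bsub>\<F> W\<^esub> z)" .
qed

lemma gs_d_1_apply:
  "s \<le> 2 \<Longrightarrow> \<sigma> \<in> simplices \<U> s \<Longrightarrow> a \<in> rsimplices (\<T> \<sigma>) (2 - s) \<Longrightarrow>
    \<delta> 1 x s \<sigma> a = gs_val \<U> \<A> 1 x s \<sigma> a"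
  by (simp add: gs_d_eq numeral_2_eq_2)

end

context linear_category begin

lemma hdif_closed: "p \<in> Homs C A B \<Longrightarrow> n \<in> Homs C A B \<Longrightarrow> hdif C A B p n \<in> Homs C A B"
  by (simp add: hdif_type mem_Homs)

lemma hdif_self: "x \<in> Homs C A B \<Longrightarrow> hdif C A B x x = \<zero>\<^bsub>HomMod C A B\<^esub>"
  by (simp add: hdif_def hadd_group)

text \<open>
  The pattern in which the terms of \<open>d d\<close> cancel in the two cases that involve twists, with the terms
  as variables: one side of the cocycle equation is a sum of three differences, the other one of four,
  and both telescope to the same difference. The primed versions are the pattern for three arrows in
  the base, the unprimed ones for two.
\<close>

lemma hdif_cancel_3:
  assumes "p \<in> Homs C A B" "q \<in> Homs C A B" "r \<in> Homs C A B" "s \<in> Homs C A B" "e \<in> Homs C A B"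
    "k \<in> Homs C A B" "l \<in> Homs C A B" "h \<in> Homs C A B"
  shows "hdif C A B (p \<oplus>\<^bsub>HomMod C A B\<^esub> q) (r \<oplus>\<^bsub>HomMod C A B\<^esub> s) \<oplus>\<^bsub>HomMod C A B\<^esub>
    (hdif C A B (e \<oplus>\<^bsub>HomMod C A B\<^esub> r) (k \<oplus>\<^bsub>HomMod C A B\<^esub> l) \<oplus>\<^bsub>HomMod C A B\<^esub>
     hdif C A B (s \<oplus>\<^bsub>HomMod C A B\<^esub> k) h)
    = hdif C A B (p \<oplus>\<^bsub>HomMod C A B\<^esub> (q \<oplus>\<^bsub>HomMod C A B\<^esub> e)) (l \<oplus>\<^bsub>HomMod C A B\<^esub> h)"
  using assms by (simp add: hdif_add_hdif hadd_closed hdif_eq_iff hadd_ac)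

lemma hdif_cancel_4:
  assumes "p \<in> Homs C A B" "q \<in> Homs C A B" "e \<in> Homs C A B" "j \<in> Homs C A B" "b \<in> Homs C A B"
    "d \<in> Homs C A B" "i \<in> Homs C A B" "l \<in> Homs C A B" "o' \<in> Homs C A B" "h \<in> Homs C A B"
  shows "hdif C A B (e \<oplus>\<^bsub>HomMod C A B\<^esub> p) (j \<oplus>\<^bsub>HomMod C A B\<^esub> b) \<oplus>\<^bsub>HomMod C A B\<^esub>
    (hdif C A B (j \<oplus>\<^bsub>HomMod C A B\<^esub> q) (d \<oplus>\<^bsub>HomMod C A B\<^esub> i) \<oplus>\<^bsub>HomMod C A B\<^esub>
     (hdif C A B (b \<oplus>\<^bsub>HomMod C A B\<^esub> i) (l \<oplus>\<^bsub>HomMod C A B\<^esub> o') \<oplus>\<^bsub>HomMod C A B\<^esub>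
      hdif C A B (d \<oplus>\<^bsub>HomMod C A B\<^esub> o') h))
    = hdif C A B (p \<oplus>\<^bsub>HomMod C A B\<^esub> (q \<oplus>\<^bsub>HomMod C A B\<^esub> e)) (l \<oplus>\<^bsub>HomMod C A B\<^esub> h)"
  using assms by (simp add: hdif_add_hdif hadd_closed hdif_eq_iff hadd_ac)

lemma hdif_cancel_3':
  assumes "a1 \<in> Homs C A B" "a2 \<in> Homs C A B" "b1 \<in> Homs C A B" "b2 \<in> Homs C A B" "b3 \<in> Homs C A B"
    "d1 \<in> Homs C A B" "d2 \<in> Homs C A B" "h \<in> Homs C A B"
  shows "hdif C A B (a1 \<oplus>\<^bsub>HomMod C A B\<^esub> a2) h \<oplus>\<^bsub>HomMod C A B\<^esub>
    (hdif C A B (b1 \<oplus>\<^bsub>HomMod C A B\<^esub> b2) (b3 \<oplus>\<^bsub>HomMod C A B\<^esub> a2) \<oplus>\<^bsub>HomMod C A B\<^esub>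
     hdif C A B (d1 \<oplus>\<^bsub>HomMod C A B\<^esub> d2) (b2 \<oplus>\<^bsub>HomMod C A B\<^esub> a1))
    = hdif C A B (b1 \<oplus>\<^bsub>HomMod C A B\<^esub> (d1 \<oplus>\<^bsub>HomMod C A B\<^esub> d2)) (h \<oplus>\<^bsub>HomMod C A B\<^esub> b3)"
  using assms by (simp add: hdif_add_hdif hadd_closed hdif_eq_iff hadd_ac)

lemma hdif_cancel_4':
  assumes "e1 \<in> Homs C A B" "e2 \<in> Homs C A B" "f1 \<in> Homs C A B" "f2 \<in> Homs C A B" "k \<in> Homs C A B"
    "b1 \<in> Homs C A B" "b3 \<in> Homs C A B" "d1 \<in> Homs C A B" "d2 \<in> Homs C A B" "h \<in> Homs C A B"
  shows "hdif C A B (e1 \<oplus>\<^bsub>HomMod C A B\<^esub> e2) h \<oplus>\<^bsub>HomMod C A B\<^esub>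
    (hdif C A B (f1 \<oplus>\<^bsub>HomMod C A B\<^esub> d2) (e1 \<oplus>\<^bsub>HomMod C A B\<^esub> f2) \<oplus>\<^bsub>HomMod C A B\<^esub>
     (hdif C A B (b1 \<oplus>\<^bsub>HomMod C A B\<^esub> d1) (k \<oplus>\<^bsub>HomMod C A B\<^esub> f1) \<oplus>\<^bsub>HomMod C A B\<^esub>
      hdif C A B (k \<oplus>\<^bsub>HomMod C A B\<^esub> f2) (b3 \<oplus>\<^bsub>HomMod C A B\<^esub> e2)))
    = hdif C A B (b1 \<oplus>\<^bsub>HomMod C A B\<^esub> (d1 \<oplus>\<^bsub>HomMod C A B\<^esub> d2)) (h \<oplus>\<^bsub>HomMod C A B\<^esub> b3)"
  using assms by (simp add: hdif_add_hdif hadd_closed hdif_eq_iff hadd_ac)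

end

context prestack begin

text \<open>
  The complex in degree one. At simplices with at most one arrow in the base all terms cancel
  after expansion. With two or three arrows the components \<open>f\<close> and \<open>c\<close> of the coboundary are composed
  with twists, and the terms match only after moving twists past restricted arrows (naturality) or
  past each other (coherence).
\<close>

lemma gs_d_gs_d:
  assumes "x \<in> carrier (\<G> 1)"
  shows "\<delta> 2 (\<delta> 1 x) = \<zero>\<^bsub>\<G> 3\<^esub>"
proof -
  define w where "w = \<delta> 1 x"
  note X = GS_1_D[OF assms]
  note W = GS_2_D[OF gs_d_1_closed[OF assms], folded w_def]
  note tys = C01_type[OF X(1)] C10_type[OF X(2), unfolded One_nat_def]
  have w0: "w 0 (U, []) (A, [b, a]) = gs_val \<U> \<A> 1 x 0 (U, []) (A, [b, a])"
    if "U \<in> Ob \<U>" "a \<in> Ar (\<F> U)" "b \<in> Ar (\<F> U)" "Dom (\<F> U) b = Cod (\<F> U) a" "Dom (\<F> U) a = A"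
    for U A a b unfolding w_def using that by (intro gs_d_1_apply) (auto simp: small_rules)
  have w1: "w 1 (V, [u]) (A, [a]) = gs_val \<U> \<A> 1 x 1 (V, [u]) (A, [a])"
    if "u \<in> Ar \<U>" "Dom \<U> u = V" "a \<in> Ar (\<F> (Cod \<U> u))" "Dom (\<F> (Cod \<U> u)) a = A" for u V A a
    unfolding w_def using that by (intro gs_d_1_apply) (auto simp: small_rules)
  have w2: "w 2 (V, [u, v]) (A, []) = gs_val \<U> \<A> 1 x 2 (V, [u, v]) (A, [])"
    if "u \<in> Ar \<U>" "v \<in> Ar \<U>" "Dom \<U> v = Cod \<U> u" "Dom \<U> u = V" "A \<in> Ob (\<F> (Cod \<U> v))" for u v V A
    unfolding w_def using that by (intro gs_d_1_apply) (auto simp: small_rules)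
  note wv = w0 w1[unfolded One_nat_def] w2 gs_val_1_0[OF X, unfolded One_nat_def]
    gs_val_1_1[OF X, unfolded One_nat_def] gs_val_1_2[OF X, unfolded One_nat_def]
  note rules = wv ps_rules tys fib_hdif fib_hdif_eq res_hdif fib_dist fib_group
  note rules' = wv ps_rules tys linear_category.hdif_type[OF fib] linear_category.comp_hdif[OF fib] res_hdif fib_dist
  have case2: "gs_val \<U> \<A> 2 w 2 (Dom \<U> u, [u, v]) (Dom (\<F> (Cod \<U> v)) a, [a])
      = \<zero>\<^bsub>\<H> (Dom \<U> u) (res_ob \<A> u (res_ob \<A> v (Dom (\<F> (Cod \<U> v)) a)))
          (res_ob \<A> (v \<bullet>\<^bsub>\<U>\<^esub> u) (Cod (\<F> (Cod \<U> v)) a))\<^esub>"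
    if uv: "u \<in> Ar \<U>" "v \<in> Ar \<U>" "Dom \<U> v = Cod \<U> u" "a \<in> Ar (\<F> (Cod \<U> v))" for u v a
  proof -
    define V A B where "V = Dom \<U> u" and "A = Dom (\<F> (Cod \<U> v)) a" and "B = Cod (\<F> (Cod \<U> v)) a"
    let ?F = "\<F> V" and ?S = "res_ob \<A> u (res_ob \<A> v A)" and ?T = "res_ob \<A> (v \<bullet>\<^bsub>\<U>\<^esub> u) B"
    have V: "V \<in> Ob \<U>" using uv \<U>.Dom_closed by (simp add: V_def)
    interpret F: linear_category R ?F by (rule fib[OF V])
    note fold = V_def[symmetric] A_def[symmetric] B_def[symmetric]
    have obs: "A \<in> Ob (\<F> (Cod \<U> v))" "B \<in> Ob (\<F> (Cod \<U> v))"
      using uv by (auto simp: A_def B_def ps_rules)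
    note facts = uv obs V fold
    let ?M = "HomMod ?F ?S ?T"
    define Sa c c' where "Sa = res_mor \<A> u (res_mor \<A> v a)" and "c = twist \<A> v u A" and "c' = twist \<A> v u B"
    \<comment> \<open>The terms of the expansion. Those with the same name on both sides, and those with opposite
      signs on one side, cancel.\<close>
    define p where "p = c' \<bullet>\<^bsub>?F\<^esub> (Sa \<bullet>\<^bsub>?F\<^esub> res_mor \<A> u (x 1 (Cod \<U> u, [v]) (A, [])))"
    define q where "q = c' \<bullet>\<^bsub>?F\<^esub> (Sa \<bullet>\<^bsub>?F\<^esub> x 1 (V, [u]) (res_ob \<A> v A, []))"
    define r where "r = res_mor \<A> (v \<bullet>\<^bsub>\<U>\<^esub> u) a \<bullet>\<^bsub>?F\<^esub> (x 1 (V, [v \<bullet>\<^bsub>\<U>\<^esub> u]) (A, []) \<bullet>\<^bsub>?F\<^esub> c)"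
    define s where "s = res_mor \<A> (v \<bullet>\<^bsub>\<U>\<^esub> u) a \<bullet>\<^bsub>?F\<^esub> x 0 (V, []) (?S, [c])"
    define e where "e = c' \<bullet>\<^bsub>?F\<^esub> res_mor \<A> u (res_mor \<A> v (x 0 (Cod \<U> v, []) (A, [a])))"
    define k where "k = x 0 (V, []) (res_ob \<A> (v \<bullet>\<^bsub>\<U>\<^esub> u) A, [res_mor \<A> (v \<bullet>\<^bsub>\<U>\<^esub> u) a]) \<bullet>\<^bsub>?F\<^esub> c"
    define l where "l = x 1 (V, [v \<bullet>\<^bsub>\<U>\<^esub> u]) (B, []) \<bullet>\<^bsub>?F\<^esub> (c' \<bullet>\<^bsub>?F\<^esub> Sa)"
    define h where "h = x 0 (V, []) (?S, [c' \<bullet>\<^bsub>?F\<^esub> Sa])"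
    define j where "j = c' \<bullet>\<^bsub>?F\<^esub> res_mor \<A> u (x 0 (Cod \<U> u, []) (res_ob \<A> v A, [res_mor \<A> v a]))"
    define b where "b = c' \<bullet>\<^bsub>?F\<^esub> (res_mor \<A> u (x 1 (Cod \<U> u, [v]) (B, [])) \<bullet>\<^bsub>?F\<^esub> Sa)"
    define d where "d = c' \<bullet>\<^bsub>?F\<^esub> x 0 (V, []) (?S, [Sa])"
    define i where "i = c' \<bullet>\<^bsub>?F\<^esub> (x 1 (V, [u]) (res_ob \<A> v B, []) \<bullet>\<^bsub>?F\<^esub> Sa)"
    define o' where "o' = x 0 (V, []) (res_ob \<A> u (res_ob \<A> v B), [c']) \<bullet>\<^bsub>?F\<^esub> Sa"
    note defs = p_def q_def r_def s_def e_def k_def l_def h_def j_def b_def d_def i_def o'_def Sa_def c_def c'_def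
    have m: "p \<in> Homs ?F ?S ?T" "q \<in> Homs ?F ?S ?T" "r \<in> Homs ?F ?S ?T" "s \<in> Homs ?F ?S ?T" "e \<in> Homs ?F ?S ?T"
      "k \<in> Homs ?F ?S ?T" "l \<in> Homs ?F ?S ?T" "h \<in> Homs ?F ?S ?T" "j \<in> Homs ?F ?S ?T" "b \<in> Homs ?F ?S ?T"
      "d \<in> Homs ?F ?S ?T" "i \<in> Homs ?F ?S ?T" "o' \<in> Homs ?F ?S ?T"
      using facts by (simp_all add: defs rules)
    have "gs_val \<U> \<A> 2 w 2 (V, [u, v]) (A, [a]) = hdif ?F ?S ?T
       (hdif ?F ?S ?T (p \<oplus>\<^bsub>?M\<^esub> q) (r \<oplus>\<^bsub>?M\<^esub> s) \<oplus>\<^bsub>?M\<^esub> (hdif ?F ?S ?T (e \<oplus>\<^bsub>?M\<^esub> r) (k \<oplus>\<^bsub>?M\<^esub> l)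
           \<oplus>\<^bsub>?M\<^esub> hdif ?F ?S ?T (s \<oplus>\<^bsub>?M\<^esub> k) h))
       (hdif ?F ?S ?T (e \<oplus>\<^bsub>?M\<^esub> p) (j \<oplus>\<^bsub>?M\<^esub> b) \<oplus>\<^bsub>?M\<^esub> (hdif ?F ?S ?T (j \<oplus>\<^bsub>?M\<^esub> q) (d \<oplus>\<^bsub>?M\<^esub> i) \<oplus>\<^bsub>?M\<^esub>
         (hdif ?F ?S ?T (b \<oplus>\<^bsub>?M\<^esub> i) (l \<oplus>\<^bsub>?M\<^esub> o') \<oplus>\<^bsub>?M\<^esub> hdif ?F ?S ?T (d \<oplus>\<^bsub>?M\<^esub> o') h)))"
      unfolding gs_val_2_2[OF W uv(1-3) V_def[symmetric] uv(4) A_def[symmetric] B_def[symmetric]]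
      by (intro arg_cong2[of _ _ _ _ "hdif ?F ?S ?T"] arg_cong2[of _ _ _ _ "add ?M"])
        (use facts in \<open>simp_all add: defs rules' twist_nat twist_nat'\<close>)
    then show ?thesis
      unfolding F.hdif_cancel_3[OF m(1-8)] F.hdif_cancel_4[OF m(1,2,5,9-12,7,13,8)]
      by (simp add: fold F.hdif_self F.hdif_closed F.hadd_closed m)
  qed
  have case3: "gs_val \<U> \<A> 2 w 3 (Dom \<U> u, [u, v, z]) (A, [])
      = \<zero>\<^bsub>\<H> (Dom \<U> u) (res_ob \<A> u (res_ob \<A> v (res_ob \<A> z A))) (res_ob \<A> (z \<bullet>\<^bsub>\<U>\<^esub> (v \<bullet>\<^bsub>\<U>\<^esub> u)) A)\<^esub>"
    if uv: "u \<in> Ar \<U>" "v \<in> Ar \<U>" "z \<in> Ar \<U>" "Dom \<U> v = Cod \<U> u" "Dom \<U> z = Cod \<U> v" "A \<in> Ob (\<F> (Cod \<U> z))" for u v z A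
  proof -
    define V where "V = Dom \<U> u"
    let ?F = "\<F> V" and ?S = "res_ob \<A> u (res_ob \<A> v (res_ob \<A> z A))" and ?T = "res_ob \<A> (z \<bullet>\<^bsub>\<U>\<^esub> (v \<bullet>\<^bsub>\<U>\<^esub> u)) A"
    have V: "V \<in> Ob \<U>" using uv \<U>.Dom_closed by (simp add: V_def)
    interpret F: linear_category R ?F by (rule fib[OF V])
    note fold = V_def[symmetric]
    note facts = uv V fold
    let ?M = "HomMod ?F ?S ?T"
    define C1 where "C1 = twist \<A> z (v \<bullet>\<^bsub>\<U>\<^esub> u) A"
    define C2 where "C2 = twist \<A> v u (res_ob \<A> z A)"
    define C3 where "C3 = twist \<A> (z \<bullet>\<^bsub>\<U>\<^esub> v) u A"
    define C4 where "C4 = twist \<A> z v A"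
    define D where "D = res_mor \<A> u (twist \<A> z v A)"
    \<comment> \<open>As before, for three arrows.\<close>
    define a1 where "a1 = (C1 \<bullet>\<^bsub>?F\<^esub> x 0 (V, []) (?S, [C2]))"
    define a2 where "a2 = (x 0 (V, []) (res_ob \<A> (v \<bullet>\<^bsub>\<U>\<^esub> u) (res_ob \<A> z A), [C1]) \<bullet>\<^bsub>?F\<^esub> C2)"
    define h where "h = x 0 (V, []) (?S, [(C3 \<bullet>\<^bsub>?F\<^esub> D)])"
    define b1 where "b1 = (C3 \<bullet>\<^bsub>?F\<^esub> (D \<bullet>\<^bsub>?F\<^esub> res_mor \<A> u (res_mor \<A> v (x 1 (Cod \<U> v, [z]) (A, [])))))"
    define b2 where "b2 = (C1 \<bullet>\<^bsub>?F\<^esub> (x 1 (V, [(v \<bullet>\<^bsub>\<U>\<^esub> u)]) ((res_ob \<A> z A), []) \<bullet>\<^bsub>?F\<^esub> C2))"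
    define b3 where "b3 = (x 1 (V, [(z \<bullet>\<^bsub>\<U>\<^esub> (v \<bullet>\<^bsub>\<U>\<^esub> u))]) (A, []) \<bullet>\<^bsub>?F\<^esub> (C3 \<bullet>\<^bsub>?F\<^esub> D))"
    define d1 where "d1 = (C3 \<bullet>\<^bsub>?F\<^esub> (D \<bullet>\<^bsub>?F\<^esub> res_mor \<A> u (x 1 (Cod \<U> u, [v]) ((res_ob \<A> z A), []))))"
    define d2 where "d2 = (C3 \<bullet>\<^bsub>?F\<^esub> (D \<bullet>\<^bsub>?F\<^esub> x 1 (V, [u]) (res_ob \<A> v (res_ob \<A> z A), [])))"
    define e1 where "e1 = (C3 \<bullet>\<^bsub>?F\<^esub> x 0 (V, []) (?S, [D]))"
    define e2 where "e2 = (x 0 (V, []) (res_ob \<A> u (res_ob \<A> (z \<bullet>\<^bsub>\<U>\<^esub> v) A), [C3]) \<bullet>\<^bsub>?F\<^esub> D)"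
    define f1 where "f1 = (C3 \<bullet>\<^bsub>?F\<^esub> res_mor \<A> u (x 0 (Cod \<U> u, []) (res_ob \<A> v (res_ob \<A> z A), [C4])))"
    define f2 where "f2 = (C3 \<bullet>\<^bsub>?F\<^esub> (x 1 (V, [u]) (res_ob \<A> (z \<bullet>\<^bsub>\<U>\<^esub> v) A, []) \<bullet>\<^bsub>?F\<^esub> D))"
    define k where "k = (C3 \<bullet>\<^bsub>?F\<^esub> (res_mor \<A> u (x 1 (Cod \<U> u, [(z \<bullet>\<^bsub>\<U>\<^esub> v)]) (A, [])) \<bullet>\<^bsub>?F\<^esub> D))"
    note defs = a1_def a2_def h_def b1_def b2_def b3_def d1_def d2_def e1_def e2_def f1_def f2_def k_def
        C1_def C2_def C3_def C4_def D_def
    have m: "a1 \<in> Homs ?F ?S ?T" "a2 \<in> Homs ?F ?S ?T" "h \<in> Homs ?F ?S ?T" "b1 \<in> Homs ?F ?S ?T"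
        "b2 \<in> Homs ?F ?S ?T" "b3 \<in> Homs ?F ?S ?T" "d1 \<in> Homs ?F ?S ?T" "d2 \<in> Homs ?F ?S ?T"
            "e1 \<in> Homs ?F ?S ?T" "e2 \<in> Homs ?F ?S ?T" "f1 \<in> Homs ?F ?S ?T" "f2 \<in> Homs ?F ?S ?T" "k \<in> Homs ?F ?S ?T"
      using facts by (simp_all add: defs rules)
    have "gs_val \<U> \<A> 2 w 3 (V, [u, v, z]) (A, []) = hdif ?F ?S ?T
       (hdif ?F ?S ?T (a1 \<oplus>\<^bsub>?M\<^esub> a2) (h) \<oplus>\<^bsub>?M\<^esub> (hdif ?F ?S ?T (b1 \<oplus>\<^bsub>?M\<^esub> b2) (b3 \<oplus>\<^bsub>?M\<^esub> a2)
           \<oplus>\<^bsub>?M\<^esub> (hdif ?F ?S ?T (d1 \<oplus>\<^bsub>?M\<^esub> d2) (b2 \<oplus>\<^bsub>?M\<^esub> a1))))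
       (hdif ?F ?S ?T (e1 \<oplus>\<^bsub>?M\<^esub> e2) (h) \<oplus>\<^bsub>?M\<^esub> (hdif ?F ?S ?T (f1 \<oplus>\<^bsub>?M\<^esub> d2) (e1 \<oplus>\<^bsub>?M\<^esub> f2)
           \<oplus>\<^bsub>?M\<^esub> (hdif ?F ?S ?T (b1 \<oplus>\<^bsub>?M\<^esub> d1) (k \<oplus>\<^bsub>?M\<^esub> f1) \<oplus>\<^bsub>?M\<^esub> (hdif ?F ?S ?T (k \<oplus>\<^bsub>?M\<^esub> f2) (b3 \<oplus>\<^bsub>?M\<^esub> e2)))))"
      unfolding gs_val_2_3[OF W uv(1-5) V_def[symmetric] uv(6)]
      by (intro arg_cong2[of _ _ _ _ "hdif ?F ?S ?T"] arg_cong2[of _ _ _ _ "add ?M"])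
        (use facts in \<open>simp_all add: defs rules' twist_nat twist_nat' twist_coh\<close>)
    then show ?thesis
      unfolding F.hdif_cancel_3'[OF m(1,2,4,5,6,7,8,3)] F.hdif_cancel_4'[OF m(9,10,11,12,13,4,6,7,8,3)]
      by (simp add: fold F.hdif_self F.hdif_closed F.hadd_closed m)
  qed
  interpret G: module R "\<G> (2 + 1)" by (rule GS_module)
  have "\<delta> 2 w = \<zero>\<^bsub>\<G> (2 + 1)\<^esub>"
    unfolding gs_d_eq_iff[OF G.M.zero_closed]
  proof (intro allI impI ballI)
    show "gs_val \<U> \<A> 2 w s \<sigma> a = \<zero>\<^bsub>\<G> (2 + 1)\<^esub> s \<sigma> a"
      if st: "s \<le> 2 + 1" "\<sigma> \<in> simplices \<U> s" "a \<in> rsimplices (\<T> \<sigma>) (2 + 1 - s)" for s \<sigma> a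
    proof -
      have z: "\<zero>\<^bsub>\<G> (2 + 1)\<^esub> s \<sigma> a = \<zero>\<^bsub>\<V> \<sigma> a\<^esub>"
        using st by (simp add: GS_apply(3) Cpq_sel)
      consider "s = 0" | "s = 1" | "s = 2" | "s = 3" using st(1) by linarith
      then show ?thesis unfolding z
      proof cases
        case 1
        then show "gs_val \<U> \<A> 2 w s \<sigma> a = \<zero>\<^bsub>\<V> \<sigma> a\<^esub>"
          using st by (auto simp: small_rules gs_val_2_0[OF W, unfolded One_nat_def]) (simp add: rules fib_ac)
      next
        case 2
        then show "gs_val \<U> \<A> 2 w s \<sigma> a = \<zero>\<^bsub>\<V> \<sigma> a\<^esub>"
          using st by (auto simp: small_rules gs_val_2_1[OF W, unfolded One_nat_def]) (simp add: rules fib_ac)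
      next
        case 3
        then show "gs_val \<U> \<A> 2 w s \<sigma> a = \<zero>\<^bsub>\<V> \<sigma> a\<^esub>"
          using st by (auto simp: small_rules case2)
      next
        case 4
        then show "gs_val \<U> \<A> 2 w s \<sigma> a = \<zero>\<^bsub>\<V> \<sigma> a\<^esub>"
          using st by (auto simp: small_rules case3)
      qed
    qed
  qed
  then show ?thesis by (simp add: w_def)
qed

section \<open>Two-cocycles as equations\<close>

lemma gs_d_zero_iff:
  "\<delta> n x = \<zero>\<^bsub>\<G> (n + 1)\<^esub> \<longleftrightarrow> (\<forall>s \<le> n + 1. \<forall>\<sigma> \<in> simplices \<U> s.
    \<forall>a \<in> rsimplices (\<T> \<sigma>) (n + 1 - s). gs_val \<U> \<A> n x s \<sigma> a = \<zero>\<^bsub>\<V> \<sigma> a\<^esub>)"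
proof -
  interpret G: module R "\<G> (n + 1)" by (rule GS_module)
  have "\<zero>\<^bsub>\<G> (n + 1)\<^esub> s \<sigma> a = \<zero>\<^bsub>\<V> \<sigma> a\<^esub>"
    if "s \<le> n + 1" "\<sigma> \<in> simplices \<U> s" "a \<in> rsimplices (\<T> \<sigma>) (n + 1 - s)" for s \<sigma> a
    using that by (simp add: GS_apply(3) Cpq_sel)
  then show ?thesis
    unfolding gs_d_eq_iff[OF G.M.zero_closed] by simp
qed

text \<open>
  The \<open>\<epsilon>\<close>-coefficient of \<open>(v u)\<^sup>* a c\<^bsup>v,u\<^esup> = c\<^bsup>v,u\<^esup> u\<^sup>* v\<^sup>* a\<close>. Here and below \<open>u\<close>, \<open>v\<close>, \<open>w\<close> are listed in
  order of travel.
\<close>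

definition twist_natural_at :: "(nat \<Rightarrow> ('uo, 'ua, 'o, 'm) cochain) \<Rightarrow> 'ua \<Rightarrow> 'ua \<Rightarrow> 'm \<Rightarrow> bool" where
  "twist_natural_at x u v a \<longleftrightarrow> (
    let V = Dom \<U> u; A = Dom (\<F> (Cod \<U> v)) a; B = Cod (\<F> (Cod \<U> v)) a;
      M = \<H> V (res_ob \<A> u (res_ob \<A> v A)) (res_ob \<A> (v \<bullet>\<^bsub>\<U>\<^esub> u) B) in
    (res_mor \<A> (v \<bullet>\<^bsub>\<U>\<^esub> u) a \<bullet>\<^bsub>\<F> V\<^esub> x 2 (V, [u, v]) (A, [])) \<oplus>\<^bsub>M\<^esub>
      ((x 1 (V, [v \<bullet>\<^bsub>\<U>\<^esub> u]) (A, [a]) \<bullet>\<^bsub>\<F> V\<^esub> twist \<A> v u A) \<oplus>\<^bsub>M\<^esub>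
       x 0 (V, []) (res_ob \<A> u (res_ob \<A> v A), [res_mor \<A> (v \<bullet>\<^bsub>\<U>\<^esub> u) a, twist \<A> v u A]))
    = (twist \<A> v u B \<bullet>\<^bsub>\<F> V\<^esub> res_mor \<A> u (x 1 (Cod \<U> u, [v]) (A, [a]))) \<oplus>\<^bsub>M\<^esub>
      ((twist \<A> v u B \<bullet>\<^bsub>\<F> V\<^esub> x 1 (V, [u]) (res_ob \<A> v A, [res_mor \<A> v a])) \<oplus>\<^bsub>M\<^esub>
       ((x 2 (V, [u, v]) (B, []) \<bullet>\<^bsub>\<F> V\<^esub> res_mor \<A> u (res_mor \<A> v a)) \<oplus>\<^bsub>M\<^esub>
        x 0 (V, []) (res_ob \<A> u (res_ob \<A> v A), [twist \<A> v u B, res_mor \<A> u (res_mor \<A> v a)]))))"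

text \<open>
  The \<open>\<epsilon>\<close>-coefficient of \<open>c\<^bsup>w,vu\<^esup> c\<^bsup>v,u\<^esup> = c\<^bsup>wv,u\<^esup> u\<^sup>* c\<^bsup>w,v\<^esup>\<close>.
\<close>

definition twist_coherent_at :: "(nat \<Rightarrow> ('uo, 'ua, 'o, 'm) cochain) \<Rightarrow> 'ua \<Rightarrow> 'ua \<Rightarrow> 'ua \<Rightarrow> 'o \<Rightarrow> bool" where
  "twist_coherent_at x u v w A \<longleftrightarrow> (
    let V = Dom \<U> u; S = res_ob \<A> u (res_ob \<A> v (res_ob \<A> w A)); T = res_ob \<A> (w \<bullet>\<^bsub>\<U>\<^esub> (v \<bullet>\<^bsub>\<U>\<^esub> u)) A;
      M = \<H> V S T in
    x 0 (V, []) (S, [twist \<A> w (v \<bullet>\<^bsub>\<U>\<^esub> u) A, twist \<A> v u (res_ob \<A> w A)]) \<oplus>\<^bsub>M\<^esub>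
      ((x 2 (V, [v \<bullet>\<^bsub>\<U>\<^esub> u, w]) (A, []) \<bullet>\<^bsub>\<F> V\<^esub> twist \<A> v u (res_ob \<A> w A)) \<oplus>\<^bsub>M\<^esub>
       (twist \<A> w (v \<bullet>\<^bsub>\<U>\<^esub> u) A \<bullet>\<^bsub>\<F> V\<^esub> x 2 (V, [u, v]) (res_ob \<A> w A, [])))
    = x 0 (V, []) (S, [twist \<A> (w \<bullet>\<^bsub>\<U>\<^esub> v) u A, res_mor \<A> u (twist \<A> w v A)]) \<oplus>\<^bsub>M\<^esub>
      ((twist \<A> (w \<bullet>\<^bsub>\<U>\<^esub> v) u A \<bullet>\<^bsub>\<F> V\<^esub> x 1 (V, [u]) (res_ob \<A> v (res_ob \<A> w A), [twist \<A> w v A])) \<oplus>\<^bsub>M\<^esub>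
       ((twist \<A> (w \<bullet>\<^bsub>\<U>\<^esub> v) u A \<bullet>\<^bsub>\<F> V\<^esub> res_mor \<A> u (x 2 (Cod \<U> u, [v, w]) (A, []))) \<oplus>\<^bsub>M\<^esub>
        (x 2 (V, [u, w \<bullet>\<^bsub>\<U>\<^esub> v]) (A, []) \<bullet>\<^bsub>\<F> V\<^esub> res_mor \<A> u (twist \<A> w v A)))))"

definition twist_cochain_natural :: "(nat \<Rightarrow> ('uo, 'ua, 'o, 'm) cochain) \<Rightarrow> bool" where
  "twist_cochain_natural x \<longleftrightarrow> (\<forall>u \<in> Ar \<U>. \<forall>v \<in> Ar \<U>. Dom \<U> v = Cod \<U> u \<longrightarrow> (\<forall>a \<in> Ar (\<F> (Cod \<U> v)).
    twist_natural_at x u v a))"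

definition twist_cochain_coherent :: "(nat \<Rightarrow> ('uo, 'ua, 'o, 'm) cochain) \<Rightarrow> bool" where
  "twist_cochain_coherent x \<longleftrightarrow> (\<forall>u \<in> Ar \<U>. \<forall>v \<in> Ar \<U>. \<forall>w \<in> Ar \<U>. Dom \<U> v = Cod \<U> u \<longrightarrow> Dom \<U> w = Cod \<U> v \<longrightarrow>
    (\<forall>A \<in> Ob (\<F> (Cod \<U> w)).
    twist_coherent_at x u v w A))"

lemma cocycle_iff:
  assumes "x \<in> carrier (\<G> 2)"
  shows "\<delta> 2 x = \<zero>\<^bsub>\<G> 3\<^esub> \<longleftrightarrow>
    (\<forall>U \<in> Ob \<U>. hoch_cochain.mu_cocycle (\<F> U) (x 0 (U, []))) \<and>
    (\<forall>u \<in> Ar \<U>. functor_cochain.eta_multiplicative (\<F> (Cod \<U> u)) (\<F> (Dom \<U> u)) (res_ob \<A> u)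
       (res_mor \<A> u) (x 1 (Dom \<U> u, [u])) (x 0 (Cod \<U> u, [])) (x 0 (Dom \<U> u, []))) \<and>
    twist_cochain_natural x \<and> twist_cochain_coherent x"
proof -
  note X = GS_2_D[OF assms]
  let ?P = "\<lambda>s. \<forall>\<sigma> \<in> simplices \<U> s. \<forall>a \<in> rsimplices (\<T> \<sigma>) (3 - s).
    gs_val \<U> \<A> 2 x s \<sigma> a = \<zero>\<^bsub>\<V> \<sigma> a\<^esub>"
  note tys = C02_type[OF X(1)] C11_type[OF X(2), unfolded One_nat_def] C20_type[OF X(3)]
  note rules = small_rules fib_hdif_eq fib_group tys
  have all: "(\<forall>s \<le> 3. Q s) \<longleftrightarrow> Q 0 \<and> Q 1 \<and> Q 2 \<and> Q 3" for Q :: "nat \<Rightarrow> bool"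
    by (auto simp: numeral_3_eq_3 numeral_2_eq_2 le_Suc_eq)
  have 0: "?P 0 \<longleftrightarrow> (\<forall>U \<in> Ob \<U>. hoch_cochain.mu_cocycle (\<F> U) (x 0 (U, [])))" (is "_ \<longleftrightarrow> ?Q0")
  proof -
    have "?P 0 \<longleftrightarrow> (\<forall>U \<in> Ob \<U>. \<forall>a \<in> Ar (\<F> U). \<forall>b \<in> Ar (\<F> U). \<forall>h \<in> Ar (\<F> U).
        Dom (\<F> U) b = Cod (\<F> U) a \<longrightarrow> Dom (\<F> U) h = Cod (\<F> U) b \<longrightarrow>
        gs_val \<U> \<A> 2 x 0 (U, []) (Dom (\<F> U) a, [h, b, a])
          = \<zero>\<^bsub>\<H> U (Dom (\<F> U) a) (Cod (\<F> U) h)\<^esub>)"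
      by (simp add: \<U>.simplices_small) (auto simp: small_rules)
    also have "\<dots> \<longleftrightarrow> ?Q0"
      unfolding hoch_cochain.mu_cocycle_def[OF C02_hoch[OF X(1)]]
      by (intro ball_cong refl imp_cong) (simp add: gs_val_2_0[OF X] rules hoch_cochain.mu_cocycle_def[OF
          C02_hoch[OF X(1)]])
    finally show ?thesis .
  qed
  have 1: "?P 1 \<longleftrightarrow> (\<forall>u \<in> Ar \<U>. functor_cochain.eta_multiplicative (\<F> (Cod \<U> u)) (\<F> (Dom \<U> u)) (res_ob \<A> u)
       (res_mor \<A> u) (x 1 (Dom \<U> u, [u])) (x 0 (Cod \<U> u, [])) (x 0 (Dom \<U> u, [])))" (is "_ \<longleftrightarrow> ?Q1")
  proof -
    have "?P 1 \<longleftrightarrow> (\<forall>u \<in> Ar \<U>. \<forall>a \<in> Ar (\<F> (Cod \<U> u)). \<forall>b \<in> Ar (\<F> (Cod \<U> u)).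
        Dom (\<F> (Cod \<U> u)) b = Cod (\<F> (Cod \<U> u)) a \<longrightarrow>
        gs_val \<U> \<A> 2 x 1 (Dom \<U> u, [u]) (Dom (\<F> (Cod \<U> u)) a, [b, a])
          = \<zero>\<^bsub>\<H> (Dom \<U> u) (res_ob \<A> u (Dom (\<F> (Cod \<U> u)) a)) (res_ob \<A> u (Cod (\<F> (Cod \<U> u)) b))\<^esub>)"
      by (simp add: \<U>.simplices_small) (auto simp: small_rules)
    also have "\<dots> \<longleftrightarrow> ?Q1"
      by (intro ball_cong refl, subst functor_cochain.eta_multiplicative_def[OF C11_functor[OF X(2) _ refl
          refl]], assumption,
         intro ball_cong refl imp_cong)
        (auto simp: gs_val_2_1[OF X, unfolded One_nat_def] rules)
    finally show ?thesis .
  qed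
  have 2: "?P 2 \<longleftrightarrow> twist_cochain_natural x"
  proof -
    have "?P 2 \<longleftrightarrow> (\<forall>u \<in> Ar \<U>. \<forall>v \<in> Ar \<U>. Dom \<U> v = Cod \<U> u \<longrightarrow> (\<forall>a \<in> Ar (\<F> (Cod \<U> v)).
        gs_val \<U> \<A> 2 x 2 (Dom \<U> u, [u, v]) (Dom (\<F> (Cod \<U> v)) a, [a])
          = \<zero>\<^bsub>\<H> (Dom \<U> u) (res_ob \<A> u (res_ob \<A> v (Dom (\<F> (Cod \<U> v)) a)))
              (res_ob \<A> (v \<bullet>\<^bsub>\<U>\<^esub> u) (Cod (\<F> (Cod \<U> v)) a))\<^esub>))"
      by (simp add: \<U>.simplices_small) (auto simp: small_rules)
    also have "\<dots> \<longleftrightarrow> twist_cochain_natural x"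
      unfolding twist_cochain_natural_def twist_natural_at_def Let_def
      by (intro ball_cong refl imp_cong) (simp add: gs_val_2_2[OF X] rules)
    finally show ?thesis .
  qed
  have 3: "?P 3 \<longleftrightarrow> twist_cochain_coherent x"
  proof -
    have "?P 3 \<longleftrightarrow> (\<forall>u \<in> Ar \<U>. \<forall>v \<in> Ar \<U>. \<forall>w \<in> Ar \<U>. Dom \<U> v = Cod \<U> u \<longrightarrow> Dom \<U> w = Cod \<U> v \<longrightarrow> (\<forall>A \<in> Ob (\<F> (Cod \<U> w)).
        gs_val \<U> \<A> 2 x 3 (Dom \<U> u, [u, v, w]) (A, [])
          = \<zero>\<^bsub>\<H> (Dom \<U> u) (res_ob \<A> u (res_ob \<A> v (res_ob \<A> w A)))
              (res_ob \<A> (w \<bullet>\<^bsub>\<U>\<^esub> (v \<bullet>\<^bsub>\<U>\<^esub> u)) A)\<^esub>))"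
      by (simp add: \<U>.simplices_small) (auto simp: small_rules)
    also have "\<dots> \<longleftrightarrow> twist_cochain_coherent x"
      unfolding twist_cochain_coherent_def twist_coherent_at_def Let_def
      by (intro ball_cong refl imp_cong) (simp add: gs_val_2_3[OF X] rules)
    finally show ?thesis .
  qed
  have "\<delta> 2 x = \<zero>\<^bsub>\<G> 3\<^esub> \<longleftrightarrow> (\<forall>s \<le> 3. ?P s)"
    using gs_d_zero_iff[of 2 x] by (simp add: numeral_3_eq_3 numeral_2_eq_2)
  then show ?thesis unfolding all 0 1 2 3 .
qed

lemma normalized_reduced_small:
  "reduced \<U> \<A> 0 q m" "normalized \<U> \<A> p 0 c"
  "normalized \<U> \<A> 0 2 m \<longleftrightarrow> (\<forall>U \<in> Ob \<U>. \<forall>a \<in> Ar (\<F> U).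
     m (U, []) (Dom (\<F> U) a, [Ident (\<F> U) (Cod (\<F> U) a), a])
       = \<zero>\<^bsub>\<H> U (Dom (\<F> U) a) (Cod (\<F> U) a)\<^esub> \<and>
     m (U, []) (Dom (\<F> U) a, [a, Ident (\<F> U) (Dom (\<F> U) a)])
       = \<zero>\<^bsub>\<H> U (Dom (\<F> U) a) (Cod (\<F> U) a)\<^esub>)"
  "normalized \<U> \<A> 1 1 f \<longleftrightarrow> (\<forall>u \<in> Ar \<U>. \<forall>A \<in> Ob (\<F> (Cod \<U> u)).
     f (Dom \<U> u, [u]) (A, [Ident (\<F> (Cod \<U> u)) A])
       = \<zero>\<^bsub>\<H> (Dom \<U> u) (res_ob \<A> u A) (res_ob \<A> u A)\<^esub>)"
  "reduced \<U> \<A> 1 1 f \<longleftrightarrow> (\<forall>U \<in> Ob \<U>. \<forall>a \<in> Ar (\<F> U).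
     f (U, [Ident \<U> U]) (Dom (\<F> U) a, [a]) = \<zero>\<^bsub>\<H> U (Dom (\<F> U) a) (Cod (\<F> U) a)\<^esub>)"
  "reduced \<U> \<A> 2 0 c \<longleftrightarrow> (\<forall>u \<in> Ar \<U>. \<forall>A \<in> Ob (\<F> (Cod \<U> u)).
     c (Dom \<U> u, [Ident \<U> (Dom \<U> u), u]) (A, []) = \<zero>\<^bsub>\<H> (Dom \<U> u) (res_ob \<A> u A) (res_ob \<A> u A)\<^esub> \<and>
     c (Dom \<U> u, [u, Ident \<U> (Cod \<U> u)]) (A, []) = \<zero>\<^bsub>\<H> (Dom \<U> u) (res_ob \<A> u A) (res_ob \<A> u A)\<^esub>)"
  "normalized \<U> \<A> 0 1 g \<longleftrightarrow> (\<forall>U \<in> Ob \<U>. \<forall>A \<in> Ob (\<F> U).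
     g (U, []) (A, [Ident (\<F> U) A]) = \<zero>\<^bsub>\<H> U A A\<^esub>)"
  "reduced \<U> \<A> 1 0 t \<longleftrightarrow> (\<forall>U \<in> Ob \<U>. \<forall>A \<in> Ob (\<F> U).
     t (U, [Ident \<U> U]) (A, []) = \<zero>\<^bsub>\<H> U A A\<^esub>)"
proof -
  show "reduced \<U> \<A> 0 q m" by (auto simp: reduced_def simplices_def)
  show "normalized \<U> \<A> p 0 c" by (auto simp: normalized_def rsimplices_def)
qed (auto simp: normalized_def reduced_def small_rules; force simp: small_rules)+

end

section \<open>Deformations are normalized reduced cocycles\<close>

lemma cochain_sel:
  "cochain2 m f c 0 = m" "cochain2 m f c 1 = f" "cochain2 m f c 2 = c" "cochain2 m f c \<in> extensional {..2}"
  "cochain1 g t 0 = g" "cochain1 g t 1 = t" "cochain1 g t \<in> extensional {..1}"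
  by (simp_all add: cochain2_def cochain1_def)

lemma deform_sel:
  "fib (deform \<U> \<A> m f c) U = deform_cat (fib \<A> U) (m (U, []))"
  "res_ob (deform \<U> \<A> m f c) = res_ob \<A>"
  "res_mor (deform \<U> \<A> m f c) u = (\<lambda>(a, a'). (res_mor \<A> u a, res_mor \<A> u a'
     \<oplus>\<^bsub>HomMod (fib \<A> (Dom \<U> u)) (res_ob \<A> u (Dom (fib \<A> (Cod \<U> u)) a)) (res_ob \<A> u (Cod (fib \<A> (Cod \<U> u)) a))\<^esub>
       f (Dom \<U> u, [u]) (Dom (fib \<A> (Cod \<U> u)) a, [a])))"
  "twist (deform \<U> \<A> m f c) u v A = (twist \<A> u v A, c (Dom \<U> v, [v, u]) (A, []))"
  by (simp_all add: deform_def Let_def)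

context prestack begin

lemma GSnr_2_iff:
  "x \<in> carrier (\<N> 2) \<longleftrightarrow> x \<in> carrier (\<G> 2) \<and> normalized \<U> \<A> 0 2 (x 0) \<and>
     normalized \<U> \<A> 1 1 (x 1) \<and> reduced \<U> \<A> 1 1 (x 1) \<and> reduced \<U> \<A> 2 0 (x 2)"
proof -
  have all: "(\<forall>s \<le> 2. Q s) \<longleftrightarrow> Q 0 \<and> Q 1 \<and> Q 2" for Q :: "nat \<Rightarrow> bool"
    by (auto simp: numeral_2_eq_2 le_Suc_eq)
  show ?thesis
    unfolding GSnr_def all by (simp add: normalized_reduced_small(1,2))
qed

lemma GSnr_1_iff:
  "y \<in> carrier (\<N> 1) \<longleftrightarrow> y \<in> carrier (\<G> 1) \<and> normalized \<U> \<A> 0 1 (y 0) \<and> reduced \<U> \<A> 1 0 (y 1)"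
proof -
  have all: "(\<forall>s \<le> 1. Q s) \<longleftrightarrow> Q 0 \<and> Q 1" for Q :: "nat \<Rightarrow> bool"
    by (auto simp: le_Suc_eq)
  show ?thesis
    unfolding GSnr_def all by (simp add: normalized_reduced_small(1,2))
qed

text \<open>
  Every axiom of a prestack for the deformed datum is compared with one clause on the right: fibres
  and restriction functors with the equations in simplices of at most one arrow, the two axioms for
  twists with the equations for two and three arrows, the unit axioms with the conditions to be
  normalized and reduced. Invertibility of the twists comes from \<open>E_iso\<close>.
\<close>

lemma deform_prestack_iff:
  assumes "x \<in> carrier (\<G> 2)"
  shows "prestack (dual_ring R) \<U> (deform \<U> \<A> (x 0) (x 1) (x 2)) \<longleftrightarrow>
    x \<in> carrier (\<N> 2) \<and> \<delta> 2 x = \<zero>\<^bsub>\<G> 3\<^esub>" (is "prestack _ _ ?B \<longleftrightarrow> _")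
proof -
  note X = GS_2_D[OF assms]
  let ?E = "\<lambda>U. deform_cat (\<F> U) (x 0 (U, []))"
  note H = C02_hoch[OF X(1)]
  note Esel = hoch_cochain.E_sel[OF H] hoch_cochain.dual_sel[OF H]
  note Homs_E = hoch_cochain.Homs_E[OF H]
  note Fc = C11_functor[OF X(2) _ refl refl]
  note tys = C02_type[OF X(1)] C11_type[OF X(2), unfolded One_nat_def] C20_type[OF X(3)]
  note rules = Esel ps_rules tys fib_dist fib_group deform_sel
  show ?thesis
  proof
    assume "prestack (dual_ring R) \<U> ?B"
    then interpret B: prestack "dual_ring R" \<U> ?B .
    have E: "category (?E U)" if "U \<in> Ob \<U>" for U
      using B.fib_cat[OF that] by (simp add: deform_sel)
    have mu: "hoch_cochain.mu_unital (\<F> U) (x 0 (U, []))" "hoch_cochain.mu_cocycle (\<F> U) (x 0 (U, []))"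
      if "U \<in> Ob \<U>" for U
      using hoch_cochain.E_category_iff[OF H[OF that]] E[OF that] by auto
    have eta: "functor_cochain.eta_unital (\<F> (Cod \<U> u)) (\<F> (Dom \<U> u)) (res_ob \<A> u) (x 1 (Dom \<U> u, [u])) \<and>
      functor_cochain.eta_multiplicative (\<F> (Cod \<U> u)) (\<F> (Dom \<U> u)) (res_ob \<A> u)
       (res_mor \<A> u) (x 1 (Dom \<U> u, [u])) (x 0 (Cod \<U> u, [])) (x 0 (Dom \<U> u, []))" if u: "u \<in> Ar \<U>" for u
      using B.res[OF u] unfolding deform_sel
      using functor_cochain.deform_functor_iff[OF Fc[OF u] H H E E] u by (simp add: ps_rules)
    have "normalized \<U> \<A> 0 2 (x 0)"
      unfolding normalized_reduced_small using mu(1) hoch_cochain.mu_unital_def[OF H] by blast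
    moreover have "normalized \<U> \<A> 1 1 (x 1)"
      unfolding normalized_reduced_small using eta functor_cochain.eta_unital_def[OF Fc] by blast
    moreover have "reduced \<U> \<A> 1 1 (x 1)"
      unfolding normalized_reduced_small
    proof (intro ballI)
      fix U a assume a: "U \<in> Ob \<U>" "a \<in> Ar (\<F> U)"
      have "(a, \<zero>\<^bsub>\<H> U (Dom (\<F> U) a) (Cod (\<F> U) a)\<^esub>) \<in> Ar (fib ?B U)"
        using a by (simp add: rules)
      from B.res_mor_Ident[OF a(1) this] a
      show "x 1 (U, [Ident \<U> U]) (Dom (\<F> U) a, [a]) = \<zero>\<^bsub>\<H> U (Dom (\<F> U) a) (Cod (\<F> U) a)\<^esub>"
        by (simp add: rules)
    qed
    moreover have "reduced \<U> \<A> 2 0 (x 2)"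
      unfolding normalized_reduced_small
    proof (intro ballI conjI)
      fix u A assume a: "u \<in> Ar \<U>" "A \<in> Ob (\<F> (Cod \<U> u))"
      show "x 2 (Dom \<U> u, [Ident \<U> (Dom \<U> u), u]) (A, []) = \<zero>\<^bsub>\<H> (Dom \<U> u) (res_ob \<A> u A) (res_ob \<A> u A)\<^esub>"
        using B.twist_Ident_right[of u A] a by (simp add: rules)
      show "x 2 (Dom \<U> u, [u, Ident \<U> (Cod \<U> u)]) (A, []) = \<zero>\<^bsub>\<H> (Dom \<U> u) (res_ob \<A> u A) (res_ob \<A> u A)\<^esub>"
        using B.twist_Ident_left[of u A] a by (simp add: rules)
    qed
    moreover have "twist_cochain_natural x"
      unfolding twist_cochain_natural_def
    proof (intro ballI impI)
      fix u v a assume a: "u \<in> Ar \<U>" "v \<in> Ar \<U>" "Dom \<U> v = Cod \<U> u" "a \<in> Ar (\<F> (Cod \<U> v))"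
      let ?A = "Dom (\<F> (Cod \<U> v)) a" and ?B' = "Cod (\<F> (Cod \<U> v)) a"
      have "(a, \<zero>\<^bsub>\<H> (Cod \<U> v) ?A ?B'\<^esub>) \<in> Homs (fib ?B (Cod \<U> v)) ?A ?B'"
        using a by (simp add: rules Homs_E)
      from B.twist_natural[OF a(2,1) a(3)[symmetric] this] a
      show "twist_natural_at x u v a"
        unfolding twist_natural_at_def Let_def
        by (simp add: rules fib_ac)
    qed
    moreover have "twist_cochain_coherent x"
      unfolding twist_cochain_coherent_def
    proof (intro ballI impI)
      fix u v w A assume a: "u \<in> Ar \<U>" "v \<in> Ar \<U>" "w \<in> Ar \<U>" "Dom \<U> v = Cod \<U> u" "Dom \<U> w = Cod \<U> v"
          "A \<in> Ob (\<F> (Cod \<U> w))"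
      from B.twist_coherent[OF a(3,2,1) a(5)[symmetric] a(4)[symmetric], of A] a
      show "twist_coherent_at x u v w A"
        unfolding twist_coherent_at_def Let_def
        by (simp add: rules fib_ac)
    qed
    ultimately show "x \<in> carrier (\<N> 2) \<and> \<delta> 2 x = \<zero>\<^bsub>\<G> 3\<^esub>"
      unfolding GSnr_2_iff cocycle_iff[OF assms] using assms mu eta by blast
  next
    assume "x \<in> carrier (\<N> 2) \<and> \<delta> 2 x = \<zero>\<^bsub>\<G> 3\<^esub>"
    then have nr: "normalized \<U> \<A> 0 2 (x 0)" "normalized \<U> \<A> 1 1 (x 1)" "reduced \<U> \<A> 1 1 (x 1)"
        "reduced \<U> \<A> 2 0 (x 2)"
      and coc: "\<And>U. U \<in> Ob \<U> \<Longrightarrow> hoch_cochain.mu_cocycle (\<F> U) (x 0 (U, []))"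
       "\<And>u. u \<in> Ar \<U> \<Longrightarrow> functor_cochain.eta_multiplicative (\<F> (Cod \<U> u)) (\<F> (Dom \<U> u)) (res_ob \<A> u)
       (res_mor \<A> u) (x 1 (Dom \<U> u, [u])) (x 0 (Cod \<U> u, [])) (x 0 (Dom \<U> u, []))"
       "twist_cochain_natural x" "twist_cochain_coherent x"
      unfolding GSnr_2_iff cocycle_iff[OF assms] by auto
    have E: "category (?E U)" if U: "U \<in> Ob \<U>" for U
      using hoch_cochain.E_category_iff[OF H[OF U]] coc(1)[OF U] nr(1)
      unfolding hoch_cochain.mu_unital_def[OF H[OF U]] normalized_reduced_small using U by blast
    show "prestack (dual_ring R) \<U> ?B"
    proof (intro prestack.intro prestack_axioms.intro dual_ring_cring is_cring \<U>.category_axioms, goal_cases)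
      case (1 U)
      then show ?case using hoch_cochain.E_linear_category[OF H E] by (simp add: deform_sel)
    next
      case (2 u)
      have "functor_cochain.eta_unital (\<F> (Cod \<U> u)) (\<F> (Dom \<U> u)) (res_ob \<A> u) (x 1 (Dom \<U> u, [u]))"
        unfolding functor_cochain.eta_unital_def[OF Fc[OF 2]] using nr(2) 2 unfolding
            normalized_reduced_small by blast
      then show ?case unfolding deform_sel
        using functor_cochain.deform_functor_iff[OF Fc[OF 2] H H E E] coc(2) 2 by (simp add: ps_rules)
    next
      case (3 U A)
      then show ?case by (simp add: rules)
    next
      case (4 U a)
      then show ?case using nr(3)[unfolded normalized_reduced_small]
        by (auto simp: rules)
    next
      case (5 u v A)
      have V: "Dom \<U> v \<in> Ob \<U>" using 5 by (simp add: ps_rules)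
      show ?case unfolding deform_sel
        by (rule hoch_cochain.E_iso[OF H[OF V] E[OF V]]) (use 5 twist_iso[OF 5(1-3)] in \<open>auto simp: rules mem_Homs\<close>)
    next
      case (6 u v a A B)
      then obtain a1 a2 where a: "a = (a1, a2)" and t: "a1 \<in> Ar (\<F> (Cod \<U> u))" "a2 \<in> Ar (\<F> (Cod \<U> u))"
        "Dom (\<F> (Cod \<U> u)) a1 = A" "Dom (\<F> (Cod \<U> u)) a2 = A" "Cod (\<F> (Cod \<U> u)) a1 = B" "Cod (\<F> (Cod \<U> u)) a2 = B"
        by (auto simp: rules Homs_E mem_Homs)
      let ?V = "Dom \<U> v" 
      let ?M = "\<H> ?V (res_ob \<A> v (res_ob \<A> u A)) (res_ob \<A> (u \<bullet>\<^bsub>\<U>\<^esub> v) B)"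
      \<comment> \<open>Both sides have the summand \<open>?t\<close> in common, which carries the \<open>\<epsilon>\<close>-part of \<open>a\<close>; what
        remains is the cocycle equation \<open>?L = ?R\<close>.\<close>
      let ?t = "twist \<A> u v B \<bullet>\<^bsub>\<F> ?V\<^esub> res_mor \<A> v (res_mor \<A> u a2)"
      let ?L = "(res_mor \<A> (u \<bullet>\<^bsub>\<U>\<^esub> v) a1 \<bullet>\<^bsub>\<F> ?V\<^esub> x 2 (?V, [v, u]) (A, [])) \<oplus>\<^bsub>?M\<^esub>
        ((x 1 (?V, [u \<bullet>\<^bsub>\<U>\<^esub> v]) (A, [a1]) \<bullet>\<^bsub>\<F> ?V\<^esub> twist \<A> u v A) \<oplus>\<^bsub>?M\<^esub>
         x 0 (?V, []) (res_ob \<A> v (res_ob \<A> u A), [res_mor \<A> (u \<bullet>\<^bsub>\<U>\<^esub> v) a1, twist \<A> u v A]))"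
      let ?R = "(twist \<A> u v B \<bullet>\<^bsub>\<F> ?V\<^esub> res_mor \<A> v (x 1 (Cod \<U> v, [u]) (A, [a1]))) \<oplus>\<^bsub>?M\<^esub>
      ((twist \<A> u v B \<bullet>\<^bsub>\<F> ?V\<^esub> x 1 (?V, [v]) (res_ob \<A> u A, [res_mor \<A> u a1])) \<oplus>\<^bsub>?M\<^esub>
       ((x 2 (?V, [v, u]) (B, []) \<bullet>\<^bsub>\<F> ?V\<^esub> res_mor \<A> v (res_mor \<A> u a1)) \<oplus>\<^bsub>?M\<^esub>
        x 0 (?V, []) (res_ob \<A> v (res_ob \<A> u A), [twist \<A> u v B, res_mor \<A> v (res_mor \<A> u a1)])))"
      have ob: "A \<in> Ob (\<F> (Cod \<U> u))" "B \<in> Ob (\<F> (Cod \<U> u))"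
        using t 6(1) by (auto simp: ps_rules)
      have "?L = ?R"
        using coc(3) 6(1-3) t unfolding twist_cochain_natural_def twist_natural_at_def Let_def by auto
      moreover have "res_mor ?B (u \<bullet>\<^bsub>\<U>\<^esub> v) a \<bullet>\<^bsub>fib ?B ?V\<^esub> twist ?B u v A
          = (twist \<A> u v B \<bullet>\<^bsub>\<F> ?V\<^esub> res_mor \<A> v (res_mor \<A> u a1), ?t \<oplus>\<^bsub>?M\<^esub> ?L)"
        using 6(1-3) t ob by (simp add: a rules fib_ac twist_nat)
      moreover have "twist ?B u v B \<bullet>\<^bsub>fib ?B ?V\<^esub> res_mor ?B v (res_mor ?B u a)
          = (twist \<A> u v B \<bullet>\<^bsub>\<F> ?V\<^esub> res_mor \<A> v (res_mor \<A> u a1), ?t \<oplus>\<^bsub>?M\<^esub> ?R)"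
        using 6(1-3) t ob by (simp add: a rules fib_ac)
      ultimately show ?case by simp
    next
      case (7 v A)
      then show ?case using nr(4)[unfolded normalized_reduced_small] by (simp add: rules)
    next
      case (8 u A)
      then show ?case using nr(4)[unfolded normalized_reduced_small] by (simp add: rules)
    next
      case (9 u v w A)
      have A: "A \<in> Ob (\<F> (Cod \<U> u))" using 9 by (simp add: rules)
      show ?case
        using coc(4)[unfolded twist_cochain_coherent_def twist_coherent_at_def Let_def, rule_format, of w v u A] 9 A
        by (simp add: rules fib_ac twist_coh)
    qed
  qed
qed

end

section \<open>Morphisms of deformations and coboundaries\<close>

lemma deform_mor_sel:
  "on_ob (deform_mor \<U> \<A> g t) U A = A"
  "on_mor (deform_mor \<U> \<A> g t) U =
    (\<lambda>(a, a'). (a, a' \<oplus>\<^bsub>HomMod (fib \<A> U) (Dom (fib \<A> U) a) (Cod (fib \<A> U) a)\<^esub> g (U, []) (Dom (fib \<A> U) a, [a])))"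
  "tau (deform_mor \<U> \<A> g t) u A = (Ident (fib \<A> (Dom \<U> u)) (res_ob \<A> u A), t (Dom \<U> u, [u]) (A, []))"
  by (simp_all add: deform_mor_def Let_def)

context prestack begin

lemma GS_minus_apply:
  assumes "x \<in> carrier (\<G> n)" "y \<in> carrier (\<G> n)"
    "s \<le> n" "\<sigma> \<in> simplices \<U> s" "a \<in> rsimplices (\<T> \<sigma>) (n - s)"
  shows "(x \<ominus>\<^bsub>\<G> n\<^esub> y) s \<sigma> a = x s \<sigma> a \<oplus>\<^bsub>\<V> \<sigma> a\<^esub> \<ominus>\<^bsub>\<V> \<sigma> a\<^esub> y s \<sigma> a"
proof -
  interpret G: module R "\<G> n" by (rule GS_module)
  interpret M: module R "\<C> s (n - s)" by (rule Cpq_module)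
  have cy: "y s \<in> carrier (\<C> s (n - s))" and cn: "(\<ominus>\<^bsub>\<G> n\<^esub> y) s \<in> carrier (\<C> s (n - s))"
    using assms G.M.a_inv_closed[OF assms(2)] by (auto simp: GS_carrier)
  have "(\<ominus>\<^bsub>\<G> n\<^esub> y) s \<oplus>\<^bsub>\<C> s (n - s)\<^esub> y s = \<zero>\<^bsub>\<C> s (n - s)\<^esub>"
    using G.M.l_neg[OF assms(2)] GS_apply(1,3)[OF assms(3)] by metis
  then have "(\<ominus>\<^bsub>\<G> n\<^esub> y) s = \<ominus>\<^bsub>\<C> s (n - s)\<^esub> y s"
    using M.M.minus_equality cy cn by metis
  then show ?thesis
    using assms(4,5) Cpq_apply(3)[OF cy cy zero_closed assms(4,5)]
    by (simp add: a_minus_def GS_apply(1)[OF assms(3)] Cpq_sel)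
qed

text \<open>
  The \<open>\<epsilon>\<close>-coefficient of \<open>g (u\<^sup>* a) \<tau> = \<tau> u\<^sup>* (g a)\<close> for \<open>g = 1 + g\<^sub>1 \<epsilon>\<close> and \<open>\<tau> = 1 + \<tau>\<^sub>1 \<epsilon>\<close> between the
  deformations given by \<open>x\<close> and \<open>x'\<close>.
\<close>

definition tau_natural_at :: "(nat \<Rightarrow> ('uo, 'ua, 'o, 'm) cochain) \<Rightarrow> (nat \<Rightarrow> ('uo, 'ua, 'o, 'm) cochain) \<Rightarrow>
    ('uo, 'ua, 'o, 'm) cochain \<Rightarrow> ('uo, 'ua, 'o, 'm) cochain \<Rightarrow> 'ua \<Rightarrow> 'm \<Rightarrow> bool" where
  "tau_natural_at x x' g t u a \<longleftrightarrow>
     (let V = Dom \<U> u; A = Dom (\<F> (Cod \<U> u)) a; B = Cod (\<F> (Cod \<U> u)) a;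
        M = \<H> V (res_ob \<A> u A) (res_ob \<A> u B) in
      x 1 (V, [u]) (A, [a]) \<oplus>\<^bsub>M\<^esub> (g (V, []) (res_ob \<A> u A, [res_mor \<A> u a])
          \<oplus>\<^bsub>M\<^esub> (res_mor \<A> u a \<bullet>\<^bsub>\<F> V\<^esub> t (V, [u]) (A, [])))
      = x' 1 (V, [u]) (A, [a]) \<oplus>\<^bsub>M\<^esub> (res_mor \<A> u (g (Cod \<U> u, []) (A, [a]))
          \<oplus>\<^bsub>M\<^esub> (t (V, [u]) (B, []) \<bullet>\<^bsub>\<F> V\<^esub> res_mor \<A> u a)))"

text \<open>
  The \<open>\<epsilon>\<close>-coefficient of \<open>\<tau>\<^bsup>vu\<^esup> c\<^bsup>v,u\<^esup> = g (c\<^bsup>v,u\<^esup>) \<tau>\<^sup>u u\<^sup>* (\<tau>\<^sup>v)\<close>.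
\<close>

definition tau_coherent_at :: "(nat \<Rightarrow> ('uo, 'ua, 'o, 'm) cochain) \<Rightarrow> (nat \<Rightarrow> ('uo, 'ua, 'o, 'm) cochain) \<Rightarrow>
    ('uo, 'ua, 'o, 'm) cochain \<Rightarrow> ('uo, 'ua, 'o, 'm) cochain \<Rightarrow> 'ua \<Rightarrow> 'ua \<Rightarrow> 'o \<Rightarrow> bool" where
  "tau_coherent_at x x' g t u v A \<longleftrightarrow>
     (let V = Dom \<U> u; M = \<H> V (res_ob \<A> u (res_ob \<A> v A)) (res_ob \<A> (v \<bullet>\<^bsub>\<U>\<^esub> u) A) in
      x' 2 (V, [u, v]) (A, []) \<oplus>\<^bsub>M\<^esub> (t (V, [v \<bullet>\<^bsub>\<U>\<^esub> u]) (A, []) \<bullet>\<^bsub>\<F> V\<^esub> twist \<A> v u A)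
      = x 2 (V, [u, v]) (A, []) \<oplus>\<^bsub>M\<^esub> (g (V, []) (res_ob \<A> u (res_ob \<A> v A), [twist \<A> v u A]) \<oplus>\<^bsub>M\<^esub>
        ((twist \<A> v u A \<bullet>\<^bsub>\<F> V\<^esub> res_mor \<A> u (t (Cod \<U> u, [v]) (A, []))) \<oplus>\<^bsub>M\<^esub>
         (twist \<A> v u A \<bullet>\<^bsub>\<F> V\<^esub> t (V, [u]) (res_ob \<A> v A, [])))))"

text \<open>
  The cochain contains \<open>-\<tau>\<^sub>1\<close> because the terms in \<open>g\<^sub>1\<close> and those in \<open>\<tau>\<^sub>1\<close> have opposite relative
  signs in the differential and in the equations of a morphism.
\<close>

lemma coboundary_iff:
  assumes "x \<in> carrier (\<G> 2)" "x' \<in> carrier (\<G> 2)"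
    and g: "g \<in> carrier (\<C> 0 1)" and t: "t \<in> carrier (\<C> 1 0)"
  shows "\<delta> 1 (cochain1 g (\<ominus>\<^bsub>\<C> 1 0\<^esub> t)) = x \<ominus>\<^bsub>\<G> 2\<^esub> x' \<longleftrightarrow>
    (\<forall>U \<in> Ob \<U>. functor_cochain.eta_multiplicative (\<F> U) (\<F> U) (\<lambda>A. A) (\<lambda>a. a) (g (U, [])) (x 0 (U, []))
      (x' 0 (U, []))) \<and>
    (\<forall>u \<in> Ar \<U>. \<forall>a \<in> Ar (\<F> (Cod \<U> u)). tau_natural_at x x' g t u a) \<and>
    (\<forall>u \<in> Ar \<U>. \<forall>v \<in> Ar \<U>. Dom \<U> v = Cod \<U> u \<longrightarrow> (\<forall>A \<in> Ob (\<F> (Cod \<U> v)). tau_coherent_at x x' g t u v A))"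
proof -
  interpret G: module R "\<G> 2" by (rule GS_module)
  interpret M: module R "\<C> 1 0" by (rule Cpq_module)
  define t' where "t' = \<ominus>\<^bsub>\<C> 1 0\<^esub> t"
  define y where "y = cochain1 g t'"
  have t': "t' \<in> carrier (\<C> 1 0)" unfolding t'_def using M.M.a_inv_closed[OF t] .
  have Y: "y 0 \<in> carrier (\<C> 0 1)" "y 1 \<in> carrier (\<C> 1 0)" using g t' by (simp_all only: y_def cochain_sel)
  have y: "y 0 = g" "y 1 = t'" by (simp_all only: y_def cochain_sel)
  have tv: "t' (V, [u]) (A, []) = \<ominus>\<^bsub>\<H> V (res_ob \<A> u A) (res_ob \<A> u A)\<^esub> t (V, [u]) (A, [])"
    if "u \<in> Ar \<U>" "Dom \<U> u = V" "A \<in> Ob (\<F> (Cod \<U> u))" for V u A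
    unfolding t'_def using Cpq_apply(3)[OF t t zero_closed, of "(V, [u])" "(A, [])"] that
    by (auto simp: small_rules)
  note X = GS_2_D[OF assms(1)] and X' = GS_2_D[OF assms(2)]
  note tys = C02_type[OF X(1)] C11_type[OF X(2), unfolded One_nat_def] C20_type[OF X(3)]
    C02_type[OF X'(1)] C11_type[OF X'(2), unfolded One_nat_def] C20_type[OF X'(3)]
    C01_type[OF g] C10_type[OF t, unfolded One_nat_def] C10_type[OF t', unfolded One_nat_def]
  define w where "w = x \<ominus>\<^bsub>\<G> (1 + 1)\<^esub> x'"
  have w: "w \<in> carrier (\<G> (1 + 1))"
    unfolding w_def using G.M.minus_closed[OF assms(1,2)] by (simp add: numeral_2_eq_2)
  have wv: "w s \<sigma> a = x s \<sigma> a \<oplus>\<^bsub>\<V> \<sigma> a\<^esub> \<ominus>\<^bsub>\<V> \<sigma> a\<^esub> x' s \<sigma> a"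
    if "s \<le> 2" "\<sigma> \<in> simplices \<U> s" "a \<in> rsimplices (\<T> \<sigma>) (2 - s)" for s \<sigma> a
    unfolding w_def using GS_minus_apply[OF assms(1,2) that] by (simp add: numeral_2_eq_2)
  let ?P = "\<lambda>s. \<forall>\<sigma> \<in> simplices \<U> s. \<forall>a \<in> rsimplices (\<T> \<sigma>) (2 - s).
    gs_val \<U> \<A> 1 y s \<sigma> a = x s \<sigma> a \<oplus>\<^bsub>\<V> \<sigma> a\<^esub> \<ominus>\<^bsub>\<V> \<sigma> a\<^esub> x' s \<sigma> a"
  have all: "(\<forall>s \<le> 2. Q s) \<longleftrightarrow> Q 0 \<and> Q 1 \<and> Q 2" for Q :: "nat \<Rightarrow> bool"
    by (auto simp: numeral_2_eq_2 le_Suc_eq)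
  have "\<delta> 1 y = w \<longleftrightarrow> (\<forall>s \<le> 2. ?P s)"
    using wv unfolding gs_d_eq_iff[OF w] by (simp add: numeral_2_eq_2)
  then have iff: "\<delta> 1 y = w \<longleftrightarrow> ?P 0 \<and> ?P 1 \<and> ?P 2" unfolding all .
  note rules = small_rules fib_hdif fib_hdif_eq res_hdif fib_dist fib_group fib_ac tys y[unfolded One_nat_def] tv
  have 0: "?P 0 \<longleftrightarrow> (\<forall>U \<in> Ob \<U>. functor_cochain.eta_multiplicative (\<F> U) (\<F> U) (\<lambda>A. A) (\<lambda>a. a) (g (U, [])) (x
      0 (U, [])) (x' 0 (U, [])))"
    (is "_ \<longleftrightarrow> ?Q0")
  proof -
    have "?P 0 \<longleftrightarrow> (\<forall>U \<in> Ob \<U>. \<forall>a \<in> Ar (\<F> U). \<forall>b \<in> Ar (\<F> U). Dom (\<F> U) b = Cod (\<F> U) a \<longrightarrow>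
        gs_val \<U> \<A> 1 y 0 (U, []) (Dom (\<F> U) a, [b, a]) = x 0 (U, []) (Dom (\<F> U) a, [b, a])
          \<oplus>\<^bsub>\<H> U (Dom (\<F> U) a) (Cod (\<F> U) b)\<^esub>
          \<ominus>\<^bsub>\<H> U (Dom (\<F> U) a) (Cod (\<F> U) b)\<^esub> x' 0 (U, []) (Dom (\<F> U) a, [b, a]))"
      by (simp add: \<U>.simplices_small) (auto simp: small_rules)
    also have "\<dots> \<longleftrightarrow> ?Q0"
      by (intro ball_cong refl, subst functor_cochain.eta_multiplicative_def[OF C01_functor[OF g]], assumption,
         intro ball_cong refl imp_cong)
        (auto simp: gs_val_1_0[OF Y, unfolded One_nat_def] rules)
    finally show ?thesis .
  qed
  have 1: "?P 1 \<longleftrightarrow> (\<forall>u \<in> Ar \<U>. \<forall>a \<in> Ar (\<F> (Cod \<U> u)). tau_natural_at x x' g t u a)"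
    (is "_ \<longleftrightarrow> ?Q1")
  proof -
    have "?P 1 \<longleftrightarrow> (\<forall>u \<in> Ar \<U>. \<forall>a \<in> Ar (\<F> (Cod \<U> u)).
        gs_val \<U> \<A> 1 y 1 (Dom \<U> u, [u]) (Dom (\<F> (Cod \<U> u)) a, [a]) = x 1 (Dom \<U> u, [u]) (Dom (\<F> (Cod \<U> u)) a, [a])
          \<oplus>\<^bsub>\<H> (Dom \<U> u) (res_ob \<A> u (Dom (\<F> (Cod \<U> u)) a)) (res_ob \<A> u (Cod (\<F> (Cod \<U> u)) a))\<^esub>
          \<ominus>\<^bsub>\<H> (Dom \<U> u) (res_ob \<A> u (Dom (\<F> (Cod \<U> u)) a)) (res_ob \<A> u (Cod (\<F> (Cod \<U> u)) a))\<^esub>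
            x' 1 (Dom \<U> u, [u]) (Dom (\<F> (Cod \<U> u)) a, [a]))"
      by (simp add: \<U>.simplices_small) (auto simp: small_rules)
    also have "\<dots> \<longleftrightarrow> ?Q1" unfolding tau_natural_at_def Let_def
      by (intro ball_cong refl) (auto simp: gs_val_1_1[OF Y, unfolded One_nat_def] rules)
    finally show ?thesis .
  qed
  have 2: "?P 2 \<longleftrightarrow> (\<forall>u \<in> Ar \<U>. \<forall>v \<in> Ar \<U>. Dom \<U> v = Cod \<U> u \<longrightarrow> (\<forall>A \<in> Ob (\<F> (Cod \<U> v)). tau_coherent_at x x' g
      t u v A))" (is "_ \<longleftrightarrow> ?Q2")
  proof -
    have "?P 2 \<longleftrightarrow> (\<forall>u \<in> Ar \<U>. \<forall>v \<in> Ar \<U>. Dom \<U> v = Cod \<U> u \<longrightarrow> (\<forall>A \<in> Ob (\<F> (Cod \<U> v)).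
        gs_val \<U> \<A> 1 y 2 (Dom \<U> u, [u, v]) (A, []) = x 2 (Dom \<U> u, [u, v]) (A, [])
          \<oplus>\<^bsub>\<H> (Dom \<U> u) (res_ob \<A> u (res_ob \<A> v A)) (res_ob \<A> (v \<bullet>\<^bsub>\<U>\<^esub> u) A)\<^esub>
          \<ominus>\<^bsub>\<H> (Dom \<U> u) (res_ob \<A> u (res_ob \<A> v A)) (res_ob \<A> (v \<bullet>\<^bsub>\<U>\<^esub> u) A)\<^esub> x' 2 (Dom \<U> u, [u, v]) (A, [])))"
      by (simp add: \<U>.simplices_small) (auto simp: small_rules)
    also have "\<dots> \<longleftrightarrow> ?Q2" unfolding tau_coherent_at_def Let_def
      by (intro ball_cong refl imp_cong) (auto simp: gs_val_1_2[OF Y, unfolded One_nat_def] rules)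
    finally show ?thesis .
  qed
  have "w = x \<ominus>\<^bsub>\<G> 2\<^esub> x'" by (simp add: w_def numeral_2_eq_2)
  then show ?thesis using iff[unfolded 0 1 2] unfolding y_def t'_def by blast
qed

lemma cocycle_deform_cat:
  assumes "x \<in> carrier (\<N> 2)" "\<delta> 2 x = \<zero>\<^bsub>\<G> 3\<^esub>" "U \<in> Ob \<U>"
  shows "category (deform_cat (\<F> U) (x 0 (U, [])))"
proof -
  have "x \<in> carrier (\<G> 2)" using assms(1) unfolding GSnr_2_iff by blast
  then interpret B: prestack "dual_ring R" \<U> "deform \<U> \<A> (x 0) (x 1) (x 2)"
    using deform_prestack_iff assms by blast
  show ?thesis using B.fib_cat[OF assms(3)] by (simp add: deform_sel)
qed

text \<open>
  Each clause of the definition of a morphism matches one equation of \<open>coboundary_iff\<close> or one unit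
  condition. That the target cocycle is normalized is used when \<open>\<tau>\<close>, whose degree zero part is an
  identity, is composed in the target.
\<close>

lemma deform_morphism_iff:
  assumes x: "x \<in> carrier (\<N> 2)" "\<delta> 2 x = \<zero>\<^bsub>\<G> 3\<^esub>"
    and x': "x' \<in> carrier (\<N> 2)" "\<delta> 2 x' = \<zero>\<^bsub>\<G> 3\<^esub>"
    and g: "g \<in> carrier (\<C> 0 1)" and t: "t \<in> carrier (\<C> 1 0)"
  shows "prestack_morphism (dual_ring R) \<U> (deform \<U> \<A> (x 0) (x 1) (x 2)) (deform \<U> \<A> (x' 0) (x' 1) (x' 2))
      (deform_mor \<U> \<A> g t) \<longleftrightarrow>
    normalized \<U> \<A> 0 1 g \<and> reduced \<U> \<A> 1 0 t \<and>
    \<delta> 1 (cochain1 g (\<ominus>\<^bsub>\<C> 1 0\<^esub> t)) = x \<ominus>\<^bsub>\<G> 2\<^esub> x'"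
    (is "prestack_morphism _ _ ?B ?B' ?g \<longleftrightarrow> _")
proof -
  have gs: "x \<in> carrier (\<G> 2)" "x' \<in> carrier (\<G> 2)"
    using x x' unfolding GSnr_2_iff by blast+
  note X = GS_2_D[OF gs(1)] and X' = GS_2_D[OF gs(2)]
  note H = C02_hoch[OF X(1)] and H' = C02_hoch[OF X'(1)]
  note E = cocycle_deform_cat[OF x] and E' = cocycle_deform_cat[OF x']
  note Esel = hoch_cochain.E_sel[OF H] hoch_cochain.dual_sel[OF H] hoch_cochain.E_sel[OF H']
      hoch_cochain.dual_sel[OF H']
  note tys = C02_type[OF X(1)] C11_type[OF X(2), unfolded One_nat_def] C20_type[OF X(3)]
    C02_type[OF X'(1)] C11_type[OF X'(2), unfolded One_nat_def] C20_type[OF X'(3)]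
    C01_type[OF g] C10_type[OF t, unfolded One_nat_def]
  have un: "x' 0 (U, []) (A, [Ident (\<F> U) B, a]) = \<zero>\<^bsub>\<H> U A B\<^esub>"
    "x' 0 (U, []) (A, [a, Ident (\<F> U) A]) = \<zero>\<^bsub>\<H> U A B\<^esub>"
    if "U \<in> Ob \<U>" "a \<in> Ar (\<F> U)" "Dom (\<F> U) a = A" "Cod (\<F> U) a = B" for U a A B
    using x'(1) that unfolding GSnr_2_iff normalized_reduced_small by auto
  have un1: "x' 1 (V, [u]) (A, [Ident (\<F> W) A]) = \<zero>\<^bsub>\<H> V (res_ob \<A> u A) (res_ob \<A> u A)\<^esub>"
    if "u \<in> Ar \<U>" "Dom \<U> u = V" "Cod \<U> u = W" "A \<in> Ob (\<F> W)" for u V W A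
    using x'(1) that unfolding GSnr_2_iff normalized_reduced_small by auto
  note rules = Esel ps_rules tys fib_dist fib_group deform_sel deform_mor_sel un un1[unfolded One_nat_def]
  let ?Q0 = "(\<forall>U \<in> Ob \<U>. functor_cochain.eta_multiplicative (\<F> U) (\<F> U) (\<lambda>A. A) (\<lambda>a. a) (g (U, [])) (x 0 (U,
      [])) (x' 0 (U, [])))"
  let ?Q1 = "\<forall>u \<in> Ar \<U>. \<forall>a \<in> Ar (\<F> (Cod \<U> u)). tau_natural_at x x' g t u a"
  let ?Q2 = "\<forall>u \<in> Ar \<U>. \<forall>v \<in> Ar \<U>. Dom \<U> v = Cod \<U> u \<longrightarrow> (\<forall>A \<in> Ob (\<F> (Cod \<U> v)). tau_coherent_at x x' g t u v A)"
  have 0: "(\<forall>U \<in> Ob \<U>. linear_functor (dual_ring R) (fib ?B U) (fib ?B' U) (on_ob ?g U) (on_mor ?g U))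
     \<longleftrightarrow> normalized \<U> \<A> 0 1 g \<and> ?Q0"
  proof -
    have "linear_functor (dual_ring R) (fib ?B U) (fib ?B' U) (on_ob ?g U) (on_mor ?g U) \<longleftrightarrow>
        functor_cochain.eta_unital (\<F> U) (\<F> U) (\<lambda>A. A) (g (U, [])) \<and>
        functor_cochain.eta_multiplicative (\<F> U) (\<F> U) (\<lambda>A. A) (\<lambda>a. a) (g (U, [])) (x 0 (U, [])) (x' 0 (U, []))"
      if U: "U \<in> Ob \<U>" for U
      unfolding deform_sel deform_mor_sel
      using functor_cochain.deform_functor_iff[OF C01_functor[OF g U] H[OF U] H'[OF U] E[OF U] E'[OF U]]
      by (simp add: deform_mor_def Let_def)
    then show ?thesis
      unfolding normalized_reduced_small using functor_cochain.eta_unital_def[OF C01_functor[OF g]] by blast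
  qed
  have 1: "(\<forall>u \<in> Ar \<U>. \<forall>A \<in> Ob (fib ?B (Cod \<U> u)).
        tau ?g u A \<in> Homs (fib ?B' (Dom \<U> u)) (res_ob ?B' u (on_ob ?g (Cod \<U> u) A)) (on_ob ?g (Dom \<U> u)
            (res_ob ?B u A)))"
    by (auto simp: rules mem_Homs)
  have 2: "(\<forall>u \<in> Ar \<U>. \<forall>A \<in> Ob (fib ?B (Cod \<U> u)). \<forall>B \<in> Ob (fib ?B (Cod \<U> u)). \<forall>a \<in> Homs (fib ?B (Cod \<U> u)) A B.
        on_mor ?g (Dom \<U> u) (res_mor ?B u a) \<bullet>\<^bsub>fib ?B' (Dom \<U> u)\<^esub> tau ?g u A
          = tau ?g u B \<bullet>\<^bsub>fib ?B' (Dom \<U> u)\<^esub> res_mor ?B' u (on_mor ?g (Cod \<U> u) a)) \<longleftrightarrow> ?Q1" (is "?L1 \<longleftrightarrow> _")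
  proof
    assume L: ?L1
    show ?Q1
    proof (intro ballI)
      fix u a assume a: "u \<in> Ar \<U>" "a \<in> Ar (\<F> (Cod \<U> u))"
      let ?A = "Dom (\<F> (Cod \<U> u)) a" and ?B1 = "Cod (\<F> (Cod \<U> u)) a"
      let ?z = "(a, \<zero>\<^bsub>\<H> (Cod \<U> u) ?A ?B1\<^esub>)"
      have "?A \<in> Ob (fib ?B (Cod \<U> u))" "?B1 \<in> Ob (fib ?B (Cod \<U> u))" "?z \<in> Homs (fib ?B (Cod \<U> u)) ?A ?B1"
        using a by (auto simp: rules mem_Homs)
      with L a(1) have "on_mor ?g (Dom \<U> u) (res_mor ?B u ?z) \<bullet>\<^bsub>fib ?B' (Dom \<U> u)\<^esub> tau ?g u ?A
          = tau ?g u ?B1 \<bullet>\<^bsub>fib ?B' (Dom \<U> u)\<^esub> res_mor ?B' u (on_mor ?g (Cod \<U> u) ?z)" by blast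
      then show "tau_natural_at x x' g t u a"
        unfolding tau_natural_at_def Let_def
        using a by (simp add: rules fib_ac)
    qed
  next
    assume Q: ?Q1
    show ?L1
    proof (intro ballI)
      fix u A B a assume a: "u \<in> Ar \<U>" "a \<in> Homs (fib ?B (Cod \<U> u)) A B"
      then obtain a1 a2 where e: "a = (a1, a2)" and s: "a1 \<in> Ar (\<F> (Cod \<U> u))" "a2 \<in> Ar (\<F> (Cod \<U> u))"
        "Dom (\<F> (Cod \<U> u)) a1 = A" "Dom (\<F> (Cod \<U> u)) a2 = A" "Cod (\<F> (Cod \<U> u)) a1 = B" "Cod (\<F> (Cod \<U> u)) a2 = B"
        by (auto simp: rules mem_Homs)
      have ob: "A \<in> Ob (\<F> (Cod \<U> u))" "B \<in> Ob (\<F> (Cod \<U> u))"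
        using s a(1) by (auto simp: ps_rules)
      let ?V = "Dom \<U> u"
      let ?M = "\<H> ?V (res_ob \<A> u A) (res_ob \<A> u B)"
      let ?L = "x 1 (?V, [u]) (A, [a1]) \<oplus>\<^bsub>?M\<^esub> (g (?V, []) (res_ob \<A> u A, [res_mor \<A> u a1])
          \<oplus>\<^bsub>?M\<^esub> (res_mor \<A> u a1 \<bullet>\<^bsub>\<F> ?V\<^esub> t (?V, [u]) (A, [])))"
      let ?R = "x' 1 (?V, [u]) (A, [a1]) \<oplus>\<^bsub>?M\<^esub> (res_mor \<A> u (g (Cod \<U> u, []) (A, [a1]))
          \<oplus>\<^bsub>?M\<^esub> (t (?V, [u]) (B, []) \<bullet>\<^bsub>\<F> ?V\<^esub> res_mor \<A> u a1))"
      have "?L = ?R" using Q a(1) s unfolding tau_natural_at_def Let_def by auto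
      moreover have "on_mor ?g (Dom \<U> u) (res_mor ?B u a) \<bullet>\<^bsub>fib ?B' (Dom \<U> u)\<^esub> tau ?g u A
          = (res_mor \<A> u a1, res_mor \<A> u a2 \<oplus>\<^bsub>?M\<^esub> ?L)"
        using a(1) s ob by (simp add: e rules fib_ac)
      moreover have "tau ?g u B \<bullet>\<^bsub>fib ?B' (Dom \<U> u)\<^esub> res_mor ?B' u (on_mor ?g (Cod \<U> u) a)
          = (res_mor \<A> u a1, res_mor \<A> u a2 \<oplus>\<^bsub>?M\<^esub> ?R)"
        using a(1) s ob by (simp add: e rules fib_ac)
      ultimately show "on_mor ?g (Dom \<U> u) (res_mor ?B u a) \<bullet>\<^bsub>fib ?B' (Dom \<U> u)\<^esub> tau ?g u A
          = tau ?g u B \<bullet>\<^bsub>fib ?B' (Dom \<U> u)\<^esub> res_mor ?B' u (on_mor ?g (Cod \<U> u) a)" by simp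
    qed
  qed
  have 3: "(\<forall>u \<in> Ar \<U>. \<forall>v \<in> Ar \<U>. Cod \<U> v = Dom \<U> u \<longrightarrow> (\<forall>A \<in> Ob (fib ?B (Cod \<U> u)).
        tau ?g (u \<bullet>\<^bsub>\<U>\<^esub> v) A \<bullet>\<^bsub>fib ?B' (Dom \<U> v)\<^esub> twist ?B' u v (on_ob ?g (Cod \<U> u) A)
          = on_mor ?g (Dom \<U> v) (twist ?B u v A) \<bullet>\<^bsub>fib ?B' (Dom \<U> v)\<^esub>
              (tau ?g v (res_ob ?B u A) \<bullet>\<^bsub>fib ?B' (Dom \<U> v)\<^esub> res_mor ?B' v (tau ?g u A)))) \<longleftrightarrow> ?Q2" (is "?L2 \<longleftrightarrow> _")
  proof -
    have *: "tau ?g (v \<bullet>\<^bsub>\<U>\<^esub> u) A \<bullet>\<^bsub>fib ?B' (Dom \<U> u)\<^esub> twist ?B' v u (on_ob ?g (Cod \<U> v) A)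
          = on_mor ?g (Dom \<U> u) (twist ?B v u A) \<bullet>\<^bsub>fib ?B' (Dom \<U> u)\<^esub>
              (tau ?g u (res_ob ?B v A) \<bullet>\<^bsub>fib ?B' (Dom \<U> u)\<^esub> res_mor ?B' u (tau ?g v A)) \<longleftrightarrow>
      tau_coherent_at x x' g t u v A"
      if "u \<in> Ar \<U>" "v \<in> Ar \<U>" "Dom \<U> v = Cod \<U> u" "A \<in> Ob (\<F> (Cod \<U> v))" for u v A
      unfolding tau_coherent_at_def Let_def using that by (simp add: rules fib_ac)
    have "?L2 \<longleftrightarrow> (\<forall>u \<in> Ar \<U>. \<forall>v \<in> Ar \<U>. Dom \<U> v = Cod \<U> u \<longrightarrow> (\<forall>A \<in> Ob (\<F> (Cod \<U> v)).
        tau ?g (v \<bullet>\<^bsub>\<U>\<^esub> u) A \<bullet>\<^bsub>fib ?B' (Dom \<U> u)\<^esub> twist ?B' v u (on_ob ?g (Cod \<U> v) A)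
          = on_mor ?g (Dom \<U> u) (twist ?B v u A) \<bullet>\<^bsub>fib ?B' (Dom \<U> u)\<^esub>
              (tau ?g u (res_ob ?B v A) \<bullet>\<^bsub>fib ?B' (Dom \<U> u)\<^esub> res_mor ?B' u (tau ?g v A))))"
    proof -
      have "Ob (fib ?B U) = Ob (\<F> U)" for U by (simp add: deform_sel deform_cat_def)
      then show ?thesis by metis
    qed
    then show ?thesis using * by simp
  qed
  have 4: "(\<forall>U \<in> Ob \<U>. \<forall>A \<in> Ob (fib ?B U). tau ?g (Ident \<U> U) A = Ident (fib ?B' U) (on_ob ?g U A))
      \<longleftrightarrow> reduced \<U> \<A> 1 0 t"
    unfolding normalized_reduced_small by (auto simp: rules)
  show ?thesis
    unfolding prestack_morphism_def 0 2 3 4 coboundary_iff[OF gs g t] using 1 by auto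
qed

section \<open>Degenerate values\<close>

lemma gs_d_1_linear:
  assumes "x \<in> carrier (\<G> 1)" "y \<in> carrier (\<G> 1)" "r \<in> carrier R"
  shows "\<delta> 1 (x \<oplus>\<^bsub>\<G> 1\<^esub> y) = \<delta> 1 x \<oplus>\<^bsub>\<G> 2\<^esub> \<delta> 1 y"
    "\<delta> 1 (r \<odot>\<^bsub>\<G> 1\<^esub> x) = r \<odot>\<^bsub>\<G> 2\<^esub> \<delta> 1 x"
proof -
  interpret G: module R "\<G> 2" by (rule GS_module)
  have 2: "(1::nat) + 1 = 2" by simp
  note iff = gs_d_eq_iff[of _ 1, unfolded 2]
  show "\<delta> 1 (x \<oplus>\<^bsub>\<G> 1\<^esub> y) = \<delta> 1 x \<oplus>\<^bsub>\<G> 2\<^esub> \<delta> 1 y"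
    unfolding iff[OF G.M.a_closed[OF gs_d_1_closed[OF assms(1)] gs_d_1_closed[OF assms(2)]]]
    using gs_val_1_linear(1)[OF assms] by (auto simp only: GS_apply(1) Cpq_sel mk_cochain_apply gs_d_1_apply)
  show "\<delta> 1 (r \<odot>\<^bsub>\<G> 1\<^esub> x) = r \<odot>\<^bsub>\<G> 2\<^esub> \<delta> 1 x"
    unfolding iff[OF G.smult_closed[OF assms(3) gs_d_1_closed[OF assms(1)]]]
    using gs_val_1_linear(2)[OF assms] by (auto simp only: GS_apply(2) Cpq_sel mk_cochain_apply gs_d_1_apply)
qed

text \<open>
  Linearity of the differential in degree two, restricted to its kernel: this is all that the
  cohomology in degree two requires of it.
\<close>

lemma gs_d_2_kernel:
  assumes "x \<in> carrier (\<G> 2)" "y \<in> carrier (\<G> 2)" "r \<in> carrier R"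
    and d: "\<delta> 2 x = \<zero>\<^bsub>\<G> 3\<^esub>" "\<delta> 2 y = \<zero>\<^bsub>\<G> 3\<^esub>"
  shows "\<delta> 2 (x \<oplus>\<^bsub>\<G> 2\<^esub> y) = \<zero>\<^bsub>\<G> 3\<^esub>"
    "\<delta> 2 (r \<odot>\<^bsub>\<G> 2\<^esub> x) = \<zero>\<^bsub>\<G> 3\<^esub>"
proof -
  have 3: "(2::nat) + 1 = 3" by simp
  note iff = gs_d_zero_iff[of 2, unfolded 3]
  have "gs_val \<U> \<A> 2 (x \<oplus>\<^bsub>\<G> 2\<^esub> y) s \<sigma> a = \<zero>\<^bsub>\<V> \<sigma> a\<^esub> \<and>
      gs_val \<U> \<A> 2 (r \<odot>\<^bsub>\<G> 2\<^esub> x) s \<sigma> a = \<zero>\<^bsub>\<V> \<sigma> a\<^esub>"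
    if s: "s \<le> 3" "\<sigma> \<in> simplices \<U> s" "a \<in> rsimplices (\<T> \<sigma>) (3 - s)" for s \<sigma> a
  proof -
    interpret V: module R "\<V> \<sigma> a" by (rule val_mod_module[OF s(2,3)])
    show ?thesis
      using gs_val_2_linear[OF assms(1-3) s] d[unfolded iff] s assms(3) by simp
  qed
  then show "\<delta> 2 (x \<oplus>\<^bsub>\<G> 2\<^esub> y) = \<zero>\<^bsub>\<G> 3\<^esub>"
    "\<delta> 2 (r \<odot>\<^bsub>\<G> 2\<^esub> x) = \<zero>\<^bsub>\<G> 3\<^esub>"
    unfolding iff by blast+
qed

lemma gs_d_2_zero: "\<delta> 2 \<zero>\<^bsub>\<G> 2\<^esub> = \<zero>\<^bsub>\<G> 3\<^esub>"
proof -
  interpret G1: module R "\<G> 1" by (rule GS_module)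
  interpret G: module R "\<G> 2" by (rule GS_module)
  have "\<zero>\<^bsub>\<G> 2\<^esub> = \<zero>\<^bsub>R\<^esub> \<odot>\<^bsub>\<G> 2\<^esub> \<delta> 1 \<zero>\<^bsub>\<G> 1\<^esub>"
    using gs_d_1_closed[OF G1.M.zero_closed] by simp
  also have "\<dots> = \<delta> 1 (\<zero>\<^bsub>R\<^esub> \<odot>\<^bsub>\<G> 1\<^esub> \<zero>\<^bsub>\<G> 1\<^esub>)"
    using gs_d_1_linear(2)[OF G1.M.zero_closed G1.M.zero_closed zero_closed] by simp
  finally show ?thesis
    using gs_d_gs_d[OF G1.smult_closed[OF zero_closed G1.M.zero_closed]] by metis
qed

lemma GSnr_closed:
  assumes "x \<in> carrier (\<N> n)" "y \<in> carrier (\<N> n)" "r \<in> carrier R"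
  shows "x \<oplus>\<^bsub>\<G> n\<^esub> y \<in> carrier (\<N> n)" "r \<odot>\<^bsub>\<G> n\<^esub> x \<in> carrier (\<N> n)"
proof -
  interpret G: module R "\<G> n" by (rule GS_module)
  have xy: "x \<in> carrier (\<G> n)" "y \<in> carrier (\<G> n)"
    "\<And>p. p \<le> n \<Longrightarrow> normalized \<U> \<A> p (n - p) (x p) \<and> reduced \<U> \<A> p (n - p) (x p)"
    "\<And>p. p \<le> n \<Longrightarrow> normalized \<U> \<A> p (n - p) (y p) \<and> reduced \<U> \<A> p (n - p) (y p)"
    using assms by (auto simp: GSnr_def)
  have zz: "\<zero>\<^bsub>\<V> \<sigma> a\<^esub> \<oplus>\<^bsub>\<V> \<sigma> a\<^esub> \<zero>\<^bsub>\<V> \<sigma> a\<^esub> = \<zero>\<^bsub>\<V> \<sigma> a\<^esub>"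
    "r \<odot>\<^bsub>\<V> \<sigma> a\<^esub> \<zero>\<^bsub>\<V> \<sigma> a\<^esub> = \<zero>\<^bsub>\<V> \<sigma> a\<^esub>"
    if s: "\<sigma> \<in> simplices \<U> s" "a \<in> rsimplices (\<T> \<sigma>) q" for s q \<sigma> a
  proof -
    interpret V: module R "\<V> \<sigma> a" by (rule val_mod_module[OF s])
    show "\<zero>\<^bsub>\<V> \<sigma> a\<^esub> \<oplus>\<^bsub>\<V> \<sigma> a\<^esub> \<zero>\<^bsub>\<V> \<sigma> a\<^esub> = \<zero>\<^bsub>\<V> \<sigma> a\<^esub>"
      "r \<odot>\<^bsub>\<V> \<sigma> a\<^esub> \<zero>\<^bsub>\<V> \<sigma> a\<^esub> = \<zero>\<^bsub>\<V> \<sigma> a\<^esub>"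
      using assms(3) by simp_all
  qed
  have nr: "normalized \<U> \<A> p (n - p) ((x \<oplus>\<^bsub>\<G> n\<^esub> y) p) \<and> reduced \<U> \<A> p (n - p) ((x \<oplus>\<^bsub>\<G> n\<^esub> y) p)"
    "normalized \<U> \<A> p (n - p) ((r \<odot>\<^bsub>\<G> n\<^esub> x) p) \<and> reduced \<U> \<A> p (n - p) ((r \<odot>\<^bsub>\<G> n\<^esub> x) p)" if "p \<le> n" for p
    using xy(3,4)[OF that] unfolding GS_apply[OF that] normalized_def reduced_def Cpq_sel
    by (auto simp: zz)
  show "x \<oplus>\<^bsub>\<G> n\<^esub> y \<in> carrier (\<N> n)" "r \<odot>\<^bsub>\<G> n\<^esub> x \<in> carrier (\<N> n)"
    unfolding GSnr_def using nr G.M.a_closed[OF xy(1,2)] G.smult_closed[OF assms(3) xy(1)] by simp_all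
qed

lemma GSnr_zero_closed: "\<zero>\<^bsub>\<G> n\<^esub> \<in> carrier (\<N> n)"
proof -
  interpret G: module R "\<G> n" by (rule GS_module)
  have "normalized \<U> \<A> p (n - p) (\<zero>\<^bsub>\<G> n\<^esub> p) \<and> reduced \<U> \<A> p (n - p) (\<zero>\<^bsub>\<G> n\<^esub> p)" if "p \<le> n" for p
    unfolding GS_apply[OF that] normalized_def reduced_def Cpq_sel by auto
  then show ?thesis unfolding GSnr_def using G.M.zero_closed by simp
qed

text \<open>
  At identities the first component of the coboundary of \<open>(g, t)\<close> is \<open>g(1)\<close>, and the last one
  is \<open>t\<^sup>1 - g(1)\<close>.
\<close>

lemma coboundary_normalized_reduced:
  assumes y: "y \<in> carrier (\<G> 1)" and dy: "\<delta> 1 y \<in> carrier (\<N> 2)"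
  shows "y \<in> carrier (\<N> 1)"
proof -
  note Y = GS_1_D[OF y]
  note tys = C01_type[OF Y(1)] C10_type[OF Y(2), unfolded One_nat_def]
  note nr = dy[unfolded GSnr_2_iff normalized_reduced_small]
  have g: "y 0 (U, []) (A, [Ident (\<F> U) A]) = \<zero>\<^bsub>\<H> U A A\<^esub>" if U: "U \<in> Ob \<U>" "A \<in> Ob (\<F> U)" for U A
  proof -
    interpret C: linear_category R "\<F> U" using fib[OF U(1)] .
    have "\<delta> 1 y 0 (U, []) (A, [Ident (\<F> U) A, Ident (\<F> U) A]) = \<zero>\<^bsub>\<H> U A A\<^esub>"
      using nr[THEN conjunct2, THEN conjunct1] U C.Ident_type[OF U(2)] by metis
    moreover have "\<delta> 1 y 0 (U, []) (A, [Ident (\<F> U) A, Ident (\<F> U) A])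
        = gs_val \<U> \<A> 1 y 0 (U, []) (A, [Ident (\<F> U) A, Ident (\<F> U) A])"
      using U by (intro gs_d_1_apply) (auto simp: small_rules intro!: exI[of _ "Ident (\<F> U) A"])
    ultimately show ?thesis
      using U by (intro C.hadd_idem_zero) (auto simp: gs_val_1_0[OF Y, unfolded One_nat_def] ps_rules tys
          fib_hdif fib_hdif_eq fib_group)
  qed
  have t: "y 1 (U, [Ident \<U> U]) (A, []) = \<zero>\<^bsub>\<H> U A A\<^esub>" if U: "U \<in> Ob \<U>" "A \<in> Ob (\<F> U)" for U A
  proof -
    interpret C: linear_category R "\<F> U" using fib[OF U(1)] .
    have "\<delta> 1 y 2 (U, [Ident \<U> U, Ident \<U> U]) (A, []) = \<zero>\<^bsub>\<H> U A A\<^esub>"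
      using nr U by (metis \<U>.Ident_type res_ob_Ident)
    moreover have "\<delta> 1 y 2 (U, [Ident \<U> U, Ident \<U> U]) (A, [])
        = gs_val \<U> \<A> 1 y 2 (U, [Ident \<U> U, Ident \<U> U]) (A, [])"
      using U by (intro gs_d_1_apply) (auto simp: small_rules intro!: exI[of _ "Ident \<U> U"])
    ultimately show ?thesis
      using U by (intro C.hadd_idem_zero) (auto simp: gs_val_1_2[OF Y, unfolded One_nat_def] ps_rules tys
          fib_hdif fib_hdif_eq fib_group g)
  qed
  show ?thesis unfolding GSnr_1_iff normalized_reduced_small using y g t by auto
qed

text \<open>
  For a cocycle two families of degenerate values determine all others. Associativity at \<open>(1, 1, a)\<close>
  gives \<open>m(1, a) = m(1, 1) a\<close>, and symmetrically for \<open>m(a, 1)\<close>; functoriality at \<open>(1, 1)\<close> gives \<open>f(1)\<close>;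
  naturality for two identities of the base gives \<open>f\<^sup>1(a)\<close>; coherence at \<open>(1, 1, u)\<close> and \<open>(u, 1, 1)\<close>
  gives \<open>c\<^bsup>u,1\<^esup>\<close> and \<open>c\<^bsup>1,u\<^esup>\<close>.
\<close>

lemma cocycle_normalized_reduced:
  assumes x: "x \<in> carrier (\<G> 2)" and dx: "\<delta> 2 x = \<zero>\<^bsub>\<G> 3\<^esub>"
    and m1: "\<And>U A. U \<in> Ob \<U> \<Longrightarrow> A \<in> Ob (\<F> U) \<Longrightarrow>
      x 0 (U, []) (A, [Ident (\<F> U) A, Ident (\<F> U) A]) = \<zero>\<^bsub>\<H> U A A\<^esub>"
    and c1: "\<And>U A. U \<in> Ob \<U> \<Longrightarrow> A \<in> Ob (\<F> U) \<Longrightarrow>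
      x 2 (U, [Ident \<U> U, Ident \<U> U]) (A, []) = \<zero>\<^bsub>\<H> U A A\<^esub>"
  shows "x \<in> carrier (\<N> 2)"
proof -
  note X = GS_2_D[OF x]
  note tys = C02_type[OF X(1)] C11_type[OF X(2), unfolded One_nat_def] C20_type[OF X(3)]
  note H = C02_hoch[OF X(1)] and Fc = C11_functor[OF X(2) _ refl refl]
  note rules = ps_rules tys fib_dist fib_group m1 c1
  have E: "\<And>U. U \<in> Ob \<U> \<Longrightarrow> hoch_cochain.mu_cocycle (\<F> U) (x 0 (U, []))"
     "\<And>u. u \<in> Ar \<U> \<Longrightarrow> functor_cochain.eta_multiplicative (\<F> (Cod \<U> u)) (\<F> (Dom \<U> u)) (res_ob \<A> u)
       (res_mor \<A> u) (x 1 (Dom \<U> u, [u])) (x 0 (Cod \<U> u, [])) (x 0 (Dom \<U> u, []))"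
     "twist_cochain_natural x" "twist_cochain_coherent x"
    using dx unfolding cocycle_iff[OF x] by auto
  have m: "x 0 (U, []) (Dom (\<F> U) a, [Ident (\<F> U) (Cod (\<F> U) a), a]) = \<zero>\<^bsub>\<H> U (Dom (\<F> U) a) (Cod (\<F> U) a)\<^esub>"
    "x 0 (U, []) (Dom (\<F> U) a, [a, Ident (\<F> U) (Dom (\<F> U) a)]) = \<zero>\<^bsub>\<H> U (Dom (\<F> U) a) (Cod (\<F> U) a)\<^esub>"
    if U: "U \<in> Ob \<U>" "a \<in> Ar (\<F> U)" for U a
  proof -
    interpret C: linear_category R "\<F> U" using fib[OF U(1)] .
    note coc = E(1)[OF U(1), unfolded hoch_cochain.mu_cocycle_def[OF H[OF U(1)]], rule_format]
    show "x 0 (U, []) (Dom (\<F> U) a, [Ident (\<F> U) (Cod (\<F> U) a), a]) = \<zero>\<^bsub>\<H> U (Dom (\<F> U) a) (Cod (\<F> U) a)\<^esub>"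
      using coc[of a "Ident (\<F> U) (Cod (\<F> U) a)" "Ident (\<F> U) (Cod (\<F> U) a)"] U
      by (intro C.hadd_idem_zero) (auto simp: rules)
    show "x 0 (U, []) (Dom (\<F> U) a, [a, Ident (\<F> U) (Dom (\<F> U) a)]) = \<zero>\<^bsub>\<H> U (Dom (\<F> U) a) (Cod (\<F> U) a)\<^esub>"
      using coc[of "Ident (\<F> U) (Dom (\<F> U) a)" "Ident (\<F> U) (Dom (\<F> U) a)" a] U
      by (intro C.hadd_idem_zero) (auto simp: rules)
  qed
  have f: "x 1 (Dom \<U> u, [u]) (A, [Ident (\<F> (Cod \<U> u)) A]) = \<zero>\<^bsub>\<H> (Dom \<U> u) (res_ob \<A> u A) (res_ob \<A> u A)\<^esub>"
    if u: "u \<in> Ar \<U>" "A \<in> Ob (\<F> (Cod \<U> u))" for u A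
  proof -
    interpret C: linear_category R "\<F> (Dom \<U> u)" using fib[OF \<U>.Dom_closed[OF u(1)]] .
    show ?thesis
      using E(2)[OF u(1), unfolded functor_cochain.eta_multiplicative_def[OF Fc[OF u(1)]], rule_format,
          of "Ident (\<F> (Cod \<U> u)) A" "Ident (\<F> (Cod \<U> u)) A"] u
      by (intro C.hadd_idem_zero) (auto simp: rules)
  qed
  have f1: "x 1 (U, [Ident \<U> U]) (Dom (\<F> U) a, [a]) = \<zero>\<^bsub>\<H> U (Dom (\<F> U) a) (Cod (\<F> U) a)\<^esub>"
    if U: "U \<in> Ob \<U>" "a \<in> Ar (\<F> U)" for U a
  proof -
    interpret C: linear_category R "\<F> U" using fib[OF U(1)] .
    show ?thesis
      using E(3)[unfolded twist_cochain_natural_def twist_natural_at_def Let_def, rule_format, of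
          "Ident \<U> U" "Ident \<U> U" a] U
      by (intro C.hadd_idem_zero) (auto simp: rules m)
  qed
  have c: "x 2 (Dom \<U> u, [Ident \<U> (Dom \<U> u), u]) (A, []) = \<zero>\<^bsub>\<H> (Dom \<U> u) (res_ob \<A> u A) (res_ob \<A> u A)\<^esub>"
     "x 2 (Dom \<U> u, [u, Ident \<U> (Cod \<U> u)]) (A, []) = \<zero>\<^bsub>\<H> (Dom \<U> u) (res_ob \<A> u A) (res_ob \<A> u A)\<^esub>"
    if u: "u \<in> Ar \<U>" "A \<in> Ob (\<F> (Cod \<U> u))" for u A
  proof -
    interpret C: linear_category R "\<F> (Dom \<U> u)" using fib[OF \<U>.Dom_closed[OF u(1)]] .
    note coh = E(4)[unfolded twist_cochain_coherent_def twist_coherent_at_def Let_def, rule_format]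
    have f': "x (Suc 0) (Dom \<U> u, [Ident \<U> (Dom \<U> u)]) (res_ob \<A> u A, [Ident (\<F> (Dom \<U> u)) (res_ob \<A> u A)])
      = \<zero>\<^bsub>\<H> (Dom \<U> u) (res_ob \<A> u A) (res_ob \<A> u A)\<^esub>"
      using f[of "Ident \<U> (Dom \<U> u)" "res_ob \<A> u A"] u by (simp add: ps_rules)
    have f'': "x (Suc 0) (Dom \<U> u, [u]) (A, [Ident (\<F> (Cod \<U> u)) A])
      = \<zero>\<^bsub>\<H> (Dom \<U> u) (res_ob \<A> u A) (res_ob \<A> u A)\<^esub>"
      using f[OF u] by simp
    show "x 2 (Dom \<U> u, [Ident \<U> (Dom \<U> u), u]) (A, []) = \<zero>\<^bsub>\<H> (Dom \<U> u) (res_ob \<A> u A) (res_ob \<A> u A)\<^esub>"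
      using coh[of "Ident \<U> (Dom \<U> u)" "Ident \<U> (Dom \<U> u)" u A] u
      by (intro C.hadd_idem_zero) (auto simp: rules f')
    show "x 2 (Dom \<U> u, [u, Ident \<U> (Cod \<U> u)]) (A, []) = \<zero>\<^bsub>\<H> (Dom \<U> u) (res_ob \<A> u A) (res_ob \<A> u A)\<^esub>"
      using coh[of u "Ident \<U> (Cod \<U> u)" "Ident \<U> (Cod \<U> u)" A] u
      by (intro C.hadd_idem_zero) (auto simp: rules f'')
  qed
  show ?thesis
    unfolding GSnr_2_iff normalized_reduced_small using x m f f1 c by blast
qed

end

section \<open>Classes and quotients\<close>

text \<open>
  The general form of the classification: \<open>D\<close> is the deformation of a cocycle and \<open>cl\<close> its class.
\<close>

lemma quotient_bij:
  assumes eq: "equiv S E" and D: "D ` Z = S"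
    and iff: "\<And>x y. x \<in> Z \<Longrightarrow> y \<in> Z \<Longrightarrow> (D x, D y) \<in> E \<longleftrightarrow> cl x = cl y"
  shows "\<exists>\<Phi>. bij_betw \<Phi> (cl ` Z) (S // E) \<and> (\<forall>x \<in> Z. \<Phi> (cl x) = E `` {D x})"
proof -
  define \<Phi> where "\<Phi> X = E `` {D (SOME x. x \<in> Z \<and> cl x = X)}" for X
  have \<Phi>: "\<Phi> (cl x) = E `` {D x}" if x: "x \<in> Z" for x
  proof -
    have "(SOME z. z \<in> Z \<and> cl z = cl x) \<in> Z \<and> cl (SOME z. z \<in> Z \<and> cl z = cl x) = cl x"
      by (rule someI[of "\<lambda>z. z \<in> Z \<and> cl z = cl x" x]) (use x in simp)
    then show ?thesis
      unfolding \<Phi>_def using iff x equiv_class_eq[OF eq] by blast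
  qed
  have "bij_betw \<Phi> (cl ` Z) (S // E)"
  proof (rule bij_betwI')
    fix X Y assume "X \<in> cl ` Z" "Y \<in> cl ` Z"
    then obtain x y where "x \<in> Z" "X = cl x" "y \<in> Z" "Y = cl y" by blast
    then show "\<Phi> X = \<Phi> Y \<longleftrightarrow> X = Y"
      using \<Phi> iff D eq_equiv_class_iff[OF eq] by (metis imageI)
  next
    fix X assume "X \<in> cl ` Z"
    then show "\<Phi> X \<in> S // E" using \<Phi> D by (auto intro!: quotientI)
  next
    fix B assume "B \<in> S // E"
    then obtain b where "b \<in> S" "B = E `` {b}" by (rule quotientE)
    then show "\<exists>X \<in> cl ` Z. B = \<Phi> X" using D \<Phi> by auto
  qed
  then show ?thesis using \<Phi> by blast
qed

context module begin

lemma submodule_abelian_subgroup: "submodule N R M \<Longrightarrow> abelian_subgroup N M"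
  by (intro abelian_subgroupI3 additive_subgroup.intro submodule.axioms(1))
      (auto simp: abelian_group_axioms M.abelian_group_axioms)

lemma coset_eq_iff:
  assumes "submodule N R M" "x \<in> carrier M" "y \<in> carrier M"
  shows "N +>\<^bsub>M\<^esub> x = N +>\<^bsub>M\<^esub> y \<longleftrightarrow> x \<ominus>\<^bsub>M\<^esub> y \<in> N"
proof -
  interpret N: abelian_subgroup N M using submodule_abelian_subgroup assms(1) .
  show ?thesis
  proof
    assume "N +>\<^bsub>M\<^esub> x = N +>\<^bsub>M\<^esub> y"
    then have "x \<in> N +>\<^bsub>M\<^esub> y" using N.a_rcos_self[OF assms(2)] by simp
    then show "x \<ominus>\<^bsub>M\<^esub> y \<in> N" using N.a_rcos_module[OF assms(3,2)] by (simp add: a_minus_def)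
  next
    assume "x \<ominus>\<^bsub>M\<^esub> y \<in> N"
    then have "x \<in> N +>\<^bsub>M\<^esub> y" using N.a_rcos_module[OF assms(3,2)] by (simp add: a_minus_def)
    then show "N +>\<^bsub>M\<^esub> x = N +>\<^bsub>M\<^esub> y"
      using M.a_repr_independence[OF _ assms(3) N.a_subgroup] by simp
  qed
qed

lemma coset_smult:
  assumes N: "submodule N R M" and r: "r \<in> carrier R" and x: "x \<in> carrier M"
  shows "(\<Union>x' \<in> N +>\<^bsub>M\<^esub> x. N +>\<^bsub>M\<^esub> (r \<odot>\<^bsub>M\<^esub> x')) = N +>\<^bsub>M\<^esub> (r \<odot>\<^bsub>M\<^esub> x)"
proof -
  interpret N: abelian_subgroup N M using submodule_abelian_subgroup N .
  interpret S: submodule N R M by fact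
  have "N +>\<^bsub>M\<^esub> (r \<odot>\<^bsub>M\<^esub> x') = N +>\<^bsub>M\<^esub> (r \<odot>\<^bsub>M\<^esub> x)" if x': "x' \<in> N +>\<^bsub>M\<^esub> x" for x'
  proof -
    have c: "x' \<in> carrier M" using x' x N.a_elemrcos_carrier by blast
    have "x' \<ominus>\<^bsub>M\<^esub> x \<in> N" using N.a_rcos_module[OF x c] x' by (simp add: a_minus_def)
    then have "r \<odot>\<^bsub>M\<^esub> (x' \<ominus>\<^bsub>M\<^esub> x) \<in> N" using r by simp
    then have "(r \<odot>\<^bsub>M\<^esub> x') \<ominus>\<^bsub>M\<^esub> (r \<odot>\<^bsub>M\<^esub> x) \<in> N"
      using r x c by (simp add: a_minus_def smult_r_distr smult_r_minus)
    then show ?thesis using coset_eq_iff[OF N] r x c by simp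
  qed
  then show ?thesis using N.a_rcos_self[OF x] by blast
qed

end

text \<open>
  The second isomorphism theorem \<open>Z' / (Z' \<inter> N) \<cong> (Z' + N) / N\<close>, for submodules with
  \<open>N' \<inter> Z' = N \<inter> Z'\<close> and \<open>Z' \<subseteq> Z \<subseteq> Z' + N\<close>.
\<close>

lemma quotient_iso:
  fixes R :: "'k ring" and M :: "('k, 'c) module"
  assumes "module R M" and Z': "submodule Z' R M" and N': "submodule N' R M" and Z: "submodule Z R M" and N:
      "submodule N R M"
    and sub: "Z' \<subseteq> Z" and iff: "\<And>x. x \<in> Z' \<Longrightarrow> x \<in> N \<longleftrightarrow> x \<in> N'"
    and surj: "\<And>z. z \<in> Z \<Longrightarrow> \<exists>x \<in> Z'. z \<ominus>\<^bsub>M\<^esub> x \<in> N"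
  shows "\<exists>\<iota>. \<iota> \<in> module_iso R (quot_module (M\<lparr>carrier := Z'\<rparr>) N') (quot_module (M\<lparr>carrier := Z\<rparr>) N) \<and>
    (\<forall>x \<in> Z'. \<iota> (N' +>\<^bsub>M\<^esub> x) = N +>\<^bsub>M\<^esub> x)"
proof -
  interpret module R M by fact
  interpret N: abelian_subgroup N M using submodule_abelian_subgroup N .
  interpret N': abelian_subgroup N' M using submodule_abelian_subgroup N' .
  interpret SZ: submodule Z R M by fact
  interpret SZ': submodule Z' R M by fact
  have c: "x \<in> carrier M" if "x \<in> Z" for x using that SZ.subset by auto
  have cos: "H +>\<^bsub>M\<lparr>carrier := W\<rparr>\<^esub> x = H +>\<^bsub>M\<^esub> x" for H W x by (simp add: a_r_coset_def r_coset_def)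
  have car: "carrier (quot_module (M\<lparr>carrier := W\<rparr>) H) = (\<lambda>x. H +>\<^bsub>M\<^esub> x) ` W" for H W
    by (auto simp: quot_module_def A_RCOSETS_def RCOSETS_def a_r_coset_def r_coset_def)
  have add: "X \<oplus>\<^bsub>quot_module (M\<lparr>carrier := W\<rparr>) H\<^esub> Y = X <+>\<^bsub>M\<^esub> Y" for X Y H W
    by (simp add: quot_module_def set_add_def set_mult_def)
  have smult: "r \<odot>\<^bsub>quot_module (M\<lparr>carrier := W\<rparr>) H\<^esub> X = (\<Union>x \<in> X. H +>\<^bsub>M\<^esub> (r \<odot>\<^bsub>M\<^esub> x))" for r X H W
    by (simp add: quot_module_def cos)
  have cl: "N' +>\<^bsub>M\<^esub> x = N' +>\<^bsub>M\<^esub> y \<longleftrightarrow> N +>\<^bsub>M\<^esub> x = N +>\<^bsub>M\<^esub> y" if "x \<in> Z'" "y \<in> Z'" for x y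
  proof -
    have "\<ominus>\<^bsub>M\<^esub> y \<in> Z'" using SZ'.m_inv_closed[of y] that(2) by (simp add: a_inv_def)
    then have "x \<ominus>\<^bsub>M\<^esub> y \<in> Z'" using SZ'.m_closed[of x "\<ominus>\<^bsub>M\<^esub> y"] that(1) by (simp add: a_minus_def)
    then show ?thesis
      using coset_eq_iff[OF N, of x y] coset_eq_iff[OF N', of x y] that sub c iff[of "x \<ominus>\<^bsub>M\<^esub> y"] by
          (simp add: subsetD)
  qed
  define \<iota> where "\<iota> X = N +>\<^bsub>M\<^esub> (SOME x. x \<in> Z' \<and> N' +>\<^bsub>M\<^esub> x = X)" for X
  have \<iota>: "\<iota> (N' +>\<^bsub>M\<^esub> x) = N +>\<^bsub>M\<^esub> x" if x: "x \<in> Z'" for x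
  proof -
    let ?s = "SOME z. z \<in> Z' \<and> N' +>\<^bsub>M\<^esub> z = N' +>\<^bsub>M\<^esub> x"
    have "?s \<in> Z' \<and> N' +>\<^bsub>M\<^esub> ?s = N' +>\<^bsub>M\<^esub> x"
      by (rule someI[of "\<lambda>z. z \<in> Z' \<and> N' +>\<^bsub>M\<^esub> z = N' +>\<^bsub>M\<^esub> x" x]) (use x in simp)
    then show ?thesis unfolding \<iota>_def using cl x by blast
  qed
  have img: "(\<lambda>x. N +>\<^bsub>M\<^esub> x) ` Z' = (\<lambda>x. N +>\<^bsub>M\<^esub> x) ` Z"
  proof
    show "(\<lambda>x. N +>\<^bsub>M\<^esub> x) ` Z \<subseteq> (\<lambda>x. N +>\<^bsub>M\<^esub> x) ` Z'"
    proof (rule image_subsetI)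
      fix z assume z: "z \<in> Z"
      then obtain x where "x \<in> Z'" "z \<ominus>\<^bsub>M\<^esub> x \<in> N" using surj by blast
      then show "N +>\<^bsub>M\<^esub> z \<in> (\<lambda>x. N +>\<^bsub>M\<^esub> x) ` Z'"
        using coset_eq_iff[OF N, of z x] z c sub by (simp add: subsetD)
    qed
  qed (use sub in blast)
  have "\<iota> \<in> module_iso R (quot_module (M\<lparr>carrier := Z'\<rparr>) N') (quot_module (M\<lparr>carrier := Z\<rparr>) N)"
    unfolding module_iso_def iso_def hom_def
  proof (simp add: car add smult, intro conjI ballI)
    show "\<iota> \<in> (\<lambda>x. N' +>\<^bsub>M\<^esub> x) ` Z' \<rightarrow> (\<lambda>x. N +>\<^bsub>M\<^esub> x) ` Z" using \<iota> sub by auto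
    show "\<iota> (N' +>\<^bsub>M\<^esub> x <+>\<^bsub>M\<^esub> (N' +>\<^bsub>M\<^esub> y)) = \<iota> (N' +>\<^bsub>M\<^esub> x) <+>\<^bsub>M\<^esub> \<iota> (N' +>\<^bsub>M\<^esub> y)"
      if "x \<in> Z'" "y \<in> Z'" for x y
      using that sub c N.a_rcos_sum N'.a_rcos_sum \<iota> SZ'.m_closed by (simp add: subsetD)
    show "bij_betw \<iota> ((\<lambda>x. N' +>\<^bsub>M\<^esub> x) ` Z') ((\<lambda>x. N +>\<^bsub>M\<^esub> x) ` Z)"
      unfolding bij_betw_def inj_on_def using \<iota> cl img by (auto simp: image_image)
    show "\<iota> (\<Union>x' \<in> N' +>\<^bsub>M\<^esub> x. N' +>\<^bsub>M\<^esub> (r \<odot>\<^bsub>M\<^esub> x')) = (\<Union>x' \<in> \<iota> (N' +>\<^bsub>M\<^esub> x). N +>\<^bsub>M\<^esub> (r \<odot>\<^bsub>M\<^esub> x'))"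
      if "r \<in> carrier R" "x \<in> Z'" for r x
      using that sub c \<iota> coset_smult[OF N] coset_smult[OF N'] by (simp add: subsetD)
  qed
  then show ?thesis using \<iota> by blast
qed

section \<open>Isomorphisms of deformations\<close>

lemma (in module) submoduleI_smult:
  assumes "H \<subseteq> carrier M" "\<zero>\<^bsub>M\<^esub> \<in> H" "\<And>a b. a \<in> H \<Longrightarrow> b \<in> H \<Longrightarrow> a \<oplus>\<^bsub>M\<^esub> b \<in> H"
    "\<And>a x. a \<in> carrier R \<Longrightarrow> x \<in> H \<Longrightarrow> a \<odot>\<^bsub>M\<^esub> x \<in> H"
  shows "submodule H R M"
proof (rule submoduleI[OF assms(1,2)])
  fix a assume a: "a \<in> H"
  have "(\<ominus>\<^bsub>R\<^esub> \<one>\<^bsub>R\<^esub>) \<odot>\<^bsub>M\<^esub> a = \<ominus>\<^bsub>M\<^esub> a" using a assms(1) smult_l_minus[of "\<one>\<^bsub>R\<^esub>" a] by auto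
  then show "\<ominus>\<^bsub>M\<^esub> a \<in> H" using assms(4)[OF _ a, of "\<ominus>\<^bsub>R\<^esub> \<one>\<^bsub>R\<^esub>"] by simp
qed (use assms in auto)

context prestack begin

lemma GSnr_sel:
  "\<zero>\<^bsub>\<N> n\<^esub> = \<zero>\<^bsub>\<G> n\<^esub>" "x \<oplus>\<^bsub>\<N> n\<^esub> y = x \<oplus>\<^bsub>\<G> n\<^esub> y"
  "carrier (\<N> n) \<subseteq> carrier (\<G> n)"
  "H +>\<^bsub>\<N> n\<^esub> x = H +>\<^bsub>\<G> n\<^esub> x"
  "(\<N> n)\<lparr>carrier := W\<rparr> = (\<G> n)\<lparr>carrier := W\<rparr>"
  by (auto simp: GSnr_def a_r_coset_def r_coset_def)

lemma cochain_eta: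
  "x \<in> carrier (\<G> 2) \<Longrightarrow> cochain2 (x 0) (x 1) (x 2) = x"
  "y \<in> carrier (\<G> 1) \<Longrightarrow> cochain1 (y 0) (y 1) = y"
proof -
  have "{..2} = {0, 1, 2::nat}" "{..1} = {0, 1::nat}" by auto
  then show "x \<in> carrier (\<G> 2) \<Longrightarrow> cochain2 (x 0) (x 1) (x 2) = x"
    "y \<in> carrier (\<G> 1) \<Longrightarrow> cochain1 (y 0) (y 1) = y"
    unfolding GS_1_carrier GS_2_carrier by (auto simp: cochain2_def cochain1_def extensional_def fun_eq_iff)
qed

lemma cochain_carrier:
  "cochain2 m f c \<in> carrier (\<G> 2) \<longleftrightarrow> m \<in> carrier (\<C> 0 2) \<and> f \<in> carrier (\<C> 1 1) \<and> c \<in> carrier (\<C> 2 0)"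
  "cochain1 g t \<in> carrier (\<G> 1) \<longleftrightarrow> g \<in> carrier (\<C> 0 1) \<and> t \<in> carrier (\<C> 1 0)"
  unfolding GS_1_carrier GS_2_carrier cochain_sel by (simp_all only: cochain_sel simp_thms)

lemma first_order_deformation_iff:
  "first_order_deformation R \<U> \<A> B \<longleftrightarrow> (\<exists>x \<in> cocycles \<N> \<delta> 2. B = deform \<U> \<A> (x 0) (x 1) (x 2))"
proof
  assume B: "first_order_deformation R \<U> \<A> B"
  then obtain m f c where mfc: "m \<in> carrier (\<C> 0 2)" "f \<in> carrier (\<C> 1 1)" "c \<in> carrier (\<C> 2 0)"
    and eq: "B = deform \<U> \<A> m f c" by (auto simp: first_order_deformation_def)
  let ?x = "cochain2 m f c"
  have x: "?x \<in> carrier (\<G> 2)" using mfc cochain_carrier by blast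
  have "prestack (dual_ring R) \<U> (deform \<U> \<A> m f c)"
    using B unfolding first_order_deformation_def eq by blast
  then have "?x \<in> carrier (\<N> 2) \<and> \<delta> 2 ?x = \<zero>\<^bsub>\<G> 3\<^esub>"
    using deform_prestack_iff[OF x] unfolding cochain_sel by blast
  then show "\<exists>x \<in> cocycles \<N> \<delta> 2. B = deform \<U> \<A> (x 0) (x 1) (x 2)"
    using eq by (intro bexI[of _ ?x]) (simp_all only: cochain_sel, simp add: cocycles_def GSnr_sel)
next
  assume "\<exists>x \<in> cocycles \<N> \<delta> 2. B = deform \<U> \<A> (x 0) (x 1) (x 2)"
  then obtain x where x: "x \<in> carrier (\<N> 2)" "\<delta> 2 x = \<zero>\<^bsub>\<G> 3\<^esub>" and B: "B = deform \<U> \<A> (x 0) (x 1) (x 2)"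
    by (auto simp: cocycles_def GSnr_sel)
  then have gs: "x \<in> carrier (\<G> 2)" using GSnr_sel(3) by blast
  show "first_order_deformation R \<U> \<A> B"
    using deform_prestack_iff[OF gs] GS_2_D[OF gs] x unfolding first_order_deformation_def B by blast
qed

lemma cocyclesD:
  assumes "x \<in> cocycles \<N> \<delta> 2"
  shows "x \<in> carrier (\<N> 2)" "\<delta> 2 x = \<zero>\<^bsub>\<G> 3\<^esub>" "x \<in> carrier (\<G> 2)"
  using assms GSnr_sel(3) by (auto simp: cocycles_def GSnr_sel(1))

lemma GS_1_inv:
  assumes "g \<in> carrier (\<C> 0 1)" "t \<in> carrier (\<C> 1 0)"
  shows "(\<ominus>\<^bsub>R\<^esub> \<one>\<^bsub>R\<^esub>) \<odot>\<^bsub>\<G> 1\<^esub> cochain1 g t = cochain1 (\<ominus>\<^bsub>\<C> 0 1\<^esub> g) (\<ominus>\<^bsub>\<C> 1 0\<^esub> t)"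
proof -
  interpret M0: module R "\<C> 0 1" by (rule Cpq_module)
  interpret M1: module R "\<C> 1 0" by (rule Cpq_module)
  interpret G: module R "\<G> 1" by (rule GS_module)
  have "(\<ominus>\<^bsub>R\<^esub> \<one>\<^bsub>R\<^esub>) \<odot>\<^bsub>\<C> 0 1\<^esub> g = \<ominus>\<^bsub>\<C> 0 1\<^esub> g" "(\<ominus>\<^bsub>R\<^esub> \<one>\<^bsub>R\<^esub>) \<odot>\<^bsub>\<C> 1 0\<^esub> t = \<ominus>\<^bsub>\<C> 1 0\<^esub> t"
    using M0.smult_l_minus[OF one_closed assms(1)] M1.smult_l_minus[OF one_closed assms(2)]
      M0.smult_one[OF assms(1)] M1.smult_one[OF assms(2)] by simp_all
  moreover have "\<ominus>\<^bsub>R\<^esub> \<one>\<^bsub>R\<^esub> \<in> carrier R" by simp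
  then have "(\<ominus>\<^bsub>R\<^esub> \<one>\<^bsub>R\<^esub>) \<odot>\<^bsub>\<G> 1\<^esub> cochain1 g t \<in> carrier (\<G> 1)"
    using G.smult_closed[of "\<ominus>\<^bsub>R\<^esub> \<one>\<^bsub>R\<^esub>" "cochain1 g t"] cochain_carrier(2)[of g t] assms by blast
  from cochain_eta(2)[OF this, symmetric]
  have "(\<ominus>\<^bsub>R\<^esub> \<one>\<^bsub>R\<^esub>) \<odot>\<^bsub>\<G> 1\<^esub> cochain1 g t = cochain1 ((\<ominus>\<^bsub>R\<^esub> \<one>\<^bsub>R\<^esub>) \<odot>\<^bsub>\<C> 0 1\<^esub> g) ((\<ominus>\<^bsub>R\<^esub> \<one>\<^bsub>R\<^esub>) \<odot>\<^bsub>\<C> 1 0\<^esub> t)"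
    by (simp only: GS_apply(2)[of 0 1] GS_apply(2)[of 1 1] cochain_sel le0 order_refl diff_zero diff_self_eq_0)
  ultimately show ?thesis by simp
qed

lemma GSnr_1_iff':
  "cochain1 g t \<in> carrier (\<N> 1) \<longleftrightarrow> g \<in> carrier (\<C> 0 1) \<and> t \<in> carrier (\<C> 1 0) \<and>
     normalized \<U> \<A> 0 1 g \<and> reduced \<U> \<A> 1 0 t"
  unfolding GSnr_1_iff cochain_carrier cochain_sel by blast

text \<open>
  The candidate for the inverse is \<open>(1 - g \<epsilon>, 1 - t \<epsilon>)\<close>. The two composites are identities because
  \<open>\<epsilon>\<^sup>2 = 0\<close> and the cocycles vanish at identities; that the candidate is a morphism
  back follows from \<open>d (-y) = - d y\<close>.
\<close>

lemma deform_iso_iff: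
  assumes x: "x \<in> cocycles \<N> \<delta> 2" and x': "x' \<in> cocycles \<N> \<delta> 2"
    and g: "g \<in> carrier (\<C> 0 1)" and t: "t \<in> carrier (\<C> 1 0)"
  shows "prestack_iso (dual_ring R) \<U> (deform \<U> \<A> (x 0) (x 1) (x 2)) (deform \<U> \<A> (x' 0) (x' 1) (x' 2))
      (deform_mor \<U> \<A> g t) \<longleftrightarrow>
    cochain1 g (\<ominus>\<^bsub>\<C> 1 0\<^esub> t) \<in> carrier (\<N> 1) \<and>
    \<delta> 1 (cochain1 g (\<ominus>\<^bsub>\<C> 1 0\<^esub> t)) = x \<ominus>\<^bsub>\<G> 2\<^esub> x'"
    (is "prestack_iso _ _ ?B ?B' ?g \<longleftrightarrow> ?nr \<and> ?d")
proof -
  interpret M0: module R "\<C> 0 1" by (rule Cpq_module)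
  interpret M1: module R "\<C> 1 0" by (rule Cpq_module)
  interpret G: module R "\<G> 2" by (rule GS_module)
  interpret G1: module R "\<G> 1" by (rule GS_module)
  note X = cocyclesD[OF x] and X' = cocyclesD[OF x']
  define g' t' where "g' = \<ominus>\<^bsub>\<C> 0 1\<^esub> g" and "t' = \<ominus>\<^bsub>\<C> 1 0\<^esub> t"
  have g': "g' \<in> carrier (\<C> 0 1)" and t': "t' \<in> carrier (\<C> 1 0)"
    unfolding g'_def t'_def by (rule M0.M.a_inv_closed[OF g], rule M1.M.a_inv_closed[OF t])
  have gv: "g' (U, []) (A, [a]) = \<ominus>\<^bsub>\<H> U A (Cod (\<F> U) a)\<^esub> g (U, []) (A, [a])"
    if "U \<in> Ob \<U>" "a \<in> Ar (\<F> U)" "Dom (\<F> U) a = A" for U a A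
    unfolding g'_def using Cpq_apply(3)[OF g g zero_closed, of "(U, [])" "(A, [a])"] that
    by (auto simp: small_rules)
  have tv: "t' (V, [u]) (A, []) = \<ominus>\<^bsub>\<H> V (res_ob \<A> u A) (res_ob \<A> u A)\<^esub> t (V, [u]) (A, [])"
    if "u \<in> Ar \<U>" "Dom \<U> u = V" "A \<in> Ob (\<F> (Cod \<U> u))" for V u A
    unfolding t'_def using Cpq_apply(3)[OF t t zero_closed, of "(V, [u])" "(A, [])"] that
    by (auto simp: small_rules)
  have nrt: "reduced \<U> \<A> 1 0 t' \<longleftrightarrow> reduced \<U> \<A> 1 0 t" if "t \<in> carrier (\<C> 1 0)"
  proof -
    have "t' (U, [Ident \<U> U]) (A, []) = \<zero>\<^bsub>\<H> U A A\<^esub> \<longleftrightarrow> t (U, [Ident \<U> U]) (A, []) = \<zero>\<^bsub>\<H> U A A\<^esub>"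
      if U: "U \<in> Ob \<U>" "A \<in> Ob (\<F> U)" for U A
    proof -
      interpret C: linear_category R "\<F> U" by (rule fib[OF U(1)])
      have 1: "t' (U, [Ident \<U> U]) (A, []) = \<ominus>\<^bsub>\<H> U A A\<^esub> t (U, [Ident \<U> U]) (A, [])"
        using tv[of "Ident \<U> U" U A] U by (simp add: ps_rules)
      have 2: "t (U, [Ident \<U> U]) (A, []) \<in> Homs (\<F> U) A A"
        using C10_type[OF t, of "Ident \<U> U" A U] U by (simp add: ps_rules)
      show ?thesis unfolding 1 using C.hadd_group(5)[OF 2] C.hneg_zero[OF U(2) U(2)] by metis
    qed
    then show ?thesis unfolding normalized_reduced_small by blast
  qed
  have mor: "prestack_morphism (dual_ring R) \<U> ?B ?B' ?g \<longleftrightarrow> ?nr \<and> ?d"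
    unfolding deform_morphism_iff[OF X(1,2) X'(1,2) g t] GSnr_1_iff'
    using g t' nrt[OF t] unfolding t'_def by blast
  have "\<exists>h. prestack_morphism (dual_ring R) \<U> ?B' ?B h \<and>
        psmor_eq \<U> ?B (psmor_comp \<U> ?B h ?g) (psmor_id \<U> ?B) \<and>
        psmor_eq \<U> ?B' (psmor_comp \<U> ?B' ?g h) (psmor_id \<U> ?B')" if nrd: "?nr" "?d"
  proof (intro exI conjI)
    let ?h = "deform_mor \<U> \<A> g' t'"
    have y: "cochain1 g t' \<in> carrier (\<N> 1)" "\<delta> 1 (cochain1 g t') = x \<ominus>\<^bsub>\<G> 2\<^esub> x'"
      using nrd by (simp_all only: t'_def)
    have y1: "cochain1 g t' \<in> carrier (\<G> 1)" using y(1) GSnr_sel(3) by blast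
    have m1: "\<ominus>\<^bsub>R\<^esub> \<one>\<^bsub>R\<^esub> \<in> carrier R" by simp
    have e: "(\<ominus>\<^bsub>R\<^esub> \<one>\<^bsub>R\<^esub>) \<odot>\<^bsub>\<G> 1\<^esub> cochain1 g t' = cochain1 g' (\<ominus>\<^bsub>\<C> 1 0\<^esub> t')"
      unfolding g'_def using GS_1_inv[OF g t'] .
    have nr: "cochain1 g' (\<ominus>\<^bsub>\<C> 1 0\<^esub> t') \<in> carrier (\<N> 1)"
      using GSnr_closed(2)[OF y(1) y(1) m1] unfolding e .
    have "\<delta> 1 (cochain1 g' (\<ominus>\<^bsub>\<C> 1 0\<^esub> t')) = (\<ominus>\<^bsub>R\<^esub> \<one>\<^bsub>R\<^esub>) \<odot>\<^bsub>\<G> 2\<^esub> (x \<ominus>\<^bsub>\<G> 2\<^esub> x')"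
      using gs_d_1_linear(2)[OF y1 y1 m1] unfolding e y(2) .
    also have "\<dots> = x' \<ominus>\<^bsub>\<G> 2\<^esub> x"
      using X(3) X'(3) by (simp add: G.smult_l_minus a_minus_def G.M.minus_add G.M.a_comm)
    finally have d: "\<delta> 1 (cochain1 g' (\<ominus>\<^bsub>\<C> 1 0\<^esub> t')) = x' \<ominus>\<^bsub>\<G> 2\<^esub> x" .
    have red: "normalized \<U> \<A> 0 1 g" "reduced \<U> \<A> 1 0 t" "normalized \<U> \<A> 0 1 g'"
      using y(1) nr nrt[OF t] unfolding GSnr_1_iff' by blast+
    show "prestack_morphism (dual_ring R) \<U> ?B' ?B ?h"
      unfolding deform_morphism_iff[OF X'(1,2) X(1,2) g' t'] using d red nrt[OF t] by blast
    note H = C02_hoch[OF GS_2_D(1)[OF X(3)]] and H' = C02_hoch[OF GS_2_D(1)[OF X'(3)]]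
    note Esel = hoch_cochain.E_sel[OF H] hoch_cochain.dual_sel[OF H] hoch_cochain.E_sel[OF H']
        hoch_cochain.dual_sel[OF H']
    note tys = C01_type[OF g] C10_type[OF t, unfolded One_nat_def] C01_type[OF g'] C10_type[OF t', unfolded
        One_nat_def]
    have un: "z 0 (U, []) (A, [Ident (\<F> U) B, a]) = \<zero>\<^bsub>\<H> U A B\<^esub>"
      if "z \<in> carrier (\<N> 2)" "U \<in> Ob \<U>" "a \<in> Ar (\<F> U)" "Dom (\<F> U) a = A" "Cod (\<F> U) a = B" for z U a A B
      using that unfolding GSnr_2_iff normalized_reduced_small by auto
    have un1: "g (U, []) (A, [Ident (\<F> U) A]) = \<zero>\<^bsub>\<H> U A A\<^esub>"
      "g' (U, []) (A, [Ident (\<F> U) A]) = \<zero>\<^bsub>\<H> U A A\<^esub>" if "U \<in> Ob \<U>" "A \<in> Ob (\<F> U)" for U A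
      using red(1,3) that unfolding normalized_reduced_small by auto
    note rules = Esel small_rules tys fib_dist fib_group deform_sel deform_mor_sel un[OF X(1)] un[OF X'(1)] un1
      psmor_eq_def psmor_comp_def psmor_id_def tv gv fib_ac
    show "psmor_eq \<U> ?B (psmor_comp \<U> ?B ?h ?g) (psmor_id \<U> ?B)"
      by (auto simp: rules)
    show "psmor_eq \<U> ?B' (psmor_comp \<U> ?B' ?g ?h) (psmor_id \<U> ?B')"
      by (auto simp: rules)
  qed
  then show ?thesis unfolding prestack_iso_def mor by blast
qed

section \<open>Normalization of cocycles\<close>

lemma cocycle_minus_coboundary:
  assumes z: "z \<in> carrier (\<G> 2)" "\<delta> 2 z = \<zero>\<^bsub>\<G> 3\<^esub>" and y: "y \<in> carrier (\<G> 1)"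
  shows "\<delta> 2 (z \<ominus>\<^bsub>\<G> 2\<^esub> \<delta> 1 y) = \<zero>\<^bsub>\<G> 3\<^esub>"
proof -
  interpret G: module R "\<G> 2" by (rule GS_module)
  have dy: "\<delta> 1 y \<in> carrier (\<G> 2)" by (rule gs_d_1_closed[OF y])
  have m1: "\<ominus>\<^bsub>R\<^esub> \<one>\<^bsub>R\<^esub> \<in> carrier R" by simp
  have "z \<ominus>\<^bsub>\<G> 2\<^esub> \<delta> 1 y = z \<oplus>\<^bsub>\<G> 2\<^esub> (\<ominus>\<^bsub>R\<^esub> \<one>\<^bsub>R\<^esub>) \<odot>\<^bsub>\<G> 2\<^esub> \<delta> 1 y"
    using z(1) dy by (simp add: G.smult_l_minus a_minus_def)
  then show ?thesis
    using gs_d_2_kernel(1)[OF z(1) G.smult_closed[OF m1 dy] m1 z(2)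
        gs_d_2_kernel(2)[OF dy dy m1 gs_d_gs_d[OF y] gs_d_gs_d[OF y]]] by simp
qed

text \<open>
  The cochain \<open>(g, t)\<close> is found by solving \<open>d (g, t) = (m, f, c)\<close> at identities. The first
  component asks for \<open>g(1) = m(1, 1)\<close>, which \<open>g(a) = a m(1, 1)\<close> satisfies and which is linear in \<open>a\<close>;
  the last component asks for \<open>t\<^sup>1 - g(1) = c\<^bsup>1,1\<^esup>\<close>.
\<close>

lemma cocycle_normalize:
  assumes z: "z \<in> carrier (\<G> 2)" and dz: "\<delta> 2 z = \<zero>\<^bsub>\<G> 3\<^esub>"
  shows "\<exists>y \<in> carrier (\<G> 1). z \<ominus>\<^bsub>\<G> 2\<^esub> \<delta> 1 y \<in> carrier (\<N> 2)"
proof -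
  interpret G: module R "\<G> 2" by (rule GS_module)
  note Z = GS_2_D[OF z]
  note tz = C02_type[OF Z(1)] C11_type[OF Z(2), unfolded One_nat_def] C20_type[OF Z(3)]
  define G :: "('uo, 'ua, 'o, 'm) cochain" where "G \<sigma> a = hd (snd a) \<bullet>\<^bsub>\<F> (fst \<sigma>)\<^esub> z 0 \<sigma> (fst a, [Ident (\<F>
      (fst \<sigma>)) (fst a), Ident (\<F> (fst \<sigma>)) (fst a)])" for \<sigma> a
  define T :: "('uo, 'ua, 'o, 'm) cochain" where "T \<sigma> a = (let V = fst \<sigma>; u = hd (snd \<sigma>); uA = res_ob \<A> u (fst a) in
    z 2 (V, [u, Ident \<U> (Cod \<U> u)]) (fst a, []) \<oplus>\<^bsub>\<H> V uA uA\<^esub>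
      z 0 (V, []) (uA, [Ident (\<F> V) uA, Ident (\<F> V) uA]))" for \<sigma> a
  define y where "y = cochain1 (mk_cochain \<U> \<A> 0 1 G) (mk_cochain \<U> \<A> 1 0 T)"
  have cg: "mk_cochain \<U> \<A> 0 1 G \<in> carrier (\<C> 0 1)"
  proof (rule C01_I)
    fix U assume U: "U \<in> Ob \<U>"
    show "functor_cochain R (\<F> U) (\<F> U) (\<lambda>A. A) (\<lambda>a. a) (G (U, []))"
      by (rule functor_cochain.intro[OF id_functor[OF U]], rule functor_cochain_axioms.intro)
        (use U in \<open>auto simp: G_def ps_rules tz fib_dist\<close>)
  qed
  have ct: "mk_cochain \<U> \<A> 1 0 T \<in> carrier (\<C> 1 0)"
    by (rule C10_I) (auto simp: T_def Let_def ps_rules tz)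
  have y: "y \<in> carrier (\<G> 1)" unfolding y_def cochain_carrier using cg ct by blast
  note Y = GS_1_D[OF y]
  note ty = C01_type[OF Y(1)] C10_type[OF Y(2), unfolded One_nat_def]
  have y0: "y 0 (U, []) (A, [a]) = a \<bullet>\<^bsub>\<F> U\<^esub> z 0 (U, []) (A, [Ident (\<F> U) A, Ident (\<F> U) A])"
    if "U \<in> Ob \<U>" "a \<in> Ar (\<F> U)" "Dom (\<F> U) a = A" for U A a
    unfolding y_def cochain_sel using that by (subst mk_cochain_apply) (auto simp: small_rules G_def)
  have y1: "y 1 (V, [u]) (A, []) = z 2 (V, [u, Ident \<U> (Cod \<U> u)]) (A, []) \<oplus>\<^bsub>\<H> V (res_ob \<A> u A) (res_ob \<A> u A)\<^esub>
      z 0 (V, []) (res_ob \<A> u A, [Ident (\<F> V) (res_ob \<A> u A), Ident (\<F> V) (res_ob \<A> u A)])"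
    if "u \<in> Ar \<U>" "Dom \<U> u = V" "A \<in> Ob (\<F> (Cod \<U> u))" for u V A
    unfolding y_def cochain_sel using that by (subst mk_cochain_apply) (auto simp: small_rules T_def Let_def)
  define x where "x = z \<ominus>\<^bsub>\<G> 2\<^esub> \<delta> 1 y"
  have dy: "\<delta> 1 y \<in> carrier (\<G> 2)" by (rule gs_d_1_closed[OF y])
  have x: "x \<in> carrier (\<G> 2)" unfolding x_def using z dy by simp
  have dx: "\<delta> 2 x = \<zero>\<^bsub>\<G> 3\<^esub>"
    unfolding x_def by (rule cocycle_minus_coboundary[OF z dz y])
  have xv: "x s \<sigma> a = z s \<sigma> a \<oplus>\<^bsub>\<V> \<sigma> a\<^esub> \<ominus>\<^bsub>\<V> \<sigma> a\<^esub> gs_val \<U> \<A> 1 y s \<sigma> a"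
    if "s \<le> 2" "\<sigma> \<in> simplices \<U> s" "a \<in> rsimplices (\<T> \<sigma>) (2 - s)" for s \<sigma> a
    unfolding x_def GS_minus_apply[OF z dy that] gs_d_1_apply[OF that] ..
  have "x \<in> carrier (\<N> 2)"
  proof (rule cocycle_normalized_reduced[OF x dx])
    fix U A assume U: "U \<in> Ob \<U>" "A \<in> Ob (\<F> U)"
    have "x 0 (U, []) (A, [Ident (\<F> U) A, Ident (\<F> U) A]) = z 0 (U, []) (A, [Ident (\<F> U) A, Ident (\<F> U) A])
        \<oplus>\<^bsub>\<H> U A A\<^esub> \<ominus>\<^bsub>\<H> U A A\<^esub> gs_val \<U> \<A> 1 y 0 (U, []) (A, [Ident (\<F> U) A, Ident (\<F> U) A])"
      using U by (subst xv) (auto simp: small_rules intro!: exI[of _ "Ident (\<F> U) A"])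
    then show "x 0 (U, []) (A, [Ident (\<F> U) A, Ident (\<F> U) A]) = \<zero>\<^bsub>\<H> U A A\<^esub>"
      using U by (simp add: gs_val_1_0[OF Y, unfolded One_nat_def] ps_rules tz y0 fib_hdif fib_hdif_eq fib_group)
    have "x 2 (U, [Ident \<U> U, Ident \<U> U]) (A, []) = z 2 (U, [Ident \<U> U, Ident \<U> U]) (A, [])
        \<oplus>\<^bsub>\<H> U A A\<^esub> \<ominus>\<^bsub>\<H> U A A\<^esub> gs_val \<U> \<A> 1 y 2 (U, [Ident \<U> U, Ident \<U> U]) (A, [])"
      using U by (subst xv) (auto simp: small_rules intro!: exI[of _ "Ident \<U> U"])
    then show "x 2 (U, [Ident \<U> U, Ident \<U> U]) (A, []) = \<zero>\<^bsub>\<H> U A A\<^esub>"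
      using U by (simp add: gs_val_1_2[OF Y, unfolded One_nat_def] ps_rules tz y0 y1[unfolded One_nat_def]
          fib_hdif fib_hdif_eq fib_group fib_ac)
  qed
  then show ?thesis using y unfolding x_def by blast
qed

section \<open>Cohomology classes and equivalence classes\<close>

lemma coboundaries_2:
  "coboundaries \<N> \<delta> 2 = \<delta> 1 ` carrier (\<N> 1)"
  "coboundaries \<G> \<delta> 2 = \<delta> 1 ` carrier (\<G> 1)"
  by (simp_all add: coboundaries_def numeral_2_eq_2)

lemma submodules:
  "submodule (cocycles \<N> \<delta> 2) R (\<G> 2)"
  "submodule (cocycles \<G> \<delta> 2) R (\<G> 2)"
  "submodule (coboundaries \<N> \<delta> 2) R (\<G> 2)"
  "submodule (coboundaries \<G> \<delta> 2) R (\<G> 2)"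
proof -
  interpret G: module R "\<G> 2" by (rule GS_module)
  interpret G1: module R "\<G> 1" by (rule GS_module)
  have sub: "x \<in> carrier (\<G> n)" if "x \<in> carrier (\<N> n)" for x n using GSnr_sel(3) that by blast
  have z: "\<zero>\<^bsub>\<N> n\<^esub> \<in> carrier (\<N> n)" for n
    unfolding GSnr_sel by (rule GSnr_zero_closed)
  have coc: "cocycles \<N> \<delta> 2 = {x \<in> carrier (\<N> 2). \<delta> 2 x = \<zero>\<^bsub>\<G> 3\<^esub>}"
    "cocycles \<G> \<delta> 2 = {x \<in> carrier (\<G> 2). \<delta> 2 x = \<zero>\<^bsub>\<G> 3\<^esub>}"
    by (simp_all add: cocycles_def GSnr_sel)
  have ker: "submodule {x \<in> W. \<delta> 2 x = \<zero>\<^bsub>\<G> 3\<^esub>} R (\<G> 2)"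
    if W: "W \<subseteq> carrier (\<G> 2)" "\<zero>\<^bsub>\<G> 2\<^esub> \<in> W" "\<And>a b. a \<in> W \<Longrightarrow> b \<in> W \<Longrightarrow> a \<oplus>\<^bsub>\<G> 2\<^esub> b \<in> W"
      "\<And>a r. r \<in> carrier R \<Longrightarrow> a \<in> W \<Longrightarrow> r \<odot>\<^bsub>\<G> 2\<^esub> a \<in> W" for W
  proof (rule G.submoduleI_smult)
    show "a \<oplus>\<^bsub>\<G> 2\<^esub> b \<in> {x \<in> W. \<delta> 2 x = \<zero>\<^bsub>\<G> 3\<^esub>}"
      if "a \<in> {x \<in> W. \<delta> 2 x = \<zero>\<^bsub>\<G> 3\<^esub>}" "b \<in> {x \<in> W. \<delta> 2 x = \<zero>\<^bsub>\<G> 3\<^esub>}" for a b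
      using that W(1) W(3)[of a b] gs_d_2_kernel(1)[OF _ _ zero_closed, of a b] by blast
    show "r \<odot>\<^bsub>\<G> 2\<^esub> a \<in> {x \<in> W. \<delta> 2 x = \<zero>\<^bsub>\<G> 3\<^esub>}"
      if "r \<in> carrier R" "a \<in> {x \<in> W. \<delta> 2 x = \<zero>\<^bsub>\<G> 3\<^esub>}" for r a
      using that W(1) W(4)[of r a] gs_d_2_kernel(2)[of a a r] by blast
  qed (use W gs_d_2_zero in auto)
  show "submodule (cocycles \<N> \<delta> 2) R (\<G> 2)"
    unfolding coc using z[of 2] sub GSnr_closed(1)[OF _ _ zero_closed] GSnr_closed(2)
    by (intro ker) (auto simp only: GSnr_sel(1))
  show "submodule (cocycles \<G> \<delta> 2) R (\<G> 2)"
    unfolding coc by (rule ker) auto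
  have im: "submodule (\<delta> 1 ` W) R (\<G> 2)"
    if W: "W \<subseteq> carrier (\<G> 1)" "\<zero>\<^bsub>\<G> 1\<^esub> \<in> W" "\<And>a b. a \<in> W \<Longrightarrow> b \<in> W \<Longrightarrow> a \<oplus>\<^bsub>\<G> 1\<^esub> b \<in> W"
      "\<And>a r. r \<in> carrier R \<Longrightarrow> a \<in> W \<Longrightarrow> r \<odot>\<^bsub>\<G> 1\<^esub> a \<in> W" for W
  proof (rule G.submoduleI_smult)
    show "\<delta> 1 ` W \<subseteq> carrier (\<G> 2)" using W(1) gs_d_1_closed by blast
    have "\<zero>\<^bsub>R\<^esub> \<odot>\<^bsub>\<G> 1\<^esub> \<zero>\<^bsub>\<G> 1\<^esub> \<in> W" using W(2,4) by blast
    moreover have "\<delta> 1 (\<zero>\<^bsub>R\<^esub> \<odot>\<^bsub>\<G> 1\<^esub> \<zero>\<^bsub>\<G> 1\<^esub>) = \<zero>\<^bsub>\<G> 2\<^esub>"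
      using gs_d_1_linear(2)[OF G1.M.zero_closed G1.M.zero_closed zero_closed]
        gs_d_1_closed[OF G1.M.zero_closed] G.smult_l_null by simp
    ultimately show "\<zero>\<^bsub>\<G> 2\<^esub> \<in> \<delta> 1 ` W" by (metis imageI)
    show "a \<oplus>\<^bsub>\<G> 2\<^esub> b \<in> \<delta> 1 ` W" if ab: "a \<in> \<delta> 1 ` W" "b \<in> \<delta> 1 ` W" for a b
    proof -
      from ab(1) obtain a' where a': "a = \<delta> 1 a'" "a' \<in> W" by (rule imageE)
      from ab(2) obtain b' where b': "b = \<delta> 1 b'" "b' \<in> W" by (rule imageE)
      have "a \<oplus>\<^bsub>\<G> 2\<^esub> b = \<delta> 1 (a' \<oplus>\<^bsub>\<G> 1\<^esub> b')"
        unfolding a' b' using W(1) a'(2) b'(2) by (intro gs_d_1_linear(1)[OF _ _ zero_closed, symmetric]) blast+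
      then show ?thesis using W(3)[OF a'(2) b'(2)] by (rule image_eqI)
    qed
    show "r \<odot>\<^bsub>\<G> 2\<^esub> a \<in> \<delta> 1 ` W" if ra: "r \<in> carrier R" "a \<in> \<delta> 1 ` W" for r a
    proof -
      from ra(2) obtain a' where a': "a = \<delta> 1 a'" "a' \<in> W" by (rule imageE)
      have "a' \<in> carrier (\<G> 1)" using W(1) a'(2) by blast
      then have "r \<odot>\<^bsub>\<G> 2\<^esub> a = \<delta> 1 (r \<odot>\<^bsub>\<G> 1\<^esub> a')"
        unfolding a' using gs_d_1_linear(2)[OF _ _ ra(1), of a' a'] by simp
      then show ?thesis using W(4)[OF ra(1) a'(2)] by (rule image_eqI)
    qed
  qed
  show "submodule (coboundaries \<N> \<delta> 2) R (\<G> 2)"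
    unfolding coboundaries_2
    using z[of 1] sub GSnr_closed(1)[OF _ _ zero_closed] GSnr_closed(2) by (intro im) (auto simp only: GSnr_sel(1))
  show "submodule (coboundaries \<G> \<delta> 2) R (\<G> 2)"
    unfolding coboundaries_2 by (rule im[OF subset_refl G1.M.zero_closed G1.M.a_closed G1.smult_closed])
qed

text \<open>
  The injectivity of the comparison map between the two cohomology modules.
\<close>

lemma coboundary_cocycle_iff:
  assumes "x \<in> cocycles \<N> \<delta> 2"
  shows "x \<in> coboundaries \<G> \<delta> 2 \<longleftrightarrow> x \<in> coboundaries \<N> \<delta> 2"
proof
  assume "x \<in> coboundaries \<G> \<delta> 2"
  then obtain y where y: "y \<in> carrier (\<G> 1)" "x = \<delta> 1 y" unfolding coboundaries_2 by (rule imageE)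
  have "y \<in> carrier (\<N> 1)"
    by (rule coboundary_normalized_reduced[OF y(1)]) (use cocyclesD(1)[OF assms] y(2) in simp)
  then show "x \<in> coboundaries \<N> \<delta> 2" unfolding coboundaries_2 y(2) by (rule imageI)
next
  assume "x \<in> coboundaries \<N> \<delta> 2"
  then show "x \<in> coboundaries \<G> \<delta> 2" unfolding coboundaries_2 using image_mono[OF GSnr_sel(3)] by (rule rev_subsetD)
qed

text \<open>
  Every normalized reduced one-cochain is of the form \<open>(g, -t)\<close>, so ranging over the pairs
  \<open>(g, t)\<close> ranges over all of them.
\<close>

lemma deformation_equiv_iff:
  assumes x: "x \<in> cocycles \<N> \<delta> 2" and x': "x' \<in> cocycles \<N> \<delta> 2"
  shows "(deform \<U> \<A> (x 0) (x 1) (x 2), deform \<U> \<A> (x' 0) (x' 1) (x' 2)) \<in> deformation_equiv R \<U> \<A> \<longleftrightarrow>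
    x \<ominus>\<^bsub>\<G> 2\<^esub> x' \<in> coboundaries \<N> \<delta> 2"
proof -
  interpret M1: module R "\<C> 1 0" by (rule Cpq_module)
  have fod: "first_order_deformation R \<U> \<A> (deform \<U> \<A> (x 0) (x 1) (x 2))"
    "first_order_deformation R \<U> \<A> (deform \<U> \<A> (x' 0) (x' 1) (x' 2))"
    using x x' unfolding first_order_deformation_iff by blast+
  have "(deform \<U> \<A> (x 0) (x 1) (x 2), deform \<U> \<A> (x' 0) (x' 1) (x' 2)) \<in> deformation_equiv R \<U> \<A> \<longleftrightarrow>
    (\<exists>g \<in> carrier (\<C> 0 1). \<exists>t \<in> carrier (\<C> 1 0).
      cochain1 g (\<ominus>\<^bsub>\<C> 1 0\<^esub> t) \<in> carrier (\<N> 1) \<and>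
      \<delta> 1 (cochain1 g (\<ominus>\<^bsub>\<C> 1 0\<^esub> t)) = x \<ominus>\<^bsub>\<G> 2\<^esub> x')"
    unfolding deformation_equiv_def using fod deform_iso_iff[OF x x'] by auto
  also have "\<dots> \<longleftrightarrow> x \<ominus>\<^bsub>\<G> 2\<^esub> x' \<in> coboundaries \<N> \<delta> 2"
  proof
    assume "x \<ominus>\<^bsub>\<G> 2\<^esub> x' \<in> coboundaries \<N> \<delta> 2"
    then obtain y where y: "y \<in> carrier (\<N> 1)" "\<delta> 1 y = x \<ominus>\<^bsub>\<G> 2\<^esub> x'"
      unfolding coboundaries_2 by force
    have y1: "y \<in> carrier (\<G> 1)" using y GSnr_sel(3) by blast
    note Y = GS_1_D[OF y1]
    have "cochain1 (y 0) (\<ominus>\<^bsub>\<C> 1 0\<^esub> (\<ominus>\<^bsub>\<C> 1 0\<^esub> y 1)) = y"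
      unfolding M1.M.minus_minus[OF Y(2)] by (rule cochain_eta(2)[OF y1])
    then show "\<exists>g \<in> carrier (\<C> 0 1). \<exists>t \<in> carrier (\<C> 1 0).
      cochain1 g (\<ominus>\<^bsub>\<C> 1 0\<^esub> t) \<in> carrier (\<N> 1) \<and>
      \<delta> 1 (cochain1 g (\<ominus>\<^bsub>\<C> 1 0\<^esub> t)) = x \<ominus>\<^bsub>\<G> 2\<^esub> x'"
      using y by (intro bexI[OF _ Y(1)] bexI[OF _ M1.M.a_inv_closed[OF Y(2)]]) simp
  next
    assume "\<exists>g \<in> carrier (\<C> 0 1). \<exists>t \<in> carrier (\<C> 1 0).
      cochain1 g (\<ominus>\<^bsub>\<C> 1 0\<^esub> t) \<in> carrier (\<N> 1) \<and>
      \<delta> 1 (cochain1 g (\<ominus>\<^bsub>\<C> 1 0\<^esub> t)) = x \<ominus>\<^bsub>\<G> 2\<^esub> x'"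
    then show "x \<ominus>\<^bsub>\<G> 2\<^esub> x' \<in> coboundaries \<N> \<delta> 2"
      unfolding coboundaries_2 by (metis imageI)
  qed
  finally show ?thesis .
qed

lemma deformation_equiv_class:
  assumes x: "x \<in> cocycles \<N> \<delta> 2" and x': "x' \<in> cocycles \<N> \<delta> 2"
  shows "(deform \<U> \<A> (x 0) (x 1) (x 2), deform \<U> \<A> (x' 0) (x' 1) (x' 2)) \<in> deformation_equiv R \<U> \<A> \<longleftrightarrow>
    coboundaries \<N> \<delta> 2 +>\<^bsub>\<G> 2\<^esub> x
      = coboundaries \<N> \<delta> 2 +>\<^bsub>\<G> 2\<^esub> x'"
  unfolding deformation_equiv_iff[OF assms]
    module.coset_eq_iff[OF GS_module submodules(3) cocyclesD(3)[OF x] cocyclesD(3)[OF x']] ..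

text \<open>
  An equivalence relation because it is the kernel of the passage to cosets.
\<close>

lemma deformation_equiv_equiv:
  "equiv {\<B>. first_order_deformation R \<U> \<A> \<B>} (deformation_equiv R \<U> \<A>)"
proof (rule equivI)
  show "deformation_equiv R \<U> \<A> \<subseteq> {\<B>. first_order_deformation R \<U> \<A> \<B>} \<times> {\<B>. first_order_deformation R \<U> \<A> \<B>}"
    by (auto simp: deformation_equiv_def)
  show "refl_on {\<B>. first_order_deformation R \<U> \<A> \<B>} (deformation_equiv R \<U> \<A>)"
    unfolding first_order_deformation_iff using deformation_equiv_class by (intro refl_onI) force
  have rep: "\<exists>x \<in> cocycles \<N> \<delta> 2. \<exists>y \<in> cocycles \<N> \<delta> 2.
      B = deform \<U> \<A> (x 0) (x 1) (x 2) \<and> B' = deform \<U> \<A> (y 0) (y 1) (y 2)"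
    if "(B, B') \<in> deformation_equiv R \<U> \<A>" for B B'
  proof -
    have "first_order_deformation R \<U> \<A> B" "first_order_deformation R \<U> \<A> B'"
      using that by (auto simp: deformation_equiv_def)
    then show ?thesis unfolding first_order_deformation_iff by blast
  qed
  show "sym (deformation_equiv R \<U> \<A>)"
  proof (rule symI)
    fix B B' assume B: "(B, B') \<in> deformation_equiv R \<U> \<A>"
    obtain x y where xy: "x \<in> cocycles \<N> \<delta> 2" "y \<in> cocycles \<N> \<delta> 2"
      "B = deform \<U> \<A> (x 0) (x 1) (x 2)" "B' = deform \<U> \<A> (y 0) (y 1) (y 2)" using rep[OF B] by blast
    show "(B', B) \<in> deformation_equiv R \<U> \<A>"
      using B deformation_equiv_class[OF xy(1,2)] deformation_equiv_class[OF xy(2,1)] unfolding xy(3,4) by simp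
  qed
  show "trans (deformation_equiv R \<U> \<A>)"
  proof (rule transI)
    fix B B' B'' assume B: "(B, B') \<in> deformation_equiv R \<U> \<A>" "(B', B'') \<in> deformation_equiv R \<U> \<A>"
    obtain x y where xy: "x \<in> cocycles \<N> \<delta> 2" "y \<in> cocycles \<N> \<delta> 2"
      "B = deform \<U> \<A> (x 0) (x 1) (x 2)" "B' = deform \<U> \<A> (y 0) (y 1) (y 2)" using rep[OF B(1)] by blast
    obtain z where z: "z \<in> cocycles \<N> \<delta> 2" "B'' = deform \<U> \<A> (z 0) (z 1) (z 2)"
      using rep[OF B(2)] by blast
    show "(B, B'') \<in> deformation_equiv R \<U> \<A>"
      using B deformation_equiv_class[OF xy(1,2)] deformation_equiv_class[OF xy(2) z(1)]
        deformation_equiv_class[OF xy(1) z(1)] xy(3,4) z(2) by simp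
  qed
qed

lemma carrier_cohomology:
  "carrier (cohomology \<N> \<delta> 2) =
     (\<lambda>x. coboundaries \<N> \<delta> 2 +>\<^bsub>\<G> 2\<^esub> x) ` cocycles \<N> \<delta> 2"
  "carrier (cohomology \<G> \<delta> 2) =
     (\<lambda>x. coboundaries \<G> \<delta> 2 +>\<^bsub>\<G> 2\<^esub> x) ` cocycles \<G> \<delta> 2"
  unfolding cohomology_def GSnr_sel(5)
  by (auto simp: quot_module_def A_RCOSETS_def RCOSETS_def a_r_coset_def r_coset_def)

lemma cohom_class_GSnr: "cohom_class \<N> d 2 x = coboundaries \<N> d 2 +>\<^bsub>\<G> 2\<^esub> x"
  by (simp only: cohom_class_def GSnr_sel(4))

text \<open>
  The surjectivity of the comparison map between the two cohomology modules.
\<close>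

lemma cocycle_cobordant_normalized:
  assumes z: "z \<in> cocycles \<G> \<delta> 2"
  shows "\<exists>x \<in> cocycles \<N> \<delta> 2. z \<ominus>\<^bsub>\<G> 2\<^esub> x \<in> coboundaries \<G> \<delta> 2"
proof -
  interpret G: module R "\<G> 2" by (rule GS_module)
  have z': "z \<in> carrier (\<G> 2)" "\<delta> 2 z = \<zero>\<^bsub>\<G> 3\<^esub>"
    using z by (simp_all add: cocycles_def)
  obtain y where y: "y \<in> carrier (\<G> 1)" "z \<ominus>\<^bsub>\<G> 2\<^esub> \<delta> 1 y \<in> carrier (\<N> 2)"
    using cocycle_normalize[OF z'] by blast
  let ?dy = "\<delta> 1 y"
  have dy: "?dy \<in> carrier (\<G> 2)" by (rule gs_d_1_closed[OF y(1)])
  have "\<delta> 2 (z \<ominus>\<^bsub>\<G> 2\<^esub> ?dy) = \<zero>\<^bsub>\<G> 3\<^esub>"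
    by (rule cocycle_minus_coboundary[OF z' y(1)])
  then have x: "z \<ominus>\<^bsub>\<G> 2\<^esub> ?dy \<in> cocycles \<N> \<delta> 2"
    using y(2) by (simp add: cocycles_def GSnr_sel(1))
  \<comment> \<open>The representative is \<open>z - d y\<close>, so its difference to \<open>z\<close> is \<open>d y\<close>.\<close>
  have "z \<ominus>\<^bsub>\<G> 2\<^esub> (z \<ominus>\<^bsub>\<G> 2\<^esub> ?dy) = ?dy"
    using z'(1) dy by (simp add: a_minus_def G.M.minus_add G.M.r_neg G.M.a_assoc[symmetric])
  then have "z \<ominus>\<^bsub>\<G> 2\<^esub> (z \<ominus>\<^bsub>\<G> 2\<^esub> ?dy) \<in> coboundaries \<G> \<delta> 2"
    unfolding coboundaries_2 using y(1) by simp
  with x show ?thesis by blast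
qed

lemma coset_GS_iff:
  assumes x: "x \<in> cocycles \<N> \<delta> 2" and y: "y \<in> cocycles \<N> \<delta> 2"
  shows "coboundaries \<G> \<delta> 2 +>\<^bsub>\<G> 2\<^esub> x = coboundaries \<G> \<delta> 2 +>\<^bsub>\<G> 2\<^esub> y
    \<longleftrightarrow> coboundaries \<N> \<delta> 2 +>\<^bsub>\<G> 2\<^esub> x = coboundaries \<N> \<delta> 2 +>\<^bsub>\<G> 2\<^esub> y"
proof -
  interpret G: module R "\<G> 2" by (rule GS_module)
  interpret SZ: submodule "cocycles \<N> \<delta> 2" R "\<G> 2" by (rule submodules)
  have "\<ominus>\<^bsub>\<G> 2\<^esub> y \<in> cocycles \<N> \<delta> 2" using SZ.m_inv_closed[of y] y by (simp add: a_inv_def)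
  then have "x \<ominus>\<^bsub>\<G> 2\<^esub> y \<in> cocycles \<N> \<delta> 2"
    using SZ.m_closed[OF x] by (simp add: a_minus_def)
  then show ?thesis
    unfolding G.coset_eq_iff[OF submodules(3) cocyclesD(3)[OF x] cocyclesD(3)[OF y]]
      G.coset_eq_iff[OF submodules(4) cocyclesD(3)[OF x] cocyclesD(3)[OF y]]
    by (rule coboundary_cocycle_iff)
qed

lemma cocycles_mono: "cocycles \<N> \<delta> 2 \<subseteq> cocycles \<G> \<delta> 2"
proof
  fix x assume x: "x \<in> cocycles \<N> \<delta> 2"
  show "x \<in> cocycles \<G> \<delta> 2" using cocyclesD(2,3)[OF x] by (simp add: cocycles_def)
qed

lemma coset_GS_image:
  "(\<lambda>x. coboundaries \<G> \<delta> 2 +>\<^bsub>\<G> 2\<^esub> x) ` cocycles \<N> \<delta> 2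
    = (\<lambda>x. coboundaries \<G> \<delta> 2 +>\<^bsub>\<G> 2\<^esub> x) ` cocycles \<G> \<delta> 2"
  (is "?cl ` ?Z' = ?cl ` ?Z")
proof
  interpret G: module R "\<G> 2" by (rule GS_module)
  show "?cl ` ?Z' \<subseteq> ?cl ` ?Z"
    by (rule image_mono[OF cocycles_mono])
  show "?cl ` ?Z \<subseteq> ?cl ` ?Z'"
  proof (rule image_subsetI)
    fix z assume z: "z \<in> ?Z"
    then obtain x where x: "x \<in> ?Z'" "z \<ominus>\<^bsub>\<G> 2\<^esub> x \<in> coboundaries \<G> \<delta> 2"
      using cocycle_cobordant_normalized by blast
    have zc: "z \<in> carrier (\<G> 2)" using z by (simp add: cocycles_def)
    have "?cl z = ?cl x" using x(2) unfolding G.coset_eq_iff[OF submodules(4) zc cocyclesD(3)[OF x(1)]] .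
    then show "?cl z \<in> ?cl ` ?Z'" using x(1) by (rule image_eqI)
  qed
qed

lemma deform_image:
  "(\<lambda>x. deform \<U> \<A> (x 0) (x 1) (x 2)) ` cocycles \<N> \<delta> 2 = {\<B>. first_order_deformation R \<U> \<A> \<B>}"
  unfolding first_order_deformation_iff by blast

lemma cohomology_Def_bij:
  "\<exists>\<Phi>. bij_betw \<Phi> (carrier (cohomology \<N> \<delta> 2)) (Def R \<U> \<A>) \<and>
     (\<forall>x \<in> cocycles \<N> \<delta> 2. \<Phi> (cohom_class \<N> \<delta> 2 x)
       = deformation_equiv R \<U> \<A> `` {deform \<U> \<A> (x 0) (x 1) (x 2)})"
  "\<exists>\<Psi>. bij_betw \<Psi> (carrier (cohomology \<G> \<delta> 2)) (Def R \<U> \<A>) \<and>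
     (\<forall>x \<in> cocycles \<N> \<delta> 2. \<Psi> (cohom_class \<G> \<delta> 2 x)
       = deformation_equiv R \<U> \<A> `` {deform \<U> \<A> (x 0) (x 1) (x 2)})"
proof -
  show "\<exists>\<Phi>. bij_betw \<Phi> (carrier (cohomology \<N> \<delta> 2)) (Def R \<U> \<A>) \<and>
     (\<forall>x \<in> cocycles \<N> \<delta> 2. \<Phi> (cohom_class \<N> \<delta> 2 x)
       = deformation_equiv R \<U> \<A> `` {deform \<U> \<A> (x 0) (x 1) (x 2)})"
    unfolding carrier_cohomology Def_def cohom_class_GSnr
    by (rule quotient_bij[OF deformation_equiv_equiv deform_image deformation_equiv_class])
  show "\<exists>\<Psi>. bij_betw \<Psi> (carrier (cohomology \<G> \<delta> 2)) (Def R \<U> \<A>) \<and>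
     (\<forall>x \<in> cocycles \<N> \<delta> 2. \<Psi> (cohom_class \<G> \<delta> 2 x)
       = deformation_equiv R \<U> \<A> `` {deform \<U> \<A> (x 0) (x 1) (x 2)})"
    unfolding carrier_cohomology Def_def cohom_class_def coset_GS_image[symmetric]
    by (rule quotient_bij[OF deformation_equiv_equiv deform_image trans[OF deformation_equiv_class
        coset_GS_iff[symmetric]]])
qed

lemma cohomology_iso:
  "\<exists>\<iota>. \<iota> \<in> module_iso R (cohomology \<N> \<delta> 2) (cohomology \<G> \<delta> 2) \<and>
     (\<forall>x \<in> cocycles \<N> \<delta> 2.
        \<iota> (cohom_class \<N> \<delta> 2 x) = cohom_class \<G> \<delta> 2 x)"
  unfolding cohom_class_GSnr cohomology_def GSnr_sel(5)
  unfolding cohom_class_def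
  by (rule quotient_iso[OF GS_module submodules(1) submodules(3) submodules(2) submodules(4)
      cocycles_mono coboundary_cocycle_iff cocycle_cobordant_normalized])

end

theorem theorem3p19:
  fixes K :: "'k ring"
    and \<U> :: "('uo, 'ua) cat"
    and \<A> :: "('k, 'uo, 'ua, 'o, 'm) prestack"
  assumes "cring K" and "category \<U>" and "prestack K \<U> \<A>"
  shows
    "(\<forall>m1 \<in> carrier (Cpq K \<U> \<A> 0 2). \<forall>f1 \<in> carrier (Cpq K \<U> \<A> 1 1). \<forall>c1 \<in> carrier (Cpq K \<U> \<A> 2 0).
        first_order_deformation K \<U> \<A> (deform \<U> \<A> m1 f1 c1) \<longleftrightarrow>
          cochain2 m1 f1 c1 \<in> carrier (GSnr K \<U> \<A> 2) \<and>
          gs_d \<U> \<A> 2 (cochain2 m1 f1 c1) = \<zero>\<^bsub>GS K \<U> \<A> 3\<^esub>) \<and>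
     (\<forall>m1 f1 c1 m1' f1' c1'.
        cochain2 m1 f1 c1 \<in> cocycles (GSnr K \<U> \<A>) (gs_d \<U> \<A>) 2 \<longrightarrow>
        cochain2 m1' f1' c1' \<in> cocycles (GSnr K \<U> \<A>) (gs_d \<U> \<A>) 2 \<longrightarrow>
        (\<forall>g1 \<in> carrier (Cpq K \<U> \<A> 0 1). \<forall>t1 \<in> carrier (Cpq K \<U> \<A> 1 0).
           prestack_iso (dual_ring K) \<U> (deform \<U> \<A> m1 f1 c1) (deform \<U> \<A> m1' f1' c1')
             (deform_mor \<U> \<A> g1 t1) \<longleftrightarrow>
           cochain1 g1 (\<ominus>\<^bsub>Cpq K \<U> \<A> 1 0\<^esub> t1) \<in> carrier (GSnr K \<U> \<A> 1) \<and>
           gs_d \<U> \<A> 1 (cochain1 g1 (\<ominus>\<^bsub>Cpq K \<U> \<A> 1 0\<^esub> t1))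
             = cochain2 m1 f1 c1 \<ominus>\<^bsub>GS K \<U> \<A> 2\<^esub> cochain2 m1' f1' c1')) \<and>
     (\<exists>\<Phi>. bij_betw \<Phi> (carrier (cohomology (GSnr K \<U> \<A>) (gs_d \<U> \<A>) 2)) (Def K \<U> \<A>) \<and>
        (\<forall>m1 f1 c1. cochain2 m1 f1 c1 \<in> cocycles (GSnr K \<U> \<A>) (gs_d \<U> \<A>) 2 \<longrightarrow>
           \<Phi> (cohom_class (GSnr K \<U> \<A>) (gs_d \<U> \<A>) 2 (cochain2 m1 f1 c1))
             = deformation_equiv K \<U> \<A> `` {deform \<U> \<A> m1 f1 c1})) \<and>
     (\<exists>\<iota> \<Psi>. \<iota> \<in> module_iso K (cohomology (GSnr K \<U> \<A>) (gs_d \<U> \<A>) 2)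
                 (cohomology (GS K \<U> \<A>) (gs_d \<U> \<A>) 2) \<and>
        (\<forall>x \<in> cocycles (GSnr K \<U> \<A>) (gs_d \<U> \<A>) 2.
           \<iota> (cohom_class (GSnr K \<U> \<A>) (gs_d \<U> \<A>) 2 x) = cohom_class (GS K \<U> \<A>) (gs_d \<U> \<A>) 2 x) \<and>
        bij_betw \<Psi> (carrier (cohomology (GS K \<U> \<A>) (gs_d \<U> \<A>) 2)) (Def K \<U> \<A>) \<and>
        (\<forall>m1 f1 c1. cochain2 m1 f1 c1 \<in> cocycles (GSnr K \<U> \<A>) (gs_d \<U> \<A>) 2 \<longrightarrow>
           \<Psi> (cohom_class (GS K \<U> \<A>) (gs_d \<U> \<A>) 2 (cochain2 m1 f1 c1))
             = deformation_equiv K \<U> \<A> `` {deform \<U> \<A> m1 f1 c1}))"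
proof -
  from assms(3) interpret prestack K \<U> \<A> .
  have 1: "first_order_deformation K \<U> \<A> (deform \<U> \<A> m f c) \<longleftrightarrow>
      cochain2 m f c \<in> carrier (GSnr K \<U> \<A> 2) \<and> gs_d \<U> \<A> 2 (cochain2 m f c) = \<zero>\<^bsub>GS K \<U> \<A> 3\<^esub>"
    if "m \<in> carrier (Cpq K \<U> \<A> 0 2)" "f \<in> carrier (Cpq K \<U> \<A> 1 1)" "c \<in> carrier (Cpq K \<U> \<A> 2 0)" for m f c
  proof -
    have "cochain2 m f c \<in> carrier (GS K \<U> \<A> 2)" using that cochain_carrier(1) by blast
    from deform_prestack_iff[OF this, unfolded cochain_sel] show ?thesis
      unfolding first_order_deformation_def using that by blast
  qed
  have 2: "prestack_iso (dual_ring K) \<U> (deform \<U> \<A> m f c) (deform \<U> \<A> m' f' c') (deform_mor \<U> \<A> g t) \<longleftrightarrow>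
      cochain1 g (\<ominus>\<^bsub>Cpq K \<U> \<A> 1 0\<^esub> t) \<in> carrier (GSnr K \<U> \<A> 1) \<and>
      gs_d \<U> \<A> 1 (cochain1 g (\<ominus>\<^bsub>Cpq K \<U> \<A> 1 0\<^esub> t)) = cochain2 m f c \<ominus>\<^bsub>GS K \<U> \<A> 2\<^esub> cochain2 m' f' c'"
    if "cochain2 m f c \<in> cocycles (GSnr K \<U> \<A>) (gs_d \<U> \<A>) 2" "cochain2 m' f' c' \<in> cocycles (GSnr K \<U> \<A>) (gs_d \<U> \<A>) 2"
      "g \<in> carrier (Cpq K \<U> \<A> 0 1)" "t \<in> carrier (Cpq K \<U> \<A> 1 0)" for m f c m' f' c' g t
    using deform_iso_iff[OF that, unfolded cochain_sel] .
  obtain \<Phi> where \<Phi>: "bij_betw \<Phi> (carrier (cohomology (GSnr K \<U> \<A>) (gs_d \<U> \<A>) 2)) (Def K \<U> \<A>)"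
    "\<And>x. x \<in> cocycles (GSnr K \<U> \<A>) (gs_d \<U> \<A>) 2 \<Longrightarrow> \<Phi> (cohom_class (GSnr K \<U> \<A>) (gs_d \<U> \<A>) 2 x)
       = deformation_equiv K \<U> \<A> `` {deform \<U> \<A> (x 0) (x 1) (x 2)}"
    using cohomology_Def_bij(1) by blast
  obtain \<Psi> where \<Psi>: "bij_betw \<Psi> (carrier (cohomology (GS K \<U> \<A>) (gs_d \<U> \<A>) 2)) (Def K \<U> \<A>)"
    "\<And>x. x \<in> cocycles (GSnr K \<U> \<A>) (gs_d \<U> \<A>) 2 \<Longrightarrow> \<Psi> (cohom_class (GS K \<U> \<A>) (gs_d \<U> \<A>) 2 x)
       = deformation_equiv K \<U> \<A> `` {deform \<U> \<A> (x 0) (x 1) (x 2)}"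
    using cohomology_Def_bij(2) by blast
  obtain \<iota> where \<iota>: "\<iota> \<in> module_iso K (cohomology (GSnr K \<U> \<A>) (gs_d \<U> \<A>) 2) (cohomology (GS K \<U> \<A>) (gs_d \<U> \<A>) 2)"
    "\<forall>x \<in> cocycles (GSnr K \<U> \<A>) (gs_d \<U> \<A>) 2.
        \<iota> (cohom_class (GSnr K \<U> \<A>) (gs_d \<U> \<A>) 2 x) = cohom_class (GS K \<U> \<A>) (gs_d \<U> \<A>) 2 x"
    using cohomology_iso by blast
  show ?thesis
  proof (intro conjI)
    show "\<exists>\<Phi>. bij_betw \<Phi> (carrier (cohomology (GSnr K \<U> \<A>) (gs_d \<U> \<A>) 2)) (Def K \<U> \<A>) \<and>
        (\<forall>m1 f1 c1. cochain2 m1 f1 c1 \<in> cocycles (GSnr K \<U> \<A>) (gs_d \<U> \<A>) 2 \<longrightarrow>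
           \<Phi> (cohom_class (GSnr K \<U> \<A>) (gs_d \<U> \<A>) 2 (cochain2 m1 f1 c1))
             = deformation_equiv K \<U> \<A> `` {deform \<U> \<A> m1 f1 c1})"
      using \<Phi>(1) \<Phi>(2)[of "cochain2 _ _ _", unfolded cochain_sel] by blast
    show "\<exists>\<iota> \<Psi>. \<iota> \<in> module_iso K (cohomology (GSnr K \<U> \<A>) (gs_d \<U> \<A>) 2)
                 (cohomology (GS K \<U> \<A>) (gs_d \<U> \<A>) 2) \<and>
        (\<forall>x \<in> cocycles (GSnr K \<U> \<A>) (gs_d \<U> \<A>) 2.
           \<iota> (cohom_class (GSnr K \<U> \<A>) (gs_d \<U> \<A>) 2 x) = cohom_class (GS K \<U> \<A>) (gs_d \<U> \<A>) 2 x) \<and>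
        bij_betw \<Psi> (carrier (cohomology (GS K \<U> \<A>) (gs_d \<U> \<A>) 2)) (Def K \<U> \<A>) \<and>
        (\<forall>m1 f1 c1. cochain2 m1 f1 c1 \<in> cocycles (GSnr K \<U> \<A>) (gs_d \<U> \<A>) 2 \<longrightarrow>
           \<Psi> (cohom_class (GS K \<U> \<A>) (gs_d \<U> \<A>) 2 (cochain2 m1 f1 c1))
             = deformation_equiv K \<U> \<A> `` {deform \<U> \<A> m1 f1 c1})"
      using \<iota> \<Psi>(1) \<Psi>(2)[of "cochain2 _ _ _", unfolded cochain_sel]
      by (intro exI[of _ \<iota>] exI[of _ \<Psi>]) blast
  qed (intro ballI allI impI 1 2; assumption)+
qed

end
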